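(* Let $p\ge 3$ be a prime and $k$ an algebraically closed field of characteristic $p$. The sequence $$\left(\max_{s\ge1,\ m\in X^+_s}\dim_k \mathrm{H}^n(SL_2(p^s),L(m))\right)_n$$ grows exponentially.
   Context: $SL_2(p^s)$ is the finite group $SL_2(\mathbb F_{p^s})$; $X^+_s=\{m\in\mathbb N: m<p^s\}$; $L(m)$ is the simple module of highest weight $m$ of the algebraic group $SL_2$ over $k$, restricted to $SL_2(p^s)$. A sequence $(x_n)$ grows exponentially if it is bounded above and below by exponential functions, i.e. there are constants $c,c'>0$ and $\alpha,\beta>1$ with $c\,\alpha^n\le x_n\le c'\beta^n$ for all sufficiently large $n$. *)

theory Defs
  imports "Jordan_Normal_Form.VS_Connect" "HOL-Algebra.AbelCoset"
begin

section \<open>Cohomology of a group with coefficients in a module\<close>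

text \<open>
  \<open>G\<close> is a group, \<open>M\<close> a vector space (a \<^type>\<open>module\<close> record, scalars in the type \<open>'k\<close>)
  and \<open>act\<close> a linear action of \<open>G\<close> on \<open>M\<close>.  Cohomology is that of the complex of inhomogeneous
  cochains \<open>C\<^sup>n = Map (G\<^sup>n, M)\<close>; elements of \<open>G\<^sup>n\<close> are lists of length \<open>n\<close>, and cochains are
  extensional functions.
\<close>

definition tuples :: "('g, 'b) monoid_scheme \<Rightarrow> nat \<Rightarrow> 'g list set" where
  "tuples G n = {gs. length gs = n \<and> set gs \<subseteq> carrier G}"

definition cochains ::
    "('g, 'b) monoid_scheme \<Rightarrow> ('k, 'v) module \<Rightarrow> nat \<Rightarrow> ('k, 'g list \<Rightarrow> 'v) module" where
  "cochains G M n =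
    \<lparr> carrier = tuples G n \<rightarrow>\<^sub>E carrier M,
      mult = undefined,
      one = undefined,
      zero = (\<lambda>gs\<in>tuples G n. \<zero>\<^bsub>M\<^esub>),
      add = (\<lambda>\<phi> \<psi>. \<lambda>gs\<in>tuples G n. \<phi> gs \<oplus>\<^bsub>M\<^esub> \<psi> gs),
      smult = (\<lambda>a \<phi>. \<lambda>gs\<in>tuples G n. a \<odot>\<^bsub>M\<^esub> \<phi> gs) \<rparr>"

text \<open>\<open>(g\<^sub>1, \<dots>, g\<^bsub>n+1\<^esub>) \<mapsto> (g\<^sub>1, \<dots>, g\<^sub>i g\<^bsub>i+1\<^esub>, \<dots>, g\<^bsub>n+1\<^esub>)\<close> for \<open>1 \<le> i \<le> n\<close>
  (list positions count from \<open>0\<close>).\<close>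

definition merge_at :: "('g, 'b) monoid_scheme \<Rightarrow> nat \<Rightarrow> 'g list \<Rightarrow> 'g list" where
  "merge_at G i gs = take (i - 1) gs @ (gs ! (i - 1) \<otimes>\<^bsub>G\<^esub> gs ! i) # drop (i + 1) gs"

definition alternate :: "('k, 'v) module \<Rightarrow> nat \<Rightarrow> 'v \<Rightarrow> 'v" where
  "alternate M i x = (if even i then x else \<ominus>\<^bsub>M\<^esub> x)"

definition coboundary ::
    "('g, 'b) monoid_scheme \<Rightarrow> ('k, 'v) module \<Rightarrow> ('g \<Rightarrow> 'v \<Rightarrow> 'v) \<Rightarrow> nat \<Rightarrow>
     ('g list \<Rightarrow> 'v) \<Rightarrow> ('g list \<Rightarrow> 'v)" where
  "coboundary G M act n \<phi> = (\<lambda>gs\<in>tuples G (Suc n).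
      act (hd gs) (\<phi> (tl gs))
      \<oplus>\<^bsub>M\<^esub> (\<Oplus>\<^bsub>M\<^esub>i\<in>{1..n}. alternate M i (\<phi> (merge_at G i gs)))
      \<oplus>\<^bsub>M\<^esub> alternate M (Suc n) (\<phi> (butlast gs)))"

definition cocycles ::
    "('g, 'b) monoid_scheme \<Rightarrow> ('k, 'v) module \<Rightarrow> ('g \<Rightarrow> 'v \<Rightarrow> 'v) \<Rightarrow> nat \<Rightarrow> ('g list \<Rightarrow> 'v) set" where
  "cocycles G M act n =
    {\<phi> \<in> carrier (cochains G M n). coboundary G M act n \<phi> = \<zero>\<^bsub>cochains G M (Suc n)\<^esub>}"

definition coboundaries ::
    "('g, 'b) monoid_scheme \<Rightarrow> ('k, 'v) module \<Rightarrow> ('g \<Rightarrow> 'v \<Rightarrow> 'v) \<Rightarrow> nat \<Rightarrow> ('g list \<Rightarrow> 'v) set" where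
  "coboundaries G M act n =
    (case n of
       0 \<Rightarrow> {\<zero>\<^bsub>cochains G M 0\<^esub>}
     | Suc l \<Rightarrow> coboundary G M act l ` carrier (cochains G M l))"

text \<open>Adding \<open>N\<close> in the scalar multiplication only matters for the scalar \<open>0\<close>: for \<open>a \<noteq> 0\<close> the
  set \<open>a X\<close> is already a coset, while \<open>0 X\<close> is just \<open>{0}\<close>.\<close>

definition quotient_module :: "('k, 'v) module \<Rightarrow> 'v set \<Rightarrow> ('k, 'v set) module" where
  "quotient_module M N =
    \<lparr> carrier = a_rcosets\<^bsub>M\<^esub> N,
      mult = undefined,
      one = undefined,
      zero = N,
      add = (\<lambda>X Y. X <+>\<^bsub>M\<^esub> Y),
      smult = (\<lambda>a X. N <+>\<^bsub>M\<^esub> ((\<lambda>x. a \<odot>\<^bsub>M\<^esub> x) ` X)) \<rparr>"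

definition group_cohomology ::
    "('g, 'b) monoid_scheme \<Rightarrow> ('k, 'v) module \<Rightarrow> ('g \<Rightarrow> 'v \<Rightarrow> 'v) \<Rightarrow> nat \<Rightarrow>
     ('k, ('g list \<Rightarrow> 'v) set) module" where
  "group_cohomology G M act n =
    quotient_module (cochains G M n \<lparr> carrier := cocycles G M act n \<rparr>) (coboundaries G M act n)"


section \<open>The groups\<close>

text \<open>\<open>SL2 UNIV\<close> is the group of \<open>k\<close>-points of the algebraic group; \<open>SL2 (finite_subfield q)\<close> is
  the finite group over the subfield of order \<open>q\<close>.  For \<open>k\<close> algebraically closed of
  characteristic \<open>p\<close> and \<open>q = p\<^sup>s\<close>, \<open>s \<ge> 1\<close>, the only subfield of \<open>k\<close> with \<open>q\<close> elements is the set
  of roots of \<open>x\<^sup>q - x\<close>.\<close>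

definition SL2 :: "'k::field set \<Rightarrow> 'k mat monoid" where
  "SL2 F =
    \<lparr> carrier = {A \<in> carrier_mat 2 2. elements_mat A \<subseteq> F \<and> det A = 1},
      mult = (*),
      one = 1\<^sub>m 2 \<rparr>"

definition finite_subfield :: "nat \<Rightarrow> 'k::field set" where
  "finite_subfield q = {x. x ^ q = x}"


section \<open>Simple modules of the algebraic group\<close>

text \<open>A finite-dimensional rational module is given in coordinates: the space is
  \<open>carrier_vec d\<close>, and \<open>\<rho>\<close> maps each element of \<open>SL2 UNIV\<close> to a \<open>d \<times> d\<close> matrix.
  The following are the polynomial functions in the four matrix entries; their restrictions to
  \<open>SL2 UNIV\<close> form the coordinate ring of the algebraic group.\<close>

inductive_set polynomial_functions :: "('k::field mat \<Rightarrow> 'k) set" where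
  const: "(\<lambda>A. c) \<in> polynomial_functions"
| entry: "i < 2 \<Longrightarrow> j < 2 \<Longrightarrow> (\<lambda>A. A $$ (i, j)) \<in> polynomial_functions"
| plus: "f \<in> polynomial_functions \<Longrightarrow> g \<in> polynomial_functions \<Longrightarrow>
    (\<lambda>A. f A + g A) \<in> polynomial_functions"
| times: "f \<in> polynomial_functions \<Longrightarrow> g \<in> polynomial_functions \<Longrightarrow>
    (\<lambda>A. f A * g A) \<in> polynomial_functions"

definition rational_representation :: "nat \<Rightarrow> ('k::field mat \<Rightarrow> 'k mat) \<Rightarrow> bool" where
  "rational_representation d \<rho> \<longleftrightarrow>
    (\<forall>A\<in>carrier (SL2 UNIV). \<rho> A \<in> carrier_mat d d) \<and>
    \<rho> (1\<^sub>m 2) = 1\<^sub>m d \<and>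
    (\<forall>A\<in>carrier (SL2 UNIV). \<forall>B\<in>carrier (SL2 UNIV). \<rho> (A * B) = \<rho> A * \<rho> B) \<and>
    (\<forall>i<d. \<forall>j<d. \<exists>f\<in>polynomial_functions. \<forall>A\<in>carrier (SL2 UNIV). \<rho> A $$ (i, j) = f A)"

definition simple_representation :: "nat \<Rightarrow> ('k::field mat \<Rightarrow> 'k mat) \<Rightarrow> bool" where
  "simple_representation d \<rho> \<longleftrightarrow>
    d \<noteq> 0 \<and>
    (\<forall>W. VectorSpace.subspace class_ring W (module_vec TYPE('k) d) \<longrightarrow>
         (\<forall>A\<in>carrier (SL2 UNIV). \<forall>w\<in>W. \<rho> A *\<^sub>v w \<in> W) \<longrightarrow>
         W = {0\<^sub>v d} \<or> W = carrier_vec d)"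

definition torus :: "'k::field \<Rightarrow> 'k mat" where
  "torus t = mat_of_rows_list 2 [[t, 0], [0, inverse t]]"

text \<open>Weights of the diagonal torus are identified with integers via \<open>torus t \<mapsto> t\<^sup>\<mu>\<close>, so that
  the positive root is \<open>2\<close>, and \<open>\<mu>\<close> is below \<open>m\<close> in the usual partial order on weights iff
  \<open>m - \<mu>\<close> is a nonnegative multiple of \<open>2\<close>.\<close>

definition weight_space :: "nat \<Rightarrow> ('k::field mat \<Rightarrow> 'k mat) \<Rightarrow> int \<Rightarrow> 'k vec set" where
  "weight_space d \<rho> \<mu> =
    {v \<in> carrier_vec d. \<forall>t. t \<noteq> 0 \<longrightarrow> \<rho> (torus t) *\<^sub>v v = (t powi \<mu>) \<cdot>\<^sub>v v}"

definition is_weight :: "nat \<Rightarrow> ('k::field mat \<Rightarrow> 'k mat) \<Rightarrow> int \<Rightarrow> bool" where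
  "is_weight d \<rho> \<mu> \<longleftrightarrow> weight_space d \<rho> \<mu> \<noteq> {0\<^sub>v d}"

definition highest_weight :: "nat \<Rightarrow> ('k::field mat \<Rightarrow> 'k mat) \<Rightarrow> int \<Rightarrow> bool" where
  "highest_weight d \<rho> m \<longleftrightarrow>
    is_weight d \<rho> m \<and> (\<forall>\<mu>. is_weight d \<rho> \<mu> \<longrightarrow> (\<exists>j::nat. \<mu> = m - 2 * int j))"

text \<open>\<open>(d, \<rho>)\<close> is a model of \<open>L(m)\<close>, which is determined by this property up to isomorphism.\<close>

definition simple_module_L :: "nat \<Rightarrow> nat \<Rightarrow> ('k::field mat \<Rightarrow> 'k mat) \<Rightarrow> bool" where
  "simple_module_L m d \<rho> \<longleftrightarrow>
    rational_representation d \<rho> \<and> simple_representation d \<rho> \<and> highest_weight d \<rho> (int m)"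


section \<open>Dimensions of the cohomology groups, and their growth\<close>

definition SL2_cohomology_dim :: "nat \<Rightarrow> nat \<Rightarrow> ('k::field mat \<Rightarrow> 'k mat) \<Rightarrow> nat \<Rightarrow> nat" where
  "SL2_cohomology_dim q d \<rho> n =
    vectorspace.dim class_ring
      (group_cohomology (SL2 (finite_subfield q)) (module_vec TYPE('k) d) (\<lambda>A v. \<rho> A *\<^sub>v v) n)"

text \<open>All values of \<open>dim\<^sub>k H\<^sup>n(SL\<^sub>2(p\<^sup>s), L(m))\<close> for \<open>s \<ge> 1\<close> and \<open>m < p\<^sup>s\<close>.  Isomorphic models of
  \<open>L(m)\<close> contribute the same value.\<close>

definition SL2_cohomology_dims :: "'k::field itself \<Rightarrow> nat \<Rightarrow> nat \<Rightarrow> nat set" where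
  "SL2_cohomology_dims k p n =
    {SL2_cohomology_dim (p ^ s) d \<rho> n |s m d (\<rho> :: 'k mat \<Rightarrow> 'k mat).
       s \<ge> 1 \<and> m < p ^ s \<and> simple_module_L m d \<rho>}"

definition grows_exponentially :: "(nat \<Rightarrow> real) \<Rightarrow> bool" where
  "grows_exponentially x \<longleftrightarrow>
    (\<exists>c c' \<alpha> \<beta>. c > 0 \<and> c' > 0 \<and> \<alpha> > 1 \<and> \<beta> > 1 \<and>
      (\<forall>\<^sub>F n in sequentially. c * \<alpha> ^ n \<le> x n \<and> x n \<le> c' * \<beta> ^ n))"

end

theory Submission
  imports Defs "HOL-Library.Function_Algebras"
begin

text \<open>
  Let \<open>q = p\<^sup>s\<close> and let \<open>B\<close> be the subgroup of upper triangular matrices in \<open>G = SL\<^sub>2(q)\<close>.  Modulo \<open>p\<close>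
  the index of \<open>B\<close> is \<open>1\<close>, and transfer to \<open>G\<close> followed by restriction to \<open>B\<close> is the identity in
  positive degrees, because the big Bruhat cell contributes norms from the trivial group.  Hence
  \<open>H\<^sup>n(G, L(m))\<close> is \<open>H\<^sup>n(B, L(m))\<close> for \<open>n > 0\<close>.  Over the unipotent radical, \<open>L(m)\<close> is a tensor product of
  truncated polynomial modules, one for each \<open>p\<close>-adic digit \<open>m\<^sub>i\<close> of \<open>m\<close>.  The tensor product of
  their periodic resolutions is minimal and \<open>B\<close>-equivariant, so \<open>H\<^sup>n(B, L(m))\<close> has as a basis those
  generators of degree \<open>n\<close> that the torus fixes: the \<open>(j\<^sub>0, \<dots>, j\<^bsub>s-1\<^esub>)\<close> with sum \<open>n\<close> whose weight is
  divisible by \<open>q - 1\<close>.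

  Checking this congruence digit by digit produces carries, which determine \<open>j\<close>, add up to at most
  \<open>3n\<close>, and force the preceding carry whenever they vanish; there are at most exponentially many such
  sequences, uniformly in \<open>s\<close> and \<open>m\<close>.  For \<open>m = 0\<close> every sequence of carries in \<open>{2p - 2, 2p}\<close> occurs,
  and choosing \<open>s\<close> proportional to \<open>n\<close> gives exponentially many.
\<close>

section \<open>Equivariant resolutions over a finite group\<close>

text \<open>The minimal resolution exists over B only, while the cohomology of G is defined by its
  own cochains. The two are compared over B, where the bar complex of G is a resolution as well;
  restriction to B is then the inclusion of G-invariant into B-invariant cochains, and transfer goes
  back on the level of cochains. Lifting maps equivariantly needs terms that are injective relative
  to the trivial group, although p divides the order of B. This is expressed by an operator whose
  conjugates over the group add up to the identity: for the bar complex the restriction to a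
  transversal, for polynomial functions on the field evaluation at zero times the indicator function
  of zero, up to sign. Minimality enters in one form only: differentials vanish on invariants, so
  boundary and homotopy terms disappear and the invariants themselves are the cohomology of B.

  The obstacle in the upper bound is that a multidegree has s entries, with s unbounded for fixed n.
  Carries are therefore read in the direction in which a zero carry leaves no choice, and the count
  is charged to the nonzero ones.\<close>

definition fsupp :: "'x set \<Rightarrow> ('x \<Rightarrow> 'k::zero) set" where
  "fsupp X = {f. \<forall>x. x \<notin> X \<longrightarrow> f x = 0}"

definition scl :: "'k::times \<Rightarrow> ('x \<Rightarrow> 'k) \<Rightarrow> ('x \<Rightarrow> 'k)" where
  "scl c f = (\<lambda>x. c * f x)"

text \<open>Linearity is asked on the whole function space, while the modules are the subspaces
  \<open>fsupp X\<close>: algebraic identities then carry no membership conditions, and all terms of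
  a complex share one type.\<close>

definition lin :: "(('x \<Rightarrow> 'k::field) \<Rightarrow> ('y \<Rightarrow> 'k)) \<Rightarrow> bool" where
  "lin f \<longleftrightarrow> (\<forall>u v. f (u + v) = f u + f v) \<and> (\<forall>c u. f (scl c u) = scl c (f u))"

lemma scl_apply [simp]: "scl c f x = c * f x"
  by (simp add: scl_def)

lemma scl_1 [simp]: "scl (1::'k::field) f = f"
  by (auto simp: fun_eq_iff)

lemma sum_fun_apply: "(\<Sum>i\<in>I. (f i :: 'x \<Rightarrow> 'k::comm_monoid_add)) x = (\<Sum>i\<in>I. f i x)"
  by (induction I rule: infinite_finite_induct) auto

lemma linI:
  assumes "\<And>u v. f (u + v) = f u + f v" "\<And>c u. f (scl c u) = scl c (f u)"
  shows "lin f"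
  using assms by (auto simp: lin_def)

lemma lin_add: "lin f \<Longrightarrow> f (u + v) = f u + f v"
  and lin_scl: "lin f \<Longrightarrow> f (scl c u) = scl c (f u)"
  by (auto simp: lin_def)

lemma lin_0: assumes "lin f" shows "f 0 = 0"
  using lin_add[OF assms, of 0 0] by simp

lemma lin_minus: assumes "lin f" shows "f (- u) = - f u"
  using lin_add[OF assms, of u "-u"] lin_0[OF assms] by (simp add: minus_unique)

lemma lin_diff: assumes "lin f" shows "f (u - v) = f u - f v"
  using lin_add[OF assms, of u "-v"] lin_minus[OF assms] by simp

lemma lin_sum: assumes "lin f" shows "f (\<Sum>i\<in>I. u i) = (\<Sum>i\<in>I. f (u i))"
  using sum_comp_morphism[of f u I] lin_0[OF assms] lin_add[OF assms] by (simp add: o_def)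

lemma lin_zero [intro]: "lin (\<lambda>x. 0)"
  by (auto intro!: linI simp: fun_eq_iff)

lemma lin_id [intro]: "lin (\<lambda>x. x)"
  by (auto intro!: linI)

lemma lin_comp: "lin f \<Longrightarrow> lin g \<Longrightarrow> lin (\<lambda>x. f (g x))"
  by (auto simp: lin_def)

lemma lin_plus: "lin f \<Longrightarrow> lin g \<Longrightarrow> lin (\<lambda>x. f x + g x)"
  by (auto simp: lin_def fun_eq_iff algebra_simps)

lemma lin_minus_fun: "lin f \<Longrightarrow> lin g \<Longrightarrow> lin (\<lambda>x. f x - g x)"
  by (auto simp: lin_def fun_eq_iff algebra_simps)

lemma lin_sum_fun: "(\<And>i. i \<in> I \<Longrightarrow> lin (f i)) \<Longrightarrow> lin (\<lambda>x. \<Sum>i\<in>I. f i x)"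
  by (induction I rule: infinite_finite_induct) (auto intro: lin_plus)

lemma fsupp_add [intro]: "u \<in> fsupp X \<Longrightarrow> v \<in> fsupp X \<Longrightarrow> u + v \<in> fsupp (X :: 'x set)"
  for u v :: "'x \<Rightarrow> 'k::field"
  by (auto simp: fsupp_def)

lemma fsupp_diff [intro]: "u \<in> fsupp X \<Longrightarrow> v \<in> fsupp X \<Longrightarrow> u - v \<in> fsupp (X :: 'x set)"
  for u v :: "'x \<Rightarrow> 'k::field"
  by (auto simp: fsupp_def)

lemma fsupp_0 [intro]: "0 \<in> fsupp (X :: 'x set)"
  by (auto simp: fsupp_def)

lemma fsupp_scl [intro]: "u \<in> fsupp X \<Longrightarrow> scl c u \<in> fsupp (X :: 'x set)"
  for u :: "'x \<Rightarrow> 'k::field"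
  by (auto simp: fsupp_def)

lemma fsupp_sum [intro]: "(\<And>i. i \<in> I \<Longrightarrow> u i \<in> fsupp X) \<Longrightarrow> (\<Sum>i\<in>I. u i) \<in> fsupp (X :: 'x set)"
  for u :: "'i \<Rightarrow> 'x \<Rightarrow> 'k::field"
  by (induction I rule: infinite_finite_induct) auto

text \<open>The complex starts with the resolved module in index \<open>0\<close>, so \<open>d 0\<close> is the augmentation and the
  \<open>n\<close>-th term of the resolution has index \<open>n + 1\<close>.  The operator \<open>th\<close> is a witness for the relative
  injectivity of these terms.\<close>

locale equiv_resolution = group H for H :: "('b, 'r) monoid_scheme" (structure) +
  fixes X :: "nat \<Rightarrow> 'x set"
    and d s :: "nat \<Rightarrow> ('x \<Rightarrow> 'k::field) \<Rightarrow> ('x \<Rightarrow> 'k)"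
    and ac :: "'b \<Rightarrow> ('x \<Rightarrow> 'k) \<Rightarrow> ('x \<Rightarrow> 'k)"
    and th :: "('x \<Rightarrow> 'k) \<Rightarrow> ('x \<Rightarrow> 'k)"
  assumes fin_H: "finite (carrier H)"
    and lin_d: "lin (d n)" and lin_s: "lin (s n)" and lin_ac: "lin (ac h)" and lin_th: "lin th"
    and d_in: "x \<in> fsupp (X n) \<Longrightarrow> d n x \<in> fsupp (X (Suc n))"
    and s_in: "x \<in> fsupp (X (Suc n)) \<Longrightarrow> s n x \<in> fsupp (X n)"
    and ac_in: "h \<in> carrier H \<Longrightarrow> x \<in> fsupp (X n) \<Longrightarrow> ac h x \<in> fsupp (X n)"
    and th_in: "x \<in> fsupp (X (Suc n)) \<Longrightarrow> th x \<in> fsupp (X (Suc n))"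
    and ac_one: "x \<in> fsupp (X n) \<Longrightarrow> ac \<one> x = x"
    and ac_mult: "h \<in> carrier H \<Longrightarrow> h' \<in> carrier H \<Longrightarrow> x \<in> fsupp (X n) \<Longrightarrow>
      ac (h \<otimes> h') x = ac h (ac h' x)"
    and d_ac: "h \<in> carrier H \<Longrightarrow> x \<in> fsupp (X n) \<Longrightarrow> d n (ac h x) = ac h (d n x)"
    and d_d: "x \<in> fsupp (X n) \<Longrightarrow> d (Suc n) (d n x) = 0"
    and contr_0: "x \<in> fsupp (X 0) \<Longrightarrow> s 0 (d 0 x) = x"
    and contr: "x \<in> fsupp (X (Suc n)) \<Longrightarrow> d n (s n x) + s (Suc n) (d (Suc n) x) = x"
    and th_sum: "x \<in> fsupp (X (Suc n)) \<Longrightarrow> (\<Sum>h\<in>carrier H. ac h (th (ac (inv h) x))) = x"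
begin

lemma sum_left_mult:
  assumes "g \<in> carrier H"
  shows "(\<Sum>h\<in>carrier H. f h) = (\<Sum>h\<in>carrier H. f (g \<otimes> h))"
  by (rule sum.reindex_bij_witness[of _ "\<lambda>h. g \<otimes> h" "\<lambda>h. inv g \<otimes> h"])
    (use assms in \<open>auto simp: m_assoc[symmetric]\<close>)

end

section \<open>Comparison maps and homotopies between two resolutions\<close>

locale resolution_pair =
  A: equiv_resolution H X d s ac th + C: equiv_resolution H Y d' s' ac' th'
  for H :: "('b, 'r) monoid_scheme" (structure)
    and X :: "nat \<Rightarrow> 'x set" and d s and ac :: "'b \<Rightarrow> ('x \<Rightarrow> 'k::field) \<Rightarrow> ('x \<Rightarrow> 'k)" and th
    and Y :: "nat \<Rightarrow> 'y set" and d' s' and ac' :: "'b \<Rightarrow> ('y \<Rightarrow> 'k) \<Rightarrow> ('y \<Rightarrow> 'k)" and th'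
begin

definition equiv_map :: "'x set \<Rightarrow> 'y set \<Rightarrow> (('x \<Rightarrow> 'k) \<Rightarrow> ('y \<Rightarrow> 'k)) \<Rightarrow> bool" where
  "equiv_map V W f \<longleftrightarrow> lin f \<and> (\<forall>x\<in>fsupp V. f x \<in> fsupp W) \<and>
     (\<forall>h\<in>carrier H. \<forall>x\<in>fsupp V. f (ac h x) = ac' h (f x))"

text \<open>Averaging a merely linear map against \<open>th'\<close> makes it equivariant, and leaves it unchanged
  on inputs where it was equivariant already.\<close>

definition average :: "(('x \<Rightarrow> 'k) \<Rightarrow> ('y \<Rightarrow> 'k)) \<Rightarrow> ('x \<Rightarrow> 'k) \<Rightarrow> ('y \<Rightarrow> 'k)" where
  "average f x = (\<Sum>h\<in>carrier H. ac' h (th' (f (ac (inv h) x))))"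

lemma average_equiv_map:
  assumes "lin f" and f_in: "\<And>x. x \<in> fsupp (X n) \<Longrightarrow> f x \<in> fsupp (Y (Suc l))"
  shows "equiv_map (X n) (Y (Suc l)) (average f)"
  unfolding equiv_map_def
proof (intro conjI ballI)
  show "lin (average f)"
    unfolding average_def
    by (intro lin_sum_fun lin_comp[OF C.lin_ac] lin_comp[OF C.lin_th] lin_comp[OF assms(1)] A.lin_ac)
next
  fix x :: "'x \<Rightarrow> 'k" assume "x \<in> fsupp (X n)"
  then show "average f x \<in> fsupp (Y (Suc l))"
    unfolding average_def
    by (intro fsupp_sum C.ac_in C.th_in f_in A.ac_in) auto
next
  fix g and x :: "'x \<Rightarrow> 'k" assume g: "g \<in> carrier H" and x: "x \<in> fsupp (X n)"
  have in_Y: "th' (f (ac (inv h) x)) \<in> fsupp (Y (Suc l))" if "h \<in> carrier H" for h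
    using that x by (intro C.th_in f_in A.ac_in) auto
  have "average f (ac g x) = (\<Sum>h\<in>carrier H. ac' (g \<otimes> h) (th' (f (ac (inv (g \<otimes> h)) (ac g x)))))"
    unfolding average_def by (rule A.sum_left_mult[OF g])
  also have "\<dots> = (\<Sum>h\<in>carrier H. ac' g (ac' h (th' (f (ac (inv h) x)))))"
  proof (rule sum.cong[OF refl])
    fix h assume h: "h \<in> carrier H"
    have "ac (inv (g \<otimes> h)) (ac g x) = ac (inv (g \<otimes> h) \<otimes> g) x"
      using g h x by (subst A.ac_mult) auto
    also have "inv (g \<otimes> h) \<otimes> g = inv h"
      using g h by (simp add: A.inv_mult_group A.m_assoc)
    finally show "ac' (g \<otimes> h) (th' (f (ac (inv (g \<otimes> h)) (ac g x)))) = ac' g (ac' h (th' (f (ac (inv h) x))))"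
      using C.ac_mult[OF g h in_Y[OF h]] by simp
  qed
  also have "\<dots> = ac' g (average f x)"
    by (simp add: average_def lin_sum[OF C.lin_ac])
  finally show "average f (ac g x) = ac' g (average f x)" .
qed

text \<open>Only the values of \<open>f\<close> on the orbit of \<open>x\<close> enter, and
  \<open>th_sum\<close> averages the translates of \<open>y\<close> back to \<open>y\<close>. In
  this way a map that is under control on boundaries alone keeps its values there.\<close>

lemma average_eq:
  assumes x: "x \<in> fsupp (X n)" and y: "y \<in> fsupp (Y (Suc l))"
    and eq: "\<And>h. h \<in> carrier H \<Longrightarrow> f (ac h x) = ac' h y"
  shows "average f x = y"
proof -
  have "average f x = (\<Sum>h\<in>carrier H. ac' h (th' (ac' (inv h) y)))"
    unfolding average_def by (intro sum.cong refl) (simp add: eq)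
  then show ?thesis using C.th_sum[OF y] by simp
qed

text \<open>The usual lift through a contraction. Since \<open>s\<close> is merely linear,
  \<open>d' n (lift_map f n (s n x))\<close> is known to be equivariant only on the image of
  \<open>d n\<close>; averaging makes it so everywhere.\<close>

primrec lift_map :: "(('x \<Rightarrow> 'k) \<Rightarrow> ('y \<Rightarrow> 'k)) \<Rightarrow> nat \<Rightarrow> ('x \<Rightarrow> 'k) \<Rightarrow> ('y \<Rightarrow> 'k)" where
  "lift_map f 0 = f"
| "lift_map f (Suc n) = average (\<lambda>x. d' n (lift_map f n (s n x)))"

lemma equiv_mapD:
  assumes "equiv_map V W f"
  shows "lin f" "x \<in> fsupp V \<Longrightarrow> f x \<in> fsupp W"
    "h \<in> carrier H \<Longrightarrow> x \<in> fsupp V \<Longrightarrow> f (ac h x) = ac' h (f x)"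
  using assms by (auto simp: equiv_map_def)

text \<open>On a boundary the contraction returns a preimage up to \<open>d n (s n z)\<close>; the
  lift of that correction is itself a boundary, so \<open>d'\<close> kills it.\<close>

theorem comparison:
  assumes "equiv_map (X 0) (Y 0) f"
  shows "equiv_map (X n) (Y n) (lift_map f n)"
    and "x \<in> fsupp (X n) \<Longrightarrow> lift_map f (Suc n) (d n x) = d' n (lift_map f n x)"
proof -
  have "equiv_map (X n) (Y n) (lift_map f n) \<and>
    (\<forall>x\<in>fsupp (X n). lift_map f (Suc n) (d n x) = d' n (lift_map f n x))" for n
  proof (induction n)
    case 0
    have "lift_map f (Suc 0) (d 0 x) = d' 0 (lift_map f 0 x)" if x: "x \<in> fsupp (X 0)" for x
      unfolding lift_map.simps
    proof (rule average_eq)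
      show "d 0 x \<in> fsupp (X (Suc 0))" using x by (rule A.d_in)
      show "d' 0 (f x) \<in> fsupp (Y (Suc 0))"
        using x by (intro C.d_in equiv_mapD(2)[OF assms])
      fix h assume h: "h \<in> carrier H"
      have "s 0 (ac h (d 0 x)) = ac h x"
        using A.contr_0[OF A.ac_in[OF h x]] A.d_ac[OF h x] by simp
      then show "d' 0 (f (s 0 (ac h (d 0 x)))) = ac' h (d' 0 (f x))"
        using C.d_ac[OF h] equiv_mapD(2,3)[OF assms] h x by simp
    qed
    then show ?case using assms by simp
  next
    case (Suc n)
    note IH = equiv_mapD[OF conjunct1[OF Suc]]
    have eq: "equiv_map (X (Suc n)) (Y (Suc n)) (lift_map f (Suc n))"
      unfolding lift_map.simps
    proof (rule average_equiv_map)
      show "lin (\<lambda>x. d' n (lift_map f n (s n x)))"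
        by (intro lin_comp[OF C.lin_d] lin_comp[OF IH(1)] A.lin_s)
      show "d' n (lift_map f n (s n x)) \<in> fsupp (Y (Suc n))" if "x \<in> fsupp (X (Suc n))" for x :: "'x \<Rightarrow> 'k"
        using that by (intro C.d_in IH(2) A.s_in)
    qed
    note E = equiv_mapD[OF eq]
    have "lift_map f (Suc (Suc n)) (d (Suc n) x) = d' (Suc n) (lift_map f (Suc n) x)"
      if x: "x \<in> fsupp (X (Suc n))" for x
      unfolding lift_map.simps(2)[of f "Suc n"]
    proof (rule average_eq)
      show "d (Suc n) x \<in> fsupp (X (Suc (Suc n)))" using x by (rule A.d_in)
      show "d' (Suc n) (lift_map f (Suc n) x) \<in> fsupp (Y (Suc (Suc n)))"
        using x by (intro C.d_in E(2))
      fix h assume h: "h \<in> carrier H"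
      define z where "z = ac h x"
      have z: "z \<in> fsupp (X (Suc n))" unfolding z_def using h x by (rule A.ac_in)
      have "s (Suc n) (ac h (d (Suc n) x)) = z - d n (s n z)"
        using A.contr[OF z] A.d_ac[OF h x] by (simp add: z_def algebra_simps)
      moreover have "d' (Suc n) (lift_map f (Suc n) (d n (s n z))) = 0"
        using Suc A.s_in[OF z] by (simp add: C.d_d[OF IH(2)] del: lift_map.simps)
      ultimately have "d' (Suc n) (lift_map f (Suc n) (s (Suc n) (ac h (d (Suc n) x)))) =
          d' (Suc n) (lift_map f (Suc n) z)"
        by (simp add: lin_diff[OF E(1)] lin_diff[OF C.lin_d] del: lift_map.simps)
      also have "\<dots> = ac' h (d' (Suc n) (lift_map f (Suc n) x))"
        using E(2,3) h x C.d_ac by (simp add: z_def del: lift_map.simps)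
      finally show "d' (Suc n) (lift_map f (Suc n) (s (Suc n) (ac h (d (Suc n) x)))) =
        ac' h (d' (Suc n) (lift_map f (Suc n) x))" .
    qed
    with eq show ?case by blast
  qed
  then show "equiv_map (X n) (Y n) (lift_map f n)"
    and "x \<in> fsupp (X n) \<Longrightarrow> lift_map f (Suc n) (d n x) = d' n (lift_map f n x)"
    by blast+
qed

text \<open>\<open>homotopy f n\<close> lowers the index from \<open>n + 1\<close> to
  \<open>n\<close>. It can start with zero because \<open>f 0\<close>, the map on the resolved
  module, vanishes in the application.\<close>

primrec homotopy :: "(nat \<Rightarrow> ('x \<Rightarrow> 'k) \<Rightarrow> ('y \<Rightarrow> 'k)) \<Rightarrow> nat \<Rightarrow> ('x \<Rightarrow> 'k) \<Rightarrow> ('y \<Rightarrow> 'k)" where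
  "homotopy f 0 = (\<lambda>x. 0)"
| "homotopy f (Suc n) = average (\<lambda>x. f (Suc n) (s (Suc n) x) - d' n (homotopy f n (s (Suc n) x)))"

theorem homotopy:
  assumes f: "\<And>n. equiv_map (X n) (Y n) (f n)"
    and chain: "\<And>n x. x \<in> fsupp (X n) \<Longrightarrow> f (Suc n) (d n x) = d' n (f n x)"
    and f_0: "\<And>x. x \<in> fsupp (X 0) \<Longrightarrow> f 0 x = 0"
  shows "equiv_map (X (Suc n)) (Y n) (homotopy f n)"
    and "x \<in> fsupp (X (Suc n)) \<Longrightarrow>
      f (Suc n) x = d' n (homotopy f n x) + homotopy f (Suc n) (d (Suc n) x)"
proof -
  note fD = equiv_mapD[OF f]
  \<comment> \<open>By the assumption \<open>cocycle\<close>, the difference of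
    \<open>f (Suc n)\<close> and \<open>d' n\<close> after \<open>homotopy f n\<close> vanishes on
    boundaries, so it factors through \<open>d (Suc n)\<close>. The next homotopy is that factor,
    averaged.\<close>
  have step: "f (Suc n) x = d' n (homotopy f n x) + homotopy f (Suc n) (d (Suc n) x)"
    if h: "equiv_map (X (Suc n)) (Y n) (homotopy f n)"
      and cocycle: "\<And>x. x \<in> fsupp (X n) \<Longrightarrow> f (Suc n) (d n x) = d' n (homotopy f n (d n x))"
      and x: "x \<in> fsupp (X (Suc n))" for n x
  proof -
    note hD = equiv_mapD[OF h]
    define y where "y = f (Suc n) x - d' n (homotopy f n x)"
    have "homotopy f (Suc n) (d (Suc n) x) = y"
      unfolding homotopy.simps
    proof (rule average_eq)
      show "d (Suc n) x \<in> fsupp (X (Suc (Suc n)))" using x by (rule A.d_in)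
      show "y \<in> fsupp (Y (Suc n))"
        unfolding y_def using x by (intro fsupp_diff fD(2) C.d_in hD(2))
      fix g assume g: "g \<in> carrier H"
      define z where "z = ac g x"
      have z: "z \<in> fsupp (X (Suc n))" unfolding z_def using g x by (rule A.ac_in)
      have s: "s (Suc n) (ac g (d (Suc n) x)) = z - d n (s n z)"
        using A.contr[OF z] A.d_ac[OF g x] by (simp add: z_def algebra_simps)
      have "f (Suc n) (z - d n (s n z)) - d' n (homotopy f n (z - d n (s n z))) =
        f (Suc n) z - d' n (homotopy f n z)"
        using cocycle[OF A.s_in[OF z]]
        by (simp add: lin_diff[OF fD(1)] lin_diff[OF hD(1)] lin_diff[OF C.lin_d])
      also have "\<dots> = ac' g y"
        using fD(3)[OF g x] hD(3)[OF g x] C.d_ac[OF g hD(2)[OF x]]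
        by (simp add: z_def y_def lin_diff[OF C.lin_ac])
      finally show "f (Suc n) (s (Suc n) (ac g (d (Suc n) x))) -
          d' n (homotopy f n (s (Suc n) (ac g (d (Suc n) x)))) = ac' g y"
        unfolding s .
    qed
    then show ?thesis by (simp add: y_def)
  qed
  have "equiv_map (X (Suc n)) (Y n) (homotopy f n) \<and>
    (\<forall>x\<in>fsupp (X n). f (Suc n) (d n x) = d' n (homotopy f n (d n x)))" for n
  proof (induction n)
    case 0
    have "equiv_map (X (Suc 0)) (Y 0) (homotopy f 0)"
      unfolding equiv_map_def homotopy.simps
      by (intro conjI ballI lin_zero fsupp_0 lin_0[OF C.lin_ac, symmetric])
    moreover have "f (Suc 0) (d 0 x) = d' 0 (homotopy f 0 (d 0 x))" if "x \<in> fsupp (X 0)" for x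
      using chain[OF that] f_0[OF that] by simp
    ultimately show ?case by blast
  next
    case (Suc n)
    then have h: "equiv_map (X (Suc n)) (Y n) (homotopy f n)"
      and cocycle: "\<And>x. x \<in> fsupp (X n) \<Longrightarrow> f (Suc n) (d n x) = d' n (homotopy f n (d n x))"
      by blast+
    note hD = equiv_mapD[OF h]
    have "f (Suc (Suc n)) (d (Suc n) x) = d' (Suc n) (homotopy f (Suc n) (d (Suc n) x))"
      if x: "x \<in> fsupp (X (Suc n))" for x
    proof -
      have "d' (Suc n) (f (Suc n) x) = d' (Suc n) (d' n (homotopy f n x)) +
          d' (Suc n) (homotopy f (Suc n) (d (Suc n) x))"
        using step[OF h cocycle x] by (simp add: lin_add[OF C.lin_d] del: homotopy.simps)
      then show ?thesis
        using chain[OF x] C.d_d[OF hD(2)[OF x]] by simp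
    qed
    moreover have "equiv_map (X (Suc (Suc n))) (Y (Suc n)) (homotopy f (Suc n))"
      unfolding homotopy.simps
    proof (rule average_equiv_map)
      show "lin (\<lambda>x. f (Suc n) (s (Suc n) x) - d' n (homotopy f n (s (Suc n) x)))"
        by (intro lin_minus_fun lin_comp[OF fD(1)] lin_comp[OF C.lin_d] lin_comp[OF hD(1)] A.lin_s)
      show "f (Suc n) (s (Suc n) x) - d' n (homotopy f n (s (Suc n) x)) \<in> fsupp (Y (Suc n))"
        if "x \<in> fsupp (X (Suc (Suc n)))" for x
        using that by (intro fsupp_diff fD(2) C.d_in hD(2) A.s_in)
    qed
    ultimately show ?case by blast
  qed
  then show "equiv_map (X (Suc n)) (Y n) (homotopy f n)"
    and "x \<in> fsupp (X (Suc n)) \<Longrightarrow>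
      f (Suc n) x = d' n (homotopy f n x) + homotopy f (Suc n) (d (Suc n) x)"
    using step by blast+
qed

declare lift_map.simps(2) [simp del] homotopy.simps(2) [simp del]

end

section \<open>The bar resolution\<close>

text \<open>The bar complex: cochains on \<open>G\<^sup>n\<^sup>+\<^sup>1\<close> with \<open>G\<close> acting on the first entry, together with the
  coefficient module as functions on the empty list.  The equation for \<open>h # g # L\<close> recovers the
  usual alternating sum.\<close>

fun bar_d :: "('g \<Rightarrow> 'g \<Rightarrow> 'g) \<Rightarrow> ('g list \<Rightarrow> 'k::ab_group_add) \<Rightarrow> 'g list \<Rightarrow> 'k" where
  "bar_d m \<phi> [] = 0"
| "bar_d m \<phi> [g] = \<phi> []"
| "bar_d m \<phi> (h # g # L) = \<phi> (m h g # L) - bar_d m (\<lambda>L. \<phi> (h # L)) (g # L)"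

text \<open>Cochains are controlled on tuples of group elements only, so the congruence is relative
  to a set that is closed under multiplication.\<close>

lemma bar_d_cong:
  assumes "\<And>L'. Suc (length L') = length L \<Longrightarrow> set L' \<subseteq> C \<Longrightarrow> \<phi> L' = \<psi> L'"
    and "set L \<subseteq> C" and "\<And>x y. x \<in> C \<Longrightarrow> y \<in> C \<Longrightarrow> m x y \<in> C"
  shows "bar_d m \<phi> L = bar_d m \<psi> L"
  using assms
proof (induction m \<phi> L arbitrary: \<psi> rule: bar_d.induct)
  case (3 m \<phi> h g L)
  have "bar_d m (\<lambda>L. \<phi> (h # L)) (g # L) = bar_d m (\<lambda>L. \<psi> (h # L)) (g # L)"
    using 3(3,4) by (intro 3(1)) (auto intro!: 3(2) 3(4))
  moreover have "\<phi> (m h g # L) = \<psi> (m h g # L)"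
    using 3(3) by (intro 3(2)) (auto intro: 3(4))
  ultimately show ?case by simp
qed auto

lemma bar_d_diff: "bar_d m (\<lambda>L. \<phi> L - \<psi> L) L = bar_d m \<phi> L - bar_d m \<psi> L"
  by (induction m \<phi> L arbitrary: \<psi> rule: bar_d.induct) (simp_all add: algebra_simps)

lemma bar_d_add: "bar_d m (\<lambda>L. \<phi> L + \<psi> L) L = bar_d m \<phi> L + bar_d m \<psi> L"
  by (induction m \<phi> L arbitrary: \<psi> rule: bar_d.induct) (simp_all add: add_diff_add)

lemma bar_d_mult: "bar_d m (\<lambda>L. c * \<phi> L) L = c * bar_d m \<phi> L" for \<phi> :: "'g list \<Rightarrow> 'k::comm_ring"
  by (induction m \<phi> L rule: bar_d.induct) (simp_all add: algebra_simps)

lemma bar_d_lin: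
  assumes T: "lin T"
  shows "bar_d m (\<lambda>L. T (\<lambda>i. \<Phi> L i) j) L = T (\<lambda>i. bar_d m (\<lambda>L. \<Phi> L i) L) j"
proof (induction L arbitrary: \<Phi>)
  case Nil
  have "T (\<lambda>i. 0) = (\<lambda>i. 0)"
    using lin_0[OF T] by (simp only: zero_fun_def)
  then show ?case by simp
next
  case (Cons h M)
  show ?case
  proof (cases M)
    case M: (Cons g L)
    have "T (\<lambda>i. \<Phi> (m h g # L) i - bar_d m (\<lambda>L. \<Phi> (h # L) i) (g # L)) =
        T (\<Phi> (m h g # L)) - T (\<lambda>i. bar_d m (\<lambda>L. \<Phi> (h # L) i) (g # L))"
      using lin_diff[OF T, of "\<Phi> (m h g # L)" "\<lambda>i. bar_d m (\<lambda>L. \<Phi> (h # L) i) (g # L)"]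
      by (simp only: fun_diff_def)
    then show ?thesis using Cons[of "\<lambda>L. \<Phi> (h # L)"] by (simp add: M)
  qed simp
qed

context group
begin

text \<open>Left translation meets the first entry only, and associativity carries it through the
  first merge. This serves both for the equivariance of the differential and for
  \<open>bar_d_bar_d\<close>.\<close>

lemma bar_d_translate:
  assumes "h \<in> carrier G" "x \<in> carrier G" "set L \<subseteq> carrier G"
  shows "bar_d (\<otimes>) (\<lambda>L. case L of [] \<Rightarrow> \<phi> [] | x # L' \<Rightarrow> \<phi> (h \<otimes> x # L')) (x # L) =
    bar_d (\<otimes>) \<phi> (h \<otimes> x # L)"
  using assms by (cases L) (auto simp: m_assoc)

text \<open>Prefixing \<open>h\<close> to the inner differential yields a translated cochain minus
  the differential of the prefixed cochain. The second part dies by induction; the first cancels the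
  term in which \<open>h\<close> and \<open>g\<close> are merged.\<close>

lemma bar_d_bar_d:
  assumes "length L \<ge> 2" "set L \<subseteq> carrier G"
  shows "bar_d (\<otimes>) (bar_d (\<otimes>) \<phi>) L = 0"
  using assms
proof (induction L arbitrary: \<phi> rule: length_induct)
  case (1 L)
  then obtain h g L' where L: "L = h # g # L'"
    by (metis Suc_le_length_iff numeral_2_eq_2)
  show ?case
  proof (cases L')
    case Nil
    then show ?thesis by (simp add: L)
  next
    case (Cons k L'')
    let ?t = "\<lambda>L. case L of [] \<Rightarrow> \<phi> [] | x # L' \<Rightarrow> \<phi> (h \<otimes> x # L')"
    have carr: "h \<in> carrier G" "g \<in> carrier G" "set (g # L') \<subseteq> carrier G"
      using 1(3) by (auto simp: L)
    have "bar_d (\<otimes>) (\<lambda>L. bar_d (\<otimes>) \<phi> (h # L)) (g # L') =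
      bar_d (\<otimes>) (\<lambda>L. ?t L - bar_d (\<otimes>) (\<lambda>L. \<phi> (h # L)) L) (g # L')"
    proof (rule bar_d_cong[where C = "carrier G"])
      fix M :: "'a list" assume "Suc (length M) = length (g # L')"
      then obtain x M' where "M = x # M'" by (cases M) (auto simp: Cons)
      then show "bar_d (\<otimes>) \<phi> (h # M) = ?t M - bar_d (\<otimes>) (\<lambda>L. \<phi> (h # L)) M" by simp
    qed (use carr in auto)
    also have "\<dots> = bar_d (\<otimes>) \<phi> (h \<otimes> g # L')"
      using 1(1)[rule_format, of "g # L'" "\<lambda>L. \<phi> (h # L)"] carr
      by (subst bar_d_diff, subst bar_d_translate) (auto simp: L Cons)
    finally show ?thesis by (simp add: L)
  qed
qed

end

lemma tuples_Nil [simp]: "[] \<in> tuples G n \<longleftrightarrow> n = 0"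
  by (auto simp: tuples_def)

lemma tuples_Cons [simp]: "x # L \<in> tuples G (Suc n) \<longleftrightarrow> x \<in> carrier G \<and> L \<in> tuples G n"
  by (auto simp: tuples_def)

lemma tuples_0 [simp]: "tuples G 0 = {[]}"
  by (auto simp: tuples_def)

lemma tuples_Suc_cases:
  assumes "L \<in> tuples G (Suc n)"
  obtains x L' where "L = x # L'" "x \<in> carrier G" "L' \<in> tuples G n"
  using assms by (cases L) (auto simp: tuples_def)

section \<open>The bar complex of a representation, as a resolution over any subgroup\<close>

locale group_representation = group G for G :: "('g, 'r) monoid_scheme" (structure) +
  fixes I :: "'i set" and R :: "'g \<Rightarrow> ('i \<Rightarrow> 'k::field) \<Rightarrow> ('i \<Rightarrow> 'k)"
  assumes fin_G: "finite (carrier G)"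
    and lin_R: "lin (R g)"
    and R_in: "g \<in> carrier G \<Longrightarrow> v \<in> fsupp I \<Longrightarrow> R g v \<in> fsupp I"
    and R_one: "v \<in> fsupp I \<Longrightarrow> R \<one> v = v"
    and R_mult: "g \<in> carrier G \<Longrightarrow> h \<in> carrier G \<Longrightarrow> v \<in> fsupp I \<Longrightarrow> R (g \<otimes> h) v = R g (R h v)"
begin

definition bar_X :: "nat \<Rightarrow> ('g list \<times> 'i) set" where
  "bar_X n = tuples G n \<times> I"

definition bar_diff :: "nat \<Rightarrow> ('g list \<times> 'i \<Rightarrow> 'k) \<Rightarrow> ('g list \<times> 'i \<Rightarrow> 'k)" where
  "bar_diff n \<Phi> = (\<lambda>(L, i). if L \<in> tuples G (Suc n) then bar_d (\<otimes>) (\<lambda>L. \<Phi> (L, i)) L else 0)"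

definition bar_s :: "nat \<Rightarrow> ('g list \<times> 'i \<Rightarrow> 'k) \<Rightarrow> ('g list \<times> 'i \<Rightarrow> 'k)" where
  "bar_s n \<Phi> = (\<lambda>(L, i). if L \<in> tuples G n then \<Phi> (\<one> # L, i) else 0)"

text \<open>Of a list only the first entry is moved, and it is moved freely; this makes the terms of
  index at least \<open>1\<close> relatively injective over every subgroup.\<close>

definition bar_act :: "'g \<Rightarrow> ('g list \<times> 'i \<Rightarrow> 'k) \<Rightarrow> ('g list \<times> 'i \<Rightarrow> 'k)" where
  "bar_act g \<Phi> = (\<lambda>(L, i). if set L \<subseteq> carrier G then
     (case L of [] \<Rightarrow> R g (\<lambda>i. \<Phi> ([], i)) i | x # L' \<Rightarrow> R g (\<lambda>i. \<Phi> (inv g \<otimes> x # L', i)) i) else 0)"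

definition bar_th :: "'g set \<Rightarrow> ('g list \<times> 'i \<Rightarrow> 'k) \<Rightarrow> ('g list \<times> 'i \<Rightarrow> 'k)" where
  "bar_th T \<Phi> = (\<lambda>(L, i). if L \<noteq> [] \<and> hd L \<in> T then \<Phi> (L, i) else 0)"

lemma bar_supp: "\<Phi> \<in> fsupp (bar_X n) \<Longrightarrow> (\<lambda>i. \<Phi> (L, i)) \<in> fsupp I"
  by (auto simp: bar_X_def fsupp_def)

lemma bar_supp_0: "\<Phi> \<in> fsupp (bar_X n) \<Longrightarrow> L \<notin> tuples G n \<Longrightarrow> \<Phi> (L, i) = 0"
  by (auto simp: bar_X_def fsupp_def)

lemma bar_supp_I: "\<Phi> \<in> fsupp (bar_X n) \<Longrightarrow> i \<notin> I \<Longrightarrow> \<Phi> (L, i) = 0"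
  by (auto simp: bar_X_def fsupp_def)

lemma in_bar_X:
  assumes "\<And>L. L \<notin> tuples G n \<Longrightarrow> (\<lambda>i. \<Phi> (L, i)) = 0" "\<And>L. L \<in> tuples G n \<Longrightarrow> (\<lambda>i. \<Phi> (L, i)) \<in> fsupp I"
  shows "\<Phi> \<in> fsupp (bar_X n)"
  using assms by (fastforce simp: bar_X_def fsupp_def fun_eq_iff)

lemma lin_bar_diff: "lin (bar_diff n)"
  by (rule linI) (auto simp: bar_diff_def fun_eq_iff bar_d_add bar_d_mult)

lemma lin_bar_s: "lin (bar_s n)"
  by (rule linI) (auto simp: bar_s_def fun_eq_iff)

lemma R_add: "R g (\<lambda>i. u i + v i) = (\<lambda>i. R g u i + R g v i)"
  using lin_add[OF lin_R, of g u v] by (simp add: plus_fun_def)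

lemma R_scl: "R g (\<lambda>i. c * v i) = (\<lambda>i. c * R g v i)"
  using lin_scl[OF lin_R, of g c v] by (simp add: scl_def)

lemma R_0: "R g (\<lambda>i. 0) = (\<lambda>i. 0)"
  using lin_0[OF lin_R, of g] by (simp add: zero_fun_def)

lemma lin_bar_act: "lin (bar_act g)"
  by (rule linI) (auto simp: bar_act_def fun_eq_iff R_add R_scl split: list.split)

lemma lin_bar_th: "lin (bar_th T)"
  by (rule linI) (auto simp: bar_th_def fun_eq_iff)

lemma bar_d_zero: "bar_d m (\<lambda>L. 0) L = (0 :: 'k)" for m :: "'g \<Rightarrow> 'g \<Rightarrow> 'g"
  using bar_d_mult[of m 0 "\<lambda>L. 0 :: 'k" L] by simp

lemma bar_diff_in:
  assumes \<Phi>: "\<Phi> \<in> fsupp (bar_X n)"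
  shows "bar_diff n \<Phi> \<in> fsupp (bar_X (Suc n))"
proof (rule in_bar_X)
  fix L :: "'g list"
  have "bar_diff n \<Phi> (L, i) = 0" if "i \<notin> I" for i
    using bar_supp_I[OF \<Phi> that] by (simp add: bar_diff_def bar_d_zero)
  then show "(\<lambda>i. bar_diff n \<Phi> (L, i)) \<in> fsupp I"
    by (simp add: fsupp_def)
qed (simp add: bar_diff_def fun_eq_iff)

lemma bar_s_in:
  assumes \<Phi>: "\<Phi> \<in> fsupp (bar_X (Suc n))"
  shows "bar_s n \<Phi> \<in> fsupp (bar_X n)"
proof (rule in_bar_X)
  fix L :: "'g list"
  show "(\<lambda>i. bar_s n \<Phi> (L, i)) \<in> fsupp I"
    using bar_supp_I[OF \<Phi>] by (simp add: fsupp_def bar_s_def)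
qed (simp add: bar_s_def fun_eq_iff)

lemma bar_act_apply:
  assumes "g \<in> carrier G" "x \<in> carrier G" "L \<in> tuples G n"
  shows "bar_act g \<Phi> (x # L, i) = R g (\<lambda>i. \<Phi> (inv g \<otimes> x # L, i)) i"
  using assms by (auto simp: bar_act_def tuples_def)

lemma bar_act_in:
  assumes g: "g \<in> carrier G" and \<Phi>: "\<Phi> \<in> fsupp (bar_X n)"
  shows "bar_act g \<Phi> \<in> fsupp (bar_X n)"
proof (rule in_bar_X)
  fix L :: "'g list" assume L: "L \<notin> tuples G n"
  show "(\<lambda>i. bar_act g \<Phi> (L, i)) = 0"
  proof (cases L)
    case Nil
    then have "(\<lambda>i. \<Phi> ([], i)) = (\<lambda>i. 0)"
      using bar_supp_0[OF \<Phi>] L by (simp add: fun_eq_iff)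
    then show ?thesis by (simp add: bar_act_def Nil R_0 fun_eq_iff)
  next
    case (Cons x L')
    have "(\<lambda>i. \<Phi> (inv g \<otimes> x # L', i)) = (\<lambda>i. 0)" if "set L \<subseteq> carrier G"
      using bar_supp_0[OF \<Phi>, of "inv g \<otimes> x # L'"] L that g by (simp add: fun_eq_iff tuples_def Cons)
    then show ?thesis by (simp add: bar_act_def Cons R_0 fun_eq_iff)
  qed
next
  fix L :: "'g list"
  show "(\<lambda>i. bar_act g \<Phi> (L, i)) \<in> fsupp I"
    using R_in[OF g bar_supp[OF \<Phi>]] by (cases L) (simp_all add: bar_act_def fsupp_def)
qed

lemma bar_th_in: "\<Phi> \<in> fsupp (bar_X n) \<Longrightarrow> bar_th T \<Phi> \<in> fsupp (bar_X n)"
  by (auto simp: bar_th_def fsupp_def)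

lemma bar_ext:
  assumes "\<Phi> \<in> fsupp (bar_X n)" "\<Psi> \<in> fsupp (bar_X n)"
    and "\<And>L i. L \<in> tuples G n \<Longrightarrow> \<Phi> (L, i) = \<Psi> (L, i)"
  shows "\<Phi> = \<Psi>"
proof (rule ext, clarify)
  fix L i show "\<Phi> (L, i) = \<Psi> (L, i)"
    using assms by (cases "L \<in> tuples G n") (auto simp: bar_supp_0)
qed

lemma bar_act_one:
  assumes \<Phi>: "\<Phi> \<in> fsupp (bar_X n)"
  shows "bar_act \<one> \<Phi> = \<Phi>"
proof (rule bar_ext[OF bar_act_in[OF one_closed \<Phi>] \<Phi>])
  fix L i assume "L \<in> tuples G n"
  then show "bar_act \<one> \<Phi> (L, i) = \<Phi> (L, i)"
    by (cases L) (auto simp: bar_act_def R_one bar_supp[OF \<Phi>] tuples_def)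
qed

lemma bar_act_mult:
  assumes g: "g \<in> carrier G" and h: "h \<in> carrier G" and \<Phi>: "\<Phi> \<in> fsupp (bar_X n)"
  shows "bar_act (g \<otimes> h) \<Phi> = bar_act g (bar_act h \<Phi>)"
proof (rule bar_ext[OF bar_act_in[OF m_closed[OF g h] \<Phi>] bar_act_in[OF g bar_act_in[OF h \<Phi>]]])
  fix L i assume L: "L \<in> tuples G n"
  show "bar_act (g \<otimes> h) \<Phi> (L, i) = bar_act g (bar_act h \<Phi>) (L, i)"
  proof (cases L)
    case Nil
    then show ?thesis using g h by (simp add: bar_act_def R_mult bar_supp[OF \<Phi>])
  next
    case (Cons x L')
    then have "inv g \<otimes> x \<in> carrier G" "set L' \<subseteq> carrier G" "x \<in> carrier G"
      using L g by (auto simp: tuples_def)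
    then show ?thesis
      using g h by (simp add: Cons bar_act_def R_mult bar_supp[OF \<Phi>] inv_mult_group m_assoc)
  qed
qed

lemma bar_diff_act:
  assumes g: "g \<in> carrier G" and \<Phi>: "\<Phi> \<in> fsupp (bar_X n)"
  shows "bar_diff n (bar_act g \<Phi>) = bar_act g (bar_diff n \<Phi>)"
proof (rule bar_ext[OF bar_diff_in[OF bar_act_in[OF g \<Phi>]] bar_act_in[OF g bar_diff_in[OF \<Phi>]]])
  fix M i assume "M \<in> tuples G (Suc n)"
  then obtain x L where M: "M = x # L" and x: "x \<in> carrier G" and L: "L \<in> tuples G n"
    by (rule tuples_Suc_cases)
  have igx: "inv g \<otimes> x \<in> carrier G" and L': "set L \<subseteq> carrier G"
    using g x L by (auto simp: tuples_def)
  define \<phi> where "\<phi> = (\<lambda>L. R g (\<lambda>i. \<Phi> (L, i)) i)"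
  have "bar_d (\<otimes>) (\<lambda>L. bar_act g \<Phi> (L, i)) (x # L) =
    bar_d (\<otimes>) (\<lambda>L. case L of [] \<Rightarrow> \<phi> [] | x # L' \<Rightarrow> \<phi> (inv g \<otimes> x # L')) (x # L)"
    by (rule bar_d_cong[where C = "carrier G"])
      (use x L' in \<open>auto simp: bar_act_def \<phi>_def split: list.split\<close>)
  also have "\<dots> = bar_d (\<otimes>) \<phi> (inv g \<otimes> x # L)"
    using g x L' by (intro bar_d_translate) auto
  also have "\<dots> = R g (\<lambda>i. bar_d (\<otimes>) (\<lambda>L. \<Phi> (L, i)) (inv g \<otimes> x # L)) i"
    unfolding \<phi>_def by (rule bar_d_lin[OF lin_R])
  also have "\<dots> = bar_act g (bar_diff n \<Phi>) (x # L, i)"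
    using igx L x L' by (simp add: bar_act_def bar_diff_def)
  finally show "bar_diff n (bar_act g \<Phi>) (M, i) = bar_act g (bar_diff n \<Phi>) (M, i)"
    using x L by (simp add: M bar_diff_def)
qed

lemma bar_diff_diff:
  assumes \<Phi>: "\<Phi> \<in> fsupp (bar_X n)"
  shows "bar_diff (Suc n) (bar_diff n \<Phi>) = 0"
proof (rule bar_ext[OF bar_diff_in[OF bar_diff_in[OF \<Phi>]] fsupp_0])
  fix L i assume L: "L \<in> tuples G (Suc (Suc n))"
  have "bar_d (\<otimes>) (\<lambda>L. bar_diff n \<Phi> (L, i)) L = bar_d (\<otimes>) (bar_d (\<otimes>) (\<lambda>L. \<Phi> (L, i))) L"
    by (rule bar_d_cong[where C = "carrier G"]) (use L in \<open>auto simp: tuples_def bar_diff_def\<close>)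
  also have "\<dots> = 0"
    using L by (intro bar_d_bar_d) (auto simp: tuples_def)
  finally show "bar_diff (Suc n) (bar_diff n \<Phi>) (L, i) = 0 (L, i)"
    using L by (simp add: bar_diff_def)
qed

lemma bar_contr_0:
  assumes \<Phi>: "\<Phi> \<in> fsupp (bar_X 0)"
  shows "bar_s 0 (bar_diff 0 \<Phi>) = \<Phi>"
  by (rule bar_ext[OF bar_s_in[OF bar_diff_in[OF \<Phi>]] \<Phi>]) (auto simp: bar_s_def bar_diff_def)

lemma bar_contr:
  assumes \<Phi>: "\<Phi> \<in> fsupp (bar_X (Suc n))"
  shows "bar_diff n (bar_s n \<Phi>) + bar_s (Suc n) (bar_diff (Suc n) \<Phi>) = \<Phi>"
proof (rule bar_ext[OF fsupp_add[OF bar_diff_in[OF bar_s_in[OF \<Phi>]] bar_s_in[OF bar_diff_in[OF \<Phi>]]] \<Phi>])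
  fix M i assume M: "M \<in> tuples G (Suc n)"
  then obtain x L where xL: "M = x # L" and x: "x \<in> carrier G" and L: "L \<in> tuples G n"
    by (rule tuples_Suc_cases)
  have "bar_d (\<otimes>) (\<lambda>L. bar_s n \<Phi> (L, i)) M = bar_d (\<otimes>) (\<lambda>L. \<Phi> (\<one> # L, i)) M"
    by (rule bar_d_cong[where C = "carrier G"]) (use M in \<open>auto simp: tuples_def bar_s_def\<close>)
  then show "(bar_diff n (bar_s n \<Phi>) + bar_s (Suc n) (bar_diff (Suc n) \<Phi>)) (M, i) = \<Phi> (M, i)"
    using M x L by (simp add: bar_s_def bar_diff_def xL)
qed

text \<open>For a list that starts with \<open>x\<close> exactly one \<open>b\<close> moves
  \<open>x\<close> into the transversal, so one summand survives, and in it the two actions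
  cancel.\<close>

lemma bar_th_sum:
  assumes B: "B \<subseteq> carrier G" and \<Phi>: "\<Phi> \<in> fsupp (bar_X (Suc n))"
    and T: "\<And>x. x \<in> carrier G \<Longrightarrow> \<exists>!b. b \<in> B \<and> inv b \<otimes> x \<in> T"
  shows "(\<Sum>b\<in>B. bar_act b (bar_th T (bar_act (inv b) \<Phi>))) = \<Phi>"
proof (rule bar_ext[OF _ \<Phi>])
  show "(\<Sum>b\<in>B. bar_act b (bar_th T (bar_act (inv b) \<Phi>))) \<in> fsupp (bar_X (Suc n))"
    using \<Phi> B by (intro fsupp_sum bar_act_in bar_th_in inv_closed) auto
  fix M i assume "M \<in> tuples G (Suc n)"
  then obtain x L where M: "M = x # L" and x: "x \<in> carrier G" and L: "L \<in> tuples G n"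
    by (rule tuples_Suc_cases)
  obtain b0 where b0: "b0 \<in> B" "inv b0 \<otimes> x \<in> T"
    and uniq: "\<And>b. b \<in> B \<Longrightarrow> inv b \<otimes> x \<in> T \<Longrightarrow> b = b0"
    using T[OF x] by metis
  have "bar_act b (bar_th T (bar_act (inv b) \<Phi>)) (x # L, i) = (if b = b0 then \<Phi> (x # L, i) else 0)"
    if b: "b \<in> B" for b
  proof -
    have bG: "b \<in> carrier G" using B b by auto
    have "bar_act b (bar_th T (bar_act (inv b) \<Phi>)) (x # L, i) =
      (if b = b0 then bar_act b (bar_act (inv b) \<Phi>) (x # L, i) else 0)"
    proof -
      have "inv b \<otimes> x \<in> T \<longleftrightarrow> b = b0" using uniq[OF b] b0 by blast
      then show ?thesis
        unfolding bar_act_apply[OF bG x L, where i = i] by (simp add: bar_th_def R_0)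
    qed
    also have "bar_act b (bar_act (inv b) \<Phi>) = \<Phi>"
      using bG by (simp add: bar_act_mult[OF _ _ \<Phi>, symmetric] bar_act_one[OF \<Phi>])
    finally show ?thesis .
  qed
  then have "(\<Sum>b\<in>B. bar_act b (bar_th T (bar_act (inv b) \<Phi>)) (x # L, i)) =
    (\<Sum>b\<in>B. if b = b0 then \<Phi> (x # L, i) else 0)"
    by (intro sum.cong) auto
  also have "\<dots> = \<Phi> (x # L, i)"
    using b0(1) finite_subset[OF B fin_G] by simp
  finally show "(\<Sum>b\<in>B. bar_act b (bar_th T (bar_act (inv b) \<Phi>))) (M, i) = \<Phi> (M, i)"
    by (simp add: M sum_fun_apply)
qed

text \<open>The chosen representative \<open>r x\<close> depends on the coset \<open>B #> x\<close>
  alone; \<open>T\<close> consists of the elements that represent their own coset.\<close>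

lemma right_transversal:
  assumes B: "subgroup B G"
  shows "\<exists>T. \<forall>x\<in>carrier G. \<exists>!b. b \<in> B \<and> inv b \<otimes> x \<in> T"
proof -
  interpret B: subgroup B G by fact
  define r where "r = (\<lambda>x. SOME y. y \<in> B #> x)"
  define T where "T = {x \<in> carrier G. r x = x}"
  have "\<exists>!b. b \<in> B \<and> inv b \<otimes> x \<in> T" if x: "x \<in> carrier G" for x
  proof -
    have "x \<in> B #> x" using x B by (rule rcos_self)
    then have "r x \<in> B #> x" unfolding r_def by (rule someI)
    then obtain c where c: "c \<in> B" "r x = c \<otimes> x" by (auto simp: r_coset_def)
    have r: "r (inv b \<otimes> x) = r x" if "b \<in> B" for b
    proof -
      have "inv b \<otimes> x \<in> B #> x" using that by (auto simp: r_coset_def)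
      then show ?thesis using repr_independence[OF _ x B] by (simp add: r_def)
    qed
    have T_iff: "inv b \<otimes> x \<in> T \<longleftrightarrow> b = inv c" if b: "b \<in> B" for b
    proof -
      have "inv b \<otimes> x \<in> T \<longleftrightarrow> c \<otimes> x = inv b \<otimes> x"
        using b x by (simp add: T_def r c)
      also have "\<dots> \<longleftrightarrow> c = inv b"
        using B.mem_carrier[OF b] B.mem_carrier[OF c(1)] x by (intro right_cancel) auto
      also have "\<dots> \<longleftrightarrow> b = inv c"
        using inv_inv[OF B.mem_carrier[OF b]] inv_inv[OF B.mem_carrier[OF c(1)]] by auto
      finally show ?thesis .
    qed
    have "inv c \<in> B" using c(1) by simp
    then show ?thesis using T_iff by (intro ex1I[of _ "inv c"]) blast+
  qed
  then show ?thesis by (intro exI[of _ T] ballI)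
qed

text \<open>The complex of the whole group, with the same contraction, serves for each subgroup;
  only \<open>th\<close> depends on the subgroup, through a transversal.\<close>

theorem bar_resolution:
  assumes B: "subgroup B G"
  shows "\<exists>T. equiv_resolution (G\<lparr>carrier := B\<rparr>) bar_X bar_diff bar_s bar_act (bar_th T)"
proof -
  interpret B: subgroup B G by fact
  obtain T where "\<forall>x\<in>carrier G. \<exists>!b. b \<in> B \<and> inv b \<otimes> x \<in> T"
    using right_transversal[OF B] by (rule exE)
  then have T: "\<exists>!b. b \<in> B \<and> inv b \<otimes> x \<in> T" if "x \<in> carrier G" for x
    using that by (rule bspec)
  define K where "K = G\<lparr>carrier := B\<rparr>"
  have K: "carrier K = B" "mult K = mult G" "one K = one G" by (simp_all add: K_def)
  have inv_B: "inv\<^bsub>K\<^esub> h = inv h" if "h \<in> B" for h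
    unfolding K_def by (rule m_inv_consistent[OF B that])
  have grp: "group K" unfolding K_def by (rule subgroup.subgroup_is_group[OF B is_group])
  have "equiv_resolution K bar_X bar_diff bar_s bar_act (bar_th T)"
  proof (intro equiv_resolution.intro[OF grp] equiv_resolution_axioms.intro, unfold K)
    show "finite B" by (rule finite_subset[OF B.subset fin_G])
    fix x :: "'g list \<times> 'i \<Rightarrow> 'k" and n
    assume x: "x \<in> fsupp (bar_X (Suc n))"
    have "(\<Sum>h\<in>B. bar_act h (bar_th T (bar_act (inv\<^bsub>K\<^esub> h) x))) =
      (\<Sum>h\<in>B. bar_act h (bar_th T (bar_act (inv h) x)))"
      by (intro sum.cong refl) (simp only: inv_B)
    also have "\<dots> = x" by (rule bar_th_sum[OF B.subset x T])
    finally show "(\<Sum>h\<in>B. bar_act h (bar_th T (bar_act (inv\<^bsub>K\<^esub> h) x))) = x" .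
  qed (assumption | rule lin_bar_diff lin_bar_s lin_bar_act lin_bar_th bar_diff_diff bar_contr_0
      bar_contr bar_diff_in bar_s_in bar_th_in bar_act_one bar_act_in bar_act_mult bar_diff_act
      B.mem_carrier)+
  then show ?thesis unfolding K_def by (rule exI)
qed

end

section \<open>Comparing a group with its Borel subgroup\<close>

text \<open>By the Bruhat decomposition the index of \<open>B\<close> is \<open>1 + card U\<close>, which is \<open>1\<close> in the field.
  The bar resolution is compared with a second, minimal resolution \<open>Y\<close> over \<open>B\<close>.\<close>

locale bruhat_pair = group_representation G I R +
  E: equiv_resolution "G\<lparr>carrier := B\<rparr>" Y d' s' ac' th'
  for G :: "('g, 'r) monoid_scheme" (structure) and I :: "'i set"
    and R :: "'g \<Rightarrow> ('i \<Rightarrow> 'k::field) \<Rightarrow> ('i \<Rightarrow> 'k)" and B :: "'g set"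
    and Y :: "nat \<Rightarrow> 'y set" and d' s' and ac' :: "'g \<Rightarrow> ('y \<Rightarrow> 'k) \<Rightarrow> ('y \<Rightarrow> 'k)" and th' +
  fixes T U :: "'g set" and w :: 'g
    and f :: "('g list \<times> 'i \<Rightarrow> 'k) \<Rightarrow> ('y \<Rightarrow> 'k)" and f' :: "('y \<Rightarrow> 'k) \<Rightarrow> ('g list \<times> 'i \<Rightarrow> 'k)"
  assumes B: "subgroup B G" and w: "w \<in> carrier G"
    and TU: "bij_betw (\<lambda>(t, u). t \<otimes> u) (T \<times> U) B" and T: "T \<subseteq> B" and U: "U \<subseteq> B"
    and card_T: "of_nat (card T) = (-1 :: 'k)" and card_U: "of_nat (card U) = (0 :: 'k)"
    and bruhat: "g \<in> carrier G \<Longrightarrow> \<exists>!c. c \<in> insert \<one> ((\<lambda>u. u \<otimes> w) ` U) \<and> inv c \<otimes> g \<in> B"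
    and w_notin: "\<one> \<notin> (\<lambda>u. u \<otimes> w) ` U"
    and lin_f: "lin f" and lin_f': "lin f'"
    and f_in: "x \<in> fsupp (bar_X 0) \<Longrightarrow> f x \<in> fsupp (Y 0)"
    and f'_in: "y \<in> fsupp (Y 0) \<Longrightarrow> f' y \<in> fsupp (bar_X 0)"
    and f_act: "b \<in> B \<Longrightarrow> x \<in> fsupp (bar_X 0) \<Longrightarrow> f (bar_act b x) = ac' b (f x)"
    and f'_f: "x \<in> fsupp (bar_X 0) \<Longrightarrow> f' (f x) = x"
    and f_f': "y \<in> fsupp (Y 0) \<Longrightarrow> f (f' y) = y"
    and minimal: "y \<in> fsupp (Y (Suc n)) \<Longrightarrow> (\<And>b. b \<in> B \<Longrightarrow> ac' b y = y) \<Longrightarrow> d' (Suc n) y = 0"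
begin

sublocale B: subgroup B G by (rule B)

section \<open>Transfer from the Borel subgroup to the group\<close>

definition invariant :: "'g set \<Rightarrow> ('g list \<times> 'i \<Rightarrow> 'k) \<Rightarrow> bool" where
  "invariant S \<Phi> \<longleftrightarrow> (\<forall>g\<in>S. bar_act g \<Phi> = \<Phi>)"

definition reps :: "'g set" where
  "reps = insert \<one> ((\<lambda>u. u \<otimes> w) ` U)"

definition rep :: "'g \<Rightarrow> 'g" where
  "rep x = (THE c. c \<in> reps \<and> inv c \<otimes> x \<in> B)"

definition transfer :: "('g list \<times> 'i \<Rightarrow> 'k) \<Rightarrow> ('g list \<times> 'i \<Rightarrow> 'k)" where
  "transfer \<Phi> = (\<Sum>c\<in>reps. bar_act c \<Phi>)"

lemma U_carrier: "U \<subseteq> carrier G"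
  using U B.subset by blast

lemma reps_carrier: "c \<in> reps \<Longrightarrow> c \<in> carrier G"
  using U_carrier w by (auto simp: reps_def)

lemma finite_U: "finite U"
  using U_carrier fin_G by (rule finite_subset)

lemma rep:
  assumes "x \<in> carrier G"
  shows "rep x \<in> reps" "inv (rep x) \<otimes> x \<in> B"
  using theI'[OF bruhat[OF assms]] unfolding rep_def reps_def by simp_all

lemma rep_eqI:
  assumes "x \<in> carrier G" "c \<in> reps" "inv c \<otimes> x \<in> B"
  shows "rep x = c"
  using the1_equality[OF bruhat[OF assms(1)]] assms(2,3) unfolding rep_def reps_def by simp

lemma act_rep:
  assumes x: "x \<in> carrier G" and \<Phi>: "\<Phi> \<in> fsupp (bar_X n)" "invariant B \<Phi>"
  shows "bar_act x \<Phi> = bar_act (rep x) \<Phi>"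
proof -
  have c: "rep x \<in> carrier G" using rep(1)[OF x] by (rule reps_carrier)
  have "x = rep x \<otimes> (inv (rep x) \<otimes> x)"
    using x c by (simp add: m_assoc[symmetric])
  then have "bar_act x \<Phi> = bar_act (rep x) (bar_act (inv (rep x) \<otimes> x) \<Phi>)"
    using bar_act_mult[OF c _ \<Phi>(1), of "inv (rep x) \<otimes> x"] x c by simp
  then show ?thesis using \<Phi>(2) rep(2)[OF x] by (simp add: invariant_def)
qed

text \<open>Left multiplication permutes the cosets of \<open>B\<close>, and \<open>g\<close> and
  its inverse induce mutually inverse maps on \<open>reps\<close>; the transfer sum is reindexed by
  them.\<close>

lemma rep_rep:
  assumes "g \<in> carrier G" "c \<in> reps"
  shows "rep (inv g \<otimes> rep (g \<otimes> c)) = c"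
proof (rule rep_eqI)
  have c: "c \<in> carrier G" using assms(2) by (rule reps_carrier)
  have gc: "g \<otimes> c \<in> carrier G" using assms c by simp
  have r: "rep (g \<otimes> c) \<in> carrier G" using rep(1)[OF gc] by (rule reps_carrier)
  show "inv g \<otimes> rep (g \<otimes> c) \<in> carrier G" using assms r by simp
  have "inv (inv (rep (g \<otimes> c)) \<otimes> (g \<otimes> c)) \<in> B"
    using rep(2)[OF gc] by (rule B.m_inv_closed)
  also have "inv (inv (rep (g \<otimes> c)) \<otimes> (g \<otimes> c)) = inv c \<otimes> (inv g \<otimes> rep (g \<otimes> c))"
    using assms c r by (simp add: inv_mult_group m_assoc)
  finally show "inv c \<otimes> (inv g \<otimes> rep (g \<otimes> c)) \<in> B" .
qed (rule assms(2))

lemma lin_transfer: "lin transfer"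
  unfolding transfer_def[abs_def] by (intro lin_sum_fun lin_bar_act)

lemma transfer_in: "\<Phi> \<in> fsupp (bar_X n) \<Longrightarrow> transfer \<Phi> \<in> fsupp (bar_X n)"
  unfolding transfer_def by (intro fsupp_sum bar_act_in reps_carrier)

lemma transfer_invariant:
  assumes \<Phi>: "\<Phi> \<in> fsupp (bar_X n)" "invariant B \<Phi>"
  shows "invariant (carrier G) (transfer \<Phi>)"
  unfolding invariant_def
proof
  fix g assume g: "g \<in> carrier G"
  have rr: "rep (g \<otimes> rep (inv g \<otimes> c)) = c" if "c \<in> reps" for c
    using rep_rep[of "inv g" c] g that by simp
  have "bar_act g (transfer \<Phi>) = (\<Sum>c\<in>reps. bar_act (rep (g \<otimes> c)) \<Phi>)"
    unfolding transfer_def lin_sum[OF lin_bar_act]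
  proof (rule sum.cong[OF refl])
    fix c assume c: "c \<in> reps"
    show "bar_act g (bar_act c \<Phi>) = bar_act (rep (g \<otimes> c)) \<Phi>"
      using bar_act_mult[OF g reps_carrier[OF c] \<Phi>(1)] act_rep[OF _ \<Phi>, of "g \<otimes> c"] g reps_carrier[OF c]
      by simp
  qed
  also have "\<dots> = transfer \<Phi>"
    unfolding transfer_def
    by (rule sum.reindex_bij_witness[of _ "\<lambda>c. rep (inv g \<otimes> c)" "\<lambda>c. rep (g \<otimes> c)"])
      (use g in \<open>simp_all add: rep_rep rr rep(1) reps_carrier\<close>)
  finally show "bar_act g (transfer \<Phi>) = transfer \<Phi>" .
qed

lemma transfer_diff:
  assumes "\<Phi> \<in> fsupp (bar_X n)"
  shows "bar_diff n (transfer \<Phi>) = transfer (bar_diff n \<Phi>)"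
  unfolding transfer_def lin_sum[OF lin_bar_diff]
  by (intro sum.cong refl bar_diff_act reps_carrier assms)

lemma card_reps: "of_nat (card reps) = (1 :: 'k)"
proof -
  have "inj_on (\<lambda>u. u \<otimes> w) U"
    using U_carrier w by (intro inj_onI) (simp add: subset_iff)
  then have "card reps = Suc (card U)"
    using w_notin finite_U by (simp add: reps_def card_image)
  then show ?thesis by (simp add: card_U)
qed

lemma sum_const_fun: "(\<Sum>i\<in>S. \<Phi>) = scl (of_nat (card S)) (\<Phi> :: 'x \<Rightarrow> 'k)"
  by (auto simp: fun_eq_iff sum_fun_apply)

lemma transfer_of_invariant:
  assumes "invariant (carrier G) \<Phi>"
  shows "transfer \<Phi> = \<Phi>"
proof -
  have "transfer \<Phi> = (\<Sum>c\<in>reps. \<Phi>)"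
    unfolding transfer_def by (rule sum.cong) (use assms reps_carrier in \<open>auto simp: invariant_def\<close>)
  then show ?thesis by (simp only: sum_const_fun card_reps scl_1)
qed

text \<open>The big Bruhat cell contributes a norm from the trivial group to \<open>U\<close>, hence a coboundary.\<close>

lemma transfer_cocycle:
  assumes \<Phi>: "\<Phi> \<in> fsupp (bar_X (Suc (Suc n)))" "invariant B \<Phi>" and cocycle: "bar_diff (Suc (Suc n)) \<Phi> = 0"
  shows "\<exists>\<Psi>\<in>fsupp (bar_X (Suc n)). invariant B \<Psi> \<and> transfer \<Phi> = \<Phi> + bar_diff (Suc n) \<Psi>"
proof -
  define z where "z = bar_act w \<Phi>"
  have z_in: "z \<in> fsupp (bar_X (Suc (Suc n)))" unfolding z_def by (rule bar_act_in[OF w \<Phi>(1)])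
  have "bar_diff (Suc (Suc n)) z = 0"
    unfolding z_def using bar_diff_act[OF w \<Phi>(1)] cocycle lin_0[OF lin_bar_act] by simp
  \<comment> \<open>A primitive of the translate \<open>z\<close>, with no invariance claimed: at
    this point exactness of the bar complex is enough.\<close>
  define y where "y = bar_s (Suc n) z"
  have y: "y \<in> fsupp (bar_X (Suc n))" unfolding y_def using z_in by (rule bar_s_in)
  have z: "z = bar_diff (Suc n) y"
    using bar_contr[OF z_in] \<open>bar_diff (Suc (Suc n)) z = 0\<close> lin_0[OF lin_bar_s] by (simp add: y_def)
  \<comment> \<open>The norm runs over all of \<open>B\<close> rather than \<open>U\<close>, so that
    the result is \<open>B\<close>-invariant. The torus then repeats the big-cell sum
    \<open>card T\<close> times, which is \<open>-1\<close> in the field; hence the sign.\<close>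
  define \<Psi> where "\<Psi> = - (\<Sum>b\<in>B. bar_act b y)"
  have sum_in: "(\<Sum>b\<in>B. bar_act b y) \<in> fsupp (bar_X (Suc n))"
    by (intro fsupp_sum bar_act_in B.mem_carrier y)
  then have \<Psi>_in: "\<Psi> \<in> fsupp (bar_X (Suc n))" by (simp add: \<Psi>_def fsupp_def)
  have act_sum: "bar_act a (\<Sum>b\<in>B. bar_act b y) = (\<Sum>b\<in>B. bar_act b y)" if a: "a \<in> B" for a
  proof -
    have "bar_act a (\<Sum>b\<in>B. bar_act b y) = (\<Sum>b\<in>B. bar_act (a \<otimes> b) y)"
      unfolding lin_sum[OF lin_bar_act]
      by (intro sum.cong refl bar_act_mult[OF _ _ y, symmetric] B.mem_carrier a)
    also have "\<dots> = (\<Sum>b\<in>B. bar_act b y)"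
      by (rule sum.reindex_bij_witness[of _ "\<lambda>b. inv a \<otimes> b" "\<lambda>b. a \<otimes> b"])
        (use a in \<open>simp_all add: m_assoc[symmetric]\<close>)
    finally show ?thesis .
  qed
  have \<Psi>_inv: "invariant B \<Psi>"
    unfolding invariant_def \<Psi>_def lin_minus[OF lin_bar_act] using act_sum by simp
  define N where "N = (\<Sum>u\<in>U. bar_act u z)"
  have N: "transfer \<Phi> = \<Phi> + N"
  proof -
    have inj: "inj_on (\<lambda>u. u \<otimes> w) U"
      using U_carrier w by (intro inj_onI) (simp add: subset_iff)
    have "transfer \<Phi> = bar_act \<one> \<Phi> + (\<Sum>c\<in>(\<lambda>u. u \<otimes> w) ` U. bar_act c \<Phi>)"
      unfolding transfer_def reps_def using w_notin finite_U by (intro sum.insert) auto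
    also have "(\<Sum>c\<in>(\<lambda>u. u \<otimes> w) ` U. bar_act c \<Phi>) = (\<Sum>u\<in>U. bar_act (u \<otimes> w) \<Phi>)"
      using inj by (rule sum.reindex_cong) auto
    also have "\<dots> = N"
      unfolding N_def z_def using U_carrier
      by (intro sum.cong refl bar_act_mult[OF _ w \<Phi>(1)]) auto
    finally show ?thesis unfolding bar_act_one[OF \<Phi>(1)] .
  qed
  have N_eq: "N = transfer \<Phi> - \<Phi>" using N by simp
  have N_in: "N \<in> fsupp (bar_X (Suc (Suc n)))"
    unfolding N_eq by (intro fsupp_diff transfer_in \<Phi>)
  \<comment> \<open>The big-cell sum is a difference of two \<open>B\<close>-invariant cochains, so
    all torus elements contribute the same.\<close>
  have N_inv: "bar_act b N = N" if "b \<in> B" for b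
    unfolding N_eq lin_diff[OF lin_bar_act]
    using transfer_invariant[OF \<Phi>] \<Phi>(2) that B.mem_carrier[OF that] by (simp add: invariant_def)
  have "bar_diff (Suc n) (\<Sum>b\<in>B. bar_act b y) = (\<Sum>b\<in>B. bar_act b z)"
    unfolding lin_sum[OF lin_bar_diff] z by (intro sum.cong refl bar_diff_act B.mem_carrier y)
  also have "\<dots> = (\<Sum>(t, u)\<in>T \<times> U. bar_act (t \<otimes> u) z)"
    using sum.reindex_bij_betw[OF TU, of "\<lambda>b. bar_act b z"] by (simp add: case_prod_unfold)
  also have "\<dots> = (\<Sum>t\<in>T. \<Sum>u\<in>U. bar_act (t \<otimes> u) z)"
    by (rule sum.cartesian_product[symmetric])
  also have "\<dots> = (\<Sum>t\<in>T. bar_act t N)"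
    unfolding N_def lin_sum[OF lin_bar_act] using T U
    by (intro sum.cong refl bar_act_mult[OF _ _ z_in] B.mem_carrier) auto
  also have "\<dots> = (\<Sum>t\<in>T. N)"
    using T N_inv by (intro sum.cong refl) auto
  also have "\<dots> = - N" unfolding sum_const_fun card_T by (simp add: fun_eq_iff)
  finally have "bar_diff (Suc n) \<Psi> = N" by (simp add: \<Psi>_def lin_minus[OF lin_bar_diff])
  then show ?thesis using N \<Psi>_in \<Psi>_inv by auto
qed

section \<open>Chain maps between the bar complex and the minimal resolution\<close>

definition th :: "('g list \<times> 'i \<Rightarrow> 'k) \<Rightarrow> ('g list \<times> 'i \<Rightarrow> 'k)" where
  "th = (SOME t. equiv_resolution (G\<lparr>carrier := B\<rparr>) bar_X bar_diff bar_s bar_act t)"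

sublocale D: equiv_resolution "G\<lparr>carrier := B\<rparr>" bar_X bar_diff bar_s bar_act th
proof -
  have "\<exists>t. equiv_resolution (G\<lparr>carrier := B\<rparr>) bar_X bar_diff bar_s bar_act t"
    using bar_resolution[OF B] by blast
  then show "equiv_resolution (G\<lparr>carrier := B\<rparr>) bar_X bar_diff bar_s bar_act th"
    unfolding th_def by (rule someI_ex)
qed

sublocale DE: resolution_pair "G\<lparr>carrier := B\<rparr>" bar_X bar_diff bar_s bar_act th Y d' s' ac' th' ..
sublocale ED: resolution_pair "G\<lparr>carrier := B\<rparr>" Y d' s' ac' th' bar_X bar_diff bar_s bar_act th ..
sublocale DD: resolution_pair "G\<lparr>carrier := B\<rparr>" bar_X bar_diff bar_s bar_act th bar_X bar_diff bar_s bar_act th ..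
sublocale EE: resolution_pair "G\<lparr>carrier := B\<rparr>" Y d' s' ac' th' Y d' s' ac' th' ..

abbreviation F where "F \<equiv> DE.lift_map f"
abbreviation F' where "F' \<equiv> ED.lift_map f'"

lemma f_equiv: "DE.equiv_map (bar_X 0) (Y 0) f"
  unfolding DE.equiv_map_def using lin_f f_in f_act by simp

lemma f'_equiv: "ED.equiv_map (Y 0) (bar_X 0) f'"
  unfolding ED.equiv_map_def
proof (intro conjI ballI)
  fix b and y :: "'y \<Rightarrow> 'k" assume b: "b \<in> carrier (G\<lparr>carrier := B\<rparr>)" and y: "y \<in> fsupp (Y 0)"
  have "f' (ac' b y) = f' (ac' b (f (f' y)))" by (simp add: f_f'[OF y])
  also have "\<dots> = f' (f (bar_act b (f' y)))" using b f_act[OF _ f'_in[OF y]] by simp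
  also have "\<dots> = bar_act b (f' y)"
    using b by (intro f'_f bar_act_in f'_in y) simp
  finally show "f' (ac' b y) = bar_act b (f' y)" .
qed (use lin_f' f'_in in auto)

lemmas F = DE.equiv_mapD[OF DE.comparison(1)[OF f_equiv]]
lemmas F' = ED.equiv_mapD[OF ED.comparison(1)[OF f'_equiv]]
lemmas F_chain = DE.comparison(2)[OF f_equiv]
lemmas F'_chain = ED.comparison(2)[OF f'_equiv]

definition h where "h = DD.homotopy (\<lambda>n \<Phi>. \<Phi> - F' n (F n \<Phi>))"
definition h' where "h' = EE.homotopy (\<lambda>n y. y - F n (F' n y))"

lemma h:
  shows "DD.equiv_map (bar_X (Suc n)) (bar_X n) (h n)"
    and "\<Phi> \<in> fsupp (bar_X (Suc n)) \<Longrightarrow>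
      \<Phi> - F' (Suc n) (F (Suc n) \<Phi>) = bar_diff n (h n \<Phi>) + h (Suc n) (bar_diff (Suc n) \<Phi>)"
proof -
  have 1: "DD.equiv_map (bar_X n) (bar_X n) (\<lambda>\<Phi>. \<Phi> - F' n (F n \<Phi>))" for n
    unfolding DD.equiv_map_def
    by (intro conjI ballI lin_minus_fun lin_comp[OF F'(1)] F(1) lin_id fsupp_diff F'(2) F(2))
      (simp_all add: F(3) F'(3) F(2) lin_diff[OF lin_bar_act])
  have 2: "bar_diff n \<Phi> - F' (Suc n) (F (Suc n) (bar_diff n \<Phi>)) = bar_diff n (\<Phi> - F' n (F n \<Phi>))"
    if "\<Phi> \<in> fsupp (bar_X n)" for n \<Phi>
    using F_chain[OF that] F'_chain[OF F(2)[OF that]] by (simp only: lin_diff[OF lin_bar_diff])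
  have 3: "\<Phi> - F' 0 (F 0 \<Phi>) = 0" if "\<Phi> \<in> fsupp (bar_X 0)" for \<Phi>
    using f'_f[OF that] by simp
  show "DD.equiv_map (bar_X (Suc n)) (bar_X n) (h n)"
    unfolding h_def by (rule DD.homotopy(1)[OF 1 2 3])
  show "\<Phi> - F' (Suc n) (F (Suc n) \<Phi>) = bar_diff n (h n \<Phi>) + h (Suc n) (bar_diff (Suc n) \<Phi>)"
    if "\<Phi> \<in> fsupp (bar_X (Suc n))"
    unfolding h_def by (rule DD.homotopy(2)[OF 1 2 3 that])
qed

lemma h':
  shows "EE.equiv_map (Y (Suc n)) (Y n) (h' n)"
    and "y \<in> fsupp (Y (Suc n)) \<Longrightarrow>
      y - F (Suc n) (F' (Suc n) y) = d' n (h' n y) + h' (Suc n) (d' (Suc n) y)"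
proof -
  have 1: "EE.equiv_map (Y n) (Y n) (\<lambda>y. y - F n (F' n y))" for n
    unfolding EE.equiv_map_def
    by (intro conjI ballI lin_minus_fun lin_comp[OF F(1)] F'(1) lin_id fsupp_diff F'(2) F(2))
      (simp_all add: F(3) F'(3) F'(2) lin_diff[OF E.lin_ac])
  have 2: "d' n y - F (Suc n) (F' (Suc n) (d' n y)) = d' n (y - F n (F' n y))"
    if "y \<in> fsupp (Y n)" for n y
    using F'_chain[OF that] F_chain[OF F'(2)[OF that]] by (simp only: lin_diff[OF E.lin_d])
  have 3: "y - F 0 (F' 0 y) = 0" if "y \<in> fsupp (Y 0)" for y
    using f_f'[OF that] by simp
  show "EE.equiv_map (Y (Suc n)) (Y n) (h' n)"
    unfolding h'_def by (rule EE.homotopy(1)[OF 1 2 3])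
  show "y - F (Suc n) (F' (Suc n) y) = d' n (h' n y) + h' (Suc n) (d' (Suc n) y)"
    if "y \<in> fsupp (Y (Suc n))"
    unfolding h'_def by (rule EE.homotopy(2)[OF 1 2 3 that])
qed

lemma invariant_subset: "invariant (carrier G) \<Phi> \<Longrightarrow> invariant B \<Phi>"
  using B.subset by (auto simp: invariant_def)

lemma F_invariant:
  assumes "\<Phi> \<in> fsupp (bar_X n)" "invariant B \<Phi>" "b \<in> B"
  shows "ac' b (F n \<Phi>) = F n \<Phi>"
  using F(3)[of b \<Phi> n] assms by (simp add: invariant_def)

text \<open>Index \<open>1\<close> is degree zero. The homotopy starts with zero there, so a cocycle
  is recovered from its image under \<open>F\<close> by applying \<open>F'\<close>.\<close>

theorem F_zero_0:
  assumes \<Phi>: "\<Phi> \<in> fsupp (bar_X (Suc 0))" and "bar_diff (Suc 0) \<Phi> = 0" "F (Suc 0) \<Phi> = 0"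
  shows "\<Phi> = 0"
proof -
  have "h 0 \<Phi> = 0" by (simp add: h_def)
  moreover have "h (Suc 0) 0 = 0"
    using DD.equiv_mapD(1)[OF h(1)] by (rule lin_0)
  ultimately show ?thesis
    using h(2)[OF \<Phi>] assms(2,3) lin_0[OF F'(1)] lin_0[OF lin_bar_diff] by simp
qed

text \<open>The homotopy yields a primitive that is invariant under \<open>B\<close> only. Its
  transfer is invariant under the group and has the same differential, because transfer fixes the
  invariant cocycle.\<close>

theorem F_zero:
  assumes \<Phi>: "\<Phi> \<in> fsupp (bar_X (Suc (Suc n)))" and inv: "invariant (carrier G) \<Phi>"
    and "bar_diff (Suc (Suc n)) \<Phi> = 0" "F (Suc (Suc n)) \<Phi> = 0"
  shows "\<exists>\<Psi>\<in>fsupp (bar_X (Suc n)). invariant (carrier G) \<Psi> \<and> \<Phi> = bar_diff (Suc n) \<Psi>"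
proof -
  define \<Psi> where "\<Psi> = h (Suc n) \<Phi>"
  note hD = DD.equiv_mapD[OF h(1)]
  have \<Psi>: "\<Psi> \<in> fsupp (bar_X (Suc n))" unfolding \<Psi>_def using \<Phi> by (rule hD(2))
  have inv\<Psi>: "invariant B \<Psi>"
    using hD(3)[OF _ \<Phi>] invariant_subset[OF inv] by (simp add: invariant_def \<Psi>_def)
  have "\<Phi> = bar_diff (Suc n) \<Psi>"
    using h(2)[OF \<Phi>] assms(3,4) lin_0[OF F'(1)] lin_0[OF hD(1)] by (simp add: \<Psi>_def)
  then have "\<Phi> = bar_diff (Suc n) (transfer \<Psi>)"
    using transfer_of_invariant[OF inv] transfer_diff[OF \<Psi>] by simp
  then show ?thesis using transfer_in[OF \<Psi>] transfer_invariant[OF \<Psi> inv\<Psi>] by blast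
qed

text \<open>By minimality the differentials of \<open>Y\<close> vanish on
  \<open>B\<close>-invariants, so both terms of the homotopy \<open>h'\<close> drop out, and
  \<open>F\<close> kills the coboundary by which transfer alters \<open>F' y\<close>. The index
  \<open>n + 2\<close> is a positive degree: in degree zero that correction would come from the
  augmentation \<open>d' 0\<close>.\<close>

theorem transfer_F':
  assumes y: "y \<in> fsupp (Y (Suc (Suc n)))" and inv: "\<And>b. b \<in> B \<Longrightarrow> ac' b y = y"
  shows "transfer (F' (Suc (Suc n)) y) \<in> fsupp (bar_X (Suc (Suc n)))"
    and "invariant (carrier G) (transfer (F' (Suc (Suc n)) y))"
    and "bar_diff (Suc (Suc n)) (transfer (F' (Suc (Suc n)) y)) = 0"
    and "F (Suc (Suc n)) (transfer (F' (Suc (Suc n)) y)) = y"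
proof -
  define \<Phi> where "\<Phi> = F' (Suc (Suc n)) y"
  have \<Phi>: "\<Phi> \<in> fsupp (bar_X (Suc (Suc n)))" unfolding \<Phi>_def using y by (rule F'(2))
  have inv\<Phi>: "invariant B \<Phi>"
    unfolding invariant_def \<Phi>_def using F'(3)[OF _ y] inv by simp
  have cocycle: "bar_diff (Suc (Suc n)) \<Phi> = 0"
    unfolding \<Phi>_def F'_chain[OF y, symmetric] using minimal[OF y inv] lin_0[OF F'(1)] by simp
  show "transfer (F' (Suc (Suc n)) y) \<in> fsupp (bar_X (Suc (Suc n)))"
    using transfer_in[OF \<Phi>] by (simp only: \<Phi>_def)
  show "invariant (carrier G) (transfer (F' (Suc (Suc n)) y))"
    using transfer_invariant[OF \<Phi> inv\<Phi>] by (simp only: \<Phi>_def)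
  show "bar_diff (Suc (Suc n)) (transfer (F' (Suc (Suc n)) y)) = 0"
    using transfer_diff[OF \<Phi>] cocycle lin_0[OF lin_transfer] by (simp only: \<Phi>_def)
  obtain \<Theta> where \<Theta>: "\<Theta> \<in> fsupp (bar_X (Suc n))" "invariant B \<Theta>"
    and tr: "transfer \<Phi> = \<Phi> + bar_diff (Suc n) \<Theta>"
    using transfer_cocycle[OF \<Phi> inv\<Phi> cocycle] by blast
  have "F (Suc (Suc n)) (bar_diff (Suc n) \<Theta>) = d' (Suc n) (F (Suc n) \<Theta>)"
    by (rule F_chain[OF \<Theta>(1)])
  also have "\<dots> = 0"
    by (intro minimal F(2) \<Theta> F_invariant)
  finally have "F (Suc (Suc n)) (transfer \<Phi>) = F (Suc (Suc n)) \<Phi>"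
    by (simp add: tr lin_add[OF F(1)])
  moreover have "d' (Suc n) (h' (Suc n) y) = 0"
    using EE.equiv_mapD(2,3)[OF h'(1)] y inv by (intro minimal) (simp_all flip: EE.equiv_mapD(3)[OF h'(1)])
  moreover have "h' (Suc (Suc n)) (d' (Suc (Suc n)) y) = 0"
    using minimal[OF y inv] lin_0[OF EE.equiv_mapD(1)[OF h'(1)]] by simp
  ultimately show "F (Suc (Suc n)) (transfer (F' (Suc (Suc n)) y)) = y"
    using h'(2)[OF y] by (simp add: \<Phi>_def)
qed

end

section \<open>Finite fields and digit expansions\<close>

locale finite_field =
  fixes p s :: nat and kt :: "'k::alg_closed_field itself"
  assumes p: "Factorial_Ring.prime p" and p3: "p \<ge> 3" and s: "s \<ge> 1" and CHAR: "CHAR('k) = p"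
begin

definition q :: nat where "q = p ^ s"

definition F :: "'k set" where "F = finite_subfield q"

definition units :: "'k set" where "units = F - {0}"

lemma p_pos: "p > 0" using p3 by simp

lemma q_ge_3: "q \<ge> 3"
proof -
  have "p ^ 1 \<le> p ^ s" using s p3 by (intro power_increasing) auto
  then show ?thesis using p3 by (simp add: q_def)
qed

lemma of_nat_q: "of_nat q = (0 :: 'k)"
proof -
  have "of_nat p = (0 :: 'k)" using CHAR by (metis of_nat_CHAR)
  then show ?thesis using s by (simp add: q_def)
qed

lemma frob: "(x + y :: 'k) ^ (p ^ i) = x ^ (p ^ i) + y ^ (p ^ i)"
  using freshmans_dream'[where 'a = 'k, of "p ^ i" i x y] p CHAR by simp

lemma odd_p: "odd p"
  using p p3 prime_odd_nat by force

lemma frob_minus: "(- x :: 'k) ^ (p ^ i) = - (x ^ (p ^ i))"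
  using odd_p by simp

lemma F_iff: "x \<in> F \<longleftrightarrow> x ^ q = x"
  by (simp add: F_def finite_subfield_def)

lemma F_0: "0 \<in> F" and F_1: "1 \<in> F"
  using q_ge_3 by (auto simp: F_iff)

lemma F_add: "x \<in> F \<Longrightarrow> y \<in> F \<Longrightarrow> x + y \<in> F"
  using frob[of x y s] by (simp add: F_iff q_def)

lemma F_minus: "x \<in> F \<Longrightarrow> - x \<in> F"
  using frob_minus[of x s] by (simp add: F_iff q_def)

lemma F_mult: "x \<in> F \<Longrightarrow> y \<in> F \<Longrightarrow> x * y \<in> F"
  by (simp add: F_iff power_mult_distrib)

lemma F_inverse: "x \<in> F \<Longrightarrow> inverse x \<in> F"
  by (simp add: F_iff power_inverse)

lemma F_divide: "x \<in> F \<Longrightarrow> y \<in> F \<Longrightarrow> x / y \<in> F"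
  by (simp add: divide_inverse F_mult F_inverse)

lemma F_power_q1:
  assumes "x \<in> units"
  shows "x ^ (q - 1) = 1"
proof -
  have "x * x ^ (q - 1) = x * 1"
    using assms q_ge_3 power_Suc[of x "q - 1"] by (simp add: units_def F_iff)
  then show ?thesis using assms by (simp add: units_def)
qed

text \<open>The polynomial \<open>x ^ q - x\<close> splits, and its derivative is \<open>-1\<close>,
  so its roots are simple.\<close>

lemma card_F: "card F = q"
proof -
  define P :: "'k poly" where "P = monom 1 q - monom 1 1"
  have deg: "degree P = q"
    using q_ge_3 degree_add_eq_left[of "- monom 1 1" "monom 1 q :: 'k poly"]
    by (simp add: P_def degree_monom_eq)
  have P0: "P \<noteq> 0" using deg q_ge_3 by auto
  have roots: "poly P x = 0 \<longleftrightarrow> x \<in> F" for x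
    by (simp add: P_def poly_monom F_iff)
  obtain A where A: "size A = degree P" "P = Polynomial.smult (lead_coeff P) (\<Prod>x\<in>#A. [:-x, 1:])"
    using alg_closed_imp_factorization[OF P0] by blast
  have set_A: "set_mset A = F"
  proof -
    have "poly P x = 0 \<longleftrightarrow> x \<in># A" for x
      by (subst A(2)) (use P0 in \<open>auto simp: poly_prod_mset prod_mset_zero_iff\<close>)
    then show ?thesis using roots by auto
  qed
  have "count A x \<le> 1" for x
  proof (rule ccontr)
    assume "\<not> count A x \<le> 1"
    then have "2 \<le> count A x" by simp
    then have "replicate_mset 2 x \<subseteq># A" by (simp only: count_le_replicate_mset_subset_eq)
    then obtain C where C: "A = replicate_mset 2 x + C" by (metis subset_mset.le_iff_add)
    define Q where "Q = Polynomial.smult (lead_coeff P) (\<Prod>x\<in>#C. [:-x, 1:])"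
    have "P = [:-x, 1:] * ([:-x, 1:] * Q)"
      unfolding Q_def by (subst A(2)) (simp add: C numeral_2_eq_2)
    then have "poly (pderiv P) x = 0"
      by (simp only: pderiv_mult poly_add poly_mult) simp
    moreover have "pderiv P = - 1"
      using of_nat_q by (simp add: P_def pderiv_diff pderiv_monom monom_0 flip: one_pCons)
    ultimately show False by simp
  qed
  then have "count A x = count (mset_set (set_mset A)) x" for x
    using le_antisym[of "count A x" 1] by (cases "x \<in># A") (auto simp: not_in_iff Suc_le_eq)
  then have "A = mset_set (set_mset A)" by (rule multiset_eqI)
  then have "card (set_mset A) = size A" by (metis size_mset_set)
  then show ?thesis using A(1) deg set_A by simp
qed

lemma finite_F: "finite F"
  using card_F q_ge_3 by (metis card.infinite not_numeral_le_zero)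

lemma finite_units: "finite units"
  using finite_F by (simp add: units_def)

lemma card_units: "card units = q - 1"
  using card_F F_0 finite_F by (simp add: units_def)

lemma of_nat_card_units: "of_nat (card units) = (- 1 :: 'k)"
proof -
  have "of_nat q = (of_nat (card units) :: 'k) + 1"
    using of_nat_Suc[of "q - 1", where 'a = 'k] q_ge_3 by (simp add: card_units add.commute)
  then show ?thesis using of_nat_q by (metis add_eq_0_iff2)
qed

text \<open>With \<open>r\<close> the remainder of \<open>e\<close> modulo \<open>q - 1\<close>, the
  polynomial \<open>x ^ r - 1\<close> has too small a degree to vanish on all units. This replaces a
  generator of the cyclic group.\<close>

lemma exists_unit_power_neq_1:
  assumes "\<not> (q - 1) dvd e"
  shows "\<exists>x\<in>units. x ^ e \<noteq> 1"
proof (rule ccontr)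
  assume *: "\<not> (\<exists>x\<in>units. x ^ e \<noteq> 1)"
  define r where "r = e mod (q - 1)"
  have r: "0 < r" "r < q - 1"
    using assms q_ge_3 by (auto simp: r_def dvd_eq_mod_eq_0 intro: mod_less_divisor)
  have x_r: "x ^ r = 1" if "x \<in> units" for x
  proof -
    have "x ^ e = x ^ ((q - 1) * (e div (q - 1)) + r)" by (simp add: r_def)
    also have "\<dots> = x ^ r"
      by (simp only: power_add power_mult F_power_q1[OF that] power_one mult_1)
    finally show ?thesis using * that by simp
  qed
  define P :: "'k poly" where "P = monom 1 r - 1"
  have "degree P = r"
    using r degree_add_eq_left[of "- 1" "monom 1 r :: 'k poly"]
    by (simp add: P_def degree_monom_eq)
  then have "P \<noteq> 0" using r by auto
  have "units \<subseteq> {x. poly P x = 0}"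
    using x_r by (auto simp: P_def poly_monom)
  then have "card units \<le> r"
    using card_poly_roots_bound[OF \<open>P \<noteq> 0\<close>] \<open>degree P = r\<close> poly_roots_finite[OF \<open>P \<noteq> 0\<close>]
    by (meson card_mono le_trans)
  then show False using r card_units by simp
qed

text \<open>A unit \<open>x\<close> with \<open>x ^ e\<close> different from \<open>1\<close>
  rescales the sum, which therefore vanishes; otherwise every unit contributes \<open>1\<close>, and
  \<open>q - 1\<close> is \<open>-1\<close> in the field. For \<open>e = 0\<close> the summand
  \<open>0 ^ 0 = 1\<close> completes the count to \<open>q\<close>, which is zero.\<close>

lemma sum_F_powers:
  "(\<Sum>y\<in>F. y ^ e) = (if e > 0 \<and> (q - 1) dvd e then - 1 else 0 :: 'k)"
proof -
  have split: "(\<Sum>y\<in>F. y ^ e) = 0 ^ e + (\<Sum>y\<in>units. y ^ e)"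
    unfolding units_def using finite_F F_0 by (rule sum.remove)
  consider "e = 0" | "e > 0" "(q - 1) dvd e" | "\<not> (q - 1) dvd e" by (cases "e = 0") auto
  then show ?thesis
  proof cases
    case 1
    then show ?thesis using of_nat_q card_F by simp
  next
    case 2
    have "y ^ e = 1" if "y \<in> units" for y
      using 2(2) F_power_q1[OF that] by (auto simp: power_mult elim!: dvdE)
    then show ?thesis using 2 split of_nat_card_units by simp
  next
    case 3
    then have e: "e > 0" by (cases e) auto
    obtain x where x: "x \<in> units" "x ^ e \<noteq> 1" using exists_unit_power_neq_1[OF 3] by blast
    have "(\<Sum>y\<in>units. y ^ e) = (\<Sum>y\<in>units. (x * y) ^ e)"
      by (rule sum.reindex_bij_witness[of _ "\<lambda>y. x * y" "\<lambda>y. y / x"])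
        (use x in \<open>auto simp: units_def F_mult F_divide\<close>)
    also have "\<dots> = x ^ e * (\<Sum>y\<in>units. y ^ e)"
      by (simp add: power_mult_distrib sum_distrib_left)
    finally have "(x ^ e - 1) * (\<Sum>y\<in>units. y ^ e) = 0" by (simp add: algebra_simps)
    then show ?thesis using x 3 e split by simp
  qed
qed

lemma unit_powi_eq_1_iff: "(\<forall>x\<in>units. x powi z = 1) \<longleftrightarrow> int (q - 1) dvd z"
proof
  assume "int (q - 1) dvd z"
  then obtain c where "z = int (q - 1) * c" by blast
  then show "\<forall>x\<in>units. x powi z = 1"
    using F_power_q1 by (simp add: power_int_mult)
next
  assume *: "\<forall>x\<in>units. x powi z = 1"
  have "x ^ nat \<bar>z\<bar> = 1" if "x \<in> units" for x
    using * that by (cases "z \<ge> 0") (auto simp: power_int_def units_def power_inverse)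
  then have "(q - 1) dvd nat \<bar>z\<bar>" using exists_unit_power_neq_1[of "nat \<bar>z\<bar>"] by auto
  then have "int (q - 1) dvd int (nat \<bar>z\<bar>)" by (simp only: int_dvd_int_iff)
  then show "int (q - 1) dvd z" by simp
qed

end

section \<open>Expansions in base \<open>p\<close>\<close>

lemma digits_unique:
  fixes a b :: "nat \<Rightarrow> nat"
  assumes "\<And>i. i < n \<Longrightarrow> a i < p" "\<And>i. i < n \<Longrightarrow> b i < p"
    and "(\<Sum>i<n. a i * p ^ i) = (\<Sum>i<n. b i * p ^ i)" and "i < n"
  shows "a i = b i"
  using assms
proof (induction n arbitrary: a b i)
  case (Suc n)
  have shift: "(\<Sum>i<Suc n. c i * p ^ i) = c 0 + p * (\<Sum>i<n. c (Suc i) * p ^ i)" for c :: "nat \<Rightarrow> nat"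
    by (subst sum.lessThan_Suc_shift) (simp add: sum_distrib_left mult.assoc mult.left_commute)
  have eq: "a 0 + p * (\<Sum>i<n. a (Suc i) * p ^ i) = b 0 + p * (\<Sum>i<n. b (Suc i) * p ^ i)"
    using Suc.prems(3) by (simp only: shift)
  have lt: "a 0 < p" "b 0 < p" using Suc.prems(1,2) by auto
  have 0: "a 0 = b 0"
    using arg_cong[OF eq, of "\<lambda>x. x mod p"] lt by simp
  then have "(\<Sum>i<n. a (Suc i) * p ^ i) = (\<Sum>i<n. b (Suc i) * p ^ i)"
    using eq lt by simp
  then have "a (Suc i) = b (Suc i)" if "i < n" for i
    by (intro Suc.IH[of "\<lambda>i. a (Suc i)" "\<lambda>i. b (Suc i)" i] Suc.prems(1,2) that) simp_all
  then show ?case using 0 Suc.prems(4) by (cases i) auto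
qed simp

lemma sum_max_digits:
  assumes "p \<ge> (1::nat)"
  shows "(\<Sum>i<n. (p - 1) * p ^ i) = p ^ n - 1"
proof (induction n)
  case (Suc n)
  have "p ^ n \<ge> 1" using assms by simp
  then show ?case using Suc assms by (simp add: algebra_simps diff_mult_distrib)
qed simp

lemma exists_digits:
  assumes "p \<ge> (1::nat)" and "m < p ^ n"
  shows "\<exists>a. (\<forall>i<n. a i < p) \<and> (\<forall>i\<ge>n. a i = 0) \<and> m = (\<Sum>i<n. a i * p ^ i)"
  using assms(2)
proof (induction n arbitrary: m)
  case 0
  then show ?case by (intro exI[of _ "\<lambda>_. 0"]) auto
next
  case (Suc n)
  have "m div p ^ n < p" using Suc.prems by (simp add: less_mult_imp_div_less)
  moreover have "m mod p ^ n < p ^ n" using assms(1) by simp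
  from Suc.IH[OF this] obtain a where a: "\<forall>i<n. a i < p" "\<forall>i\<ge>n. a i = 0" "m mod p ^ n = (\<Sum>i<n. a i * p ^ i)"
    by blast
  have "m = (\<Sum>i<n. a i * p ^ i) + (m div p ^ n) * p ^ n"
    using a(3) by (metis mod_mult_div_eq add.commute mult.commute)
  ultimately show ?case using a(1,2)
    by (intro exI[of _ "a(n := m div p ^ n)"]) (auto simp: less_Suc_eq)
qed

section \<open>A minimal resolution for the unipotent radical\<close>

text \<open>Functions on the field with \<open>q\<close> elements form \<open>k[x] / (x\<^sup>q - x)\<close>.  Writing exponents in base \<open>p\<close>
  splits this space, as a module for the additive group, into \<open>s\<close> factors of dimension \<open>p\<close>.  In the
  \<open>i\<close>-th factor the span of the monomials of degree at most \<open>m = md i\<close> has a periodic resolution by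
  copies of the whole factor, with differentials that alternately lower the exponent by \<open>m + 1\<close> and
  by \<open>p - 1 - m\<close>; for \<open>m = p - 1\<close> it is the whole factor and the resolution stops.  Below is the
  tensor product of these resolutions: \<open>f (j, a)\<close> is the coefficient of the divided power monomial
  with digits \<open>a\<close> in multidegree \<open>j\<close>.\<close>

locale koszul = finite_field p s kt for p s and kt :: "'k::alg_closed_field itself" +
  fixes md :: "nat \<Rightarrow> nat"
  assumes md: "i < s \<Longrightarrow> md i < p"
begin

definition Box :: "(nat \<Rightarrow> nat) set" where
  "Box = {a. (\<forall>i<s. a i < p) \<and> (\<forall>i\<ge>s. a i = 0)}"

definition Low :: "(nat \<Rightarrow> nat) set" where
  "Low = {a \<in> Box. \<forall>i<s. a i \<le> md i}"

definition J :: "nat \<Rightarrow> (nat \<Rightarrow> nat) set" where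
  "J n = {j. (\<forall>i\<ge>s. j i = 0) \<and> (\<forall>i<s. md i = p - 1 \<longrightarrow> j i = 0) \<and> (\<Sum>i<s. j i) = n}"

text \<open>Index \<open>0\<close>, the resolved module, sits inside index \<open>1\<close> as the
  exponents from \<open>Low\<close> in multidegree zero, so the augmentation can be the identity on
  functions.\<close>

primrec kos_X :: "nat \<Rightarrow> ((nat \<Rightarrow> nat) \<times> (nat \<Rightarrow> nat)) set" where
  "kos_X 0 = {\<lambda>_. 0} \<times> Low"
| "kos_X (Suc n) = J n \<times> Box"

definition step :: "nat \<Rightarrow> nat \<Rightarrow> nat" where
  "step i l = (if even l then md i + 1 else p - 1 - md i)"

text \<open>The Koszul sign of a tensor product of complexes; it makes the operators of different
  factors anticommute.\<close>

definition sg :: "nat \<Rightarrow> (nat \<Rightarrow> nat) \<Rightarrow> 'k" where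
  "sg i j = (- 1) ^ (\<Sum>l<i. j l)"

type_synonym 'a coeffs = "(nat \<Rightarrow> nat) \<times> (nat \<Rightarrow> nat) \<Rightarrow> 'a"

text \<open>On coefficients, lowering exponents by \<open>step\<close> means reading
  \<open>f\<close> at exponents raised by \<open>step\<close>.\<close>

definition dd :: "nat \<Rightarrow> 'k coeffs \<Rightarrow> 'k coeffs" where
  "dd i f = (\<lambda>(j, a). if j i > 0
     then sg i j * f (j(i := j i - 1), a(i := a i + step i (j i - 1))) else 0)"

definition ss :: "nat \<Rightarrow> 'k coeffs \<Rightarrow> 'k coeffs" where
  "ss i f = (\<lambda>(j, a). if step i (j i) \<le> a i \<and> a i < p
     then sg i j * f (j(i := Suc (j i)), a(i := a i - step i (j i))) else 0)"

definition pr :: "nat \<Rightarrow> 'k coeffs \<Rightarrow> 'k coeffs" where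
  "pr i f = (\<lambda>(j, a). if j i = 0 \<and> a i \<le> md i then f (j, a) else 0)"

primrec DD :: "nat \<Rightarrow> 'k coeffs \<Rightarrow> 'k coeffs" where
  "DD 0 f = (\<lambda>_. 0)"
| "DD (Suc k) f = (\<lambda>x. DD k f x + dd k f x)"

primrec PP :: "nat \<Rightarrow> 'k coeffs \<Rightarrow> 'k coeffs" where
  "PP 0 f = f"
| "PP (Suc k) f = PP k (pr k f)"

text \<open>The contraction of a tensor product: contract factor \<open>k\<close>, project the
  factors before it to the resolved module, and leave those after it alone.\<close>

primrec SS :: "nat \<Rightarrow> 'k coeffs \<Rightarrow> 'k coeffs" where
  "SS 0 f = (\<lambda>_. 0)"
| "SS (Suc k) f = (\<lambda>x. SS k f x + PP k (ss k f) x)"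

lemma lin_dd: "lin (dd i)"
  by (rule linI; rule ext; clarify) (simp_all add: dd_def distrib_left mult.left_commute)

lemma lin_ss: "lin (ss i)"
  by (rule linI; rule ext; clarify) (simp_all add: ss_def distrib_left mult.left_commute)

lemma lin_pr: "lin (pr i)"
  by (rule linI; rule ext; clarify) (simp_all add: pr_def)

lemma lin_PP: "lin (PP k)"
proof (induction k)
  case 0
  show ?case unfolding PP.simps(1)[abs_def] by (rule lin_id)
next
  case (Suc k)
  have "lin (PP k)" by (rule Suc)
  then show ?case unfolding PP.simps(2)[abs_def] by (rule lin_comp[OF _ lin_pr])
qed

lemma DD_Suc: "DD (Suc k) f = DD k f + dd k f"
  by (simp add: fun_eq_iff)

lemma SS_Suc: "SS (Suc k) f = SS k f + PP k (ss k f)"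
  by (simp add: fun_eq_iff)

lemma DD_0: "DD 0 f = 0" and SS_0: "SS 0 f = 0"
  by (simp_all add: fun_eq_iff)

lemma lin_DD: "lin (DD k)"
proof (induction k)
  case 0
  show ?case unfolding DD_0[abs_def] by (rule lin_zero)
next
  case (Suc k)
  then show ?case unfolding DD_Suc[abs_def] by (intro lin_plus lin_dd)
qed

lemma lin_SS: "lin (SS k)"
proof (induction k)
  case 0
  show ?case unfolding SS_0[abs_def] by (rule lin_zero)
next
  case (Suc k)
  then show ?case unfolding SS_Suc[abs_def] by (intro lin_plus lin_comp[OF lin_PP] lin_ss)
qed

section \<open>Commutation relations of the operators on single factors\<close>

lemma sg_upd_ge: "i \<le> l \<Longrightarrow> sg i (j(l := c)) = sg i j"
  by (auto simp: sg_def intro!: arg_cong[where f = "\<lambda>n. (- 1) ^ n"] sum.cong)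

lemma sg_upd_Suc: "l < i \<Longrightarrow> sg i (j(l := Suc (j l))) = - sg i j"
proof -
  assume "l < i"
  then have "(\<Sum>n<i. (j(l := Suc (j l))) n) = Suc (j l) + (\<Sum>n\<in>{..<i} - {l}. (j(l := Suc (j l))) n)"
    by (subst sum.remove[of _ l]) auto
  also have "\<dots> = Suc (\<Sum>n<i. j n)"
    using \<open>l < i\<close> by (subst sum.remove[of "{..<i}" l]) auto
  finally show ?thesis by (simp add: sg_def)
qed

lemma sg_upd_pred: "l < i \<Longrightarrow> j l > 0 \<Longrightarrow> sg i (j(l := j l - Suc 0)) = - sg i j"
  using sg_upd_Suc[of l i "j(l := j l - Suc 0)"] by simp

lemma sg_sg: "sg i j * sg i j = 1"
  by (simp add: sg_def flip: power_add mult_2)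

lemma dd_dd: "l < k \<Longrightarrow> dd l (dd k f) = - dd k (dd l f)"
  by (auto simp: dd_def fun_eq_iff sg_upd_ge sg_upd_pred fun_upd_twist)

lemma dd_ss: "l < k \<Longrightarrow> dd l (ss k f) = - ss k (dd l f)"
  by (auto simp: dd_def ss_def fun_eq_iff sg_upd_ge sg_upd_pred fun_upd_twist)

lemma ss_dd: "l < k \<Longrightarrow> ss l (dd k f) = - dd k (ss l f)"
  by (auto simp: dd_def ss_def fun_eq_iff sg_upd_ge sg_upd_Suc fun_upd_twist)

lemma pr_dd: "l \<noteq> k \<Longrightarrow> pr l (dd k f) = dd k (pr l f)"
  by (auto simp: dd_def pr_def fun_eq_iff)

lemma dd_pr_same: "dd k (pr k f) = 0"
  by (auto simp: dd_def pr_def step_def fun_eq_iff)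

lemma pr_dd_same: "pr k (dd k f) = 0"
  by (auto simp: dd_def pr_def fun_eq_iff)

text \<open>A common home for all degrees: the identities within one factor use bounded digits and
  zero multidegree in full factors, but not the total degree.\<close>

definition W :: "((nat \<Rightarrow> nat) \<times> (nat \<Rightarrow> nat)) set" where
  "W = {(j, a). \<forall>i<s. a i < p \<and> (md i = p - 1 \<longrightarrow> j i = 0)}"

lemma WD:
  assumes "f \<in> fsupp W" "i < s"
  shows "a i \<ge> p \<Longrightarrow> f (j, a) = 0" "md i = p - 1 \<Longrightarrow> j i > 0 \<Longrightarrow> f (j, a) = 0"
  using assms by (auto simp: fsupp_def W_def not_less[symmetric])

text \<open>Two consecutive steps add up to \<open>p\<close>, which moves every exponent out of the
  box.\<close>

lemma dd_dd_same: "f \<in> fsupp W \<Longrightarrow> k < s \<Longrightarrow> dd k (dd k f) = 0"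
  using md[of k] by (auto simp: dd_def fun_eq_iff step_def intro!: WD(1)[of f k])

text \<open>Since consecutive steps add up to \<open>p\<close>, an exponent either stays in the box
  when raised by the previous step or is at least the current step, never both: exactly one of the
  two composites returns \<open>f\<close>. In degree zero the exponents up to \<open>md k\<close>
  are left over, and \<open>pr k\<close> projects to them.\<close>

lemma dd_ss_same:
  assumes f: "f \<in> fsupp W" and k: "k < s"
  shows "dd k (ss k f) + ss k (dd k f) = f - pr k f"
proof (rule ext, clarify)
  fix j a
  show "(dd k (ss k f) + ss k (dd k f)) (j, a) = (f - pr k f) (j, a)"
  proof (cases "a k < p")
    case False
    then have "f (j, a) = 0" using WD(1)[OF f k] by simp
    then show ?thesis using False by (auto simp: dd_def ss_def pr_def)
  next
    case True
    show ?thesis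
    proof (cases "j k")
      case 0
      then show ?thesis using True
        by (auto simp: dd_def ss_def pr_def step_def sg_upd_ge sg_sg mult.assoc[symmetric] fun_upd_idem)
    next
      case (Suc n)
      show ?thesis
      proof (cases "md k = p - 1")
        case full: True
        then show ?thesis
          using Suc by (auto simp: dd_def ss_def pr_def sg_upd_ge WD(2)[OF f k])
      next
        case False
        then have "md k < p - 1" using md[OF k] by simp
        then show ?thesis using True Suc
          by (auto simp: dd_def ss_def pr_def step_def sg_upd_ge sg_sg mult.assoc[symmetric] fun_upd_idem)
      qed
    qed
  qed
qed

lemma PP_dd: "k \<ge> l \<Longrightarrow> PP l (dd k f) = dd k (PP l f)"
  by (induction l arbitrary: f) (simp_all add: pr_dd)

lemma SS_dd: "k \<ge> l \<Longrightarrow> SS l (dd k f) = - dd k (SS l f)"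
proof (induction l)
  case 0
  have "SS 0 (dd k f) = - dd k (SS 0 f)" by (simp add: SS_0 lin_0[OF lin_dd] del: SS.simps)
  then show ?case .
next
  case (Suc l)
  have IH: "SS l (dd k f) = - dd k (SS l f)" by (rule Suc.IH) (use Suc.prems in simp)
  have "SS (Suc l) (dd k f) = - dd k (SS (Suc l) f)"
    using Suc.prems by (simp add: SS_Suc ss_dd PP_dd lin_minus[OF lin_PP] lin_add[OF lin_dd] IH del: SS.simps)
  then show ?case .
qed

lemma DD_ss: "k \<ge> l \<Longrightarrow> DD l (ss k f) = - ss k (DD l f)"
proof (induction l)
  case 0
  have "DD 0 (ss k f) = - ss k (DD 0 f)" by (simp add: DD_0 lin_0[OF lin_ss] del: DD.simps)
  then show ?case .
next
  case (Suc l)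
  have IH: "DD l (ss k f) = - ss k (DD l f)" by (rule Suc.IH) (use Suc.prems in simp)
  have "DD (Suc l) (ss k f) = - ss k (DD (Suc l) f)"
    using Suc.prems by (simp add: DD_Suc dd_ss lin_add[OF lin_ss] IH del: DD.simps)
  then show ?case .
qed

lemma DD_dd: "k \<ge> l \<Longrightarrow> DD l (dd k f) = - dd k (DD l f)"
proof (induction l)
  case 0
  have "DD 0 (dd k f) = - dd k (DD 0 f)" by (simp add: DD_0 lin_0[OF lin_dd] del: DD.simps)
  then show ?case .
next
  case (Suc l)
  have IH: "DD l (dd k f) = - dd k (DD l f)" by (rule Suc.IH) (use Suc.prems in simp)
  have "DD (Suc l) (dd k f) = - dd k (DD (Suc l) f)"
    using Suc.prems by (simp add: DD_Suc dd_dd lin_add[OF lin_dd] IH del: DD.simps)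
  then show ?case .
qed

lemma dd_PP: "l < k \<Longrightarrow> dd l (PP k f) = 0"
proof (induction k arbitrary: f)
  case (Suc k)
  show ?case
  proof (cases "l = k")
    case True
    then show ?thesis by (simp add: PP_dd[symmetric] dd_pr_same lin_0[OF lin_PP])
  qed (use Suc in simp)
qed simp

lemma PP_dd_0: "l < k \<Longrightarrow> PP k (dd l f) = 0"
proof (induction k arbitrary: f)
  case (Suc k)
  show ?case
  proof (cases "l = k")
    case True
    then show ?thesis by (simp add: pr_dd_same lin_0[OF lin_PP])
  qed (use Suc in \<open>simp add: pr_dd\<close>)
qed simp

lemma DD_PP: "k \<le> n \<Longrightarrow> DD k (PP n f) = 0"
proof (induction k)
  case 0
  show ?case by (rule DD_0)
next
  case (Suc k)
  have IH: "DD k (PP n f) = 0" by (rule Suc.IH) (use Suc.prems in simp)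
  have "DD (Suc k) (PP n f) = 0"
    unfolding DD_Suc IH using Suc.prems by (simp add: dd_PP)
  then show ?case .
qed

lemma PP_DD: "k \<le> n \<Longrightarrow> PP n (DD k f) = 0"
proof (induction k)
  case 0
  have "PP n (DD 0 f) = 0" unfolding DD_0 by (rule lin_0[OF lin_PP])
  then show ?case .
next
  case (Suc k)
  have IH: "PP n (DD k f) = 0" by (rule Suc.IH) (use Suc.prems in simp)
  have "PP n (DD (Suc k) f) = 0"
    unfolding DD_Suc lin_add[OF lin_PP] IH using Suc.prems by (simp add: PP_dd_0)
  then show ?case .
qed

text \<open>The Kuenneth argument: mixed terms of different factors cancel by anticommutation, terms
  in which \<open>PP k\<close> meets \<open>DD k\<close> vanish, and the new factor contributes
  \<open>PP k f - PP (Suc k) f\<close>, so that the sum telescopes.\<close>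

lemma homotopy_identity:
  assumes f: "f \<in> fsupp W" and "k \<le> s"
  shows "DD k (SS k f) + SS k (DD k f) = f - PP k f"
  using assms(2)
proof (induction k)
  case 0
  have "DD 0 (SS 0 f) + SS 0 (DD 0 f) = f - PP 0 f" by (simp add: DD_0 SS_0 del: DD.simps SS.simps)
  then show ?case .
next
  case (Suc k)
  have 1: "DD k (SS k f) + SS k (DD k f) = f - PP k f"
    by (rule Suc.IH) (use Suc.prems in simp)
  have 2: "dd k (SS k f) + SS k (dd k f) = 0" by (simp add: SS_dd)
  have 3: "DD k (PP k (ss k f)) = 0" by (simp add: DD_PP)
  have 4: "PP k (ss k (DD k f)) = 0"
  proof -
    have "PP k (ss k (DD k f)) = - PP k (DD k (ss k f))"
      by (simp add: DD_ss lin_minus[OF lin_PP])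
    then show ?thesis by (simp add: PP_DD)
  qed
  have 5: "dd k (PP k (ss k f)) + PP k (ss k (dd k f)) = PP k f - PP (Suc k) f"
  proof -
    have "dd k (PP k (ss k f)) + PP k (ss k (dd k f)) = PP k (dd k (ss k f) + ss k (dd k f))"
      by (simp add: PP_dd lin_add[OF lin_PP])
    then show ?thesis using dd_ss_same[OF f, of k] Suc.prems by (simp add: lin_diff[OF lin_PP])
  qed
  have "DD (Suc k) (SS (Suc k) f) + SS (Suc k) (DD (Suc k) f) =
    (DD k (SS k f) + SS k (DD k f)) + (dd k (SS k f) + SS k (dd k f)) + DD k (PP k (ss k f)) +
    PP k (ss k (DD k f)) + (dd k (PP k (ss k f)) + PP k (ss k (dd k f)))"
    by (simp only: DD_Suc SS_Suc lin_add[OF lin_DD] lin_add[OF lin_SS] lin_add[OF lin_dd]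
        lin_add[OF lin_ss] lin_add[OF lin_PP] ac_simps)
  also have "\<dots> = f - PP (Suc k) f" unfolding 1 2 3 4 5 by simp
  finally show ?case .
qed

lemma DD_DD:
  assumes f: "f \<in> fsupp W" and "k \<le> s"
  shows "DD k (DD k f) = 0"
  using assms(2)
proof (induction k)
  case 0
  show ?case by (rule DD_0)
next
  case (Suc k)
  have IH: "DD k (DD k f) = 0" by (rule Suc.IH) (use Suc.prems in simp)
  have "DD (Suc k) (DD (Suc k) f) = 0"
    unfolding DD_Suc lin_add[OF lin_DD] lin_add[OF lin_dd] IH
    using dd_dd_same[OF f, of k] Suc.prems by (simp add: DD_dd)
  then show ?case .
qed

section \<open>Supports of the operators, and exactness of the complex\<close>

lemma kos_X_W: "kos_X n \<subseteq> W"
  by (cases n) (auto simp: W_def J_def Box_def Low_def)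

lemma fsupp_kos_W: "f \<in> fsupp (kos_X n) \<Longrightarrow> f \<in> fsupp W"
  using kos_X_W by (fastforce simp: fsupp_def)

lemma fsuppI: "(\<And>j a. f (j, a) \<noteq> 0 \<Longrightarrow> (j, a) \<in> X) \<Longrightarrow> f \<in> fsupp X"
  by (auto simp: fsupp_def)

lemma fsuppD: "f \<in> fsupp X \<Longrightarrow> f x \<noteq> 0 \<Longrightarrow> x \<in> X"
  by (auto simp: fsupp_def)

lemma sum_upd: "i < s \<Longrightarrow> (\<Sum>l<s. (j(i := c)) l) + j i = (\<Sum>l<s. j l) + c" for j :: "nat \<Rightarrow> nat"
proof -
  assume i: "i < s"
  have "(\<Sum>l\<in>{..<s} - {i}. (j(i := c)) l) = (\<Sum>l\<in>{..<s} - {i}. j l)"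
    by (intro sum.cong) auto
  then show ?thesis
    using i sum.remove[of "{..<s}" i "j(i := c)"] sum.remove[of "{..<s}" i j] by simp
qed

lemma dd_in:
  assumes f: "f \<in> fsupp (kos_X (Suc n))" and i: "i < s"
  shows "dd i f \<in> fsupp (kos_X (Suc (Suc n)))"
proof (rule fsuppI)
  fix j a assume "dd i f (j, a) \<noteq> 0"
  then have ji: "j i > 0" and nz: "f (j(i := j i - 1), a(i := a i + step i (j i - 1))) \<noteq> 0"
    by (auto simp: dd_def split: if_splits)
  note J = fsuppD[OF f nz]
  have "(\<forall>l<s. a l < p)"
  proof clarify
    fix l assume "l < s"
    then have "(a(i := a i + step i (j i - 1))) l < p" using J by (auto simp: Box_def)
    then show "a l < p" by (auto split: if_splits)
  qed
  moreover have "\<forall>l\<ge>s. a l = 0"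
    using J i by (auto simp: Box_def split: if_splits dest: spec)
  moreover have "\<forall>l\<ge>s. j l = 0"
    using J i by (auto simp: J_def split: if_splits dest: spec)
  moreover have "(\<Sum>l<s. j l) = Suc n"
    using sum_upd[OF i, of j "j i - 1"] J ji by (simp add: J_def)
  \<comment> \<open>In a full factor \<open>step i 0 = p\<close>, so the coefficient that would be
    read lies outside the box; the multidegree cannot leave zero there.\<close>
  moreover have "j l = 0" if "l < s" "md l = p - 1" for l
  proof (cases "l = i")
    case True
    have "(j(i := j i - 1)) l = 0" using J that unfolding kos_X.simps J_def by blast
    then have "j i = 1" using ji True by simp
    then have "(a(i := a i + step i (j i - 1))) i \<ge> p" using True that p_pos by (simp add: step_def)
    then show ?thesis using J i by (auto simp: Box_def not_less[symmetric])
  next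
    case False
    have "(j(i := j i - 1)) l = 0" using J that unfolding kos_X.simps J_def by blast
    then show ?thesis using False by simp
  qed
  ultimately show "(j, a) \<in> kos_X (Suc (Suc n))" by (simp add: J_def Box_def)
qed

lemma ss_in:
  assumes f: "f \<in> fsupp (kos_X (Suc (Suc n)))" and i: "i < s"
  shows "ss i f \<in> fsupp (kos_X (Suc n))"
proof (rule fsuppI)
  fix j a assume "ss i f (j, a) \<noteq> 0"
  then have ai: "a i < p" and nz: "f (j(i := Suc (j i)), a(i := a i - step i (j i))) \<noteq> 0"
    by (auto simp: ss_def split: if_splits)
  note J = fsuppD[OF f nz]
  have "a l < p" if "l < s" for l
  proof (cases "l = i")
    case False
    have "(a(i := a i - step i (j i))) l < p" using J that unfolding kos_X.simps Box_def by blast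
    then show ?thesis using False by simp
  qed (use ai in simp)
  moreover have "\<forall>l\<ge>s. a l = 0"
    using J i by (auto simp: Box_def split: if_splits dest: spec)
  moreover have "\<forall>l\<ge>s. j l = 0"
    using J i by (auto simp: J_def split: if_splits dest: spec)
  moreover have "(\<Sum>l<s. j l) = n"
    using sum_upd[OF i, of j "Suc (j i)"] J by (simp add: J_def)
  moreover have "j l = 0" if "l < s" "md l = p - 1" for l
  proof -
    have "(j(i := Suc (j i))) l = 0" using J that unfolding kos_X.simps J_def by blast
    then show ?thesis by (simp split: if_splits)
  qed
  ultimately show "(j, a) \<in> kos_X (Suc n)" by (simp add: J_def Box_def)
qed

lemma pr_in: "f \<in> fsupp X \<Longrightarrow> pr i f \<in> fsupp X"
  by (auto simp: fsupp_def pr_def)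

lemma PP_in: "f \<in> fsupp X \<Longrightarrow> PP k f \<in> fsupp X"
  by (induction k arbitrary: f) (auto intro: pr_in)

lemma PP_apply: "PP k f (j, a) = (if \<forall>i<k. j i = 0 \<and> a i \<le> md i then f (j, a) else 0)"
  by (induction k arbitrary: f) (auto simp: pr_def less_Suc_eq)

lemma DD_in:
  assumes f: "f \<in> fsupp (kos_X (Suc n))" and "k \<le> s"
  shows "DD k f \<in> fsupp (kos_X (Suc (Suc n)))"
  using assms(2)
proof (induction k)
  case (Suc k)
  then show ?case unfolding DD_Suc by (intro fsupp_add dd_in f) auto
qed (simp add: fsupp_def)

lemma SS_in:
  assumes f: "f \<in> fsupp (kos_X (Suc (Suc n)))" and "k \<le> s"
  shows "SS k f \<in> fsupp (kos_X (Suc n))"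
  using assms(2)
proof (induction k)
  case (Suc k)
  then show ?case unfolding SS_Suc by (intro fsupp_add PP_in ss_in f) auto
qed (simp add: fsupp_def)

definition kos_d :: "nat \<Rightarrow> 'k coeffs \<Rightarrow> 'k coeffs" where
  "kos_d n f = (if n = 0 then f else DD s f)"

definition kos_s :: "nat \<Rightarrow> 'k coeffs \<Rightarrow> 'k coeffs" where
  "kos_s n f = (if n = 0 then PP s f else SS s f)"

lemma lin_kos_d: "lin (kos_d n)"
  unfolding kos_d_def[abs_def] using lin_id lin_DD by (cases "n = 0") auto

lemma lin_kos_s: "lin (kos_s n)"
  unfolding kos_s_def[abs_def] using lin_PP lin_SS by (cases "n = 0") auto

lemma PP_kos_0:
  assumes "f \<in> fsupp (kos_X 0)"
  shows "PP s f = f"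
proof (rule ext, clarify)
  fix j a
  show "PP s f (j, a) = f (j, a)"
    using fsuppD[OF assms, of "(j, a)"] by (auto simp: PP_apply Low_def)
qed

lemma kos_d_in: "f \<in> fsupp (kos_X n) \<Longrightarrow> kos_d n f \<in> fsupp (kos_X (Suc n))"
proof (cases n)
  case 0
  assume "f \<in> fsupp (kos_X n)"
  then show ?thesis
    using fsuppD[of f "kos_X 0"] by (intro fsuppI) (auto simp: 0 kos_d_def J_def Low_def)
next
  case (Suc n')
  assume "f \<in> fsupp (kos_X n)"
  then show ?thesis using DD_in[of f n' s] by (simp add: Suc kos_d_def)
qed

lemma kos_s_in: "f \<in> fsupp (kos_X (Suc n)) \<Longrightarrow> kos_s n f \<in> fsupp (kos_X n)"
proof (cases n)
  case 0
  assume f: "f \<in> fsupp (kos_X (Suc n))"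
  show ?thesis
  proof (rule fsuppI)
    fix j a assume nz: "kos_s n f (j, a) \<noteq> 0"
    then have "f (j, a) \<noteq> 0" and low: "\<forall>i<s. j i = 0 \<and> a i \<le> md i"
      by (auto simp: kos_s_def 0 PP_apply split: if_splits)
    then have ja: "j \<in> J n" "a \<in> Box" using fsuppD[OF f] by auto
    then have "j i = 0" for i using low by (cases "i < s") (auto simp: J_def)
    then have "j = (\<lambda>_. 0)" by auto
    then show "(j, a) \<in> kos_X n" using ja low by (simp add: 0 Low_def)
  qed
next
  case (Suc n')
  assume "f \<in> fsupp (kos_X (Suc n))"
  then show ?thesis using SS_in[of f n' s] by (simp add: Suc kos_s_def)
qed

lemma kos_d_d: "f \<in> fsupp (kos_X n) \<Longrightarrow> kos_d (Suc n) (kos_d n f) = 0"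
proof (cases n)
  case 0
  assume "f \<in> fsupp (kos_X n)"
  then have "PP s f = f" using PP_kos_0 by (simp only: 0)
  then show ?thesis using DD_PP[of s s f] by (simp add: 0 kos_d_def)
next
  case (Suc n')
  assume "f \<in> fsupp (kos_X n)"
  then have "DD s (DD s f) = 0" by (intro DD_DD fsupp_kos_W) simp_all
  then show ?thesis by (simp add: Suc kos_d_def)
qed

lemma kos_contr_0: "f \<in> fsupp (kos_X 0) \<Longrightarrow> kos_s 0 (kos_d 0 f) = f"
  using PP_kos_0 by (simp add: kos_s_def kos_d_def)

text \<open>\<open>ss k\<close> reads \<open>f\<close> at a positive multidegree, whereas
  \<open>f\<close> lives in multidegree zero. What remains of the homotopy identity in this index is
  the projection \<open>kos_s 0\<close>.\<close>

lemma SS_kos_1: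
  assumes f: "f \<in> fsupp (kos_X (Suc 0))"
    and "k \<le> s"
  shows "SS k f = 0"
  using assms(2)
proof (induction k)
  case 0
  show ?case by (rule SS_0)
next
  case (Suc k)
  have IH: "SS k f = 0" by (rule Suc.IH) (use Suc.prems in simp)
  have ss_0: "ss k f = 0"
  proof (rule ext, clarify)
    fix j a
    have "f (j(k := Suc (j k)), a(k := a k - step k (j k))) = 0"
    proof (rule ccontr)
      assume "f (j(k := Suc (j k)), a(k := a k - step k (j k))) \<noteq> 0"
      then have "j(k := Suc (j k)) \<in> J 0" using fsuppD[OF f] by auto
      then have "(\<Sum>l<s. (j(k := Suc (j k))) l) = 0" by (simp add: J_def)
      then show False using Suc.prems by (auto simp: sum_eq_0_iff dest: bspec[of _ _ k])
    qed
    then show "ss k f (j, a) = 0 (j, a)" by (simp add: ss_def)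
  qed
  have "SS (Suc k) f = 0" unfolding SS_Suc IH ss_0 lin_0[OF lin_PP] by simp
  then show ?case .
qed

lemma kos_contr:
  assumes f: "f \<in> fsupp (kos_X (Suc n))"
  shows "kos_d n (kos_s n f) + kos_s (Suc n) (kos_d (Suc n) f) = f"
proof -
  have *: "DD s (SS s f) + SS s (DD s f) = f - PP s f"
    by (rule homotopy_identity[OF fsupp_kos_W[OF f]]) simp
  show ?thesis
  proof (cases n)
    case 0
    have "SS s f = 0" using SS_kos_1 f by (simp add: 0 del: SS.simps)
    then show ?thesis using * lin_0[OF lin_DD, of s] by (simp add: 0 kos_d_def kos_s_def)
  next
    case (Suc n')
    have "PP s f = 0"
    proof (rule ext, clarify)
      fix j a
      have "j \<in> J (Suc n')" if "f (j, a) \<noteq> 0" using fsuppD[OF f that] by (simp add: Suc)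
      moreover have "j \<notin> J (Suc n')" if "\<forall>i<s. j i = 0" using that by (simp add: J_def)
      ultimately show "PP s f (j, a) = 0 (j, a)" by (auto simp: PP_apply)
    qed
    then show ?thesis using * by (simp add: Suc kos_d_def kos_s_def)
  qed
qed

end

section \<open>The action of the Borel subgroup on the resolution\<close>

context koszul
begin

definition val :: "(nat \<Rightarrow> nat) \<Rightarrow> nat" where
  "val a = (\<Sum>i<s. a i * p ^ i)"

definition ifact :: "(nat \<Rightarrow> nat) \<Rightarrow> 'k" where
  "ifact a = (\<Prod>i<s. 1 / of_nat (fact (a i)))"

text \<open>Divided powers in each digit: the addition formula \<open>ee_add\<close> is then free of
  binomial coefficients, and substitution acts by plain shifts of exponents.\<close>

definition ee :: "(nat \<Rightarrow> nat) \<Rightarrow> 'k \<Rightarrow> 'k" where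
  "ee a y = ifact a * y ^ val a"

definition full :: "nat \<Rightarrow> nat" where
  "full i = (if i < s then p - 1 else 0)"

lemma finite_Box: "finite Box"
proof -
  have "Box \<subseteq> {f. \<forall>x. (x \<in> {..<s} \<longrightarrow> f x \<in> {..<p}) \<and> (x \<notin> {..<s} \<longrightarrow> f x = 0)}"
    by (auto simp: Box_def)
  then show ?thesis by (rule finite_subset) (rule finite_set_of_finite_funs; simp)
qed

lemma zero_Box: "(\<lambda>_. 0) \<in> Box"
  using p_pos by (simp add: Box_def)

lemma top_Box: "full \<in> Box"
  using p_pos by (simp add: Box_def full_def)

lemma BoxD: "a \<in> Box \<Longrightarrow> a i \<le> full i"
  by (cases "i < s") (auto simp: Box_def full_def)

lemma le_top_Box: "(\<And>i. a i \<le> full i) \<Longrightarrow> a \<in> Box"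
proof -
  assume a: "\<And>i. a i \<le> full i"
  show "a \<in> Box" unfolding Box_def
  proof (intro CollectI conjI allI impI)
    show "a i < p" if "i < s" for i using a[of i] that p_pos by (simp add: full_def)
    show "a i = 0" if "i \<ge> s" for i using a[of i] that by (simp add: full_def)
  qed
qed

lemma Box_mono: "a \<in> Box \<Longrightarrow> (\<And>i. b i \<le> a i) \<Longrightarrow> b \<in> Box"
  by (rule le_top_Box) (meson BoxD le_trans)

lemma top_ne_0: "full \<noteq> (\<lambda>_. 0)"
  using s p3 by (auto simp: full_def fun_eq_iff intro!: exI[of _ 0])

lemma val_0: "val (\<lambda>_. 0) = 0"
  by (simp add: val_def)

lemma val_top: "val full = q - 1"
  using sum_max_digits[of p s] p_pos by (simp add: val_def full_def q_def)

lemma val_add: "val (\<lambda>i. a i + b i) = val a + val b"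
  by (simp add: val_def sum.distrib algebra_simps)

lemma val_le: "a \<in> Box \<Longrightarrow> val a \<le> q - 1"
  unfolding val_top[symmetric] unfolding val_def by (intro sum_mono mult_right_mono BoxD) simp_all

lemma val_inj: "a \<in> Box \<Longrightarrow> b \<in> Box \<Longrightarrow> val a = val b \<longleftrightarrow> a = b"
proof
  assume a: "a \<in> Box" and b: "b \<in> Box" and eq: "val a = val b"
  show "a = b"
  proof
    fix i
    show "a i = b i"
    proof (cases "i < s")
      case True
      then show ?thesis
        using a b eq by (intro digits_unique[of s a p b i]) (auto simp: val_def Box_def)
    qed (use a b in \<open>simp add: Box_def\<close>)
  qed
qed simp

lemma top_diff: "a \<in> Box \<Longrightarrow> (\<lambda>i. full i - a i) \<in> Box"
  by (rule Box_mono[OF top_Box]) simp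

lemma val_top_diff: "a \<in> Box \<Longrightarrow> val (\<lambda>i. full i - a i) = q - 1 - val a"
  using val_add[of "\<lambda>i. full i - a i" a] BoxD[of a] by (simp add: val_top)

lemma fact_ne_0: "b < p \<Longrightarrow> of_nat (fact b) \<noteq> (0 :: 'k)"
  using p CHAR by (simp add: of_nat_eq_0_iff_char_dvd prime_dvd_fact_iff del: of_nat_fact)

lemma ifact_ne_0: "a \<in> Box \<Longrightarrow> ifact a \<noteq> 0"
  using fact_ne_0 by (simp add: ifact_def Box_def del: of_nat_fact)

lemma ifact_0: "ifact (\<lambda>_. 0) = 1"
  by (simp add: ifact_def)

lemma ee_0: "ee (\<lambda>_. 0) y = 1"
  by (simp add: ee_def ifact_0 val_0)

lemma ee_at_0: "a \<in> Box \<Longrightarrow> ee a 0 = (if a = (\<lambda>_. 0) then 1 else 0)"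
  using val_inj[OF _ zero_Box, of a] by (auto simp: ifact_0 ee_def val_0 power_0_left)

lemma ee_scale: "ee a (t * y) = t ^ val a * ee a y"
  by (simp add: ee_def power_mult_distrib)

lemma ee_minus: "ee a (- y) = (- 1) ^ val a * ee a y"
  using ee_scale[of a "- 1" y] by simp

lemma ee_prod: "ee a y = (\<Prod>i<s. (y ^ p ^ i) ^ a i / of_nat (fact (a i)))"
  by (simp add: ee_def ifact_def val_def power_sum prod_dividef power_mult[symmetric] mult.commute
      del: of_nat_fact)

lemma divided_binomial:
  assumes "n < p"
  shows "(x + y :: 'k) ^ n / of_nat (fact n) =
    (\<Sum>b\<le>n. (x ^ b / of_nat (fact b)) * (y ^ (n - b) / of_nat (fact (n - b))))"
proof -
  have "of_nat (n choose b) / of_nat (fact n) = (1 / of_nat (fact b)) * (1 / of_nat (fact (n - b)) :: 'k)"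
    if "b \<le> n" for b
  proof -
    have "of_nat (fact b) * of_nat (fact (n - b)) * of_nat (n choose b) = (of_nat (fact n) :: 'k)"
      using binomial_fact_lemma[OF that] by (metis of_nat_mult)
    then show ?thesis
      using fact_ne_0[of b] fact_ne_0[of "n - b"] fact_ne_0[of n] assms that
      by (simp add: field_simps del: of_nat_fact)
  qed
  then have "of_nat (n choose b) * x ^ b * y ^ (n - b) / of_nat (fact n) =
      (x ^ b / of_nat (fact b)) * (y ^ (n - b) / of_nat (fact (n - b)))" if "b \<le> n" for b
    using that by (simp add: divide_inverse mult.commute mult.left_commute del: of_nat_fact)
  then show ?thesis by (simp add: binomial_ring sum_divide_distrib del: of_nat_fact)
qed

definition below :: "(nat \<Rightarrow> nat) \<Rightarrow> (nat \<Rightarrow> nat) set" where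
  "below a = {b. \<forall>i. b i \<le> a i}"

lemma prod_sum_below:
  fixes h :: "nat \<Rightarrow> nat \<Rightarrow> 'c::comm_semiring_1"
  assumes "\<And>i. i \<ge> s \<Longrightarrow> a i = 0"
  shows "(\<Prod>i<s. \<Sum>b\<le>a i. h i b) = (\<Sum>b\<in>below a. \<Prod>i<s. h i (b i))"
proof -
  have "(\<Prod>i<s. \<Sum>b\<le>a i. h i b) = (\<Sum>g\<in>PiE {..<s} (\<lambda>i. {..a i}). \<Prod>i<s. h i (g i))"
    by (rule prod_sum_PiE) auto
  also have "\<dots> = (\<Sum>b\<in>below a. \<Prod>i<s. h i (b i))"
  proof (rule sum.reindex_bij_witness[of _ "\<lambda>b. restrict b {..<s}" "\<lambda>g i. if i < s then g i else 0"])
    fix b assume b: "b \<in> below a"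
    have "b i = 0" if "\<not> i < s" for i
    proof -
      have "b i \<le> a i" using b by (simp add: below_def)
      then show ?thesis using assms[of i] that by simp
    qed
    then show "(\<lambda>i. if i < s then restrict b {..<s} i else 0) = b" by (auto simp: fun_eq_iff)
    show "restrict b {..<s} \<in> PiE {..<s} (\<lambda>i. {..a i})" using b by (auto simp: below_def)
  next
    fix g assume "g \<in> PiE {..<s} (\<lambda>i. {..a i})"
    then show "restrict (\<lambda>i. if i < s then g i else 0) {..<s} = g"
      and "(\<lambda>i. if i < s then g i else 0) \<in> below a"
      by (auto simp: below_def PiE_def Pi_def extensional_def fun_eq_iff)
  qed auto
  finally show ?thesis .
qed

text \<open>The factors in \<open>ee_prod\<close> are divided powers of Frobenius powers, and
  Frobenius is additive; so the binomial formula applies to each digit separately.\<close>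

lemma ee_add:
  assumes a: "a \<in> Box"
  shows "ee a (x + y) = (\<Sum>b\<in>below a. ee b x * ee (\<lambda>i. a i - b i) y)"
proof -
  have "ee a (x + y) = (\<Prod>i<s. \<Sum>b\<le>a i. ((x ^ p ^ i) ^ b / of_nat (fact b)) *
      ((y ^ p ^ i) ^ (a i - b) / of_nat (fact (a i - b))))"
    unfolding ee_prod frob using a by (intro prod.cong refl divided_binomial) (auto simp: Box_def)
  also have "\<dots> = (\<Sum>b\<in>below a. \<Prod>i<s. ((x ^ p ^ i) ^ b i / of_nat (fact (b i))) *
      ((y ^ p ^ i) ^ (a i - b i) / of_nat (fact (a i - b i))))"
    using a by (intro prod_sum_below) (simp add: Box_def)
  finally show ?thesis unfolding ee_prod prod.distrib .
qed

lemma finite_below: "a \<in> Box \<Longrightarrow> finite (below a)"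
  by (rule finite_subset[OF _ finite_Box]) (auto simp: below_def intro: Box_mono)

text \<open>Pairs whose sum leaves the box contribute nothing; the others are sorted by their sum.
  Together with \<open>ee_add\<close> this composes two substitutions.\<close>

lemma convolution:
  fixes G H g :: "(nat \<Rightarrow> nat) \<Rightarrow> 'k"
  assumes g: "\<And>c. c \<notin> Box \<Longrightarrow> g c = 0"
  shows "(\<Sum>a\<in>Box. \<Sum>b\<in>Box. G a * H b * g (\<lambda>i. a i + b i)) =
    (\<Sum>c\<in>Box. (\<Sum>a\<in>below c. G a * H (\<lambda>i. c i - a i)) * g c)"
proof -
  define P where "P = {x \<in> Box \<times> Box. (\<lambda>i. fst x i + snd x i) \<in> Box}"
  have "(\<Sum>a\<in>Box. \<Sum>b\<in>Box. G a * H b * g (\<lambda>i. a i + b i)) =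
      (\<Sum>x\<in>Box \<times> Box. G (fst x) * H (snd x) * g (\<lambda>i. fst x i + snd x i))"
    by (simp add: sum.cartesian_product case_prod_unfold)
  also have "\<dots> = (\<Sum>x\<in>P. G (fst x) * H (snd x) * g (\<lambda>i. fst x i + snd x i))"
    using finite_Box g by (intro sum.mono_neutral_right) (auto simp: P_def)
  also have "\<dots> = (\<Sum>x\<in>Sigma Box below. G (snd x) * H (\<lambda>i. fst x i - snd x i) * g (fst x))"
  proof (rule sum.reindex_bij_witness[of _ "\<lambda>x. (snd x, \<lambda>i. fst x i - snd x i)"
        "\<lambda>x. (\<lambda>i. fst x i + snd x i, fst x)"], goal_cases)
    case (3 x)
    then have "snd x i \<le> fst x i" for i by (auto simp: below_def)
    then show ?case by (simp add: prod_eq_iff)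
  next
    case (4 x)
    then obtain c a where x: "x = (c, a)" and c: "c \<in> Box" and a: "\<And>i. a i \<le> c i"
      by (auto simp: below_def)
    then have "(\<lambda>i. a i + (c i - a i)) = c" by (simp add: fun_eq_iff)
    moreover have "a \<in> Box" "(\<lambda>i. c i - a i) \<in> Box" using a by (auto intro: Box_mono[OF c])
    ultimately show ?case using c by (simp add: x P_def)
  qed (auto simp: P_def below_def)
  also have "\<dots> = (\<Sum>(c, a)\<in>Sigma Box below. G a * H (\<lambda>i. c i - a i) * g c)"
    by (simp add: case_prod_unfold)
  also have "\<dots> = (\<Sum>c\<in>Box. \<Sum>a\<in>below c. G a * H (\<lambda>i. c i - a i) * g c)"
    by (rule sum.Sigma[symmetric]) (use finite_Box finite_below in auto)
  also have "\<dots> = (\<Sum>c\<in>Box. (\<Sum>a\<in>below c. G a * H (\<lambda>i. c i - a i)) * g c)"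
    by (simp only: sum_distrib_right)
  finally show ?thesis .
qed

text \<open>The sum of the first \<open>l\<close> steps of factor \<open>i\<close>, in closed form
  because two consecutive steps add up to \<open>p\<close>. It is the drop in exponent accumulated
  by the differentials up to degree \<open>l\<close>.\<close>

definition cc :: "nat \<Rightarrow> nat \<Rightarrow> nat" where
  "cc i l = (l div 2) * p + (if odd l then md i + 1 else 0)"

definition cval :: "(nat \<Rightarrow> nat) \<Rightarrow> nat" where
  "cval j = (\<Sum>i<s. cc i (j i) * p ^ i)"

definition wt :: "(nat \<Rightarrow> nat) \<Rightarrow> (nat \<Rightarrow> nat) \<Rightarrow> int" where
  "wt j a = int (val md) - 2 * int (val a) - 2 * int (cval j)"

text \<open>The action of the matrix with rows \<open>(t, y)\<close> and \<open>(0, 1 / t)\<close>: substitution of \<open>x + y / t\<close> for \<open>x\<close>,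
  followed by the torus, under which \<open>(j, c)\<close> has weight \<open>wt j c\<close>.  The weight of the multidegree is
  what makes the differentials equivariant.\<close>

definition ka :: "'k \<Rightarrow> 'k \<Rightarrow> 'k coeffs \<Rightarrow> 'k coeffs" where
  "ka t y f = (\<lambda>(j, c). t powi wt j c * (\<Sum>b\<in>Box. ee b (y / t) * f (j, \<lambda>i. c i + b i)))"

lemma wt_add: "wt j (\<lambda>i. c i + b i) = wt j c - 2 * int (val b)"
  by (simp add: wt_def val_add)

lemma lin_ka: "lin (ka t y)"
  by (rule linI; rule ext; clarify)
    (simp_all add: ka_def sum.distrib distrib_left sum_distrib_left mult.left_commute)

lemma cc_Suc: "i < s \<Longrightarrow> cc i (Suc l) = cc i l + step i l"
  using md[of i] by (auto simp: cc_def step_def elim!: evenE oddE)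

lemma ka_dd:
  assumes i: "i < s"
  shows "dd i (ka t y f) = ka t y (dd i f)"
proof (rule ext, clarify)
  fix j a
  show "dd i (ka t y f) (j, a) = ka t y (dd i f) (j, a)"
  proof (cases "j i > 0")
    case True
    define j' where "j' = j(i := j i - 1)"
    define a' where "a' = a(i := a i + step i (j i - 1))"
    \<comment> \<open>What the differential adds to the exponents it takes from the multidegree, so
      both places carry the same torus weight.\<close>
    have "val a' + cval j' = val a + cval j"
    proof -
      have "val a' = (a i + step i (j i - 1)) * p ^ i + (\<Sum>l\<in>{..<s} - {i}. a l * p ^ l)"
        unfolding val_def a'_def using i by (subst sum.remove[of _ i]) auto
      moreover have "val a = a i * p ^ i + (\<Sum>l\<in>{..<s} - {i}. a l * p ^ l)"
        unfolding val_def using i by (subst sum.remove[of _ i]) auto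
      moreover have "cval j' = cc i (j i - 1) * p ^ i + (\<Sum>l\<in>{..<s} - {i}. cc l (j l) * p ^ l)"
        unfolding cval_def j'_def using i by (subst sum.remove[of _ i]) auto
      moreover have "cval j = cc i (j i) * p ^ i + (\<Sum>l\<in>{..<s} - {i}. cc l (j l) * p ^ l)"
        unfolding cval_def using i by (subst sum.remove[of _ i]) auto
      moreover have "cc i (j i) = cc i (j i - 1) + step i (j i - 1)"
        using cc_Suc[OF i, of "j i - 1"] True by simp
      ultimately show ?thesis by (simp add: algebra_simps)
    qed
    then have wt: "wt j' a' = wt j a" by (simp add: wt_def)
    have dd: "dd i f (j, \<lambda>l. a l + b l) = sg i j * f (j', \<lambda>l. a' l + b l)" for b
    proof -
      have "(\<lambda>l. a l + b l)(i := (\<lambda>l. a l + b l) i + step i (j i - 1)) = (\<lambda>l. a' l + b l)"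
        by (auto simp: a'_def)
      then show ?thesis by (simp only: dd_def prod.case True if_True j'_def)
    qed
    have "dd i (ka t y f) (j, a) = sg i j * ka t y f (j', a')"
      using True by (simp add: dd_def j'_def a'_def)
    also have "\<dots> = sg i j * (t powi wt j a * (\<Sum>b\<in>Box. ee b (y / t) * f (j', \<lambda>l. a' l + b l)))"
      by (simp add: ka_def wt)
    also have "\<dots> = t powi wt j a * (\<Sum>b\<in>Box. ee b (y / t) * dd i f (j, \<lambda>l. a l + b l))"
      unfolding dd by (simp only: sum_distrib_left mult.left_commute)
    finally show ?thesis by (simp add: ka_def)
  qed (simp add: ka_def dd_def)
qed

lemma ka_DD: "k \<le> s \<Longrightarrow> DD k (ka t y f) = ka t y (DD k f)"
proof (induction k)
  case 0
  have "DD 0 (ka t y f) = ka t y (DD 0 f)" unfolding DD_0 by (rule lin_0[OF lin_ka, symmetric])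
  then show ?case .
next
  case (Suc k)
  have IH: "DD k (ka t y f) = ka t y (DD k f)" by (rule Suc.IH) (use Suc.prems in simp)
  have "DD (Suc k) (ka t y f) = ka t y (DD (Suc k) f)"
    unfolding DD_Suc lin_add[OF lin_ka] IH using Suc.prems by (simp add: ka_dd)
  then show ?case .
qed

lemma ka_kos_d: "kos_d n (ka t y f) = ka t y (kos_d n f)"
  by (simp add: kos_d_def ka_DD)

lemma kos_Box: "f \<in> fsupp (kos_X n) \<Longrightarrow> c \<notin> Box \<Longrightarrow> f (j, c) = 0"
  by (cases n) (auto simp: fsupp_def Low_def)

lemma ka_in:
  assumes f: "f \<in> fsupp (kos_X n)"
  shows "ka t y f \<in> fsupp (kos_X n)"
proof (rule fsuppI)
  fix j c assume "ka t y f (j, c) \<noteq> 0"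
  then have "(\<Sum>b\<in>Box. ee b (y / t) * f (j, \<lambda>i. c i + b i)) \<noteq> 0" by (auto simp: ka_def)
  then obtain b where "f (j, \<lambda>i. c i + b i) \<noteq> 0" by (metis (no_types, lifting) mult_zero_right sum.neutral)
  from fsuppD[OF f this] have in_X: "(j, \<lambda>i. c i + b i) \<in> kos_X n" .
  have Box: "c \<in> Box" if "(\<lambda>i. c i + b i) \<in> Box" by (rule Box_mono[OF that]) simp
  show "(j, c) \<in> kos_X n"
  proof (cases n)
    case 0
    then show ?thesis using in_X Box by (auto simp: Low_def dest: add_leD1)
  qed (use in_X Box in auto)
qed

lemma ka_one:
  assumes f: "f \<in> fsupp (kos_X n)"
  shows "ka 1 0 f = f"
proof (rule ext, clarify)
  fix j c
  have "(\<Sum>b\<in>Box. ee b 0 * f (j, \<lambda>i. c i + b i)) =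
    (\<Sum>b\<in>Box. if b = (\<lambda>_. 0) then f (j, c) else 0)"
    by (intro sum.cong refl) (simp add: ee_at_0)
  then show "ka 1 0 f (j, c) = f (j, c)"
    using zero_Box finite_Box by (simp add: ka_def)
qed

lemma powi_mult_self: "(t :: 'k) powi (a - b) = t powi a * t powi (- b)" if "t \<noteq> 0"
  using that by (simp add: power_int_diff power_int_minus divide_inverse)

lemma powi_minus_2val: "(t :: 'k) powi (- (2 * int n)) = (inverse t ^ 2) ^ n"
proof -
  have "t powi (2 * int n) = t ^ (2 * n)"
    using power_int_of_nat[of t "2 * n"] by simp
  then show ?thesis by (simp only: power_int_minus power_mult power_inverse)
qed

lemma powi_wt_add:
  fixes t :: 'k
  assumes "t \<noteq> 0"
  shows "t powi wt j (\<lambda>i. c i + b i) = t powi wt j c * (inverse t ^ 2) ^ val b"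
  by (simp only: wt_add powi_mult_self[OF assms] powi_minus_2val)

lemma ka_mult:
  assumes t: "t \<noteq> 0" "t' \<noteq> 0" and f: "f \<in> fsupp (kos_X n)"
  shows "ka t y (ka t' y' f) = ka (t * t') (t * y' + y / t') f"
proof (rule ext, clarify)
  fix j c
  \<comment> \<open>Moving the outer substitution past the inner torus element rescales its
    parameter by the inverse square of \<open>t'\<close>.\<close>
  define z where "z = inverse t' ^ 2 * (y / t)"
  have "ka t' y' f (j, \<lambda>i. c i + b i) = t' powi wt j c * ((inverse t' ^ 2) ^ val b *
      (\<Sum>b'\<in>Box. ee b' (y' / t') * f (j, \<lambda>i. c i + b i + b' i)))" for b
    by (simp only: ka_def prod.case powi_wt_add[OF t(2)] mult.assoc)
  then have "ka t y (ka t' y' f) (j, c) = t powi wt j c * t' powi wt j c *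
      (\<Sum>b\<in>Box. (inverse t' ^ 2) ^ val b * ee b (y / t) *
        (\<Sum>b'\<in>Box. ee b' (y' / t') * f (j, \<lambda>i. c i + b i + b' i)))"
    by (simp add: ka_def[of t] sum_distrib_left mult_ac)
  also have "\<dots> = t powi wt j c * t' powi wt j c *
      (\<Sum>b\<in>Box. \<Sum>b'\<in>Box. ee b z * ee b' (y' / t') * f (j, \<lambda>i. c i + (b i + b' i)))"
    unfolding z_def ee_scale by (simp only: sum_distrib_left mult_ac add.assoc)
  also have "(\<Sum>b\<in>Box. \<Sum>b'\<in>Box. ee b z * ee b' (y' / t') * f (j, \<lambda>i. c i + (b i + b' i))) =
      (\<Sum>a\<in>Box. (\<Sum>b\<in>below a. ee b z * ee (\<lambda>i. a i - b i) (y' / t')) * f (j, \<lambda>i. c i + a i))"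
  proof (rule convolution[where g = "\<lambda>a. f (j, \<lambda>i. c i + a i)"])
    fix a assume "a \<notin> Box"
    then have "(\<lambda>i. c i + a i) \<notin> Box" using Box_mono[of "\<lambda>i. c i + a i" a] by auto
    then show "f (j, \<lambda>i. c i + a i) = 0" by (rule kos_Box[OF f])
  qed
  also have "\<dots> = (\<Sum>a\<in>Box. ee a (z + y' / t') * f (j, \<lambda>i. c i + a i))"
    by (intro sum.cong refl) (simp add: ee_add)
  also have "z + y' / t' = (t * y' + y / t') / (t * t')"
    using t by (simp add: z_def field_simps power2_eq_square)
  finally show "ka t y (ka t' y' f) (j, c) = ka (t * t') (t * y' + y / t') f (j, c)"
    by (simp add: ka_def power_int_mult_distrib)
qed

section \<open>Relative injectivity through the indicator function of zero\<close>

lemma choose_p_minus_1: "a < p \<Longrightarrow> of_nat (p - 1 choose a) = (- 1 :: 'k) ^ a"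
proof (induction a)
  case (Suc a)
  have "p choose Suc a = (p - 1 choose a) + (p - 1 choose Suc a)"
    using p_pos by (cases p) simp_all
  moreover have "of_nat (p choose Suc a) = (0 :: 'k)"
    using dvd_choose_prime[of "Suc a" p] Suc.prems p CHAR by (simp add: of_nat_eq_0_iff_char_dvd)
  ultimately have "of_nat (p - 1 choose a) + of_nat (p - 1 choose Suc a) = (0 :: 'k)"
    by (metis of_nat_add)
  then show ?case using Suc by (simp add: add_eq_0_iff)
qed simp

text \<open>Digit by digit this is \<open>choose_p_minus_1\<close>; the signs combine to
  \<open>(- 1) ^ val a\<close> because the powers of \<open>p\<close> are odd.\<close>

lemma ifact_top_diff:
  assumes a: "a \<in> Box"
  shows "ifact a * ifact (\<lambda>i. full i - a i) * of_nat (fact (p - 1)) ^ s = (- 1) ^ val a"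
proof -
  have "(1 / of_nat (fact (a i))) * (1 / of_nat (fact (full i - a i))) * of_nat (fact (p - 1)) =
      ((- 1) ^ a i :: 'k)" if i: "i < s" for i
  proof -
    have ai: "a i < p" using a i by (simp add: Box_def)
    have "of_nat (fact (a i)) * of_nat (fact (p - 1 - a i)) * of_nat (p - 1 choose a i) =
        (of_nat (fact (p - 1)) :: 'k)"
    proof -
      have "fact (a i) * fact (p - 1 - a i) * (p - 1 choose a i) = (fact (p - 1) :: nat)"
        by (rule binomial_fact_lemma) (use ai in simp)
      then show ?thesis by (metis of_nat_mult)
    qed
    then show ?thesis
      using fact_ne_0[OF ai] fact_ne_0[of "p - 1 - a i"] i p_pos choose_p_minus_1[OF ai]
      by (simp add: full_def field_simps del: of_nat_fact)
  qed
  then have "(\<Prod>i<s. (1 / of_nat (fact (a i))) * (1 / of_nat (fact (full i - a i))) * of_nat (fact (p - 1))) =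
      (\<Prod>i<s. (- 1) ^ a i :: 'k)"
    by (intro prod.cong) auto
  also have "\<dots> = (- 1) ^ val a"
  proof -
    have "(- 1 :: 'k) ^ (a i * p ^ i) = (- 1) ^ a i" for i
      using odd_p by (simp add: power_mult mult.commute[of "a i"])
    then show ?thesis by (simp add: val_def power_sum)
  qed
  finally show ?thesis by (simp only: ifact_def prod.distrib prod_constant card_lessThan)
qed

text \<open>\<open>ee full y\<close> is \<open>y ^ (q - 1)\<close> divided by
  \<open>fact (p - 1) ^ s\<close>, so this is the coefficient of \<open>- y ^ (q - 1)\<close> in
  terms of divided powers.\<close>

definition w0 :: 'k where "w0 = - (of_nat (fact (p - 1)) ^ s)"

definition vv :: "(nat \<Rightarrow> nat) \<Rightarrow> 'k" where
  "vv c = (if c = (\<lambda>_. 0) then 1 else if c = full then w0 else 0)"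

text \<open>\<open>vv\<close> holds the coefficients of \<open>1 - x\<^sup>q\<^sup>-\<^sup>1\<close>, the indicator function of \<open>0\<close> on the field
  of order \<open>q\<close>.\<close>

definition kth :: "'k coeffs \<Rightarrow> 'k coeffs" where
  "kth f = (\<lambda>(j, c). - (f (j, \<lambda>_. 0) * vv c))"

lemma lin_kth: "lin kth"
  by (rule linI; rule ext; clarify) (simp_all add: kth_def algebra_simps)

lemma kth_in: "f \<in> fsupp (kos_X (Suc n)) \<Longrightarrow> kth f \<in> fsupp (kos_X (Suc n))"
proof (rule fsuppI)
  fix j c assume f: "f \<in> fsupp (kos_X (Suc n))" and nz: "kth f (j, c) \<noteq> 0"
  then have "f (j, \<lambda>_. 0) \<noteq> 0" "vv c \<noteq> 0" by (auto simp: kth_def)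
  then show "(j, c) \<in> kos_X (Suc n)"
    using fsuppD[OF f] zero_Box top_Box by (auto simp: vv_def split: if_splits)
qed

lemma sum_ee_vv:
  assumes c: "c \<in> Box"
  shows "(\<Sum>b\<in>Box. ee b y * vv (\<lambda>i. c i + b i)) =
    (if c = (\<lambda>_. 0) then 1 else 0) + w0 * ee (\<lambda>i. full i - c i) y"
proof -
  have "vv (\<lambda>i. c i + b i) = (if b = (\<lambda>_. 0) then if c = (\<lambda>_. 0) then 1 else 0 else 0) +
    (if b = (\<lambda>i. full i - c i) then w0 else 0)" for b
  proof -
    have "(\<lambda>i. c i + b i) = full \<longleftrightarrow> b = (\<lambda>i. full i - c i)"
      unfolding fun_eq_iff
    proof (rule all_cong1)
      show "c x + b x = full x \<longleftrightarrow> b x = full x - c x" for x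
        using BoxD[OF c, of x] by linarith
    qed
    moreover have "(\<lambda>i. c i + b i) = (\<lambda>_. 0) \<longleftrightarrow> c = (\<lambda>_. 0) \<and> b = (\<lambda>_. 0)"
      by (auto simp: fun_eq_iff)
    ultimately show ?thesis using top_ne_0 by (auto simp: vv_def)
  qed
  then have "(\<Sum>b\<in>Box. ee b y * vv (\<lambda>i. c i + b i)) =
    (\<Sum>b\<in>Box. if b = (\<lambda>_. 0) then ee b y * (if c = (\<lambda>_. 0) then 1 else 0) else 0) +
    (\<Sum>b\<in>Box. if b = (\<lambda>i. full i - c i) then ee b y * w0 else 0)"
    by (simp add: distrib_left sum.distrib if_distrib[of "(*) _"] cong: if_cong)
  then show ?thesis
    using finite_Box zero_Box top_diff[OF c] by (simp add: ee_0 mult.commute)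
qed

lemma sum_F_ee_ee:
  "(\<Sum>y\<in>F. ee a (- y) * ee b y) = (- 1) ^ val a * ifact a * ifact b *
    (if val a + val b > 0 \<and> (q - 1) dvd (val a + val b) then - 1 else 0)"
proof -
  have "(\<Sum>y\<in>F. ee a (- y) * ee b y) = (\<Sum>y\<in>F. (- 1) ^ val a * ifact a * ifact b * y ^ (val a + val b))"
    by (intro sum.cong refl) (simp add: ee_minus ee_def[of a] ee_def[of b] power_add mult_ac)
  then show ?thesis by (simp only: sum_distrib_left[symmetric] sum_F_powers)
qed

lemma multiples_q1:
  assumes "u \<le> q - 1" "v \<le> q - 1"
  shows "u + v > 0 \<and> (q - 1) dvd (u + v) \<longleftrightarrow> u + v = q - 1 \<or> (u = q - 1 \<and> v = q - 1)"
proof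
  assume *: "u + v > 0 \<and> (q - 1) dvd (u + v)"
  then obtain k where k: "u + v = (q - 1) * k" by blast
  have "k < 3"
  proof (rule ccontr)
    assume "\<not> k < 3"
    then have "(q - 1) * 3 \<le> u + v" by (simp add: k)
    then show False using assms q_ge_3 by linarith
  qed
  moreover have "k \<noteq> 0" using k * by auto
  ultimately consider "k = 1" | "k = 2" by linarith
  then show "u + v = q - 1 \<or> (u = q - 1 \<and> v = q - 1)"
  proof cases
    case 2
    then show ?thesis using k assms by simp
  qed (use k in simp)
next
  assume "u + v = q - 1 \<or> (u = q - 1 \<and> v = q - 1)"
  then consider "u + v = q - 1" | "u + v = (q - 1) * 2" by linarith
  then show "u + v > 0 \<and> (q - 1) dvd (u + v)"
    using q_ge_3 by cases simp_all
qed

text \<open>Translating the indicator of zero by \<open>y\<close> gives the indicator of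
  \<open>- y\<close>; weighted with the values \<open>ee a (- y)\<close>, these add up to the
  function \<open>ee a\<close>. The identity compares coefficients.\<close>

lemma orthogonality:
  assumes a: "a \<in> Box" and c: "c \<in> Box"
  shows "(\<Sum>y\<in>F. ee a (- y) * (\<Sum>b\<in>Box. ee b y * vv (\<lambda>i. c i + b i))) = (if a = c then 1 else 0)"
proof -
  define N :: 'k where "N = of_nat (fact (p - 1)) ^ s"
  have N: "N \<noteq> 0" unfolding N_def using fact_ne_0[of "p - 1"] p_pos by (simp del: of_nat_fact)
  have zero: "(\<Sum>y\<in>F. ee a (- y)) = (if a = full then - ((- 1) ^ val a * ifact a) else 0)"
  proof -
    have "(\<Sum>y\<in>F. ee a (- y) * ee (\<lambda>_. 0) y) = (\<Sum>y\<in>F. ee a (- y))" by (simp add: ee_0)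
    moreover have "ifact (\<lambda>_. 0) = 1" by (simp add: ifact_def)
    moreover have "val a + val (\<lambda>_. 0) > 0 \<and> (q - 1) dvd (val a + val (\<lambda>_. 0)) \<longleftrightarrow> a = full"
      using multiples_q1[OF val_le[OF a], of 0] val_inj[OF a top_Box] q_ge_3
      by (auto simp: val_0 val_top)
    ultimately show ?thesis using sum_F_ee_ee[of a "\<lambda>_. 0"]
      by (cases "a = full") (auto simp: val_0)
  qed
  have main: "(\<Sum>y\<in>F. ee a (- y) * ee (\<lambda>i. full i - c i) y) =
    (if a = c \<or> (a = full \<and> c = (\<lambda>_. 0)) then - ((- 1) ^ val a * ifact a * ifact (\<lambda>i. full i - c i)) else 0)"
  proof -
    have "val a + val (\<lambda>i. full i - c i) > 0 \<and> (q - 1) dvd (val a + val (\<lambda>i. full i - c i)) \<longleftrightarrow>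
      a = c \<or> (a = full \<and> c = (\<lambda>_. 0))"
    proof -
      have "val a + (q - 1 - val c) = q - 1 \<longleftrightarrow> val a = val c"
        "q - 1 - val c = q - 1 \<longleftrightarrow> val c = 0"
        using val_le[OF a] val_le[OF c] q_ge_3 by linarith+
      then show ?thesis
        unfolding multiples_q1[OF val_le[OF a] val_le[OF top_diff[OF c]]]
        unfolding val_top_diff[OF c]
        using val_inj[OF a c] val_inj[OF a top_Box] val_inj[OF c zero_Box] by (simp add: val_0 val_top)
    qed
    then show ?thesis unfolding sum_F_ee_ee by (simp split: if_split)
  qed
  have "ee a (- y) * (\<Sum>b\<in>Box. ee b y * vv (\<lambda>i. c i + b i)) =
      (if c = (\<lambda>_. 0) then ee a (- y) else 0) - N * (ee a (- y) * ee (\<lambda>i. full i - c i) y)" for y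
    unfolding sum_ee_vv[OF c] w0_def N_def by (simp add: algebra_simps)
  then have "(\<Sum>y\<in>F. ee a (- y) * (\<Sum>b\<in>Box. ee b y * vv (\<lambda>i. c i + b i))) =
    (if c = (\<lambda>_. 0) then (\<Sum>y\<in>F. ee a (- y)) else 0) -
    N * (\<Sum>y\<in>F. ee a (- y) * ee (\<lambda>i. full i - c i) y)"
    by (simp add: sum_subtractf sum_distrib_left)
  also have "\<dots> = (if a = c then 1 else 0)"
  proof (cases "a = c")
    case True
    have "N * ((- 1) ^ val a * ifact a * ifact (\<lambda>i. full i - a i)) =
        (- 1) ^ val a * (ifact a * ifact (\<lambda>i. full i - a i) * N)"
      by (simp only: mult_ac)
    also have "\<dots> = (- 1) ^ val a * (- 1) ^ val a"
      using ifact_top_diff[OF a] by (simp only: N_def)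
    also have "\<dots> = 1" by (simp flip: power_add mult_2)
    finally have "N * ((- 1) ^ val a * ifact a * ifact (\<lambda>i. full i - a i)) = 1" .
    then show ?thesis using True top_ne_0 zero main by auto
  next
    case False
    show ?thesis
    \<comment> \<open>The exponents \<open>0\<close> and \<open>q - 1\<close> agree on units, so
      this off-diagonal pair receives a contribution from each of the two terms of
      \<open>vv\<close>, and they cancel.\<close>
    proof (cases "a = full \<and> c = (\<lambda>_. 0)")
      case True
      have "(- 1 :: 'k) ^ val full = 1"
        using odd_p by (simp add: val_top q_def)
      then have "ifact full * ifact (\<lambda>i. 0) * N = 1"
        using ifact_top_diff[OF top_Box] by (simp add: N_def)
      then have "N * ifact full = 1" by (simp add: ifact_def[of "\<lambda>_. 0"] mult.commute)
      then show ?thesis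
        using True False zero main \<open>(- 1 :: 'k) ^ val full = 1\<close>
        by (simp add: mult.assoc[symmetric])
    qed (use False zero main in auto)
  qed
  finally show ?thesis .
qed

text \<open>After substituting \<open>t * y\<close> for \<open>y\<close>, the inner sums are
  independent of \<open>t\<close> and \<open>orthogonality\<close> isolates one coefficient; the
  torus weights on the way in and out cancel, which is the fact \<open>u\<close>.\<close>

lemma ka_kth:
  assumes t: "t \<in> units" and c: "c \<in> Box" and f: "f \<in> fsupp (kos_X (Suc n))"
  shows "(\<Sum>y\<in>F. ka t y (kth (ka (inverse t) (- y) f)) (j, c)) = - f (j, c)"
proof -
  have t0: "t \<noteq> 0" and tF: "t \<in> F" using t by (auto simp: units_def)
  define V where "V y = (\<Sum>b\<in>Box. ee b y * vv (\<lambda>i. c i + b i))" for y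
  define S where "S b = (\<Sum>y\<in>F. ee b (- y) * V y)" for b
  define u where "u = t powi wt j c * inverse t powi wt j (\<lambda>_. 0)"
  have u: "u * (t ^ 2) ^ val c = 1"
  proof -
    have "wt j c = wt j (\<lambda>_. 0) - 2 * int (val c)" using wt_add[of j "\<lambda>_. 0" c] by simp
    then have "u = (inverse t ^ 2) ^ val c"
      using t0 by (simp add: u_def powi_mult_self powi_minus_2val power_int_inverse)
    then show ?thesis using t0 by (simp flip: power_mult_distrib)
  qed
  have 1: "ka (inverse t) (- (t * y)) f (j, \<lambda>_. 0) = inverse t powi wt j (\<lambda>_. 0) *
      (\<Sum>b\<in>Box. (t ^ 2) ^ val b * ee b (- y) * f (j, b))" for y
  proof -
    have "- (t * y) / inverse t = t ^ 2 * - y"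
      using t0 by (simp add: power2_eq_square divide_inverse)
    then show ?thesis unfolding ka_def by (simp only: prod.case ee_scale add_0)
  qed
  have 2: "ka t (t * y) (kth g) (j, c) = - (t powi wt j c * g (j, \<lambda>_. 0) * V y)" for y g
    using t0 by (simp add: ka_def kth_def V_def sum_distrib_left mult_ac sum_negf)
  have "ka t (t * y) (kth (ka (inverse t) (- (t * y)) f)) (j, c) =
      - u * (\<Sum>b\<in>Box. (t ^ 2) ^ val b * f (j, b) * (ee b (- y) * V y))" for y
  proof -
    have "ka t (t * y) (kth (ka (inverse t) (- (t * y)) f)) (j, c) =
        - u * ((\<Sum>b\<in>Box. (t ^ 2) ^ val b * ee b (- y) * f (j, b)) * V y)"
      unfolding 2 1 u_def by simp
    also have "(\<Sum>b\<in>Box. (t ^ 2) ^ val b * ee b (- y) * f (j, b)) * V y =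
        (\<Sum>b\<in>Box. (t ^ 2) ^ val b * f (j, b) * (ee b (- y) * V y))"
      unfolding sum_distrib_right by (simp only: mult_ac)
    finally show ?thesis .
  qed
  then have "(\<Sum>y\<in>F. ka t (t * y) (kth (ka (inverse t) (- (t * y)) f)) (j, c)) =
      - u * (\<Sum>b\<in>Box. (t ^ 2) ^ val b * f (j, b) * S b)"
    unfolding S_def by (simp only: sum_distrib_left[symmetric] sum.swap[of _ Box F])
  also have "(\<Sum>b\<in>Box. (t ^ 2) ^ val b * f (j, b) * S b) =
      (\<Sum>b\<in>Box. if b = c then (t ^ 2) ^ val c * f (j, c) else 0)"
    unfolding S_def V_def using c by (intro sum.cong refl) (simp add: orthogonality)
  also have "- u * \<dots> = - f (j, c)"
    using u c finite_Box by (simp add: mult.assoc[symmetric])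
  finally have "(\<Sum>y\<in>F. ka t (t * y) (kth (ka (inverse t) (- (t * y)) f)) (j, c)) = - f (j, c)" .
  moreover have "(\<Sum>y\<in>F. ka t y (kth (ka (inverse t) (- y) f)) (j, c)) =
      (\<Sum>y\<in>F. ka t (t * y) (kth (ka (inverse t) (- (t * y)) f)) (j, c))"
    by (rule sum.reindex_bij_witness[of _ "\<lambda>y. t * y" "\<lambda>y. y / t"])
      (use t0 tF in \<open>auto simp: F_mult F_divide\<close>)
  ultimately show ?thesis by simp
qed

text \<open>Each \<open>t\<close> contributes \<open>- f\<close>, and there are \<open>q - 1\<close>
  of them, which is \<open>-1\<close> in the field; the sign in \<open>kth\<close> is there for
  this.\<close>

lemma kth_sum:
  assumes f: "f \<in> fsupp (kos_X (Suc n))"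
  shows "(\<Sum>t\<in>units. \<Sum>y\<in>F. ka t y (kth (ka (inverse t) (- y) f))) = f"
proof (rule ext, clarify)
  fix j c
  define g where "g = (\<Sum>t\<in>units. \<Sum>y\<in>F. ka t y (kth (ka (inverse t) (- y) f)))"
  have g: "g \<in> fsupp (kos_X (Suc n))"
    unfolding g_def by (intro fsupp_sum ka_in kth_in f)
  show "(\<Sum>t\<in>units. \<Sum>y\<in>F. ka t y (kth (ka (inverse t) (- y) f))) (j, c) = f (j, c)"
  proof (cases "c \<in> Box")
    case True
    have "g (j, c) = (\<Sum>t\<in>units. - f (j, c))"
      unfolding g_def sum_fun_apply by (intro sum.cong refl ka_kth[OF _ True f])
    then show ?thesis using of_nat_card_units by (simp add: g_def)
  next
    case False
    then show ?thesis using kos_Box[OF f False] kos_Box[OF g False] by (simp add: g_def)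
  qed
qed

text \<open>Invariance, read at exponent zero, makes the polynomial with coefficients
  \<open>f (j, a)\<close> in divided powers constant on the field. Its degree is at most
  \<open>q - 1\<close>, so power sums extract the coefficients.\<close>

lemma unipotent_invariant:
  assumes f: "f \<in> fsupp (kos_X (Suc n))" and inv: "\<And>y. y \<in> F \<Longrightarrow> ka 1 y f = f"
    and b: "b \<noteq> (\<lambda>_. 0)"
  shows "f (j, b) = 0"
proof (cases "b \<in> Box")
  case True
  \<comment> \<open>Pairing with \<open>y ^ e\<close> picks out the exponent \<open>val b\<close>:
    the other positive multiple of \<open>q - 1\<close> in reach would need
    \<open>e = q - 1\<close>, which a nonzero \<open>b\<close> excludes.\<close>
  define e where "e = q - 1 - val b"
  have val_b: "0 < val b" "val b \<le> q - 1"
    using val_inj[OF True zero_Box] b val_le[OF True] by (auto simp: val_0)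
  have "(\<Sum>a\<in>Box. ee a y * f (j, a)) = f (j, \<lambda>_. 0)" if "y \<in> F" for y
    using fun_cong[OF inv[OF that], of "(j, \<lambda>_. 0)"] by (simp add: ka_def)
  then have "(\<Sum>y\<in>F. y ^ e * (\<Sum>a\<in>Box. ee a y * f (j, a))) = (\<Sum>y\<in>F. y ^ e * f (j, \<lambda>_. 0))"
    by (intro sum.cong) auto
  also have "\<dots> = 0"
  proof -
    have "\<not> (e > 0 \<and> (q - 1) dvd e)" using val_b q_ge_3 by (auto simp: e_def dest: dvd_imp_le)
    then show ?thesis by (auto simp: sum_distrib_right[symmetric] sum_F_powers)
  qed
  finally have "0 = (\<Sum>y\<in>F. \<Sum>a\<in>Box. ifact a * f (j, a) * y ^ (val a + e))"
    by (simp add: sum_distrib_left ee_def power_add mult_ac)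
  also have "\<dots> = (\<Sum>a\<in>Box. ifact a * f (j, a) * (\<Sum>y\<in>F. y ^ (val a + e)))"
    by (subst sum.swap) (simp add: sum_distrib_left)
  also have "\<dots> = (\<Sum>a\<in>Box. if a = b then - (ifact b * f (j, b)) else 0)"
  proof (intro sum.cong refl)
    fix a assume a: "a \<in> Box"
    have "val a + e > 0 \<and> (q - 1) dvd (val a + e) \<longleftrightarrow> a = b"
      using multiples_q1[OF val_le[OF a], of e] val_inj[OF a True] val_b val_le[OF a] q_ge_3
      by (auto simp: e_def)
    then show "ifact a * f (j, a) * (\<Sum>y\<in>F. y ^ (val a + e)) = (if a = b then - (ifact b * f (j, b)) else 0)"
      by (simp add: sum_F_powers)
  qed
  finally show ?thesis using True finite_Box ifact_ne_0[OF True] by simp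
qed (use kos_Box[OF f] in simp)

text \<open>A differential reads coefficients at exponents raised by a step, hence at nonzero
  exponents, where invariants vanish. The step is zero only in a full factor at positive
  multidegree, where \<open>f\<close> vanishes anyway.\<close>

lemma kos_minimal:
  assumes f: "f \<in> fsupp (kos_X (Suc n))" and inv: "\<And>y. y \<in> F \<Longrightarrow> ka 1 y f = f"
  shows "kos_d (Suc n) f = 0"
proof -
  have dd_0: "dd i f = 0" if i: "i < s" for i
  proof (rule ext, clarify)
    fix j a
    have "f (j(i := j i - 1), a(i := a i + step i (j i - 1))) = 0" if ji: "j i > 0"
    proof (cases "step i (j i - 1) = 0")
      case True
      then have "odd (j i - 1)" "md i = p - 1"
        using md[OF i] by (auto simp: step_def split: if_splits)
      then show ?thesis
        using WD(2)[OF fsupp_kos_W[OF f] i, of "j(i := j i - 1)"] by (auto elim: oddE)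
    next
      case False
      then have "(a(i := a i + step i (j i - 1))) i \<noteq> 0" by simp
      then have nz: "a(i := a i + step i (j i - 1)) \<noteq> (\<lambda>_. 0)" by metis
      show ?thesis by (rule unipotent_invariant[OF f _ nz]) (rule inv)
    qed
    then show "dd i f (j, a) = 0 (j, a)" by (simp add: dd_def)
  qed
  have "DD k f = 0" if "k \<le> s" for k
    using that
  proof (induction k)
    case 0
    show ?case by (rule DD_0)
  next
    case (Suc k)
    have IH: "DD k f = 0" by (rule Suc.IH) (use Suc.prems in simp)
    have "DD (Suc k) f = 0" unfolding DD_Suc IH using dd_0[of k] Suc.prems by simp
    then show ?case .
  qed
  then show ?thesis by (simp add: kos_d_def)
qed

text \<open>The multidegrees of the generators that are fixed by the torus.\<close>

definition Sol :: "nat \<Rightarrow> (nat \<Rightarrow> nat) set" where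
  "Sol n = {j \<in> J n. int (q - 1) dvd wt j (\<lambda>_. 0)}"

lemma kos_invariant:
  assumes f: "f \<in> fsupp (kos_X (Suc n))" and inv: "\<And>t y. t \<in> units \<Longrightarrow> y \<in> F \<Longrightarrow> ka t y f = f"
    and nz: "f (j, a) \<noteq> 0"
  shows "a = (\<lambda>_. 0) \<and> j \<in> Sol n"
proof -
  have "1 \<in> units" using F_1 by (simp add: units_def)
  then have a: "a = (\<lambda>_. 0)" using unipotent_invariant[OF f inv, of a j] nz by blast
  have "t powi wt j (\<lambda>_. 0) = 1" if t: "t \<in> units" for t
  proof -
    have "t powi wt j (\<lambda>_. 0) * (\<Sum>b\<in>Box. ee b 0 * f (j, b)) = f (j, \<lambda>_. 0)"
      using fun_cong[OF inv[OF t F_0], of "(j, \<lambda>_. 0)"] by (simp add: ka_def)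
    moreover have "(\<Sum>b\<in>Box. ee b 0 * f (j, b)) = (\<Sum>b\<in>Box. if b = (\<lambda>_. 0) then f (j, \<lambda>_. 0) else 0)"
      by (intro sum.cong refl) (simp add: ee_at_0)
    ultimately have "t powi wt j (\<lambda>_. 0) * f (j, \<lambda>_. 0) = f (j, \<lambda>_. 0)"
      using finite_Box zero_Box by simp
    then show ?thesis using nz a by simp
  qed
  then show ?thesis using unit_powi_eq_1_iff fsuppD[OF f nz] a by (auto simp: Sol_def)
qed

lemma Sol_invariant:
  assumes j: "j \<in> Sol n" and t: "t \<in> units"
  defines "e \<equiv> \<lambda>x. if x = (j, \<lambda>_. 0) then 1 else 0 :: 'k"
  shows "ka t y e = e"
proof -
  show "ka t y e = e"
  proof (rule ext, clarify)
    fix j' c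
    have "(\<Sum>b\<in>Box. ee b (y / t) * e (j', \<lambda>i. c i + b i)) =
      (\<Sum>b\<in>Box. if b = (\<lambda>_. 0) then (if j' = j \<and> c = (\<lambda>_. 0) then 1 else 0) else 0)"
    proof (intro sum.cong refl)
      fix b
      have "(\<lambda>i. c i + b i) = (\<lambda>_. 0) \<longleftrightarrow> c = (\<lambda>_. 0) \<and> b = (\<lambda>_. 0)"
        by (auto simp: fun_eq_iff)
      then show "ee b (y / t) * e (j', \<lambda>i. c i + b i) =
          (if b = (\<lambda>_. 0) then (if j' = j \<and> c = (\<lambda>_. 0) then 1 else 0) else 0)"
        by (simp add: e_def ee_0)
    qed
    also have "\<dots> = (if j' = j \<and> c = (\<lambda>_. 0) then 1 else 0)"
      using finite_Box zero_Box by simp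
    finally show "ka t y e (j', c) = e (j', c)"
      using j t unit_powi_eq_1_iff by (auto simp: ka_def e_def Sol_def)
  qed
qed

text \<open>Stated for a group with coordinates \<open>(t, u)\<close> that multiply like upper
  triangular matrices of determinant one, which keeps matrices out of the construction.\<close>

theorem kos_resolution:
  assumes H: "group H" and t: "bij_betw (\<lambda>h. (t h, u h)) (carrier H) (units \<times> F)"
    and one: "t \<one>\<^bsub>H\<^esub> = 1" "u \<one>\<^bsub>H\<^esub> = 0"
    and mult: "\<And>g h. g \<in> carrier H \<Longrightarrow> h \<in> carrier H \<Longrightarrow> t (g \<otimes>\<^bsub>H\<^esub> h) = t g * t h"
      "\<And>g h. g \<in> carrier H \<Longrightarrow> h \<in> carrier H \<Longrightarrow> u (g \<otimes>\<^bsub>H\<^esub> h) = t g * u h + u g / t h"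
    and inv: "\<And>g. g \<in> carrier H \<Longrightarrow> t (inv\<^bsub>H\<^esub> g) = inverse (t g)"
      "\<And>g. g \<in> carrier H \<Longrightarrow> u (inv\<^bsub>H\<^esub> g) = - u g"
  shows "equiv_resolution H kos_X kos_d kos_s (\<lambda>h. ka (t h) (u h)) kth"
proof (rule equiv_resolution.intro[OF H], rule equiv_resolution_axioms.intro)
  have t0: "t h \<noteq> 0" if "h \<in> carrier H" for h
    using bij_betwE[OF t] that by (auto simp: units_def)
  show "lin (kos_d n)" "lin (kos_s n)" "lin (ka (t h) (u h))" "lin kth" for n h
    by (rule lin_kos_d lin_kos_s lin_ka lin_kth)+
  show "kos_d n f \<in> fsupp (kos_X (Suc n))" "kos_d (Suc n) (kos_d n f) = 0"
    if "f \<in> fsupp (kos_X n)" for f n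
    using that by (rule kos_d_in kos_d_d)+
  show "kos_s n f \<in> fsupp (kos_X n)" "kth f \<in> fsupp (kos_X (Suc n))"
    "kos_d n (kos_s n f) + kos_s (Suc n) (kos_d (Suc n) f) = f"
    if "f \<in> fsupp (kos_X (Suc n))" for f n
    using that by (rule kos_s_in kth_in kos_contr)+
  show "kos_s 0 (kos_d 0 f) = f" if "f \<in> fsupp (kos_X 0)" for f
    using that by (rule kos_contr_0)
  show "ka (t h) (u h) f \<in> fsupp (kos_X n)" "kos_d n (ka (t h) (u h) f) = ka (t h) (u h) (kos_d n f)"
    if "f \<in> fsupp (kos_X n)" for h f n
    using ka_in[OF that] ka_kos_d by simp_all
  show "finite (carrier H)"
    using bij_betw_finite[OF t] finite_units finite_F by simp
  show "ka (t \<one>\<^bsub>H\<^esub>) (u \<one>\<^bsub>H\<^esub>) f = f" if "f \<in> fsupp (kos_X n)" for f n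
    using ka_one[OF that] by (simp add: one)
  show "ka (t (h \<otimes>\<^bsub>H\<^esub> h')) (u (h \<otimes>\<^bsub>H\<^esub> h')) f = ka (t h) (u h) (ka (t h') (u h') f)"
    if "h \<in> carrier H" "h' \<in> carrier H" "f \<in> fsupp (kos_X n)" for h h' f n
    using ka_mult[OF t0[OF that(1)] t0[OF that(2)] that(3)] that by (simp add: mult)
  show "(\<Sum>h\<in>carrier H. ka (t h) (u h) (kth (ka (t (inv\<^bsub>H\<^esub> h)) (u (inv\<^bsub>H\<^esub> h)) f))) = f"
    if f: "f \<in> fsupp (kos_X (Suc n))" for f n
  proof -
    have "(\<Sum>h\<in>carrier H. ka (t h) (u h) (kth (ka (t (inv\<^bsub>H\<^esub> h)) (u (inv\<^bsub>H\<^esub> h)) f))) =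
      (\<Sum>h\<in>carrier H. (\<lambda>(t, y). ka t y (kth (ka (inverse t) (- y) f))) (t h, u h))"
      by (intro sum.cong refl) (simp add: inv)
    also have "\<dots> = (\<Sum>(t, y)\<in>units \<times> F. ka t y (kth (ka (inverse t) (- y) f)))"
      by (rule sum.reindex_bij_betw[OF t])
    also have "\<dots> = f"
      using kth_sum[OF f] by (simp only: sum.cartesian_product)
    finally show ?thesis .
  qed
qed

end

section \<open>Simple modules\<close>

definition mat2 :: "'a \<Rightarrow> 'a \<Rightarrow> 'a \<Rightarrow> 'a \<Rightarrow> 'a mat" where
  "mat2 a b c e = mat 2 2 (\<lambda>(i, j). if i = 0 then (if j = 0 then a else b) else (if j = 0 then c else e))"

lemma mat2_index [simp]:
  "mat2 a b c e $$ (0, 0) = a" "mat2 a b c e $$ (0, Suc 0) = b"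
  "mat2 a b c e $$ (Suc 0, 0) = c" "mat2 a b c e $$ (Suc 0, Suc 0) = e"
  by (simp_all add: mat2_def)

lemma mat2_carrier [simp]: "mat2 a b c e \<in> carrier_mat 2 2"
  by (simp add: mat2_def)

lemma mat2_dim [simp]: "dim_row (mat2 a b c e) = 2" "dim_col (mat2 a b c e) = 2"
  by (simp_all add: mat2_def)

lemma less_2_cases': "(i::nat) < 2 \<longleftrightarrow> i = 0 \<or> i = Suc 0"
  by auto

lemma mat2_eta: "A \<in> carrier_mat 2 2 \<Longrightarrow> A = mat2 (A $$ (0, 0)) (A $$ (0, 1)) (A $$ (1, 0)) (A $$ (1, 1))"
  by (rule eq_matI) (auto simp: less_2_cases')

lemma mat2_eq_iff: "mat2 a b c e = mat2 a' b' c' e' \<longleftrightarrow> a = a' \<and> b = b' \<and> c = c' \<and> e = e'"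
  by (metis mat2_index)

lemma sum_below_2: "sum f {0..<2} = f 0 + f (Suc 0)" for f :: "nat \<Rightarrow> 'a::comm_monoid_add"
  by (simp add: numeral_2_eq_2)

lemma mat2_mult: "mat2 a b c e * mat2 a' b' c' e' =
    mat2 (a * a' + b * c') (a * b' + b * e') (c * a' + e * c') (c * b' + e * (e' :: 'a::comm_ring_1))"
  by (rule eq_matI) (auto simp: less_2_cases' scalar_prod_def sum_below_2)

lemma mat2_one: "1\<^sub>m 2 = mat2 1 0 0 (1 :: 'a::comm_ring_1)"
  by (rule eq_matI) (auto simp: less_2_cases')

lemma det_mat2: "det (mat2 a b c e) = a * e - b * (c :: 'a::comm_ring_1)"
proof -
  have "det (mat2 a b c e) = (\<Sum>i<2. mat2 a b c e $$ (i, 0) * cofactor (mat2 a b c e) i 0)"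
    by (rule laplace_expansion_column) auto
  also have "\<dots> = a * e - b * c"
    by (simp add: numeral_2_eq_2 cofactor_def det_single mat_delete_def)
  finally show ?thesis .
qed

lemma elements_mat2: "elements_mat (mat2 a b c e) = {a, b, c, e}"
proof
  show "elements_mat (mat2 a b c e) \<subseteq> {a, b, c, e}"
    by (auto simp: less_2_cases' dest!: elements_matD)
  show "{a, b, c, e} \<subseteq> elements_mat (mat2 a b c e)"
    using elements_matI[OF mat2_carrier, of 0 0 a a b c e] elements_matI[OF mat2_carrier, of 0 1 b a b c e]
      elements_matI[OF mat2_carrier, of 1 0 c a b c e] elements_matI[OF mat2_carrier, of 1 1 e a b c e]
    by simp
qed

lemma mat2_in_SL2: "mat2 a b c e \<in> carrier (SL2 K) \<longleftrightarrow> {a, b, c, e} \<subseteq> K \<and> a * e - b * c = 1"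
  by (simp add: SL2_def elements_mat2 det_mat2)

lemma SL2_cases:
  assumes "A \<in> carrier (SL2 K)"
  obtains a b c e where "A = mat2 a b c e" "a \<in> K" "b \<in> K" "c \<in> K" "e \<in> K" "a * e - b * c = 1"
proof -
  have A: "A \<in> carrier_mat 2 2" using assms by (simp add: SL2_def)
  from mat2_eta[OF A] show ?thesis
    using assms that by (metis insert_subset mat2_in_SL2)
qed

lemma torus_mat2: "torus t = mat2 t 0 0 (inverse t)"
  by (rule eq_matI) (auto simp: torus_def mat_of_rows_list_def less_2_cases')

text \<open>In a finite field, one plus the product of all linear factors is a nonconstant
  polynomial without roots.\<close>

lemma infinite_alg_closed_field: "infinite (UNIV :: 'k::alg_closed_field set)"
proof
  assume fin: "finite (UNIV :: 'k set)"
  define P :: "'k poly" where "P = (\<Prod>a\<in>UNIV. [:- a, 1:]) + 1"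
  have deg: "degree (\<Prod>a\<in>UNIV. [:- a, 1 :: 'k:]) = card (UNIV :: 'k set)"
    by (subst degree_prod_eq_sum_degree) auto
  have "card (UNIV :: 'k set) > 0" using fin by (simp add: card_gt_0_iff)
  then have "degree P > 0" unfolding P_def using deg by (subst degree_add_eq_left) auto
  then obtain x where "poly P x = 0" using alg_closed_imp_poly_has_root by blast
  moreover have "poly P x = 1"
    using fin by (simp add: P_def poly_prod)
  ultimately show False by simp
qed

text \<open>Stands in for Zariski density below: identities are checked where the torus or the big
  cell is available.\<close>

lemma poly_eq_nonzero:
  fixes P Q :: "'k::alg_closed_field poly"
  assumes "\<And>x. x \<noteq> 0 \<Longrightarrow> poly P x = poly Q x"
  shows "P = Q"
proof -
  have "- {0} \<subseteq> {x. poly (P - Q) x = 0}" using assms by auto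
  moreover have "infinite (- {0 :: 'k})"
    using infinite_alg_closed_field by (simp add: Compl_eq_Diff_UNIV)
  ultimately have "infinite {x. poly (P - Q) x = 0}" by (metis finite_subset)
  then show ?thesis using poly_roots_finite[of "P - Q"] by auto
qed

lemma power_eq_1:
  assumes "\<And>t :: 'k::alg_closed_field. t \<noteq> 0 \<Longrightarrow> t ^ n = 1"
  shows "n = 0"
proof -
  have "monom 1 n = (1 :: 'k poly)"
    using assms by (intro poly_eq_nonzero) (simp add: poly_monom)
  then have "degree (monom (1 :: 'k) n) = 0" by simp
  then show ?thesis by (simp add: degree_monom_eq)
qed

lemma powi_eq_1:
  assumes "\<And>t :: 'k::alg_closed_field. t \<noteq> 0 \<Longrightarrow> t powi z = 1"
  shows "z = 0"
proof -
  have "t ^ nat \<bar>z\<bar> = 1" if "t \<noteq> 0" for t :: 'k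
    using assms[OF that] that by (cases "z \<ge> 0") (auto simp: power_int_def power_inverse)
  then have "nat \<bar>z\<bar> = 0" by (rule power_eq_1)
  then show ?thesis by simp
qed

text \<open>Comparing coefficients of \<open>y ^ a\<close> leaves an identity between powers of
  \<open>t\<close>, and a character of the torus determines its exponent.\<close>

lemma scaling_coeff:
  fixes Q :: "'k::alg_closed_field poly"
  assumes "\<And>t y. t \<noteq> 0 \<Longrightarrow> t powi \<alpha> * poly Q (t ^ 2 * y) = t powi \<beta> * poly Q y"
    and nz: "coeff Q a \<noteq> 0"
  shows "\<alpha> + 2 * int a = \<beta>"
proof -
  have "t powi (\<alpha> + 2 * int a - \<beta>) = 1" if t: "t \<noteq> 0" for t :: 'k
  proof -
    have "Polynomial.smult (t powi \<alpha>) (pcompose Q [:0, t ^ 2:]) = Polynomial.smult (t powi \<beta>) Q"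
      using assms(1)[OF t] by (intro poly_eq_nonzero) (simp add: poly_pcompose mult.commute)
    then have "t powi \<alpha> * ((t ^ 2) ^ a * coeff Q a) = t powi \<beta> * coeff Q a"
      by (metis coeff_smult coeff_pcompose_linear)
    then have "t powi \<alpha> * (t ^ 2) ^ a = t powi \<beta>" using nz by simp
    moreover have "(t ^ 2) ^ a = t powi (2 * int a)"
      using power_int_of_nat[of t "2 * a"] by (simp flip: power_mult)
    ultimately show ?thesis using t by (simp add: power_int_diff power_int_add)
  qed
  then have "\<alpha> + 2 * int a - \<beta> = 0" by (rule powi_eq_1)
  then show ?thesis by simp
qed

abbreviation SLK :: "'k::field mat set" where "SLK \<equiv> carrier (SL2 UNIV)"

text \<open>Curves along which regular functions become polynomials in one variable: the unipotent
  subgroups, and the paths that lead into the big cell.\<close>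

definition poly_curve :: "('k::field \<Rightarrow> 'k mat) \<Rightarrow> bool" where
  "poly_curve C \<longleftrightarrow> (\<forall>x. C x \<in> SLK) \<and> (\<forall>i<2. \<forall>j<2. \<exists>P. \<forall>x. C x $$ (i, j) = poly P x)"

lemma curve_polynomial_function:
  assumes C: "poly_curve C" and f: "f \<in> polynomial_functions"
  shows "\<exists>P. \<forall>x. f (C x) = poly P x"
  using f
proof induction
  case (const c)
  show ?case by (rule exI[of _ "[:c:]"]) simp
next
  case (entry i j)
  then show ?case using C by (auto simp: poly_curve_def)
next
  case (plus f g)
  then show ?case by (metis poly_add)
next
  case (times f g)
  then show ?case by (metis poly_mult)
qed

text \<open>On the torus a regular function is a Laurent polynomial, and \<open>t ^ N\<close> clears
  its denominators. Saying so for all large \<open>N\<close> lets finitely many functions share one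
  \<open>N\<close>.\<close>

lemma torus_polynomial_function:
  fixes f :: "'k::field mat \<Rightarrow> 'k"
  assumes "f \<in> polynomial_functions"
  shows "\<forall>\<^sub>F N in sequentially. \<exists>P. \<forall>t. t \<noteq> 0 \<longrightarrow> f (torus t) * t ^ N = poly P t"
  using assms
proof induction
  case (const c)
  show ?case
  proof (rule always_eventually, rule allI)
    fix N show "\<exists>P. \<forall>t. t \<noteq> 0 \<longrightarrow> c * t ^ N = poly P t"
      by (rule exI[of _ "monom c N"]) (simp add: poly_monom)
  qed
next
  case (entry i j)
  have "\<exists>P. \<forall>t. t \<noteq> 0 \<longrightarrow> torus t $$ (i, j) * t ^ N = poly P t" if N: "N \<ge> 1" for N
  proof -
    consider "i = 0 \<and> j = 0" | "i = 1 \<and> j = 1" | "i \<noteq> j" using entry by linarith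
    then show ?thesis
    proof cases
      case 1
      then show ?thesis
        by (intro exI[of _ "monom 1 (Suc N)"]) (simp add: torus_mat2 poly_monom)
    next
      case 2
      then show ?thesis using N
        by (intro exI[of _ "monom 1 (N - 1)"]) (auto simp: torus_mat2 poly_monom power_eq_if)
    next
      case 3
      then show ?thesis using entry
        by (intro exI[of _ 0]) (auto simp: torus_mat2 less_2_cases')
    qed
  qed
  then show ?case by (auto simp: eventually_sequentially)
next
  case (plus f g)
  from plus.IH show ?case
  proof eventually_elim
    case (elim N)
    then show ?case by (metis distrib_right poly_add)
  qed
next
  case (times f g)
  from times.IH obtain Nf Ng where
    f: "\<And>N. N \<ge> Nf \<Longrightarrow> \<exists>P. \<forall>t. t \<noteq> 0 \<longrightarrow> f (torus t) * t ^ N = poly P t" and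
    g: "\<And>N. N \<ge> Ng \<Longrightarrow> \<exists>P. \<forall>t. t \<noteq> 0 \<longrightarrow> g (torus t) * t ^ N = poly P t"
    by (auto simp: eventually_sequentially)
  have "\<exists>P. \<forall>t. t \<noteq> 0 \<longrightarrow> f (torus t) * g (torus t) * t ^ N = poly P t" if N: "N \<ge> Nf + Ng" for N
  proof -
    obtain P Q where P: "\<And>t. t \<noteq> 0 \<Longrightarrow> f (torus t) * t ^ Nf = poly P t"
      and Q: "\<And>t. t \<noteq> 0 \<Longrightarrow> g (torus t) * t ^ (N - Nf) = poly Q t"
    proof -
      have "Ng \<le> N - Nf" using N by simp
      from f[OF le_refl] g[OF this] show ?thesis using that by blast
    qed
    have "f (torus t) * g (torus t) * t ^ N = poly (P * Q) t" if "t \<noteq> 0" for t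
    proof -
      have "t ^ N = t ^ Nf * t ^ (N - Nf)" using N by (simp flip: power_add)
      then show ?thesis using P[OF that] Q[OF that] by (simp add: mult_ac)
    qed
    then show ?thesis by blast
  qed
  then show ?case by (auto simp: eventually_sequentially)
qed

section \<open>Coordinates, weights and a highest weight functional on a simple module\<close>

locale simple_SL2_module = koszul p s kt md for p s and kt :: "'k::alg_closed_field itself" and md +
  fixes d :: nat and \<rho> :: "'k mat \<Rightarrow> 'k mat"
  assumes rat: "rational_representation d \<rho>" and simple: "simple_representation d \<rho>"
    and hw: "highest_weight d \<rho> (int (val md))"
    and md_0: "i \<ge> s \<Longrightarrow> md i = 0"
begin

definition V :: "(nat \<Rightarrow> 'k) set" where "V = fsupp {..<d}"

definition Rp :: "'k mat \<Rightarrow> (nat \<Rightarrow> 'k) \<Rightarrow> (nat \<Rightarrow> 'k)" where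
  "Rp A w = (\<lambda>i. if i < d then (\<Sum>j<d. \<rho> A $$ (i, j) * w j) else 0)"

lemma lin_Rp: "lin (Rp A)"
  by (rule linI; rule ext) (simp_all add: Rp_def distrib_left sum.distrib sum_distrib_left mult.left_commute)

lemma Rp_in: "Rp A w \<in> V"
  by (simp add: V_def fsupp_def Rp_def)

lemma VD: "w \<in> V \<Longrightarrow> \<not> i < d \<Longrightarrow> w i = 0"
  by (simp add: V_def fsupp_def)

lemma V_eqI: "v \<in> V \<Longrightarrow> w \<in> V \<Longrightarrow> (\<And>i. i < d \<Longrightarrow> v i = w i) \<Longrightarrow> v = w"
proof (rule ext)
  fix i assume "v \<in> V" "w \<in> V" "\<And>i. i < d \<Longrightarrow> v i = w i"
  then show "v i = w i" by (cases "i < d") (simp_all add: VD)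
qed

lemma rho_carrier: "A \<in> SLK \<Longrightarrow> \<rho> A \<in> carrier_mat d d"
  using rat by (simp add: rational_representation_def)

lemma SLK_mult: "A \<in> SLK \<Longrightarrow> B \<in> SLK \<Longrightarrow> A * B \<in> (SLK :: 'k mat set)"
  by (auto simp: SL2_def det_mult)

lemma rho_mult_index:
  assumes "A \<in> SLK" "B \<in> SLK" "i < d" "j < d"
  shows "\<rho> (A * B) $$ (i, j) = (\<Sum>k<d. \<rho> A $$ (i, k) * \<rho> B $$ (k, j))"
proof -
  have "\<rho> (A * B) = \<rho> A * \<rho> B" using rat assms by (simp add: rational_representation_def)
  then show ?thesis
    using rho_carrier[OF assms(1)] rho_carrier[OF assms(2)] assms(3,4)
    by (simp add: scalar_prod_def lessThan_atLeast0)
qed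

lemma rho_one_index: "i < d \<Longrightarrow> j < d \<Longrightarrow> \<rho> (1\<^sub>m 2) $$ (i, j) = (if i = j then 1 else 0)"
  using rat by (simp add: rational_representation_def)

lemma Rp_one: "w \<in> V \<Longrightarrow> Rp (1\<^sub>m 2) w = w"
proof (rule V_eqI[OF Rp_in])
  fix i assume "i < d"
  then have "(\<Sum>j<d. \<rho> (1\<^sub>m 2) $$ (i, j) * w j) = (\<Sum>j<d. if j = i then w i else 0)"
    by (intro sum.cong refl) (simp add: rho_one_index)
  then show "Rp (1\<^sub>m 2) w i = w i" using \<open>i < d\<close> by (simp add: Rp_def)
qed

lemma Rp_mult:
  assumes "A \<in> SLK" "B \<in> SLK"
  shows "Rp (A * B) w = Rp A (Rp B w)"
proof (rule V_eqI[OF Rp_in Rp_in])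
  fix i assume i: "i < d"
  have "Rp (A * B) w i = (\<Sum>j<d. \<Sum>k<d. \<rho> A $$ (i, k) * (\<rho> B $$ (k, j) * w j))"
    using i assms by (simp add: Rp_def rho_mult_index sum_distrib_right mult.assoc)
  also have "\<dots> = (\<Sum>k<d. \<Sum>j<d. \<rho> A $$ (i, k) * (\<rho> B $$ (k, j) * w j))" by (rule sum.swap)
  also have "\<dots> = Rp A (Rp B w) i" using i by (simp add: Rp_def sum_distrib_left)
  finally show "Rp (A * B) w i = Rp A (Rp B w) i" .
qed

lemma vec_Rp: "A \<in> SLK \<Longrightarrow> vec d (Rp A w) = \<rho> A *\<^sub>v vec d w"
  using rho_carrier[of A]
  by (intro eq_vecI) (auto simp: Rp_def scalar_prod_def lessThan_atLeast0)

lemma vec_inj: "v \<in> V \<Longrightarrow> w \<in> V \<Longrightarrow> vec d v = vec d w \<Longrightarrow> v = w"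
  by (rule V_eqI) (metis index_vec)+

lemma simple_dichotomy:
  assumes K: "K \<subseteq> V" and K0: "0 \<in> K" and add: "\<And>u v. u \<in> K \<Longrightarrow> v \<in> K \<Longrightarrow> u + v \<in> K"
    and scl: "\<And>c u. u \<in> K \<Longrightarrow> scl c u \<in> K"
    and stable: "\<And>A w. A \<in> SLK \<Longrightarrow> w \<in> K \<Longrightarrow> Rp A w \<in> K"
  shows "K = {0} \<or> K = V"
proof -
  define W where "W = vec d ` K"
  have vec_add: "vec d u + vec d v = vec d (u + v)" for u v :: "nat \<Rightarrow> 'k" by (intro eq_vecI) auto
  have vec_smult: "c \<cdot>\<^sub>v vec d u = vec d (scl c u)" for c and u :: "nat \<Rightarrow> 'k" by (intro eq_vecI) auto
  have vec_0: "vec d (0 :: nat \<Rightarrow> 'k) = 0\<^sub>v d" by (intro eq_vecI) auto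
  have "VectorSpace.subspace class_ring W (module_vec TYPE('k) d)"
  proof (intro subspace.intro submodule.intro vec_vs vec_module, unfold module_vec_simps)
    show "W \<subseteq> carrier_vec d" by (auto simp: W_def)
    show "v + w \<in> W" if "v \<in> W" "w \<in> W" for v w
      using that add unfolding W_def by (auto simp: vec_add)
    show "0\<^sub>v d \<in> W" using K0 vec_0 unfolding W_def by (metis imageI)
    show "c \<cdot>\<^sub>v v \<in> W" if "v \<in> W" for c v
      using that scl unfolding W_def by (auto simp: vec_smult)
  qed
  moreover have "\<rho> A *\<^sub>v w \<in> W" if "A \<in> SLK" "w \<in> W" for A w
    using that stable unfolding W_def by (auto simp: vec_Rp[symmetric])
  ultimately have "W = {0\<^sub>v d} \<or> W = carrier_vec d"
    using simple by (simp add: simple_representation_def)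
  then show ?thesis
  proof
    assume W: "W = {0\<^sub>v d}"
    have V0: "0 \<in> V" by (auto simp: V_def)
    have "w = 0" if "w \<in> K" for w
      using that W K vec_inj[OF _ V0, of w] unfolding W_def vec_0 by auto
    then show ?thesis using K0 by auto
  next
    assume W: "W = carrier_vec d"
    have "w \<in> K" if w: "w \<in> V" for w
    proof -
      have "vec d w \<in> W" by (simp add: W)
      then obtain v where v: "v \<in> K" "vec d w = vec d v" unfolding W_def by auto
      then have "w = v" using w K by (intro vec_inj) auto
      then show ?thesis using v by simp
    qed
    then show ?thesis using K by auto
  qed
qed

lemma torus_SLK: "t \<noteq> 0 \<Longrightarrow> torus t \<in> (SLK :: 'k mat set)"
  by (simp add: torus_mat2 mat2_in_SL2)

lemma torus_mult: "torus (x * t) = torus t * torus (x :: 'k)"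
  by (simp add: torus_mat2 mat2_mult mult.commute)

lemma torus_one: "torus (1 :: 'k) = 1\<^sub>m 2"
  by (simp add: torus_mat2 mat2_one)

lemma rho_polynomial:
  "i < d \<Longrightarrow> j < d \<Longrightarrow> \<exists>f\<in>polynomial_functions. \<forall>A\<in>SLK. \<rho> A $$ (i, j) = f A"
  using rat by (simp add: rational_representation_def)

lemma Rp_curve:
  assumes C: "poly_curve C"
  shows "\<exists>P. \<forall>x i. i < d \<longrightarrow> Rp (C x) w i = poly (P i) x"
proof -
  have "\<exists>P. \<forall>x. \<rho> (C x) $$ (i, j) = poly P x" if ij: "i < d" "j < d" for i j
  proof -
    obtain f where f: "f \<in> polynomial_functions" "\<And>A. A \<in> SLK \<Longrightarrow> \<rho> A $$ (i, j) = f A"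
      using rho_polynomial[OF ij] by blast
    then show ?thesis
      using curve_polynomial_function[OF C f(1)] C by (simp add: poly_curve_def)
  qed
  then obtain Q where Q: "\<And>i j x. i < d \<Longrightarrow> j < d \<Longrightarrow> \<rho> (C x) $$ (i, j) = poly (Q i j) x" by metis
  have "Rp (C x) w i = poly (\<Sum>j<d. Polynomial.smult (w j) (Q i j)) x" if "i < d" for x i
    using that by (simp add: Rp_def poly_sum Q mult.commute)
  then show ?thesis by (intro exI[of _ "\<lambda>i. \<Sum>j<d. Polynomial.smult (w j) (Q i j)"]) simp
qed

definition fn :: "(nat \<Rightarrow> 'k) \<Rightarrow> (nat \<Rightarrow> 'k) \<Rightarrow> 'k" where
  "fn r w = (\<Sum>i<d. r i * w i)"

lemma fn_add: "fn r (u + v) = fn r u + fn r v"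
  by (simp add: fn_def distrib_left sum.distrib)

lemma fn_scl: "fn r (scl c u) = c * fn r u"
  by (simp add: fn_def sum_distrib_left mult.left_commute)

lemma fn_0: "fn r 0 = 0"
  by (simp add: fn_def)

lemma fn_sum: "fn r (\<Sum>i\<in>S. u i) = (\<Sum>i\<in>S. fn r (u i))"
  using sum_comp_morphism[of "fn r" u S] fn_0 fn_add by (simp add: o_def)

lemma fn_curve: "poly_curve C \<Longrightarrow> \<exists>P. \<forall>x. fn r (Rp (C x) w) = poly P x"
proof -
  assume "poly_curve C"
  then obtain P where P: "\<And>x i. i < d \<Longrightarrow> Rp (C x) w i = poly (P i) x" using Rp_curve by metis
  have "fn r (Rp (C x) w) = poly (\<Sum>i<d. Polynomial.smult (r i) (P i)) x" for x
    by (simp add: fn_def P poly_sum)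
  then show ?thesis by blast
qed

abbreviation up :: "'k \<Rightarrow> 'k mat" where "up x \<equiv> mat2 1 x 0 1"
abbreviation low :: "'k \<Rightarrow> 'k mat" where "low x \<equiv> mat2 1 0 x 1"

lemma up_SLK: "up x \<in> SLK" and low_SLK: "low x \<in> SLK"
  by (simp_all add: mat2_in_SL2)

lemma up_curve: "poly_curve up" and low_curve: "poly_curve low"
  unfolding poly_curve_def
  by (auto simp: up_SLK low_SLK less_2_cases' intro: exI[of _ 0] exI[of _ 1] exI[of _ "[:0, 1:]"])

lemma torus_up: "t \<noteq> 0 \<Longrightarrow> torus t * up x = up (t ^ 2 * x) * torus t"
  by (simp add: torus_mat2 mat2_mult mat2_eq_iff power2_eq_square field_simps)

lemma torus_low: "t \<noteq> 0 \<Longrightarrow> torus t * low (t ^ 2 * y) = low y * torus t"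
  by (simp add: torus_mat2 mat2_mult mat2_eq_iff power2_eq_square field_simps)

text \<open>A coordinate of highest weight that is invariant under the lower unipotent subgroup.  Through
  \<open>w \<mapsto> (x \<mapsto> fn r (Rp (up x) w))\<close> it realizes the module as polynomials of degree at most
  \<open>val md\<close>.\<close>

definition hw_functional :: "(nat \<Rightarrow> 'k) \<Rightarrow> (nat \<Rightarrow> 'k) \<Rightarrow> bool" where
  "hw_functional r v \<longleftrightarrow> v \<in> V \<and> fn r v \<noteq> 0 \<and>
    (\<forall>t w. t \<noteq> 0 \<longrightarrow> fn r (Rp (torus t) w) = t powi int (val md) * fn r w) \<and>
    (\<forall>t. t \<noteq> 0 \<longrightarrow> Rp (torus t) v = scl (t powi int (val md)) v) \<and>
    (\<forall>y w. w \<in> V \<longrightarrow> fn r (Rp (low y) w) = fn r w)"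

text \<open>The coefficient of \<open>t ^ l\<close> in \<open>t ^ N\<close> times
  \<open>\<rho> (torus t)\<close> is the projection to the weight \<open>l - N\<close>, and a
  suitable row of the top projection serves as \<open>r\<close>. It is invariant under the lower
  unipotent subgroup because no weight exceeds the highest one.\<close>

theorem exists_hw_functional: "\<exists>r v. hw_functional r v"
proof -
  define M where "M = int (val md)"
  have "\<forall>\<^sub>F N in sequentially. \<forall>i\<in>{..<d}. \<forall>j\<in>{..<d}. \<exists>P. \<forall>t. t \<noteq> 0 \<longrightarrow> \<rho> (torus t) $$ (i, j) * t ^ N = poly P t"
  proof (intro eventually_ball_finite ballI finite_lessThan)
    fix i j assume "i \<in> {..<d}" "j \<in> {..<d}"
    then obtain f where f: "f \<in> polynomial_functions" "\<And>A. A \<in> SLK \<Longrightarrow> \<rho> A $$ (i, j) = f A"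
      using rho_polynomial by (metis lessThan_iff)
    show "\<forall>\<^sub>F N in sequentially. \<exists>P. \<forall>t. t \<noteq> 0 \<longrightarrow> \<rho> (torus t) $$ (i, j) * t ^ N = poly P t"
      using torus_polynomial_function[OF f(1)] by eventually_elim (simp add: f(2) torus_SLK)
  qed
  then obtain N where "\<forall>i\<in>{..<d}. \<forall>j\<in>{..<d}. \<exists>P. \<forall>t. t \<noteq> 0 \<longrightarrow> \<rho> (torus t) $$ (i, j) * t ^ N = poly P t"
    by (auto simp: eventually_sequentially)
  then obtain pp where pp: "\<And>i j t. i < d \<Longrightarrow> j < d \<Longrightarrow> t \<noteq> 0 \<Longrightarrow> \<rho> (torus t) $$ (i, j) * t ^ N = poly (pp i j) t"
    by (metis lessThan_iff)
  \<comment> \<open>This and \<open>right\<close> compare coefficients of \<open>x ^ l\<close> in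
    the multiplicativity of \<open>\<rho>\<close> on the torus, with the matrix of
    \<open>torus t\<close> as left or as right factor.\<close>
  have left: "t ^ l * coeff (pp i j) l = t ^ N * (\<Sum>k<d. \<rho> (torus t) $$ (i, k) * coeff (pp k j) l)"
    if ij: "i < d" "j < d" and t: "t \<noteq> 0" for i j t l
  proof -
    have "pcompose (pp i j) [:0, t:] = (\<Sum>k<d. Polynomial.smult (t ^ N * \<rho> (torus t) $$ (i, k)) (pp k j))"
    proof (rule poly_eq_nonzero)
      fix x :: 'k assume x: "x \<noteq> 0"
      have "poly (pp i j) (x * t) = \<rho> (torus (x * t)) $$ (i, j) * (x * t) ^ N"
        using ij t x by (simp add: pp)
      also have "\<dots> = (\<Sum>k<d. \<rho> (torus t) $$ (i, k) * \<rho> (torus x) $$ (k, j)) * (x * t) ^ N"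
        unfolding torus_mult using ij t x by (simp add: rho_mult_index torus_SLK)
      also have "\<dots> = (\<Sum>k<d. t ^ N * \<rho> (torus t) $$ (i, k) * (\<rho> (torus x) $$ (k, j) * x ^ N))"
        unfolding power_mult_distrib sum_distrib_right by (simp only: mult_ac)
      also have "\<dots> = (\<Sum>k<d. t ^ N * \<rho> (torus t) $$ (i, k) * poly (pp k j) x)"
        using ij x by (simp add: pp)
      finally show "poly (pcompose (pp i j) [:0, t:]) x =
          poly (\<Sum>k<d. Polynomial.smult (t ^ N * \<rho> (torus t) $$ (i, k)) (pp k j)) x"
        by (simp add: poly_pcompose poly_sum)
    qed
    from arg_cong[OF this, of "\<lambda>P. coeff P l"] show ?thesis
      by (simp add: coeff_pcompose_linear coeff_sum sum_distrib_left mult_ac)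
  qed
  have right: "t ^ l * coeff (pp i j) l = t ^ N * (\<Sum>k<d. coeff (pp i k) l * \<rho> (torus t) $$ (k, j))"
    if ij: "i < d" "j < d" and t: "t \<noteq> 0" for i j t l
  proof -
    have "pcompose (pp i j) [:0, t:] = (\<Sum>k<d. Polynomial.smult (t ^ N * \<rho> (torus t) $$ (k, j)) (pp i k))"
    proof (rule poly_eq_nonzero)
      fix x :: 'k assume x: "x \<noteq> 0"
      have "poly (pp i j) (t * x) = \<rho> (torus (t * x)) $$ (i, j) * (t * x) ^ N"
        using ij t x by (simp add: pp)
      also have "\<dots> = (\<Sum>k<d. \<rho> (torus x) $$ (i, k) * \<rho> (torus t) $$ (k, j)) * (t * x) ^ N"
        unfolding torus_mult using ij t x by (simp add: rho_mult_index torus_SLK)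
      also have "\<dots> = (\<Sum>k<d. t ^ N * \<rho> (torus t) $$ (k, j) * (\<rho> (torus x) $$ (i, k) * x ^ N))"
        unfolding power_mult_distrib sum_distrib_right by (simp only: mult_ac)
      also have "\<dots> = (\<Sum>k<d. t ^ N * \<rho> (torus t) $$ (k, j) * poly (pp i k) x)"
        using ij x by (simp add: pp)
      finally show "poly (pcompose (pp i j) [:0, t:]) x =
          poly (\<Sum>k<d. Polynomial.smult (t ^ N * \<rho> (torus t) $$ (k, j)) (pp i k)) x"
        by (simp add: poly_pcompose poly_sum mult.commute)
    qed
    from arg_cong[OF this, of "\<lambda>P. coeff P l"] show ?thesis
      by (simp add: coeff_pcompose_linear coeff_sum sum_distrib_left mult_ac)
  qed
  have powi: "t powi (int l - int N) * t ^ N = t ^ l" if "t \<noteq> 0" for t :: 'k and l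
    using that by (simp add: power_int_diff)
  define comp where "comp l w = (\<lambda>i. if i < d then (\<Sum>j<d. coeff (pp i j) l * w j) else 0)" for l w
  have comp_in: "comp l w \<in> V" for l w by (simp add: comp_def V_def fsupp_def)
  have comp_torus: "Rp (torus t) (comp l w) = scl (t powi (int l - int N)) (comp l w)"
    if t: "t \<noteq> 0" for t l w
  proof (rule V_eqI[OF Rp_in])
    show "scl (t powi (int l - int N)) (comp l w) \<in> V" using comp_in unfolding V_def by (rule fsupp_scl)
    fix i assume i: "i < d"
    have "t ^ N * Rp (torus t) (comp l w) i =
        (\<Sum>k<d. \<Sum>j<d. t ^ N * (\<rho> (torus t) $$ (i, k) * (coeff (pp k j) l * w j)))"
      using i by (simp add: Rp_def comp_def sum_distrib_left)
    also have "\<dots> = (\<Sum>j<d. (t ^ N * (\<Sum>k<d. \<rho> (torus t) $$ (i, k) * coeff (pp k j) l)) * w j)"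
      by (subst sum.swap) (simp add: sum_distrib_left sum_distrib_right mult_ac)
    also have "\<dots> = (\<Sum>j<d. t ^ l * coeff (pp i j) l * w j)"
      using i t by (intro sum.cong refl) (simp add: left[symmetric])
    also have "\<dots> = t ^ l * comp l w i" using i by (simp add: comp_def sum_distrib_left mult.assoc)
    also have "\<dots> = t ^ N * scl (t powi (int l - int N)) (comp l w) i"
      using powi[OF t, of l] by (simp add: mult.left_commute mult.commute)
    finally show "Rp (torus t) (comp l w) i = scl (t powi (int l - int N)) (comp l w) i"
      using t by simp
  qed
  have weight: "int l - int N \<le> M" if nz: "comp l w \<noteq> 0" for l w
  proof -
    have "vec d (comp l w) \<in> weight_space d \<rho> (int l - int N)"
      unfolding weight_space_def
    proof (intro CollectI conjI allI impI)
      fix t :: 'k assume t: "t \<noteq> 0"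
      show "\<rho> (torus t) *\<^sub>v vec d (comp l w) = (t powi (int l - int N)) \<cdot>\<^sub>v vec d (comp l w)"
        unfolding vec_Rp[OF torus_SLK[OF t], symmetric] comp_torus[OF t] by (intro eq_vecI) auto
    qed simp
    moreover have "vec d (comp l w) \<noteq> 0\<^sub>v d"
    proof
      assume "vec d (comp l w) = 0\<^sub>v d"
      then have "comp l w i = 0" if "i < d" for i using that by (metis index_vec index_zero_vec(1))
      then have "comp l w = 0" using comp_in by (intro V_eqI) (auto simp: V_def)
      then show False using nz by simp
    qed
    ultimately have "is_weight d \<rho> (int l - int N)" by (auto simp: is_weight_def)
    then show ?thesis using hw by (auto simp: highest_weight_def M_def)
  qed
  define D where "D = (\<Sum>i<d. \<Sum>j<d. degree (pp i j))"
  have deg: "degree (pp i j) \<le> D" if "i < d" "j < d" for i j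
  proof -
    have "degree (pp i j) \<le> (\<Sum>j<d. degree (pp i j))" using that by (intro member_le_sum) auto
    also have "\<dots> \<le> D" unfolding D_def using that by (intro member_le_sum[of i]) auto
    finally show ?thesis .
  qed
  \<comment> \<open>At \<open>t = 1\<close> the coefficient matrices add up to the identity.\<close>
  have decompose: "w = (\<Sum>l\<le>D. comp l w)" if w: "w \<in> V" for w
  proof (rule V_eqI[OF w])
    show "(\<Sum>l\<le>D. comp l w) \<in> V" unfolding V_def by (intro fsupp_sum) (use comp_in in \<open>simp add: V_def\<close>)
    fix i assume i: "i < d"
    have "(\<Sum>l\<le>D. coeff (pp i j) l) = (if i = j then 1 else 0)" if j: "j < d" for j
    proof -
      have "(\<Sum>l\<le>D. coeff (pp i j) l) = (\<Sum>l\<le>degree (pp i j). coeff (pp i j) l)"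
        using deg[OF i j] by (intro sum.mono_neutral_right) (auto simp: coeff_eq_0)
      also have "\<dots> = poly (pp i j) 1" by (simp add: poly_altdef)
      also have "\<dots> = \<rho> (torus 1) $$ (i, j)" using pp[OF i j, of 1] by simp
      finally show ?thesis using i j by (simp add: torus_one rho_one_index)
    qed
    then have "(\<Sum>j<d. (\<Sum>l\<le>D. coeff (pp i j) l) * w j) = (\<Sum>j<d. if j = i then w i else 0)"
      by (intro sum.cong refl) auto
    also have "\<dots> = w i" using i by simp
    finally show "w i = (\<Sum>l\<le>D. comp l w) i"
      using i by (simp add: sum_fun_apply comp_def sum_distrib_right sum.swap[of _ "{..D}" "{..<d}"])
  qed
  obtain vv where vv: "vv \<in> carrier_vec d" "vv \<noteq> 0\<^sub>v d"
    "\<And>t. t \<noteq> 0 \<Longrightarrow> \<rho> (torus t) *\<^sub>v vv = (t powi M) \<cdot>\<^sub>v vv"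
  proof -
    have "weight_space d \<rho> M \<noteq> {0\<^sub>v d}" using hw by (simp add: highest_weight_def is_weight_def M_def)
    moreover have "0\<^sub>v d \<in> weight_space d \<rho> M"
    proof -
      have "\<rho> (torus t) *\<^sub>v 0\<^sub>v d = (t powi M) \<cdot>\<^sub>v 0\<^sub>v d" if "t \<noteq> 0" for t
        using rho_carrier[OF torus_SLK[OF that]] by (intro eq_vecI) auto
      then show ?thesis by (simp add: weight_space_def)
    qed
    ultimately show ?thesis using that unfolding weight_space_def by blast
  qed
  define v where "v = (\<lambda>i. if i < d then vv $ i else 0)"
  have v_in: "v \<in> V" by (simp add: v_def V_def fsupp_def)
  have vec_v: "vec d v = vv" using vv(1) by (intro eq_vecI) (auto simp: v_def)
  have v_torus: "Rp (torus t) v = scl (t powi M) v" if t: "t \<noteq> 0" for t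
  proof (rule vec_inj[OF Rp_in])
    show "scl (t powi M) v \<in> V" using v_in unfolding V_def by (rule fsupp_scl)
    show "vec d (Rp (torus t) v) = vec d (scl (t powi M) v)"
      unfolding vec_Rp[OF torus_SLK[OF t]] vec_v vv(3)[OF t] using vv(1)
      by (intro eq_vecI) (auto simp: v_def)
  qed
  obtain k0 where k0: "k0 < d" "v k0 \<noteq> 0"
  proof -
    have "\<exists>k<d. vv $ k \<noteq> 0"
    proof (rule ccontr)
      assume "\<not> (\<exists>k<d. vv $ k \<noteq> 0)"
      then have "vv = 0\<^sub>v d" using vv(1) by (intro eq_vecI) auto
      then show False using vv(2) by simp
    qed
    then show ?thesis using that by (auto simp: v_def)
  qed
  define l0 where "l0 = val md + N"
  define r where "r = (\<lambda>i. coeff (pp k0 i) l0)"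
  have r_torus: "fn r (Rp (torus t) w) = t powi M * fn r w" if t: "t \<noteq> 0" for t w
  proof -
    have "t ^ N * fn r (Rp (torus t) w) = (\<Sum>i<d. \<Sum>j<d. t ^ N * (r i * (\<rho> (torus t) $$ (i, j) * w j)))"
      by (simp add: fn_def Rp_def sum_distrib_left)
    also have "\<dots> = (\<Sum>j<d. (t ^ N * (\<Sum>i<d. coeff (pp k0 i) l0 * \<rho> (torus t) $$ (i, j))) * w j)"
      by (subst sum.swap) (simp add: r_def sum_distrib_left sum_distrib_right mult_ac)
    also have "\<dots> = (\<Sum>j<d. t ^ l0 * coeff (pp k0 j) l0 * w j)"
      using k0 t by (intro sum.cong refl) (simp add: right[symmetric])
    also have "\<dots> = t ^ l0 * fn r w" by (simp add: r_def fn_def sum_distrib_left mult.assoc)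
    also have "t ^ l0 = t ^ N * t powi M" by (simp add: l0_def M_def power_add)
    finally show ?thesis using t by simp
  qed
  \<comment> \<open>As \<open>v\<close> already has the highest weight, the row \<open>k0\<close> of
    the projection returns its entry \<open>v k0\<close>.\<close>
  have r_v: "fn r v \<noteq> 0"
  proof -
    have "(\<Sum>j<d. Polynomial.smult (v j) (pp k0 j)) = monom (v k0) l0"
    proof (rule poly_eq_nonzero)
      fix t :: 'k assume t: "t \<noteq> 0"
      have "(\<Sum>j<d. v j * poly (pp k0 j) t) = t ^ N * Rp (torus t) v k0"
        using k0 t by (simp add: Rp_def sum_distrib_left pp[symmetric] mult_ac)
      also have "\<dots> = v k0 * t ^ l0"
        unfolding v_torus[OF t] by (simp add: l0_def M_def power_add mult_ac)
      finally show "poly (\<Sum>j<d. Polynomial.smult (v j) (pp k0 j)) t = poly (monom (v k0) l0) t"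
        by (simp add: poly_sum poly_monom)
    qed
    from arg_cong[OF this, of "\<lambda>P. coeff P l0"] have "fn r v = v k0"
      by (simp add: coeff_sum fn_def r_def mult.commute)
    then show ?thesis using k0 by simp
  qed
  \<comment> \<open>On a weight vector the polynomial in \<open>y\<close> is homogeneous: a term
    \<open>y ^ a\<close> needs \<open>M + 2 * a = l - N\<close>. Weights are at most
    \<open>M\<close>, so only the constant term remains.\<close>
  have low_comp: "fn r (Rp (low y) (comp l w)) = fn r (comp l w)" for y l w
  proof (cases "comp l w = 0")
    case True
    then show ?thesis using lin_0[OF lin_Rp] by simp
  next
    case False
    define u where "u = comp l w"
    obtain Q where Q: "\<And>y. fn r (Rp (low y) u) = poly Q y" using fn_curve[OF low_curve] by metis
    have scale: "t powi M * poly Q (t ^ 2 * y) = t powi (int l - int N) * poly Q y" if t: "t \<noteq> 0" for t y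
    proof -
      have "t powi M * poly Q (t ^ 2 * y) = fn r (Rp (torus t) (Rp (low (t ^ 2 * y)) u))"
        by (simp add: r_torus[OF t] Q)
      also have "\<dots> = fn r (Rp (low y) (Rp (torus t) u))"
        using t by (simp add: Rp_mult[symmetric] torus_SLK low_SLK torus_low)
      also have "\<dots> = t powi (int l - int N) * poly Q y"
        unfolding u_def comp_torus[OF t] lin_scl[OF lin_Rp] fn_scl by (simp add: Q[symmetric] u_def)
      finally show ?thesis .
    qed
    have "coeff Q a = 0" if "a > 0" for a
    proof (rule ccontr)
      assume "coeff Q a \<noteq> 0"
      then have "M + 2 * int a = int l - int N"
        using scaling_coeff[of M Q "int l - int N" a] scale by blast
      then show False using weight[OF False] that by simp
    qed
    then have "Q = [:coeff Q 0:]" by (intro poly_eqI) (auto simp: coeff_pCons split: nat.split)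
    then obtain c where "Q = [:c:]" by blast
    then have "poly Q y = poly Q 0" by simp
    then have "fn r (Rp (low y) u) = fn r (Rp (low 0) u)" by (simp add: Q)
    also have "\<dots> = fn r u" using Rp_one comp_in by (simp add: u_def flip: mat2_one)
    finally show ?thesis by (simp add: u_def)
  qed
  have "fn r (Rp (low y) w) = fn r w" if w: "w \<in> V" for y w
  proof -
    have "fn r (Rp (low y) w) = fn r (Rp (low y) (\<Sum>l\<le>D. comp l w))"
      using decompose[OF w] by simp
    also have "\<dots> = fn r (\<Sum>l\<le>D. comp l w)"
      by (simp add: lin_sum[OF lin_Rp] fn_sum low_comp)
    finally show ?thesis using decompose[OF w] by simp
  qed
  then have "hw_functional r v"
    unfolding hw_functional_def using v_in r_v r_torus v_torus by (simp add: M_def)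
  then show ?thesis by blast
qed

end

section \<open>Powers of linear forms and Lucas's theorem\<close>

context koszul
begin

text \<open>Frobenius turns the power into the product of the
  \<open>(1 + x ^ (p ^ i)) ^ md i\<close>.\<close>

lemma linear_power_digits:
  assumes md_0: "\<And>i. i \<ge> s \<Longrightarrow> md i = 0"
  shows "[:1, 1 :: 'k:] ^ val md = (\<Sum>b\<in>below md. monom (\<Prod>i<s. of_nat (md i choose b i)) (val b))"
proof -
  have frob_poly: "[:1, 1 :: 'k:] ^ (p ^ i) = 1 + monom 1 (p ^ i)" for i
  proof -
    have "[:1, 1 :: 'k:] = 1 + monom 1 1" by (simp add: monom_altdef one_pCons)
    then show ?thesis
      using freshmans_dream'[where 'a = "'k poly", of "p ^ i" i 1 "monom 1 1"] p CHAR
      by (simp add: monom_power)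
  qed
  have "(1 + monom 1 (p ^ i)) ^ md i = (\<Sum>b\<le>md i. monom (of_nat (md i choose b) :: 'k) (b * p ^ i))" for i
  proof -
    have "(monom 1 (p ^ i) + 1) ^ md i = (\<Sum>b\<le>md i. of_nat (md i choose b) * monom (1 :: 'k) (p ^ i) ^ b * 1 ^ (md i - b))"
      by (rule binomial_ring)
    also have "\<dots> = (\<Sum>b\<le>md i. monom (of_nat (md i choose b)) (b * p ^ i))"
      by (intro sum.cong refl) (simp add: monom_power of_nat_poly smult_monom mult.commute)
    finally show ?thesis by (simp add: add.commute)
  qed
  then have "[:1, 1 :: 'k:] ^ val md = (\<Prod>i<s. \<Sum>b\<le>md i. monom (of_nat (md i choose b)) (b * p ^ i))"
    unfolding val_def power_sum
    by (intro prod.cong refl) (simp add: frob_poly mult.commute[of "md _"] power_mult)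
  also have "\<dots> = (\<Sum>b\<in>below md. \<Prod>i<s. monom (of_nat (md i choose b i)) (b i * p ^ i))"
    using md_0 by (rule prod_sum_below)
  also have "\<dots> = (\<Sum>b\<in>below md. monom (\<Prod>i<s. of_nat (md i choose b i)) (val b))"
  proof (intro sum.cong refl)
    fix b :: "nat \<Rightarrow> nat"
    have "(\<Prod>i<n. monom (of_nat (md i choose b i) :: 'k) (b i * p ^ i)) =
      monom (\<Prod>i<n. of_nat (md i choose b i)) (\<Sum>i<n. b i * p ^ i)" for n
      by (induction n) (simp_all add: mult_monom)
    then show "(\<Prod>i<s. monom (of_nat (md i choose b i) :: 'k) (b i * p ^ i)) =
      monom (\<Prod>i<s. of_nat (md i choose b i)) (val b)" by (simp add: val_def)
  qed
  finally show ?thesis .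
qed

lemma coeff_linear_power: "coeff ([:a, c:] ^ n) l = of_nat (n choose l) * a ^ (n - l) * (c :: 'k) ^ l"
proof -
  have "[:a, c:] = monom c 1 + [:a:]" by (simp add: monom_altdef)
  then have "[:a, c:] ^ n = (\<Sum>k\<le>n. of_nat (n choose k) * monom c 1 ^ k * [:a:] ^ (n - k))"
    by (simp only: binomial_ring)
  also have "\<dots> = (\<Sum>k\<le>n. monom (of_nat (n choose k) * a ^ (n - k) * c ^ k) k)"
    by (intro sum.cong refl)
      (simp add: monom_power of_nat_poly poly_const_pow smult_monom mult.commute mult.left_commute)
  finally have "coeff ([:a, c:] ^ n) l = (\<Sum>k\<le>n. if k = l then of_nat (n choose k) * a ^ (n - k) * c ^ k else 0)"
    by (simp add: coeff_sum)
  also have "\<dots> = of_nat (n choose l) * a ^ (n - l) * c ^ l"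
    by (cases "l \<le> n") (simp_all add: binomial_eq_0)
  finally show ?thesis .
qed

lemma md_Box: "(\<And>i. i \<ge> s \<Longrightarrow> md i = 0) \<Longrightarrow> md \<in> Box"
  using md by (simp add: Box_def)

lemma below_md: "(\<And>i. i \<ge> s \<Longrightarrow> md i = 0) \<Longrightarrow> below md = Low"
proof -
  assume md_0: "\<And>i. i \<ge> s \<Longrightarrow> md i = 0"
  have "b \<in> Low" if "b \<in> below md" for b
    using that Box_mono[OF md_Box[OF md_0], of b] by (simp add: below_def Low_def)
  moreover have "b \<in> below md" if b: "b \<in> Low" for b
  proof -
    have "b i \<le> md i" for i using b by (cases "i < s") (auto simp: Low_def Box_def)
    then show ?thesis by (simp add: below_def)
  qed
  ultimately show ?thesis by blast
qed

text \<open>Digits are unique, so at most one summand of \<open>linear_power_digits\<close> has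
  degree \<open>n\<close>; its coefficient is a product of binomials \<open>md i choose b i\<close>
  with \<open>md i < p\<close>, which do not vanish.\<close>

lemma lucas:
  assumes md_0: "\<And>i. i \<ge> s \<Longrightarrow> md i = 0"
  shows "of_nat (val md choose n) \<noteq> (0 :: 'k) \<longleftrightarrow> n \<in> val ` Low"
proof -
  have below: "below md \<subseteq> Box" using below_md[OF md_0] by (auto simp: Low_def)
  have fin: "finite (below md)" using below finite_Box by (rule finite_subset)
  have eq: "of_nat (val md choose n) = (\<Sum>b\<in>below md. if val b = n then (\<Prod>i<s. of_nat (md i choose b i)) else (0 :: 'k))"
    using arg_cong[OF linear_power_digits[OF md_0], of "\<lambda>P. coeff P n"]
    by (simp add: coeff_linear_power coeff_sum)
  show ?thesis
  proof
    assume "of_nat (val md choose n) \<noteq> (0 :: 'k)"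
    have "\<exists>b\<in>below md. val b = n"
    proof (rule ccontr)
      assume "\<not> (\<exists>b\<in>below md. val b = n)"
      then have "of_nat (val md choose n) = (0 :: 'k)" unfolding eq by (intro sum.neutral) auto
      then show False using \<open>of_nat (val md choose n) \<noteq> (0 :: 'k)\<close> by simp
    qed
    then show "n \<in> val ` Low" using below_md[OF md_0] by auto
  next
    assume "n \<in> val ` Low"
    then obtain b where b: "b \<in> below md" "val b = n" using below_md[OF md_0] by auto
    have "(\<Sum>b\<in>below md. if val b = n then (\<Prod>i<s. of_nat (md i choose b i)) else (0 :: 'k)) =
      (\<Sum>b'\<in>below md. if b' = b then (\<Prod>i<s. of_nat (md i choose b i)) else 0)"
    proof (intro sum.cong refl)
      fix b' assume "b' \<in> below md"
      then have "val b' = n \<longleftrightarrow> b' = b" using val_inj[of b' b] below b by auto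
      then show "(if val b' = n then (\<Prod>i<s. of_nat (md i choose b' i)) else (0 :: 'k)) =
        (if b' = b then (\<Prod>i<s. of_nat (md i choose b i)) else 0)" by simp
    qed
    also have "\<dots> = (\<Prod>i<s. of_nat (md i choose b i))" using b fin by simp
    also have "\<dots> \<noteq> 0"
    proof -
      have "of_nat (md i choose b i) \<noteq> (0 :: 'k)" if "i < s" for i
      proof
        assume "of_nat (md i choose b i) = (0 :: 'k)"
        moreover have "fact (b i) * fact (md i - b i) * (md i choose b i) = (fact (md i) :: nat)"
          using b by (intro binomial_fact_lemma) (simp add: below_def)
        ultimately have "of_nat (fact (md i)) = (0 :: 'k)" by (metis mult_zero_right of_nat_mult)
        then show False using fact_ne_0[OF md[OF that]] by simp
      qed
      then show ?thesis by simp
    qed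
    finally show "of_nat (val md choose n) \<noteq> (0 :: 'k)" using eq by simp
  qed
qed

end

section \<open>The simple module as a space of polynomials\<close>

locale hw_module = simple_SL2_module p s kt md d \<rho> for p s and kt :: "'k::alg_closed_field itself" and md d \<rho> +
  fixes r v :: "nat \<Rightarrow> 'k"
  assumes hwf: "hw_functional r v"
begin

abbreviation M where "M \<equiv> val md"

lemma v_in: "v \<in> V" and r_v: "fn r v \<noteq> 0"
  and r_torus: "t \<noteq> 0 \<Longrightarrow> fn r (Rp (torus t) w) = t ^ M * fn r w"
  and v_torus: "t \<noteq> 0 \<Longrightarrow> Rp (torus t) v = scl (t ^ M) v"
  and r_low: "w \<in> V \<Longrightarrow> fn r (Rp (low y) w) = fn r w"
  using hwf by (simp_all add: hw_functional_def)

definition unit :: "nat \<Rightarrow> nat \<Rightarrow> 'k" where "unit j = (\<lambda>i. if i = j then 1 else 0)"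

definition cj :: "nat \<Rightarrow> 'k poly" where
  "cj j = (SOME P. \<forall>x. fn r (Rp (up x) (unit j)) = poly P x)"

text \<open>The polynomial of \<open>x |-> fn r (Rp (up x) w)\<close>, composed from unit vectors so
  that linearity in \<open>w\<close> is built in.\<close>

definition pw :: "(nat \<Rightarrow> 'k) \<Rightarrow> 'k poly" where
  "pw w = (\<Sum>j<d. Polynomial.smult (w j) (cj j))"

lemma cj: "fn r (Rp (up x) (unit j)) = poly (cj j) x"
  using someI_ex[OF fn_curve[OF up_curve, of r "unit j"]] unfolding cj_def by blast

lemma pw: "w \<in> V \<Longrightarrow> poly (pw w) x = fn r (Rp (up x) w)"
proof -
  assume w: "w \<in> V"
  have "w = (\<Sum>j<d. scl (w j) (unit j))"
  proof (rule ext)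
    fix i show "w i = (\<Sum>j<d. scl (w j) (unit j)) i"
      using VD[OF w, of i] by (cases "i < d") (auto simp: sum_fun_apply unit_def if_distrib[of "(*) _"] cong: if_cong)
  qed
  then have "fn r (Rp (up x) w) = fn r (Rp (up x) (\<Sum>j<d. scl (w j) (unit j)))" by simp
  also have "\<dots> = (\<Sum>j<d. w j * fn r (Rp (up x) (unit j)))"
    by (simp add: lin_sum[OF lin_Rp] lin_scl[OF lin_Rp] fn_sum fn_scl)
  finally show ?thesis by (simp add: pw_def poly_sum cj)
qed

lemma pw_add: "pw (u + w) = pw u + pw w"
  by (simp add: pw_def smult_add_left sum.distrib)

lemma pw_scl: "pw (scl c u) = Polynomial.smult c (pw u)"
  by (rule poly_eqI) (simp add: pw_def coeff_sum sum_distrib_left mult.assoc)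

lemma pw_0: "pw 0 = 0"
  by (simp add: pw_def)

lemma pw_sum: "pw (\<Sum>i\<in>S. u i) = (\<Sum>i\<in>S. pw (u i))"
  using sum_comp_morphism[of pw u S] pw_0 pw_add by (simp add: o_def)

text \<open>The matrix factors as lower unipotent, diagonal, upper unipotent; \<open>r\<close>
  absorbs the first factor and turns the second into a scalar.\<close>

lemma fn_big_cell:
  assumes A: "mat2 a b c e \<in> SLK" and a: "a \<noteq> 0" and w: "w \<in> V"
  shows "fn r (Rp (mat2 a b c e) w) = a ^ M * poly (pw w) (b / a)"
proof -
  have "mat2 a b c e = low (c / a) * (torus a * up (b / a))"
    using A a by (simp add: mat2_in_SL2 torus_mat2 mat2_mult mat2_eq_iff field_simps)
  then have "Rp (mat2 a b c e) w = Rp (low (c / a)) (Rp (torus a) (Rp (up (b / a)) w))"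
    using a by (simp add: Rp_mult SLK_mult low_SLK up_SLK torus_SLK)
  then show ?thesis using a by (simp add: r_low Rp_in r_torus pw[OF w])
qed

text \<open>Right multiplication by \<open>low y\<close> turns the zero corner into
  \<open>b * y\<close>, so elements outside the big cell are reached from inside along a polynomial
  curve.\<close>

lemma translate_low:
  fixes b c e :: 'k
  assumes "mat2 0 b c e \<in> SLK"
  shows "poly_curve (\<lambda>y. mat2 (b * y) b (c + e * y) e)" "b \<noteq> 0"
    "mat2 (b * y) b (c + e * y) e \<in> SLK"
proof -
  show "b \<noteq> 0" using assms by (auto simp: mat2_in_SL2)
  show *: "mat2 (b * y) b (c + e * y) e \<in> SLK" for y
    using assms by (simp add: mat2_in_SL2 algebra_simps)
  have entries: "\<exists>P. \<forall>y. b * y = poly P y" "\<exists>P. \<forall>y. c + e * y = poly P y"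
    by (rule exI[of _ "[:0, b:]"] exI[of _ "[:c, e:]"]; simp add: mult.commute)+
  have const: "\<exists>P. \<forall>y. z = poly P (y :: 'k)" for z by (rule exI[of _ "[:z:]"]) simp
  show "poly_curve (\<lambda>y. mat2 (b * y) b (c + e * y) e)"
    unfolding poly_curve_def
  proof (intro conjI allI impI *)
    fix i j :: nat assume "i < 2" "j < 2"
    then consider "i = 0" "j = 0" | "i = 0" "j = Suc 0" | "i = Suc 0" "j = 0" | "i = Suc 0" "j = Suc 0"
      by linarith
    then show "\<exists>P. \<forall>y. mat2 (b * y) b (c + e * y) e $$ (i, j) = poly P y"
      by cases (simp_all only: mat2_index entries const[of b] const[of e])
  qed
qed

text \<open>The vectors whose orbit is killed by \<open>fn r\<close> form a submodule without
  \<open>v\<close>, hence zero. If \<open>pw w\<close> vanishes, then \<open>fn r\<close> kills the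
  translates by the big cell, and the curves of \<open>translate_low\<close> extend this to the
  whole group.\<close>

lemma pw_eq_0:
  assumes w: "w \<in> V" and pw_0': "pw w = 0"
  shows "w = 0"
proof -
  define K where "K = {w \<in> V. \<forall>A\<in>SLK. fn r (Rp A w) = 0}"
  have "K = {0} \<or> K = V"
  proof (rule simple_dichotomy)
    show "K \<subseteq> V" by (auto simp: K_def)
    show "0 \<in> K" by (auto simp: K_def V_def lin_0[OF lin_Rp] fn_0)
    show "u + v \<in> K" if "u \<in> K" "v \<in> K" for u v
      using that by (auto simp: K_def V_def lin_add[OF lin_Rp] fn_add)
    show "scl c u \<in> K" if "u \<in> K" for c u
      using that by (auto simp: K_def V_def lin_scl[OF lin_Rp] fn_scl)
    show "Rp A u \<in> K" if "A \<in> SLK" "u \<in> K" for A u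
      using that by (auto simp: K_def Rp_in Rp_mult[symmetric] SLK_mult)
  qed
  moreover have "v \<notin> K"
  proof -
    have "1\<^sub>m 2 \<in> (SLK :: 'k mat set)" by (simp add: mat2_one mat2_in_SL2)
    then show ?thesis using r_v Rp_one[OF v_in] unfolding K_def by (auto intro!: bexI[of _ "1\<^sub>m 2"])
  qed
  ultimately have K: "K = {0}" using v_in by blast
  have big: "fn r (Rp (mat2 a b c e) w) = 0" if "mat2 a b c e \<in> SLK" "a \<noteq> 0" for a b c e
    using fn_big_cell[OF that w] pw_0' by simp
  have "fn r (Rp A w) = 0" if A: "A \<in> SLK" for A
  proof -
    obtain a b c e where abce: "A = mat2 a b c e" using SL2_cases[OF A] by metis
    show ?thesis
    proof (cases "a = 0")
      case True
      then have A0: "mat2 0 b c e \<in> SLK" using A abce by simp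
      obtain P where P: "\<And>y. fn r (Rp (mat2 (b * y) b (c + e * y) e) w) = poly P y"
        using fn_curve[OF translate_low(1)[OF A0]] by metis
      have "P = 0"
      proof (rule poly_eq_nonzero)
        fix y :: 'k assume "y \<noteq> 0"
        then show "poly P y = poly 0 y"
          using big[OF translate_low(3)[OF A0, of y]] translate_low(2)[OF A0] by (simp add: P)
      qed
      then show ?thesis using P[of 0] abce True by simp
    qed (use A abce big in simp)
  qed
  then have "w \<in> K" using w by (simp add: K_def)
  then show ?thesis using K by simp
qed

text \<open>\<open>r\<close> and \<open>v\<close> have the same torus weight, and a monomial of
  positive degree would make them differ.\<close>

lemma pw_v: "pw v = [:fn r v:]"
proof -
  have "coeff (pw v) a = 0" if "a > 0" for a
  proof (rule ccontr)
    assume nz: "coeff (pw v) a \<noteq> 0"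
    have "t powi int M * poly (pw v) (t ^ 2 * y) = t powi int M * poly (pw v) y" if t: "t \<noteq> 0" for t y
    proof -
      have "t ^ M * poly (pw v) y = fn r (Rp (torus t) (Rp (up y) v))"
        by (simp add: r_torus[OF t] pw[OF v_in])
      also have "\<dots> = fn r (Rp (up (t ^ 2 * y)) (Rp (torus t) v))"
        using t by (simp add: Rp_mult[symmetric] torus_SLK up_SLK torus_up)
      also have "\<dots> = t ^ M * poly (pw v) (t ^ 2 * y)"
        by (simp add: v_torus[OF t] lin_scl[OF lin_Rp] fn_scl pw[OF v_in])
      finally show ?thesis unfolding power_int_of_nat by (rule sym)
    qed
    then have "int M + 2 * int a = int M" using nz by (rule scaling_coeff)
    then show False using that by simp
  qed
  then have "pw v = [:coeff (pw v) 0:]" by (intro poly_eqI) (auto simp: coeff_pCons split: nat.split)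
  moreover have "coeff (pw v) 0 = fn r v"
    using pw[OF v_in, of 0] Rp_one[OF v_in] by (simp add: poly_0_coeff_0 mat2_one)
  ultimately show ?thesis by simp
qed

lemma fn_v:
  assumes A: "mat2 a b c e \<in> SLK"
  shows "fn r (Rp (mat2 a b c e) v) = fn r v * a ^ M"
proof (cases "a = 0")
  case True
  then have A0: "mat2 0 b c e \<in> SLK" using A by simp
  obtain P where P: "\<And>y. fn r (Rp (mat2 (b * y) b (c + e * y) e) v) = poly P y"
    using fn_curve[OF translate_low(1)[OF A0]] by metis
  have "P = Polynomial.smult (fn r v) ([:0, b:] ^ M)"
  proof (rule poly_eq_nonzero)
    fix y :: 'k assume "y \<noteq> 0"
    then show "poly P y = poly (Polynomial.smult (fn r v) ([:0, b:] ^ M)) y"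
      using fn_big_cell[OF translate_low(3)[OF A0, of y] _ v_in] translate_low(2)[OF A0]
      by (simp add: P[symmetric] pw_v mult.commute)
  qed
  then show ?thesis using P[of 0] True by simp
next
  case False
  then show ?thesis using fn_big_cell[OF A False v_in] by (simp add: pw_v mult.commute)
qed

text \<open>The corner entry of \<open>up x * mat2 a b c e\<close> is \<open>a + x * c\<close>, so
  \<open>fn_v\<close> turns the orbit of \<open>v\<close> into powers of linear forms.\<close>

lemma pw_orbit:
  assumes A: "mat2 a b c e \<in> SLK"
  shows "pw (Rp (mat2 a b c e) v) = Polynomial.smult (fn r v) ([:a, c:] ^ M)"
proof (rule poly_eq_nonzero)
  fix x :: 'k
  have "poly (pw (Rp (mat2 a b c e) v)) x = fn r (Rp (up x * mat2 a b c e) v)"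
    using A by (simp add: pw[OF Rp_in] Rp_mult up_SLK)
  also have "up x * mat2 a b c e = mat2 (a + x * c) (b + x * e) c e" by (simp add: mat2_mult)
  also have "fn r (Rp \<dots> v) = fn r v * (a + x * c) ^ M"
    using A by (intro fn_v) (simp add: mat2_in_SL2 algebra_simps)
  finally show "poly (pw (Rp (mat2 a b c e) v)) x = poly (Polynomial.smult (fn r v) ([:a, c:] ^ M)) x"
    by simp
qed

text \<open>By \<open>lucas\<close> the exponent \<open>n\<close> is absent from the whole orbit of
  \<open>v\<close>. The vectors with this property form a submodule, which is everything because it
  contains \<open>v\<close>.\<close>

lemma pw_support:
  assumes w: "w \<in> V" and nz: "coeff (pw w) n \<noteq> 0"
  shows "n \<in> val ` Low"
proof (rule ccontr)
  assume n: "n \<notin> val ` Low"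
  define K where "K = {w \<in> V. \<forall>A\<in>SLK. coeff (pw (Rp A w)) n = 0}"
  have "K = {0} \<or> K = V"
  proof (rule simple_dichotomy)
    show "K \<subseteq> V" by (auto simp: K_def)
    show "0 \<in> K" by (auto simp: K_def V_def lin_0[OF lin_Rp] pw_0)
    show "u + v \<in> K" if "u \<in> K" "v \<in> K" for u v
      using that by (auto simp: K_def V_def lin_add[OF lin_Rp] pw_add)
    show "scl c u \<in> K" if "u \<in> K" for c u
      using that by (auto simp: K_def V_def lin_scl[OF lin_Rp] pw_scl)
    show "Rp A u \<in> K" if "A \<in> SLK" "u \<in> K" for A u
      using that by (auto simp: K_def Rp_in Rp_mult[symmetric] SLK_mult)
  qed
  moreover have "v \<in> K"
  proof -
    have "coeff (pw (Rp A v)) n = 0" if A: "A \<in> SLK" for A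
    proof -
      obtain a b c e where abce: "A = mat2 a b c e" using SL2_cases[OF A] by metis
      have "of_nat (M choose n) = (0 :: 'k)" using lucas[OF md_0, of n] n by blast
      then show ?thesis using A by (simp add: abce pw_orbit coeff_linear_power)
    qed
    then show ?thesis using v_in by (simp add: K_def)
  qed
  moreover have "v \<noteq> 0" using r_v fn_0 by auto
  ultimately have "w \<in> K" using w by auto
  moreover have "1\<^sub>m 2 \<in> (SLK :: 'k mat set)" by (simp add: mat2_one mat2_in_SL2)
  ultimately have "coeff (pw (Rp (1\<^sub>m 2) w)) n = 0" by (simp add: K_def)
  then show False using nz Rp_one[OF w] by simp
qed

lemma exists_preimage:
  assumes b: "b \<in> Low"
  shows "\<exists>w\<in>V. pw w = monom (ifact b) (val b)"
proof -
  define n where "n = val b"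
  obtain g where g: "\<And>c i. i < d \<Longrightarrow> Rp (low c) v i = poly (g i) c" using Rp_curve[OF low_curve] by metis
  \<comment> \<open>The coefficient of \<open>c ^ n\<close> in the curve
    \<open>Rp (low c) v\<close>; from \<open>(1 + x * c) ^ M\<close> it isolates the monomial
    \<open>x ^ n\<close>.\<close>
  define u where "u = (\<lambda>i. if i < d then coeff (g i) n else 0)"
  have u: "u \<in> V" by (simp add: u_def V_def fsupp_def)
  have "pw u = monom (fn r v * of_nat (M choose n)) n"
  proof (rule poly_eq_nonzero)
    fix x :: 'k
    have "(\<Sum>j<d. Polynomial.smult (poly (cj j) x) (g j)) = Polynomial.smult (fn r v) ([:1, x:] ^ M)"
    proof (rule poly_eq_nonzero)
      fix c :: 'k
      have "poly (\<Sum>j<d. Polynomial.smult (poly (cj j) x) (g j)) c = poly (pw (Rp (low c) v)) x"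
        by (simp add: poly_sum pw_def g mult.commute)
      also have "\<dots> = fn r v * (1 + x * c) ^ M"
        using pw_orbit[OF low_SLK, of c] by (simp add: mult.commute)
      finally show "poly (\<Sum>j<d. Polynomial.smult (poly (cj j) x) (g j)) c =
        poly (Polynomial.smult (fn r v) ([:1, x:] ^ M)) c" by (simp add: mult.commute)
    qed
    from arg_cong[OF this, of "\<lambda>P. coeff P n"]
    have "(\<Sum>j<d. poly (cj j) x * u j) = fn r v * of_nat (M choose n) * x ^ n"
      by (simp add: coeff_sum coeff_linear_power u_def mult.assoc)
    then show "poly (pw u) x = poly (monom (fn r v * of_nat (M choose n)) n) x"
      by (simp add: pw_def poly_sum poly_monom mult.commute)
  qed
  moreover have "fn r v * of_nat (M choose n) \<noteq> 0"
    using lucas[OF md_0, of n] b r_v by (auto simp: n_def)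
  ultimately have "pw (scl (ifact b / (fn r v * of_nat (M choose n))) u) = monom (ifact b) (val b)"
    by (simp add: pw_scl smult_monom n_def)
  moreover have "scl (ifact b / (fn r v * of_nat (M choose n))) u \<in> V"
    using u unfolding V_def by (rule fsupp_scl)
  ultimately show ?thesis by blast
qed

definition wv :: "(nat \<Rightarrow> nat) \<Rightarrow> (nat \<Rightarrow> 'k)" where
  "wv b = (SOME w. w \<in> V \<and> pw w = monom (ifact b) (val b))"

definition kap :: "(nat \<Rightarrow> nat) \<Rightarrow> (nat \<Rightarrow> 'k) \<Rightarrow> 'k" where
  "kap b w = (if b \<in> Low then coeff (pw w) (val b) / ifact b else 0)"

lemma wv: "b \<in> Low \<Longrightarrow> wv b \<in> V" "b \<in> Low \<Longrightarrow> pw (wv b) = monom (ifact b) (val b)"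
  using someI_ex[of "\<lambda>w. w \<in> V \<and> pw w = monom (ifact b) (val b)"] exists_preimage[of b]
  unfolding wv_def by blast+

lemma Low_Box: "b \<in> Low \<Longrightarrow> b \<in> Box"
  by (simp add: Low_def)

lemma finite_Low: "finite Low"
  by (rule finite_subset[OF _ finite_Box]) (auto simp: Low_Box)

lemma kap_wv: "b \<in> Low \<Longrightarrow> c \<in> Low \<Longrightarrow> kap b (wv c) = (if b = c then 1 else 0)"
  using ifact_ne_0[OF Low_Box] val_inj[OF Low_Box Low_Box] by (auto simp: kap_def wv)

lemma kap_add: "kap b (u + w) = kap b u + kap b w"
  by (simp add: kap_def pw_add add_divide_distrib)

lemma kap_scl: "kap b (scl c w) = c * kap b w"
  by (simp add: kap_def pw_scl)

lemma pw_expand: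
  assumes w: "w \<in> V"
  shows "pw w = (\<Sum>b\<in>Low. monom (kap b w * ifact b) (val b))"
proof (rule poly_eqI)
  fix n
  have "coeff (\<Sum>b\<in>Low. monom (kap b w * ifact b) (val b)) n = (\<Sum>b\<in>Low. if val b = n then coeff (pw w) n else 0)"
    using ifact_ne_0[OF Low_Box] by (auto simp: coeff_sum kap_def intro!: sum.cong)
  also have "\<dots> = coeff (pw w) n"
  proof (cases "n \<in> val ` Low")
    case True
    then obtain b where b: "b \<in> Low" "n = val b" by auto
    have "(\<Sum>b\<in>Low. if val b = n then coeff (pw w) n else 0) = (\<Sum>c\<in>Low. if c = b then coeff (pw w) n else 0)"
      using b val_inj[OF Low_Box Low_Box] by (intro sum.cong refl) auto
    then show ?thesis using b finite_Low by simp
  next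
    case False
    then have "coeff (pw w) n = 0" using pw_support[OF w] by blast
    then show ?thesis by simp
  qed
  finally show "coeff (pw w) n = coeff (\<Sum>b\<in>Low. monom (kap b w * ifact b) (val b)) n" by simp
qed

lemma expand:
  assumes w: "w \<in> V"
  shows "w = (\<Sum>b\<in>Low. scl (kap b w) (wv b))"
proof -
  define u where "u = w + scl (- 1) (\<Sum>b\<in>Low. scl (kap b w) (wv b))"
  have sum_in: "(\<Sum>b\<in>Low. scl (kap b w) (wv b)) \<in> V"
    using wv(1) unfolding V_def by (intro fsupp_sum fsupp_scl)
  have "u \<in> V" unfolding u_def using w sum_in unfolding V_def by (intro fsupp_add fsupp_scl)
  moreover have "pw u = 0"
  proof -
    have "pw (\<Sum>b\<in>Low. scl (kap b w) (wv b)) = pw w"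
      unfolding pw_expand[OF w] pw_sum by (intro sum.cong refl) (simp add: pw_scl wv smult_monom)
    then show ?thesis by (simp add: u_def pw_add pw_scl)
  qed
  ultimately have "u = 0" by (rule pw_eq_0)
  then have "w - (\<Sum>b\<in>Low. scl (kap b w) (wv b)) = 0"
    by (simp add: u_def fun_eq_iff)
  then show ?thesis by simp
qed

lemma poly_pw:
  assumes w: "w \<in> V"
  shows "poly (pw w) x = (\<Sum>b\<in>Box. kap b w * ee b x)"
proof -
  have "poly (pw w) x = (\<Sum>b\<in>Low. kap b w * ee b x)"
    by (subst pw_expand[OF w]) (simp add: poly_sum poly_monom ee_def mult.assoc)
  also have "\<dots> = (\<Sum>b\<in>Box. kap b w * ee b x)"
    using finite_Box Low_Box by (intro sum.mono_neutral_left) (auto simp: kap_def)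
  finally show ?thesis .
qed

text \<open>In the polynomial model the matrix substitutes \<open>(y + x / t) / t\<close> for
  \<open>x\<close> and multiplies by \<open>t ^ M\<close>; expanding with \<open>ee_add\<close>
  gives the formula of \<open>ka\<close> in multidegree zero. So the coordinates \<open>kap\<close>
  identify the module with index \<open>0\<close> of the resolution.\<close>

lemma kap_borel:
  assumes t: "t \<noteq> 0" and w: "w \<in> V"
  shows "kap c (Rp (mat2 t y 0 (inverse t)) w) =
    t powi wt (\<lambda>_. 0) c * (\<Sum>b\<in>Box. ee b (y / t) * kap (\<lambda>i. c i + b i) w)"
proof -
  define B where "B c = (\<Sum>b\<in>Box. ee b (y / t) * kap (\<lambda>i. c i + b i) w)" for c
  have S: "mat2 t y 0 (inverse t) \<in> SLK" using t by (simp add: mat2_in_SL2)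
  have wt: "t powi wt (\<lambda>_. 0) c = t ^ M * (inverse t ^ 2) ^ val c" for c
    using powi_wt_add[OF t, of "\<lambda>_. 0" "\<lambda>_. 0" c] by (simp add: wt_def val_0 cval_def cc_def)
  have not_Low: "B c = 0" if "c \<notin> Low" for c
  proof -
    have "(\<lambda>i. c i + b i) \<notin> Low" for b
      using that Box_mono[of "\<lambda>i. c i + b i" c] by (auto simp: Low_def dest: add_leD1)
    then show ?thesis by (simp add: B_def kap_def)
  qed
  have "pw (Rp (mat2 t y 0 (inverse t)) w) =
    (\<Sum>c\<in>Low. monom (t powi wt (\<lambda>_. 0) c * B c * ifact c) (val c))"
  proof (rule poly_eq_nonzero)
    fix x :: 'k
    have "poly (pw (Rp (mat2 t y 0 (inverse t)) w)) x = fn r (Rp (up x * mat2 t y 0 (inverse t)) w)"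
      using S by (simp add: pw[OF Rp_in] Rp_mult up_SLK)
    also have "up x * mat2 t y 0 (inverse t) = mat2 t (y + x / t) 0 (inverse t)"
      by (simp add: mat2_mult divide_inverse)
    also have "fn r (Rp \<dots> w) = t ^ M * poly (pw w) ((y + x / t) / t)"
      using t w by (intro fn_big_cell) (simp_all add: mat2_in_SL2)
    also have "(y + x / t) / t = y / t + inverse t ^ 2 * x"
      using t by (simp add: field_simps power2_eq_square)
    also have "poly (pw w) \<dots> = (\<Sum>c\<in>Box. (\<Sum>b\<in>below c. ee b (y / t) * ee (\<lambda>i. c i - b i) (inverse t ^ 2 * x)) * kap c w)"
      unfolding poly_pw[OF w] by (intro sum.cong refl) (simp add: ee_add mult.commute)
    also have "\<dots> = (\<Sum>b\<in>Box. \<Sum>c\<in>Box. ee b (y / t) * ee c (inverse t ^ 2 * x) * kap (\<lambda>i. b i + c i) w)"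
      by (rule convolution[symmetric]) (auto simp: kap_def Low_Box)
    also have "\<dots> = (\<Sum>c\<in>Box. ee c (inverse t ^ 2 * x) * B c)"
      by (subst sum.swap) (simp add: B_def sum_distrib_left mult_ac add.commute)
    also have "\<dots> = (\<Sum>c\<in>Low. ee c (inverse t ^ 2 * x) * B c)"
      using finite_Box Low_Box not_Low by (intro sum.mono_neutral_right) auto
    also have "t ^ M * \<dots> = (\<Sum>c\<in>Low. t powi wt (\<lambda>_. 0) c * B c * ifact c * x ^ val c)"
      unfolding wt sum_distrib_left ee_scale ee_def[of _ x] by (simp only: mult_ac)
    finally show "poly (pw (Rp (mat2 t y 0 (inverse t)) w)) x =
      poly (\<Sum>c\<in>Low. monom (t powi wt (\<lambda>_. 0) c * B c * ifact c) (val c)) x"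
      by (simp add: poly_sum poly_monom)
  qed
  then have "coeff (pw (Rp (mat2 t y 0 (inverse t)) w)) (val c) = t powi wt (\<lambda>_. 0) c * B c * ifact c" if "c \<in> Low" for c
    using that finite_Low val_inj[OF Low_Box Low_Box] by (simp add: coeff_sum cong: if_cong)
  then have "kap c (Rp (mat2 t y 0 (inverse t)) w) = t powi wt (\<lambda>_. 0) c * B c"
    using not_Low[of c] ifact_ne_0[OF Low_Box] by (simp add: kap_def)
  then show ?thesis by (simp add: B_def)
qed

end

section \<open>The finite group and its Borel subgroup\<close>

lemma mat2_assoc:
  fixes A B C :: "'a::field mat"
  assumes "A \<in> carrier (SL2 K)" "B \<in> carrier (SL2 K)" "C \<in> carrier (SL2 K)"
  shows "A * B * C = A * (B * C)"
  using assms by (intro assoc_mult_mat[of A 2 2 B 2 C 2]) (auto simp: SL2_def)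

context finite_field
begin

definition G :: "'k mat monoid" where "G = SL2 F"

lemma G_simps: "mult G = (*)" "one G = 1\<^sub>m 2" "carrier G = carrier (SL2 F)"
  by (simp_all add: G_def SL2_def)

lemma mat2_in_G: "mat2 a b c e \<in> carrier G \<longleftrightarrow> a \<in> F \<and> b \<in> F \<and> c \<in> F \<and> e \<in> F \<and> a * e - b * c = 1"
  by (simp add: G_def mat2_in_SL2)

lemma G_cases:
  assumes "A \<in> carrier G"
  obtains a b c e where "A = mat2 a b c e" "a \<in> F" "b \<in> F" "c \<in> F" "e \<in> F" "a * e - b * c = 1"
  using assms SL2_cases unfolding G_def by blast

lemma adjugate_in_G: "mat2 a b c e \<in> carrier G \<Longrightarrow> mat2 e (- b) (- c) a \<in> carrier G"
  by (auto simp: mat2_in_G F_minus algebra_simps)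

lemma adjugate_mult: "a * e - b * c = (1 :: 'k) \<Longrightarrow> mat2 e (- b) (- c) a * mat2 a b c e = 1\<^sub>m 2"
  by (auto simp: mat2_mult mat2_one mat2_eq_iff algebra_simps)

lemma group_G: "group G"
proof (rule groupI)
  show "x \<otimes>\<^bsub>G\<^esub> y \<in> carrier G" if xG: "x \<in> carrier G" and yG: "y \<in> carrier G" for x y
  proof -
    obtain a b c e where x: "x = mat2 a b c e" and xF: "a \<in> F" "b \<in> F" "c \<in> F" "e \<in> F" "a * e - b * c = 1"
      using xG by (rule G_cases)
    obtain a' b' c' e' where y: "y = mat2 a' b' c' e'" and yF: "a' \<in> F" "b' \<in> F" "c' \<in> F" "e' \<in> F" "a' * e' - b' * c' = 1"
      using yG by (rule G_cases)
    have "(a * a' + b * c') * (c * b' + e * e') - (a * b' + b * e') * (c * a' + e * c') =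
      (a * e - b * c) * (a' * e' - b' * c')"
      by (simp add: algebra_simps)
    then show ?thesis
      using xF yF by (simp add: G_simps(1) x y mat2_mult mat2_in_G F_add F_mult)
  qed
  show "\<one>\<^bsub>G\<^esub> \<in> carrier G" by (simp add: G_simps(2) mat2_one mat2_in_G F_0 F_1)
  show "x \<otimes>\<^bsub>G\<^esub> y \<otimes>\<^bsub>G\<^esub> z = x \<otimes>\<^bsub>G\<^esub> (y \<otimes>\<^bsub>G\<^esub> z)"
    if "x \<in> carrier G" "y \<in> carrier G" "z \<in> carrier G" for x y z
    using that mat2_assoc[of x F y z] by (simp add: G_simps)
  show "\<one>\<^bsub>G\<^esub> \<otimes>\<^bsub>G\<^esub> x = x" if "x \<in> carrier G" for x
    using that by (rule G_cases) (simp add: G_simps mat2_one mat2_mult)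
  show "\<exists>y\<in>carrier G. y \<otimes>\<^bsub>G\<^esub> x = \<one>\<^bsub>G\<^esub>" if x: "x \<in> carrier G" for x
  proof -
    obtain a b c e where abce: "x = mat2 a b c e" "a * e - b * c = 1" using G_cases[OF x] by metis
    then show ?thesis
      using x adjugate_in_G adjugate_mult by (intro bexI[of _ "mat2 e (- b) (- c) a"]) (auto simp: G_simps)
  qed
qed

sublocale G: group G by (rule group_G)

lemma inv_G: "mat2 a b c e \<in> carrier G \<Longrightarrow> inv\<^bsub>G\<^esub> mat2 a b c e = mat2 e (- b) (- c) a"
proof -
  assume A: "mat2 a b c e \<in> carrier G"
  then have "mat2 e (- b) (- c) a \<otimes>\<^bsub>G\<^esub> mat2 a b c e = \<one>\<^bsub>G\<^esub>"
    using adjugate_mult[of a e b c] by (simp add: G_simps(1,2) mat2_in_G)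
  then show ?thesis using A adjugate_in_G[OF A] by (rule G.inv_equality)
qed

lemma finite_G: "finite (carrier G)"
proof -
  have "carrier G \<subseteq> (\<lambda>(a, b, c, e). mat2 a b c e) ` (F \<times> F \<times> F \<times> F)"
    by (rule subsetI, erule G_cases) (auto simp: image_iff)
  then show ?thesis by (rule finite_subset) (simp add: finite_F)
qed

definition Bor :: "'k mat set" where "Bor = {A \<in> carrier G. A $$ (1, 0) = 0}"

lemma Bor_cases:
  assumes "A \<in> Bor"
  obtains t y where "A = mat2 t y 0 (inverse t)" "t \<in> units" "y \<in> F"
proof -
  have A: "A \<in> carrier G" using assms by (simp add: Bor_def)
  obtain a b c e where *: "A = mat2 a b c e" "a \<in> F" "b \<in> F" "a * e - b * c = 1"
    using G_cases[OF A] by metis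
  have c: "c = 0" using assms *(1) by (simp add: Bor_def)
  then have "a \<noteq> 0" "e = inverse a" using *(4) by (auto simp: inverse_unique)
  then show ?thesis using that[of a b] * c by (simp add: units_def)
qed

lemma mat2_in_Bor: "mat2 t y 0 (inverse t) \<in> Bor \<longleftrightarrow> t \<in> units \<and> y \<in> F"
  by (auto simp: Bor_def mat2_in_G units_def F_inverse F_0)

lemma mat2_in_Bor': "mat2 a b c e \<in> carrier G \<Longrightarrow> mat2 a b c e \<in> Bor \<longleftrightarrow> c = 0"
  by (simp add: Bor_def)

lemma units_mult: "x \<in> units \<Longrightarrow> y \<in> units \<Longrightarrow> x * y \<in> units"
  by (simp add: units_def F_mult)

lemma units_inverse: "x \<in> units \<Longrightarrow> inverse x \<in> units"
  by (simp add: units_def F_inverse)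

lemma units_F: "x \<in> units \<Longrightarrow> x \<in> F" and units_0: "x \<in> units \<Longrightarrow> x \<noteq> 0" and units_1: "1 \<in> units"
  using F_1 by (simp_all add: units_def)

lemma subgroup_Bor: "subgroup Bor G"
proof (rule G.subgroupI)
  show "Bor \<subseteq> carrier G" by (auto simp: Bor_def)
  have "mat2 1 0 0 (inverse 1) \<in> Bor" using units_1 F_0 unfolding mat2_in_Bor by simp
  then show "Bor \<noteq> {}" by blast
  show "inv\<^bsub>G\<^esub> A \<in> Bor" if A: "A \<in> Bor" for A
  proof -
    obtain t y where t: "A = mat2 t y 0 (inverse t)" "t \<in> units" "y \<in> F" using A by (rule Bor_cases)
    have "A \<in> carrier G" using A by (simp add: Bor_def)
    then have "inv\<^bsub>G\<^esub> A = mat2 (inverse t) (- y) 0 (inverse (inverse t))" by (simp add: t(1) inv_G)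
    then show ?thesis using t by (simp only: mat2_in_Bor units_inverse F_minus)
  qed
  show "A \<otimes>\<^bsub>G\<^esub> A' \<in> Bor" if AB: "A \<in> Bor" and AB': "A' \<in> Bor" for A A'
  proof -
    obtain t y where t: "A = mat2 t y 0 (inverse t)" "t \<in> units" "y \<in> F" using AB by (rule Bor_cases)
    obtain t' y' where t': "A' = mat2 t' y' 0 (inverse t')" "t' \<in> units" "y' \<in> F" using AB' by (rule Bor_cases)
    have "A \<otimes>\<^bsub>G\<^esub> A' = mat2 (t * t') (t * y' + y * inverse t') 0 (inverse (t * t'))"
      by (simp add: G_simps t(1) t'(1) mat2_mult)
    then show ?thesis
      using t t' by (simp only: mat2_in_Bor units_mult units_F F_add F_mult units_inverse)
  qed
qed

definition Tor :: "'k mat set" where "Tor = (\<lambda>t. mat2 t 0 0 (inverse t)) ` units"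
definition Uni :: "'k mat set" where "Uni = (\<lambda>y. mat2 1 y 0 1) ` F"
definition weyl :: "'k mat" where "weyl = mat2 0 1 (- 1) 0"

lemma card_Tor: "card Tor = card units"
  unfolding Tor_def by (rule card_image) (auto simp: inj_on_def mat2_eq_iff)

lemma card_Uni: "card Uni = q"
  unfolding Uni_def card_F[symmetric] by (rule card_image) (auto simp: inj_on_def mat2_eq_iff)

lemma Tor_Bor: "Tor \<subseteq> Bor"
  using F_0 by (auto simp: Tor_def mat2_in_Bor)

lemma Uni_Bor: "Uni \<subseteq> Bor"
  using mat2_in_Bor[of 1] units_1 by (auto simp: Uni_def)

lemma weyl_G: "weyl \<in> carrier G"
  by (simp add: weyl_def mat2_in_G F_0 F_1 F_minus)

lemma bij_Tor_Uni: "bij_betw (\<lambda>(t, u). t \<otimes>\<^bsub>G\<^esub> u) (Tor \<times> Uni) Bor"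
proof -
  have mult: "mat2 t 0 0 (inverse t) \<otimes>\<^bsub>G\<^esub> mat2 1 y 0 1 = mat2 t (t * y) 0 (inverse t)" for t y
    by (simp add: G_simps mat2_mult)
  show ?thesis
    unfolding bij_betw_def
  proof
    show "inj_on (\<lambda>(t, u). t \<otimes>\<^bsub>G\<^esub> u) (Tor \<times> Uni)"
      by (auto simp: inj_on_def Tor_def Uni_def mult mat2_eq_iff units_0)
    show "(\<lambda>(t, u). t \<otimes>\<^bsub>G\<^esub> u) ` (Tor \<times> Uni) = Bor"
    proof
      show "(\<lambda>(t, u). t \<otimes>\<^bsub>G\<^esub> u) ` (Tor \<times> Uni) \<subseteq> Bor"
        by (auto simp: Tor_def Uni_def mult mat2_in_Bor F_mult units_F)
      show "Bor \<subseteq> (\<lambda>(t, u). t \<otimes>\<^bsub>G\<^esub> u) ` (Tor \<times> Uni)"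
      proof
        fix A assume "A \<in> Bor"
        then obtain t y where t: "A = mat2 t y 0 (inverse t)" "t \<in> units" "y \<in> F" by (rule Bor_cases)
        have "A = mat2 t 0 0 (inverse t) \<otimes>\<^bsub>G\<^esub> mat2 1 (y / t) 0 1"
          using units_0[OF t(2)] by (simp add: mult t(1))
        moreover have "mat2 1 (y / t) 0 1 \<in> Uni" using t units_F F_divide by (auto simp: Uni_def)
        moreover have "mat2 t 0 0 (inverse t) \<in> Tor" using t by (auto simp: Tor_def)
        ultimately show "A \<in> (\<lambda>(t, u). t \<otimes>\<^bsub>G\<^esub> u) ` (Tor \<times> Uni)" by force
      qed
    qed
  qed
qed

lemma Uni_weyl: "(\<lambda>u. u \<otimes>\<^bsub>G\<^esub> weyl) ` Uni = (\<lambda>y. mat2 (- y) 1 (- 1) 0) ` F"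
  by (auto simp: Uni_def weyl_def G_simps mat2_mult image_image)

lemma one_notin_big_cell: "\<one>\<^bsub>G\<^esub> \<notin> (\<lambda>u. u \<otimes>\<^bsub>G\<^esub> weyl) ` Uni"
  unfolding Uni_weyl by (auto simp: G_simps mat2_one mat2_eq_iff)

text \<open>A left coset of \<open>Bor\<close> is a first column up to scalars, that is, a point of
  the projective line: the identity stands for \<open>c = 0\<close>, and the ratio
  \<open>a / c\<close> labels the other cosets.\<close>

lemma bruhat:
  assumes A: "A \<in> carrier G"
  shows "\<exists>!x. x \<in> insert \<one>\<^bsub>G\<^esub> ((\<lambda>u. u \<otimes>\<^bsub>G\<^esub> weyl) ` Uni) \<and> inv\<^bsub>G\<^esub> x \<otimes>\<^bsub>G\<^esub> A \<in> Bor"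
proof -
  obtain a b c e where abce: "A = mat2 a b c e" "a \<in> F" "c \<in> F" "a * e - b * c = 1"
    using G_cases[OF A] by metis
  have one: "inv\<^bsub>G\<^esub> \<one>\<^bsub>G\<^esub> \<otimes>\<^bsub>G\<^esub> A \<in> Bor \<longleftrightarrow> c = 0"
    using A mat2_in_Bor'[of a b c e] by (simp add: abce(1))
  have cell: "inv\<^bsub>G\<^esub> mat2 (- y) 1 (- 1) 0 \<otimes>\<^bsub>G\<^esub> A \<in> Bor \<longleftrightarrow> a = y * c" if y: "y \<in> F" for y
  proof -
    have in_G: "mat2 (- y) 1 (- 1) 0 \<in> carrier G" using y by (simp add: mat2_in_G F_0 F_1 F_minus)
    have "inv\<^bsub>G\<^esub> mat2 (- y) 1 (- 1) 0 \<otimes>\<^bsub>G\<^esub> A = mat2 (- c) (- e) (a - y * c) (b - y * e)"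
      by (simp add: inv_G[OF in_G] abce(1)) (simp add: G_simps mat2_mult)
    moreover have "inv\<^bsub>G\<^esub> mat2 (- y) 1 (- 1) 0 \<otimes>\<^bsub>G\<^esub> A \<in> carrier G" using in_G A by simp
    ultimately show ?thesis using mat2_in_Bor' by simp
  qed
  show ?thesis
  proof (cases "c = 0")
    case True
    then have "a \<noteq> 0" using abce(4) by auto
    then show ?thesis
      unfolding Uni_weyl using True one cell by (intro ex1I[of _ "\<one>\<^bsub>G\<^esub>"]) auto
  next
    case False
    then have "inv\<^bsub>G\<^esub> mat2 (- (a / c)) 1 (- 1) 0 \<otimes>\<^bsub>G\<^esub> A \<in> Bor"
      using cell[of "a / c"] abce F_divide by simp
    moreover have "y = a / c" if "a = y * c" for y using False that by simp
    ultimately show ?thesis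
      unfolding Uni_weyl using False one cell abce F_divide
      by (intro ex1I[of _ "mat2 (- (a / c)) 1 (- 1) 0"]) auto
  qed
qed

end

section \<open>Augmentations, and the comparison applied to the simple module\<close>

context hw_module
begin

definition aug :: "('k mat list \<times> nat \<Rightarrow> 'k) \<Rightarrow> 'k coeffs" where
  "aug \<Phi> = (\<lambda>(j, c). if j = (\<lambda>_. 0) then kap c (\<lambda>i. \<Phi> ([], i)) else 0)"

definition aug' :: "'k coeffs \<Rightarrow> ('k mat list \<times> nat \<Rightarrow> 'k)" where
  "aug' f = (\<lambda>(L, i). if L = [] then (\<Sum>b\<in>Low. f (\<lambda>_. 0, b) * wv b i) else 0)"

lemma F_SLK: "A \<in> carrier G \<Longrightarrow> A \<in> SLK"
  by (auto simp: G_def SL2_def)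

sublocale rep: group_representation G "{..<d}" Rp
proof unfold_locales
  show "finite (carrier G)" by (rule finite_G)
  show "lin (Rp g)" for g by (rule lin_Rp)
  show "Rp g v \<in> fsupp {..<d}" for g v using Rp_in by (simp add: V_def)
  show "Rp \<one>\<^bsub>G\<^esub> v = v" if "v \<in> fsupp {..<d}" for v
    using Rp_one that by (simp add: G_simps V_def)
  show "Rp (g \<otimes>\<^bsub>G\<^esub> h) v = Rp g (Rp h v)" if "g \<in> carrier G" "h \<in> carrier G" for g h v
    using Rp_mult[OF F_SLK F_SLK, of g h v] that by (simp add: G_simps)
qed

lemma lin_aug: "lin aug"
proof (rule linI; rule ext; clarify)
  fix u w :: "'k mat list \<times> nat \<Rightarrow> 'k" and j c x
  show "aug (u + w) (j, c) = (aug u + aug w) (j, c)"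
    using kap_add[of c "\<lambda>i. u ([], i)" "\<lambda>i. w ([], i)"] by (simp add: aug_def plus_fun_def)
  show "aug (scl x u) (j, c) = scl x (aug u) (j, c)"
    using kap_scl[of c x "\<lambda>i. u ([], i)"] by (simp add: aug_def scl_def)
qed

lemma lin_aug': "lin aug'"
  by (rule linI; rule ext; clarify)
    (simp_all add: aug'_def distrib_right sum.distrib sum_distrib_left mult.assoc)

lemma kos_resolution_Bor:
  "equiv_resolution (G\<lparr>carrier := Bor\<rparr>) kos_X kos_d kos_s (\<lambda>h. ka (h $$ (0, 0)) (h $$ (0, 1))) kth"
proof (rule kos_resolution)
  show grp: "group (G\<lparr>carrier := Bor\<rparr>)"
    by (rule subgroup.subgroup_is_group[OF subgroup_Bor group_G])
  show "bij_betw (\<lambda>h. (h $$ (0, 0), h $$ (0, 1))) (carrier (G\<lparr>carrier := Bor\<rparr>)) (units \<times> F)"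
  proof (rule bij_betwI[where g = "\<lambda>(t, y). mat2 t y 0 (inverse t)"])
    show "(\<lambda>h. (h $$ (0, 0), h $$ (0, 1))) \<in> carrier (G\<lparr>carrier := Bor\<rparr>) \<rightarrow> units \<times> F"
      by (auto elim!: Bor_cases)
    show "(\<lambda>(t, y). mat2 t y 0 (inverse t)) \<in> units \<times> F \<rightarrow> carrier (G\<lparr>carrier := Bor\<rparr>)"
      by (auto simp: mat2_in_Bor)
    show "(case (h $$ (0, 0), h $$ (0, 1)) of (t, y) \<Rightarrow> mat2 t y 0 (inverse t)) = h"
      if "h \<in> carrier (G\<lparr>carrier := Bor\<rparr>)" for h
      using that by (auto elim!: Bor_cases)
  qed auto
  show "\<one>\<^bsub>G\<lparr>carrier := Bor\<rparr>\<^esub> $$ (0, 0) = 1" "\<one>\<^bsub>G\<lparr>carrier := Bor\<rparr>\<^esub> $$ (0, 1) = 0"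
    by (simp_all add: G_simps)
  fix g assume g: "g \<in> carrier (G\<lparr>carrier := Bor\<rparr>)"
  then obtain t y where t: "g = mat2 t y 0 (inverse t)" "t \<in> units" "y \<in> F" by (auto elim!: Bor_cases)
  have gG: "g \<in> carrier G" using g by (simp add: Bor_def)
  have "inv\<^bsub>G\<lparr>carrier := Bor\<rparr>\<^esub> g = mat2 (inverse t) (- y) 0 t"
    using G.m_inv_consistent[OF subgroup_Bor, of g] g gG by (simp add: inv_G t(1))
  then show "(inv\<^bsub>G\<lparr>carrier := Bor\<rparr>\<^esub> g) $$ (0, 0) = inverse (g $$ (0, 0))"
    "(inv\<^bsub>G\<lparr>carrier := Bor\<rparr>\<^esub> g) $$ (0, 1) = - (g $$ (0, 1))"
    by (simp_all add: t(1))
  fix h assume h: "h \<in> carrier (G\<lparr>carrier := Bor\<rparr>)"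
  then obtain t' y' where t': "h = mat2 t' y' 0 (inverse t')" "t' \<in> units" "y' \<in> F" by (auto elim!: Bor_cases)
  show "(g \<otimes>\<^bsub>G\<lparr>carrier := Bor\<rparr>\<^esub> h) $$ (0, 0) = g $$ (0, 0) * h $$ (0, 0)"
    "(g \<otimes>\<^bsub>G\<lparr>carrier := Bor\<rparr>\<^esub> h) $$ (0, 1) = g $$ (0, 0) * h $$ (0, 1) + g $$ (0, 1) / h $$ (0, 0)"
    by (simp_all add: G_simps t(1) t'(1) mat2_mult divide_inverse)
qed

lemma aug_in: "x \<in> fsupp (rep.bar_X 0) \<Longrightarrow> aug x \<in> fsupp (kos_X 0)"
  by (rule fsuppI) (auto simp: aug_def kap_def split: if_splits)

lemma aug'_in: "aug' y \<in> fsupp (rep.bar_X 0)"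
proof -
  have "wv b i = 0" if "b \<in> Low" "\<not> i < d" for b i
    using VD[OF wv(1)[OF that(1)] that(2)] .
  then show ?thesis by (auto simp: aug'_def fsupp_def rep.bar_X_def intro!: sum.neutral)
qed

lemma aug_act:
  assumes b: "b \<in> Bor" and x: "x \<in> fsupp (rep.bar_X 0)"
  shows "aug (rep.bar_act b x) = ka (b $$ (0, 0)) (b $$ (0, 1)) (aug x)"
proof (rule ext, clarify)
  fix j c
  obtain t y where t: "b = mat2 t y 0 (inverse t)" "t \<in> units" using b by (rule Bor_cases)
  have w: "(\<lambda>i. x ([], i)) \<in> V" using rep.bar_supp[OF x] by (simp add: V_def)
  show "aug (rep.bar_act b x) (j, c) = ka (b $$ (0, 0)) (b $$ (0, 1)) (aug x) (j, c)"
  proof (cases "j = (\<lambda>_. 0)")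
    case True
    have "rep.bar_act b x ([], i) = Rp b (\<lambda>i. x ([], i)) i" for i
      by (simp add: rep.bar_act_def)
    then show ?thesis
      using kap_borel[OF units_0[OF t(2)] w, of c y] by (simp add: aug_def ka_def True t(1))
  qed (simp add: aug_def ka_def)
qed

lemma aug'_aug:
  assumes x: "x \<in> fsupp (rep.bar_X 0)"
  shows "aug' (aug x) = x"
proof (rule ext, clarify)
  fix L i
  have w: "(\<lambda>i. x ([], i)) \<in> V" using rep.bar_supp[OF x] by (simp add: V_def)
  show "aug' (aug x) (L, i) = x (L, i)"
  proof (cases "L = []")
    case True
    then show ?thesis
      using fun_cong[OF expand[OF w], of i] by (simp add: aug'_def aug_def sum_fun_apply)
  next
    case False
    then show ?thesis using rep.bar_supp_0[OF x, of L i] by (simp add: aug'_def)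
  qed
qed

lemma aug_aug':
  assumes y: "y \<in> fsupp (kos_X 0)"
  shows "aug (aug' y) = y"
proof (rule ext, clarify)
  fix j c
  have kap_sum: "kap c (\<Sum>b\<in>S. u b) = (\<Sum>b\<in>S. kap c (u b))" for S :: "(nat \<Rightarrow> nat) set" and u
    using sum_comp_morphism[of "kap c" u S] kap_add by (simp add: o_def kap_def pw_0)
  have eq: "(\<lambda>i. aug' y ([], i)) = (\<Sum>b\<in>Low. scl (y (\<lambda>_. 0, b)) (wv b))"
    by (simp add: aug'_def fun_eq_iff sum_fun_apply)
  show "aug (aug' y) (j, c) = y (j, c)"
  proof (cases "j = (\<lambda>_. 0) \<and> c \<in> Low")
    case True
    have "kap c (\<lambda>i. aug' y ([], i)) = (\<Sum>b\<in>Low. if b = c then y (\<lambda>_. 0, c) else 0)"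
      unfolding eq kap_sum kap_scl using True by (intro sum.cong refl) (simp add: kap_wv)
    then show ?thesis using True finite_Low by (simp add: aug_def)
  next
    case False
    then have "y (j, c) = 0" using fsuppD[OF y, of "(j, c)"] by auto
    then show ?thesis using False by (auto simp: aug_def kap_def)
  qed
qed

sublocale coh: bruhat_pair G "{..<d}" Rp Bor kos_X kos_d kos_s "\<lambda>h. ka (h $$ (0, 0)) (h $$ (0, 1))" kth
  Tor Uni weyl aug aug'
proof (intro bruhat_pair.intro bruhat_pair_axioms.intro)
  show "group_representation G {..<d} Rp" by (rule rep.group_representation_axioms)
  show "equiv_resolution (G\<lparr>carrier := Bor\<rparr>) kos_X kos_d kos_s (\<lambda>h. ka (h $$ (0, 0)) (h $$ (0, 1))) kth"
    by (rule kos_resolution_Bor)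
  show "subgroup Bor G" by (rule subgroup_Bor)
  show "weyl \<in> carrier G" by (rule weyl_G)
  show "bij_betw (\<lambda>(t, u). t \<otimes>\<^bsub>G\<^esub> u) (Tor \<times> Uni) Bor" by (rule bij_Tor_Uni)
  show "Tor \<subseteq> Bor" by (rule Tor_Bor)
  show "Uni \<subseteq> Bor" by (rule Uni_Bor)
  show "of_nat (card Tor) = (- 1 :: 'k)" by (simp add: card_Tor of_nat_card_units)
  show "of_nat (card Uni) = (0 :: 'k)" by (simp add: card_Uni of_nat_q)
  show "\<exists>!c. c \<in> insert \<one>\<^bsub>G\<^esub> ((\<lambda>u. u \<otimes>\<^bsub>G\<^esub> weyl) ` Uni) \<and> inv\<^bsub>G\<^esub> c \<otimes>\<^bsub>G\<^esub> g \<in> Bor"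
    if "g \<in> carrier G" for g using that by (rule bruhat)
  show "\<one>\<^bsub>G\<^esub> \<notin> (\<lambda>u. u \<otimes>\<^bsub>G\<^esub> weyl) ` Uni" by (rule one_notin_big_cell)
  show "lin aug" "lin aug'" by (rule lin_aug lin_aug')+
  show "aug x \<in> fsupp (kos_X 0)" if "x \<in> fsupp (rep.bar_X 0)" for x using that by (rule aug_in)
  show "aug' y \<in> fsupp (rep.bar_X 0)" for y by (rule aug'_in)
  show "aug (rep.bar_act b x) = ka (b $$ (0, 0)) (b $$ (0, 1)) (aug x)"
    if "b \<in> Bor" "x \<in> fsupp (rep.bar_X 0)" for b x using that by (rule aug_act)
  show "aug' (aug x) = x" if "x \<in> fsupp (rep.bar_X 0)" for x using that by (rule aug'_aug)
  show "aug (aug' y) = y" if "y \<in> fsupp (kos_X 0)" for y using that by (rule aug_aug')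
  show "kos_d (Suc n) y = 0"
    if "y \<in> fsupp (kos_X (Suc n))" and inv: "\<And>b. b \<in> Bor \<Longrightarrow> ka (b $$ (0, 0)) (b $$ (0, 1)) y = y" for y n
  proof (rule kos_minimal[OF that(1)])
    fix z assume "z \<in> F"
    then have "mat2 1 z 0 1 \<in> Bor" using mat2_in_Bor[of 1 z] units_1 by simp
    from inv[OF this] show "ka 1 z y = y" by simp
  qed
qed

end

section \<open>Dimensions of the cohomology groups\<close>

text \<open>The cosets of \<open>N\<close> are the fibres of \<open>\<Lambda>\<close>, so the
  quotient is a copy of \<open>fsupp X\<close> and inherits the vector space axioms from there, not
  from \<open>M\<close>. The hypothesis \<open>diff\<close> plays the part of subtraction in
  \<open>M\<close>.\<close>

lemma quotient_module_dim:
  fixes M :: "('k::field, 'v) module" and \<Lambda> :: "'v \<Rightarrow> ('x \<Rightarrow> 'k)"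
  assumes add: "\<And>x y. x \<in> carrier M \<Longrightarrow> y \<in> carrier M \<Longrightarrow> x \<oplus>\<^bsub>M\<^esub> y \<in> carrier M \<and> \<Lambda> (x \<oplus>\<^bsub>M\<^esub> y) = \<Lambda> x + \<Lambda> y"
    and smult: "\<And>a x. x \<in> carrier M \<Longrightarrow> a \<odot>\<^bsub>M\<^esub> x \<in> carrier M \<and> \<Lambda> (a \<odot>\<^bsub>M\<^esub> x) = scl a (\<Lambda> x)"
    and diff: "\<And>x y. x \<in> carrier M \<Longrightarrow> y \<in> carrier M \<Longrightarrow> \<exists>z\<in>carrier M. x = z \<oplus>\<^bsub>M\<^esub> y"
    and im: "\<Lambda> ` carrier M = fsupp X" and X: "finite X"
    and N: "N = {x \<in> carrier M. \<Lambda> x = 0}"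
  shows "vectorspace.dim class_ring (quotient_module M N) = card X"
proof -
  define Q where "Q = quotient_module M N"
  define fib where "fib u = {x \<in> carrier M. \<Lambda> x = u}" for u
  have ne: "fib u \<noteq> {}" if "u \<in> fsupp X" for u
    using that by (auto simp: fib_def simp flip: im)
  have fib_eq: "fib u = fib v \<longleftrightarrow> u = v" if "u \<in> fsupp X" for u v
    using ne[OF that] by (auto simp: fib_def)
  have diff': "\<exists>z. z \<in> fib (\<Lambda> x - \<Lambda> y) \<and> x = z \<oplus>\<^bsub>M\<^esub> y" if xy: "x \<in> carrier M" "y \<in> carrier M" for x y
  proof -
    obtain z where z: "z \<in> carrier M" "x = z \<oplus>\<^bsub>M\<^esub> y" using diff[OF xy] by blast
    then show ?thesis using add[OF z(1) xy(2)] by (auto simp: fib_def)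
  qed
  have fib_add: "fib u <+>\<^bsub>M\<^esub> fib v = fib (u + v)" if v: "v \<in> fsupp X" for u v
  proof
    show "fib u <+>\<^bsub>M\<^esub> fib v \<subseteq> fib (u + v)" using add by (auto simp: fib_def set_add_def')
    show "fib (u + v) \<subseteq> fib u <+>\<^bsub>M\<^esub> fib v"
    proof
      fix x assume x: "x \<in> fib (u + v)"
      obtain y where y: "y \<in> fib v" using ne[OF v] by blast
      have "x \<in> carrier M" "y \<in> carrier M" using x y by (auto simp: fib_def)
      from diff'[OF this] obtain z where "z \<in> fib (\<Lambda> x - \<Lambda> y)" "x = z \<oplus>\<^bsub>M\<^esub> y" by blast
      then show "x \<in> fib u <+>\<^bsub>M\<^esub> fib v" using x y by (auto simp: fib_def set_add_def')
    qed
  qed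
  have N_fib: "N = fib 0" by (simp add: N fib_def)
  have fib_smult: "N <+>\<^bsub>M\<^esub> ((\<lambda>x. a \<odot>\<^bsub>M\<^esub> x) ` fib u) = fib (scl a u)" if u: "u \<in> fsupp X" for a u
  proof
    show "N <+>\<^bsub>M\<^esub> ((\<lambda>x. a \<odot>\<^bsub>M\<^esub> x) ` fib u) \<subseteq> fib (scl a u)"
      using add smult by (auto simp: fib_def set_add_def' N)
    show "fib (scl a u) \<subseteq> N <+>\<^bsub>M\<^esub> ((\<lambda>x. a \<odot>\<^bsub>M\<^esub> x) ` fib u)"
    proof
      fix x assume x: "x \<in> fib (scl a u)"
      obtain y where y: "y \<in> fib u" using ne[OF u] by blast
      have "x \<in> carrier M" "a \<odot>\<^bsub>M\<^esub> y \<in> carrier M" using x y smult by (auto simp: fib_def)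
      from diff'[OF this] obtain z where
        "z \<in> fib (\<Lambda> x - \<Lambda> (a \<odot>\<^bsub>M\<^esub> y))" "x = z \<oplus>\<^bsub>M\<^esub> (a \<odot>\<^bsub>M\<^esub> y)" by blast
      then show "x \<in> N <+>\<^bsub>M\<^esub> ((\<lambda>x. a \<odot>\<^bsub>M\<^esub> x) ` fib u)"
        using x y smult[of y a] by (auto simp: fib_def N set_add_def')
    qed
  qed
  have coset: "N +>\<^bsub>M\<^esub> y = fib (\<Lambda> y)" if y: "y \<in> carrier M" for y
  proof
    show "N +>\<^bsub>M\<^esub> y \<subseteq> fib (\<Lambda> y)" using add y by (auto simp: fib_def N a_r_coset_def')
    show "fib (\<Lambda> y) \<subseteq> N +>\<^bsub>M\<^esub> y"
    proof
      fix x assume x: "x \<in> fib (\<Lambda> y)"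
      have "x \<in> carrier M" using x by (auto simp: fib_def)
      from diff'[OF this y] obtain z where "z \<in> fib (\<Lambda> x - \<Lambda> y)" "x = z \<oplus>\<^bsub>M\<^esub> y" by blast
      then show "x \<in> N +>\<^bsub>M\<^esub> y" using x by (auto simp: fib_def N a_r_coset_def')
    qed
  qed
  have "a_rcosets\<^bsub>M\<^esub> N = fib ` \<Lambda> ` carrier M"
    using coset by (auto simp: A_RCOSETS_def')
  then have carr: "carrier Q = fib ` fsupp X"
    by (simp add: Q_def quotient_module_def im)
  have zeroQ: "\<zero>\<^bsub>Q\<^esub> = fib 0" by (simp add: Q_def quotient_module_def N_fib)
  have addQ: "fib u \<oplus>\<^bsub>Q\<^esub> fib v = fib (u + v)" if "v \<in> fsupp X" for u v
    using fib_add[OF that] by (simp add: Q_def quotient_module_def)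
  have smultQ: "a \<odot>\<^bsub>Q\<^esub> fib u = fib (scl a u)" if "u \<in> fsupp X" for a u
    using fib_smult[OF that] by (simp add: Q_def quotient_module_def)
  have S: "(0 :: 'x \<Rightarrow> 'k) \<in> fsupp X" "u + v \<in> fsupp X" "scl a u \<in> fsupp X" "- u \<in> fsupp X"
    if "u \<in> fsupp X" "v \<in> fsupp X" for u v :: "'x \<Rightarrow> 'k" and a
    using that by (auto simp: fsupp_def)
  have S0: "(0 :: 'x \<Rightarrow> 'k) \<in> fsupp X" by (simp add: fsupp_def)
  have vsQ: "vectorspace class_ring Q"
  proof (rule vs_criteria[OF class_field]; (intro allI ballI impI)?; (elim conjE)?)
    show "\<zero>\<^bsub>Q\<^esub> \<in> carrier Q" using S0 by (simp add: zeroQ carr)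
    fix v w x assume vwx: "v \<in> carrier Q" "w \<in> carrier Q"
    show "v \<oplus>\<^bsub>Q\<^esub> w \<in> carrier Q" using vwx S by (auto simp: carr addQ)
    show "v \<oplus>\<^bsub>Q\<^esub> w = w \<oplus>\<^bsub>Q\<^esub> v" using vwx by (auto simp: carr addQ add.commute)
    assume "x \<in> carrier Q"
    then show "v \<oplus>\<^bsub>Q\<^esub> w \<oplus>\<^bsub>Q\<^esub> x = v \<oplus>\<^bsub>Q\<^esub> (w \<oplus>\<^bsub>Q\<^esub> x)" using vwx S by (auto simp: carr addQ add.assoc)
  next
    fix a v w assume vw: "v \<in> carrier Q" "w \<in> carrier Q"
    show "a \<odot>\<^bsub>Q\<^esub> (v \<oplus>\<^bsub>Q\<^esub> w) = a \<odot>\<^bsub>Q\<^esub> v \<oplus>\<^bsub>Q\<^esub> a \<odot>\<^bsub>Q\<^esub> w"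
      using vw S by (auto simp: carr addQ smultQ scl_def plus_fun_def distrib_left)
  next
    fix v assume "v \<in> carrier Q"
    then obtain u where u: "v = fib u" "u \<in> fsupp X" by (auto simp: carr)
    show "\<exists>neg_v\<in>carrier Q. v \<oplus>\<^bsub>Q\<^esub> neg_v = \<zero>\<^bsub>Q\<^esub>"
      using u S by (intro bexI[of _ "fib (- u)"]) (simp_all add: addQ zeroQ carr)
    show "v \<oplus>\<^bsub>Q\<^esub> \<zero>\<^bsub>Q\<^esub> = v" using u S0 by (simp add: addQ zeroQ)
    show "\<one>\<^bsub>class_ring\<^esub> \<odot>\<^bsub>Q\<^esub> v = v" using u by (simp add: smultQ)
    fix a b :: 'k
    show "a \<odot>\<^bsub>Q\<^esub> v \<in> carrier Q" using u S by (simp add: smultQ carr)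
    show "(a \<otimes>\<^bsub>class_ring\<^esub> b) \<odot>\<^bsub>Q\<^esub> v = a \<odot>\<^bsub>Q\<^esub> (b \<odot>\<^bsub>Q\<^esub> v)"
      using u S by (simp add: smultQ) (simp add: scl_def mult.assoc)
    show "(a \<oplus>\<^bsub>class_ring\<^esub> b) \<odot>\<^bsub>Q\<^esub> v = a \<odot>\<^bsub>Q\<^esub> v \<oplus>\<^bsub>Q\<^esub> b \<odot>\<^bsub>Q\<^esub> v"
      using u S by (simp add: smultQ addQ) (simp add: scl_def plus_fun_def distrib_right)
  qed
  define n where "n = card X"
  obtain h where h: "bij_betw h X {..<n}"
    using X ex_bij_betw_finite_nat[OF X] by (auto simp: n_def atLeast0LessThan)
  define fv where "fv w = (\<lambda>x. if x \<in> X then w $ h x else 0)" for w :: "'k vec"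
  have hn: "h x < n" if "x \<in> X" for x using h that by (auto simp: bij_betw_def)
  have fv_in: "fv w \<in> fsupp X" for w by (simp add: fv_def fsupp_def)
  interpret V: vec_space "TYPE('k)" n .
  interpret L: linear_map class_ring "module_vec TYPE('k) n" Q "fib \<circ> fv"
  proof (intro linear_map.intro mod_hom.intro mod_hom_axioms.intro V.vectorspace_axioms vsQ vec_module
      vectorspace.axioms(1)[OF vsQ])
    have "fv (v + w) = fv v + fv w" if "v \<in> carrier_vec n" "w \<in> carrier_vec n" for v w
      using that hn by (auto simp: fv_def fun_eq_iff)
    moreover have "fv (a \<cdot>\<^sub>v v) = scl a (fv v)" if "v \<in> carrier_vec n" for a v
      using that hn by (auto simp: fv_def fun_eq_iff)
    ultimately show "fib \<circ> fv \<in> LinearCombinations.module_hom class_ring (module_vec TYPE('k) n) Q"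
      unfolding LinearCombinations.module_hom_def
      by (auto simp: module_vec_simps addQ smultQ fv_in carr)
  qed
  have inj: "inj_on (fib \<circ> fv) (carrier (module_vec TYPE('k) n))"
  proof (rule inj_onI)
    fix v w assume vw: "v \<in> carrier (module_vec TYPE('k) n)" "w \<in> carrier (module_vec TYPE('k) n)"
      and "(fib \<circ> fv) v = (fib \<circ> fv) w"
    then have eq: "fv v = fv w" by (simp add: fib_eq fv_in)
    show "v = w"
    proof (rule eq_vecI)
      fix i assume "i < dim_vec w"
      then have "i \<in> h ` X" using vw h by (simp add: module_vec_simps bij_betw_def)
      then obtain x where "x \<in> X" "h x = i" by blast
      then show "v $ i = w $ i" using fun_cong[OF eq, of x] by (simp add: fv_def)
    qed (use vw in \<open>simp add: module_vec_simps\<close>)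
  qed
  have surj: "(fib \<circ> fv) ` carrier (module_vec TYPE('k) n) = carrier Q"
  proof
    show "(fib \<circ> fv) ` carrier (module_vec TYPE('k) n) \<subseteq> carrier Q" using fv_in by (auto simp: carr)
    show "carrier Q \<subseteq> (fib \<circ> fv) ` carrier (module_vec TYPE('k) n)"
    proof
      fix v assume "v \<in> carrier Q"
      then obtain u where u: "v = fib u" "u \<in> fsupp X" by (auto simp: carr)
      have "fv (vec n (\<lambda>i. u (the_inv_into X h i))) = u"
        using u(2) hn h by (auto simp: fv_def fun_eq_iff fsupp_def the_inv_into_f_f bij_betw_def)
      then show "v \<in> (fib \<circ> fv) ` carrier (module_vec TYPE('k) n)"
        using u(1) by (intro image_eqI[of _ _ "vec n (\<lambda>i. u (the_inv_into X h i))"]) (simp_all add: module_vec_simps)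
    qed
  qed
  have "vectorspace.dim class_ring (module_vec TYPE('k) n) = vectorspace.dim class_ring Q"
    by (rule L.dim_eq[OF V.fin_dim inj surj])
  then show ?thesis using V.dim_is_n by (simp add: Q_def n_def)
qed

section \<open>Inhomogeneous cochains as invariants of the bar complex\<close>

lemma merge_at_1: "merge_at G (Suc 0) (h # g # L) = (h \<otimes>\<^bsub>G\<^esub> g) # L"
  by (simp add: merge_at_def)

lemma merge_at_Suc: "i \<ge> 1 \<Longrightarrow> merge_at G (Suc i) (h # L) = h # merge_at G i L"
  by (cases i) (simp_all add: merge_at_def)

text \<open>The first merge is the term \<open>i = 1\<close>; all others happen in the tail, one
  position and one sign later.\<close>

lemma bar_d_merge_at:
  fixes \<phi> :: "'g list \<Rightarrow> 'k::comm_ring_1"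
  shows "bar_d (mult G) \<phi> (h # L) =
    (\<Sum>i\<in>{1..length L}. (-1) ^ (i - 1) * \<phi> (merge_at G i (h # L))) + (-1) ^ length L * \<phi> (butlast (h # L))"
proof (induction L arbitrary: h \<phi>)
  case Nil
  show "bar_d (mult G) \<phi> (h # []) =
    (\<Sum>i\<in>{1..length []}. (-1) ^ (i - 1) * \<phi> (merge_at G i (h # []))) + (-1) ^ length [] * \<phi> (butlast (h # []))"
    by simp
next
  case (Cons g L)
  have IH: "bar_d (mult G) (\<lambda>L. \<phi> (h # L)) (g # L) =
    (\<Sum>i\<in>{1..length L}. (-1) ^ (i - 1) * \<phi> (h # merge_at G i (g # L))) + (-1) ^ length L * \<phi> (h # butlast (g # L))"
    by (rule Cons.IH)
  have "(\<Sum>i\<in>{1..length (g # L)}. (-1) ^ (i - 1) * \<phi> (merge_at G i (h # g # L))) =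
    \<phi> ((h \<otimes>\<^bsub>G\<^esub> g) # L) + (\<Sum>i\<in>{1..length L}. (-1) ^ i * \<phi> (merge_at G (Suc i) (h # g # L)))"
    by (simp add: sum.atLeast_Suc_atMost sum.shift_bounds_cl_Suc_ivl merge_at_1 del: sum.cl_ivl_Suc)
  also have "(\<Sum>i\<in>{1..length L}. (-1) ^ i * \<phi> (merge_at G (Suc i) (h # g # L))) =
    - (\<Sum>i\<in>{1..length L}. (-1) ^ (i - 1) * \<phi> (h # merge_at G i (g # L)))"
    unfolding sum_negf[symmetric]
  proof (intro sum.cong refl)
    fix i assume "i \<in> {1..length L}"
    then show "(-1) ^ i * \<phi> (merge_at G (Suc i) (h # g # L)) = - ((-1) ^ (i - 1) * \<phi> (h # merge_at G i (g # L)))"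
      by (cases i) (simp_all add: merge_at_Suc)
  qed
  finally show "bar_d (mult G) \<phi> (h # g # L) =
    (\<Sum>i\<in>{1..length (g # L)}. (-1) ^ (i - 1) * \<phi> (merge_at G i (h # g # L))) +
      (-1) ^ length (g # L) * \<phi> (butlast (h # g # L))"
    by (simp add: IH)
qed

lemma (in group) merge_at_tuples:
  assumes "gs \<in> tuples G (Suc n)" "i \<in> {1..n}"
  shows "merge_at G i gs \<in> tuples G n"
proof -
  have gs: "set gs \<subseteq> carrier G" "length gs = Suc n" using assms(1) by (auto simp: tuples_def)
  have "gs ! (i - 1) \<in> carrier G" "gs ! i \<in> carrier G"
    using assms(2) gs by (auto intro!: subsetD[OF gs(1)] nth_mem)
  then have "gs ! (i - 1) \<otimes> gs ! i \<in> carrier G" by (rule m_closed)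
  moreover have "set (take (i - 1) gs) \<subseteq> carrier G" "set (drop (i + 1) gs) \<subseteq> carrier G"
    using set_take_subset[of "i - 1" gs] set_drop_subset[of "i + 1" gs] gs(1) by blast+
  ultimately show ?thesis
    using assms(2) gs(2) by (simp add: tuples_def merge_at_def) arith
qed

lemma butlast_tuples: "gs \<in> tuples G (Suc n) \<Longrightarrow> butlast gs \<in> tuples G n"
  by (auto simp: tuples_def dest: in_set_butlastD)

definition coords :: "'k::field vec \<Rightarrow> (nat \<Rightarrow> 'k)" where
  "coords v = (\<lambda>i. if i < dim_vec v then v $ i else 0)"

lemma coords_add: "v \<in> carrier_vec d \<Longrightarrow> w \<in> carrier_vec d \<Longrightarrow> coords (v + w) = coords v + coords w"
  by (auto simp: coords_def fun_eq_iff)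

lemma coords_smult: "coords (a \<cdot>\<^sub>v v) = scl a (coords v)"
  by (auto simp: coords_def fun_eq_iff)

lemma coords_vec: "w \<in> fsupp {..<d} \<Longrightarrow> coords (vec d w) = w"
  by (auto simp: coords_def fun_eq_iff fsupp_def)

lemma vec_coords: "v \<in> carrier_vec d \<Longrightarrow> vec d (coords v) = v"
  by (auto simp: coords_def)

lemma coords_finsum:
  fixes u :: "'i \<Rightarrow> 'k::field vec"
  assumes "finite S" "u \<in> S \<rightarrow> carrier_vec d"
  shows "finsum (module_vec TYPE('k) d) u S \<in> carrier_vec d"
    and "coords (finsum (module_vec TYPE('k) d) u S) = (\<Sum>i\<in>S. coords (u i))"
proof -
  interpret vec_space "TYPE('k)" d .
  show c: "finsum (module_vec TYPE('k) d) u S \<in> carrier_vec d"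
    using finsum_closed[of u S] assms by simp
  show "coords (finsum (module_vec TYPE('k) d) u S) = (\<Sum>i\<in>S. coords (u i))"
  proof (rule ext)
    fix k
    have "dim_vec (u i) = d" if "i \<in> S" for i using assms that by (intro carrier_vecD) blast
    moreover have "dim_vec (finsum (module_vec TYPE('k) d) u S) = d" using c by simp
    ultimately show "coords (finsum (module_vec TYPE('k) d) u S) k = (\<Sum>i\<in>S. coords (u i)) k"
      using index_finsum_vec[OF assms(1) _ assms(2), of k] by (simp add: coords_def sum_fun_apply cong: sum.cong)
  qed
qed

lemma coords_alternate:
  fixes v :: "'k::field vec"
  assumes "v \<in> carrier_vec d"
  shows "alternate (module_vec TYPE('k) d) i v \<in> carrier_vec d"
    and "coords (alternate (module_vec TYPE('k) d) i v) k = (-1) ^ i * coords v k"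
proof -
  interpret vec_space "TYPE('k)" d .
  show "alternate (module_vec TYPE('k) d) i v \<in> carrier_vec d"
    "coords (alternate (module_vec TYPE('k) d) i v) k = (-1) ^ i * coords v k"
    using assms vec_neg[OF assms] by (auto simp: alternate_def coords_def)
qed

context hw_module
begin

abbreviation LM :: "('k, 'k vec) module" where "LM \<equiv> module_vec TYPE('k) d"
abbreviation cobd where "cobd \<equiv> coboundary G LM (\<lambda>A v. \<rho> A *\<^sub>v v)"

text \<open>Inhomogeneous cochains correspond to the homogeneous cochains that are invariant under the
  group; the argument \<open>[g\<^sub>0, g\<^sub>1, \<dots>]\<close> of the latter stands for the tuple
  \<open>(g\<^sub>0, g\<^sub>0 g\<^sub>1, \<dots>)\<close>.\<close>

definition bar_of :: "nat \<Rightarrow> ('k mat list \<Rightarrow> 'k vec) \<Rightarrow> ('k mat list \<times> nat \<Rightarrow> 'k)" where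
  "bar_of n \<phi> = (\<lambda>(L, i). if L \<in> tuples G (Suc n) then Rp (hd L) (coords (\<phi> (tl L))) i else 0)"

lemma coch: "carrier (cochains G LM n) = tuples G n \<rightarrow>\<^sub>E carrier_vec d"
  by (simp add: cochains_def module_vec_simps)

lemma cochD: "\<phi> \<in> carrier (cochains G LM n) \<Longrightarrow> L \<in> tuples G n \<Longrightarrow> \<phi> L \<in> carrier_vec d"
  by (auto simp: coch)

lemma coords_in: "x \<in> carrier_vec d \<Longrightarrow> coords x \<in> V"
  by (auto simp: V_def fsupp_def coords_def)

lemma bar_of_Cons:
  "g \<in> carrier G \<Longrightarrow> L \<in> tuples G n \<Longrightarrow> bar_of n \<phi> (g # L, i) = Rp g (coords (\<phi> L)) i"
  by (simp add: bar_of_def)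

lemma bar_of_one:
  "\<phi> \<in> carrier (cochains G LM n) \<Longrightarrow> L \<in> tuples G n \<Longrightarrow> bar_of n \<phi> (\<one>\<^bsub>G\<^esub> # L, i) = coords (\<phi> L) i"
  using Rp_one[OF coords_in[OF cochD]] by (simp add: bar_of_Cons G_simps(2)[symmetric])

lemma bar_of_in: "bar_of n \<phi> \<in> fsupp (rep.bar_X (Suc n))"
  using Rp_in by (intro rep.in_bar_X) (auto simp: bar_of_def fun_eq_iff V_def)

lemma bar_of_invariant:
  assumes \<phi>: "\<phi> \<in> carrier (cochains G LM n)"
  shows "coh.invariant (carrier G) (bar_of n \<phi>)"
  unfolding coh.invariant_def
proof
  fix g assume g: "g \<in> carrier G"
  show "rep.bar_act g (bar_of n \<phi>) = bar_of n \<phi>"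
  proof (rule rep.bar_ext[OF rep.bar_act_in[OF g bar_of_in] bar_of_in])
    fix L i assume "L \<in> tuples G (Suc n)"
    then obtain x L' where L: "L = x # L'" "x \<in> carrier G" "L' \<in> tuples G n"
      by (cases L) auto
    have w: "coords (\<phi> L') \<in> fsupp {..<d}" using coords_in[OF cochD[OF \<phi> L(3)]] by (simp add: V_def)
    have "rep.bar_act g (bar_of n \<phi>) (L, i) = Rp g (Rp (inv\<^bsub>G\<^esub> g \<otimes>\<^bsub>G\<^esub> x) (coords (\<phi> L'))) i"
      using g L by (simp add: rep.bar_act_apply[OF g] bar_of_Cons)
    also have "\<dots> = Rp (g \<otimes>\<^bsub>G\<^esub> (inv\<^bsub>G\<^esub> g \<otimes>\<^bsub>G\<^esub> x)) (coords (\<phi> L')) i"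
      using g L w by (simp add: rep.R_mult)
    also have "g \<otimes>\<^bsub>G\<^esub> (inv\<^bsub>G\<^esub> g \<otimes>\<^bsub>G\<^esub> x) = x" using g L by (simp flip: G.m_assoc)
    finally show "rep.bar_act g (bar_of n \<phi>) (L, i) = bar_of n \<phi> (L, i)"
      using L by (simp add: bar_of_Cons)
  qed
qed

text \<open>The action by its first entry carries any list to one that starts with the
  identity.\<close>

lemma invariant_eqI:
  assumes "\<Phi> \<in> fsupp (rep.bar_X (Suc n))" "coh.invariant (carrier G) \<Phi>"
    and "\<Psi> \<in> fsupp (rep.bar_X (Suc n))" "coh.invariant (carrier G) \<Psi>"
    and "\<And>L i. L \<in> tuples G n \<Longrightarrow> \<Phi> (\<one>\<^bsub>G\<^esub> # L, i) = \<Psi> (\<one>\<^bsub>G\<^esub> # L, i)"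
  shows "\<Phi> = \<Psi>"
proof (rule rep.bar_ext[OF assms(1,3)])
  fix L i assume "L \<in> tuples G (Suc n)"
  then obtain x L' where L: "L = x # L'" "x \<in> carrier G" "L' \<in> tuples G n"
    by (cases L) auto
  have "\<Phi> (L, i) = rep.bar_act x \<Phi> (L, i)" "\<Psi> (L, i) = rep.bar_act x \<Psi> (L, i)"
    using assms(2,4) L(2) by (simp_all add: coh.invariant_def)
  then show "\<Phi> (L, i) = \<Psi> (L, i)"
    using L assms(5)[OF L(3)] by (simp add: rep.bar_act_apply[OF L(2)])
qed

lemma bar_of_surj:
  assumes \<Phi>: "\<Phi> \<in> fsupp (rep.bar_X (Suc n))" and inv: "coh.invariant (carrier G) \<Phi>"
  shows "\<exists>\<phi>\<in>carrier (cochains G LM n). bar_of n \<phi> = \<Phi>"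
proof
  define \<phi> where "\<phi> = (\<lambda>L\<in>tuples G n. vec d (\<lambda>i. \<Phi> (\<one>\<^bsub>G\<^esub> # L, i)))"
  show \<phi>: "\<phi> \<in> carrier (cochains G LM n)" by (simp add: coch \<phi>_def)
  show "bar_of n \<phi> = \<Phi>"
  proof (rule invariant_eqI[OF bar_of_in bar_of_invariant[OF \<phi>] \<Phi> inv])
    fix L i assume L: "L \<in> tuples G n"
    then show "bar_of n \<phi> (\<one>\<^bsub>G\<^esub> # L, i) = \<Phi> (\<one>\<^bsub>G\<^esub> # L, i)"
      using bar_of_one[OF \<phi> L, of i] coords_vec[OF rep.bar_supp[OF \<Phi>, of "\<one>\<^bsub>G\<^esub> # L"]] by (simp add: \<phi>_def)
  qed
qed

lemma bar_of_inj:
  assumes "\<phi> \<in> carrier (cochains G LM n)" "\<psi> \<in> carrier (cochains G LM n)" "bar_of n \<phi> = bar_of n \<psi>"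
  shows "\<phi> = \<psi>"
proof (rule PiE_ext)
  show "\<phi> \<in> tuples G n \<rightarrow>\<^sub>E carrier_vec d" "\<psi> \<in> tuples G n \<rightarrow>\<^sub>E carrier_vec d" using assms by (simp_all add: coch)
  fix L assume L: "L \<in> tuples G n"
  have "coords (\<phi> L) = coords (\<psi> L)"
    using bar_of_one[OF assms(1) L] bar_of_one[OF assms(2) L] by (intro ext) (simp add: assms(3))
  then show "\<phi> L = \<psi> L"
    using vec_coords[OF cochD[OF assms(1) L]] vec_coords[OF cochD[OF assms(2) L]] by metis
qed

lemma cochains_add:
  assumes "\<phi> \<in> carrier (cochains G LM n)" "\<psi> \<in> carrier (cochains G LM n)"
  shows "\<phi> \<oplus>\<^bsub>cochains G LM n\<^esub> \<psi> \<in> carrier (cochains G LM n)"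
    and "bar_of n (\<phi> \<oplus>\<^bsub>cochains G LM n\<^esub> \<psi>) = bar_of n \<phi> + bar_of n \<psi>"
proof -
  have eq: "\<phi> \<oplus>\<^bsub>cochains G LM n\<^esub> \<psi> = (\<lambda>L\<in>tuples G n. \<phi> L + \<psi> L)"
    by (simp add: cochains_def module_vec_simps)
  show "\<phi> \<oplus>\<^bsub>cochains G LM n\<^esub> \<psi> \<in> carrier (cochains G LM n)"
    unfolding eq coch using assms by (intro PiE_I) (simp_all add: add_carrier_vec cochD)
  show "bar_of n (\<phi> \<oplus>\<^bsub>cochains G LM n\<^esub> \<psi>) = bar_of n \<phi> + bar_of n \<psi>"
  proof (rule rep.bar_ext)
    show "bar_of n \<phi> + bar_of n \<psi> \<in> fsupp (rep.bar_X (Suc n))"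
      using bar_of_in[of n \<phi>] bar_of_in[of n \<psi>] by (auto simp: fsupp_def)
    fix L i assume "L \<in> tuples G (Suc n)"
    then obtain x L' where L: "L = x # L'" "x \<in> carrier G" "L' \<in> tuples G n"
      by (cases L) auto
    show "bar_of n (\<phi> \<oplus>\<^bsub>cochains G LM n\<^esub> \<psi>) (L, i) = (bar_of n \<phi> + bar_of n \<psi>) (L, i)"
      using coords_add[OF cochD[OF assms(1) L(3)] cochD[OF assms(2) L(3)]] L
      by (simp add: eq bar_of_Cons lin_add[OF lin_Rp])
  qed (rule bar_of_in)
qed

lemma cochains_smult:
  assumes "\<phi> \<in> carrier (cochains G LM n)"
  shows "a \<odot>\<^bsub>cochains G LM n\<^esub> \<phi> \<in> carrier (cochains G LM n)"
    and "bar_of n (a \<odot>\<^bsub>cochains G LM n\<^esub> \<phi>) = scl a (bar_of n \<phi>)"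
proof -
  have eq: "a \<odot>\<^bsub>cochains G LM n\<^esub> \<phi> = (\<lambda>L\<in>tuples G n. a \<cdot>\<^sub>v \<phi> L)"
    by (simp add: cochains_def module_vec_simps)
  show "a \<odot>\<^bsub>cochains G LM n\<^esub> \<phi> \<in> carrier (cochains G LM n)"
    unfolding eq using assms by (auto simp: coch)
  show "bar_of n (a \<odot>\<^bsub>cochains G LM n\<^esub> \<phi>) = scl a (bar_of n \<phi>)"
  proof (rule rep.bar_ext)
    show "scl a (bar_of n \<phi>) \<in> fsupp (rep.bar_X (Suc n))"
      using bar_of_in[of n \<phi>] by (auto simp: fsupp_def)
    fix L i assume "L \<in> tuples G (Suc n)"
    then obtain x L' where L: "L = x # L'" "x \<in> carrier G" "L' \<in> tuples G n"
      by (cases L) auto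
    then show "bar_of n (a \<odot>\<^bsub>cochains G LM n\<^esub> \<phi>) (L, i) = scl a (bar_of n \<phi>) (L, i)"
      by (simp add: eq bar_of_Cons coords_smult lin_scl[OF lin_Rp])
  qed (rule bar_of_in)
qed

lemma cochains_zero:
  "\<zero>\<^bsub>cochains G LM n\<^esub> \<in> carrier (cochains G LM n)" "bar_of n (\<zero>\<^bsub>cochains G LM n\<^esub>) = 0"
proof -
  have eq: "\<zero>\<^bsub>cochains G LM n\<^esub> = (\<lambda>L\<in>tuples G n. 0\<^sub>v d)"
    by (simp add: cochains_def module_vec_simps)
  show c: "\<zero>\<^bsub>cochains G LM n\<^esub> \<in> carrier (cochains G LM n)" unfolding eq by (simp add: coch)
  have c0: "coords (0\<^sub>v d) = 0" by (auto simp: coords_def fun_eq_iff)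
  show "bar_of n (\<zero>\<^bsub>cochains G LM n\<^esub>) = 0"
  proof (rule rep.bar_ext[OF bar_of_in])
    fix L i assume "L \<in> tuples G (Suc n)"
    then obtain x L' where L: "L = x # L'" "x \<in> carrier G" "L' \<in> tuples G n"
      by (cases L) auto
    then show "bar_of n (\<zero>\<^bsub>cochains G LM n\<^esub>) (L, i) = 0 (L, i)"
      by (simp add: eq bar_of_Cons c0 lin_0[OF lin_Rp])
  qed (simp add: fsupp_def)
qed

text \<open>Both sides are invariant, so lists that start with the identity suffice. On these,
  merging the identity with \<open>g\<close> produces the action term, and the other faces are those
  of the inhomogeneous formula, with the sign of the recursion.\<close>

lemma coboundary_bar:
  assumes \<phi>: "\<phi> \<in> carrier (cochains G LM n)"
  shows "cobd n \<phi> \<in> carrier (cochains G LM (Suc n))"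
    and "bar_of (Suc n) (cobd n \<phi>) = rep.bar_diff (Suc n) (bar_of n \<phi>)"
proof -
  interpret W: vec_space "TYPE('k)" d .
  have val: "cobd n \<phi> (g # L) \<in> carrier_vec d \<and>
      coords (cobd n \<phi> (g # L)) k = Rp g (coords (\<phi> L)) k + (\<Sum>i\<in>{1..n}. (-1) ^ i * coords (\<phi> (merge_at G i (g # L))) k)
        + (-1) ^ Suc n * coords (\<phi> (butlast (g # L))) k"
    if g: "g \<in> carrier G" and L: "L \<in> tuples G n" for g L k
  proof -
    have gL: "g # L \<in> tuples G (Suc n)" using g L by simp
    have \<rho>g: "\<rho> g \<in> carrier_mat d d" using rho_carrier[OF F_SLK[OF g]] .
    have c1: "\<rho> g *\<^sub>v \<phi> L \<in> carrier_vec d" using \<rho>g by (intro carrier_vecI) simp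
    have "\<rho> g *\<^sub>v \<phi> L = vec d (Rp g (coords (\<phi> L)))"
      using vec_Rp[OF F_SLK[OF g], of "coords (\<phi> L)"] vec_coords[OF cochD[OF \<phi> L]] by simp
    then have e1: "coords (\<rho> g *\<^sub>v \<phi> L) = Rp g (coords (\<phi> L))"
      using coords_vec[OF Rp_in[unfolded V_def]] by simp
    have m: "\<phi> (merge_at G i (g # L)) \<in> carrier_vec d" if "i \<in> {1..n}" for i
      by (rule cochD[OF \<phi> G.merge_at_tuples[OF gL that]])
    have b: "\<phi> (butlast (g # L)) \<in> carrier_vec d" by (rule cochD[OF \<phi> butlast_tuples[OF gL]])
    define u where "u i = alternate LM i (\<phi> (merge_at G i (g # L)))" for i
    have u_eq: "u = (\<lambda>i. alternate LM i (\<phi> (merge_at G i (g # L))))" by (simp add: u_def fun_eq_iff)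
    have u: "u \<in> {1..n} \<rightarrow> carrier_vec d" using coords_alternate(1)[OF m] by (auto simp: u_def)
    note c2 = coords_finsum(1)[OF _ u] and e2 = coords_finsum(2)[OF _ u]
    note c3 = coords_alternate(1)[OF b, of "Suc n"] and e3 = coords_alternate(2)[OF b, of "Suc n"]
    have "cobd n \<phi> (g # L) = \<rho> g *\<^sub>v \<phi> L + finsum LM u {1..n} + alternate LM (Suc n) (\<phi> (butlast (g # L)))"
      unfolding u_eq using gL by (simp add: coboundary_def module_vec_simps)
    moreover have "coords (\<rho> g *\<^sub>v \<phi> L + finsum LM u {1..n} + alternate LM (Suc n) (\<phi> (butlast (g # L)))) =
        coords (\<rho> g *\<^sub>v \<phi> L) + coords (finsum LM u {1..n}) + coords (alternate LM (Suc n) (\<phi> (butlast (g # L))))"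
      using c1 c2 c3 by (simp add: coords_add)
    ultimately show ?thesis
      using c1 c2 c3 e3 by (simp add: e1 e2 sum_fun_apply u_def coords_alternate(2)[OF m] del: butlast.simps One_nat_def)
  qed
  show c: "cobd n \<phi> \<in> carrier (cochains G LM (Suc n))"
    unfolding coch
  proof (rule PiE_I)
    fix gs assume "gs \<in> tuples G (Suc n)"
    then show "cobd n \<phi> gs \<in> carrier_vec d" using val by (cases gs) auto
  qed (simp add: coboundary_def)
  have inv: "coh.invariant (carrier G) (rep.bar_diff (Suc n) (bar_of n \<phi>))"
    using bar_of_invariant[OF \<phi>] rep.bar_diff_act[OF _ bar_of_in, symmetric] by (simp add: coh.invariant_def)
  show "bar_of (Suc n) (cobd n \<phi>) = rep.bar_diff (Suc n) (bar_of n \<phi>)"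
  proof (rule invariant_eqI[OF bar_of_in bar_of_invariant[OF c] rep.bar_diff_in[OF bar_of_in] inv])
    fix L i assume "L \<in> tuples G (Suc n)"
    then obtain g L' where L: "L = g # L'" "g \<in> carrier G" "L' \<in> tuples G n"
      by (cases L) auto
    have gL: "g # L' \<in> tuples G (Suc n)" "length L' = n" using L by (auto simp: tuples_def)
    have "rep.bar_diff (Suc n) (bar_of n \<phi>) (\<one>\<^bsub>G\<^esub> # L, i) =
        bar_of n \<phi> (g # L', i) - bar_d (mult G) (\<lambda>L. bar_of n \<phi> (\<one>\<^bsub>G\<^esub> # L, i)) (g # L')"
      using L by (simp add: rep.bar_diff_def)
    also have "\<dots> = Rp g (coords (\<phi> L')) i - ((\<Sum>j\<in>{1..n}. (-1) ^ (j - 1) * coords (\<phi> (merge_at G j (g # L'))) i)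
        + (-1) ^ n * coords (\<phi> (butlast (g # L'))) i)"
      using bar_of_one[OF \<phi> G.merge_at_tuples[OF gL(1)], of _ i] bar_of_one[OF \<phi> butlast_tuples[OF gL(1)], of i] L gL(2)
      by (simp add: bar_d_merge_at bar_of_Cons del: butlast.simps)
    also have "\<dots> = coords (cobd n \<phi> L) i"
    proof -
      have "(\<Sum>j\<in>{1..n}. (-1) ^ j * coords (\<phi> (merge_at G j (g # L'))) i) =
          - (\<Sum>j\<in>{1..n}. (-1) ^ (j - 1) * coords (\<phi> (merge_at G j (g # L'))) i)"
        unfolding sum_negf[symmetric]
      proof (intro sum.cong refl)
        fix j assume "j \<in> {1..n}"
        then show "(-1) ^ j * coords (\<phi> (merge_at G j (g # L'))) i = - ((-1) ^ (j - 1) * coords (\<phi> (merge_at G j (g # L'))) i)"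
          by (cases j) simp_all
      qed
      then show ?thesis using val[OF L(2,3), of i] L(1) by simp
    qed
    finally show "bar_of (Suc n) (cobd n \<phi>) (\<one>\<^bsub>G\<^esub> # L, i) = rep.bar_diff (Suc n) (bar_of n \<phi>) (\<one>\<^bsub>G\<^esub> # L, i)"
      using bar_of_one[OF c, of L i] L by simp
  qed
qed

end

context koszul
begin

lemma finite_J: "finite (J n)"
proof (rule finite_subset)
  show "J n \<subseteq> {f. \<forall>i. (i \<in> {..<s} \<longrightarrow> f i \<in> {..n}) \<and> (i \<notin> {..<s} \<longrightarrow> f i = 0)}"
  proof (clarsimp simp: J_def not_less)
    fix f :: "nat \<Rightarrow> nat" and i assume "i < s"
    then show "f i \<le> sum f {..<s}" by (intro member_le_sum) auto
  qed
  show "finite {f. \<forall>i. (i \<in> {..<s} \<longrightarrow> f i \<in> {..n}) \<and> (i \<notin> {..<s} \<longrightarrow> f i = (0 :: nat))}"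
    by (rule finite_set_of_finite_funs) auto
qed

lemma finite_Sol: "finite (Sol n)"
  using finite_J[of n] by (simp add: Sol_def)

end

section \<open>Cohomology classes and torus-fixed generators\<close>

context hw_module
begin

lemma Bor_ka: "\<lbrakk>\<And>b. b \<in> Bor \<Longrightarrow> ka (b $$ (0, 0)) (b $$ (0, 1)) y = y; t \<in> units; x \<in> F\<rbrakk> \<Longrightarrow> ka t x y = y"
  using mat2_in_Bor[of t x] by force

definition inv_supp :: "nat \<Rightarrow> ((nat \<Rightarrow> nat) \<times> (nat \<Rightarrow> nat)) set" where
  "inv_supp n = (\<lambda>j. (j, \<lambda>_. 0)) ` Sol n"

lemma finite_inv_supp: "finite (inv_supp n)" and card_inv_supp: "card (inv_supp n) = card (Sol n)"
  using finite_Sol[of n] by (auto simp: inv_supp_def intro!: card_image inj_onI)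

lemma invariant_supp:
  assumes "y \<in> fsupp (kos_X (Suc n))" and "\<And>b. b \<in> Bor \<Longrightarrow> ka (b $$ (0, 0)) (b $$ (0, 1)) y = y"
  shows "y \<in> fsupp (inv_supp n)"
proof (rule fsuppI)
  fix j a assume "y (j, a) \<noteq> 0"
  with kos_invariant[OF assms(1), of j a] Bor_ka[of y] assms(2)
  have "a = (\<lambda>_. 0) \<and> j \<in> Sol n" by blast
  then show "(j, a) \<in> inv_supp n" by (simp add: inv_supp_def)
qed

lemma supp_invariant:
  assumes y: "y \<in> fsupp (inv_supp n)"
  shows "y \<in> fsupp (kos_X (Suc n))" and "b \<in> Bor \<Longrightarrow> ka (b $$ (0, 0)) (b $$ (0, 1)) y = y"
proof -
  define e where "e j = (\<lambda>x :: (nat \<Rightarrow> nat) \<times> (nat \<Rightarrow> nat). if x = (j, \<lambda>_. 0) then 1 else 0 :: 'k)" for j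
  have y_eq: "y = (\<Sum>j\<in>Sol n. scl (y (j, \<lambda>_. 0)) (e j))"
  proof (rule ext, clarify)
    fix j a
    have "(\<Sum>j\<in>Sol n. scl (y (j, \<lambda>_. 0)) (e j)) (j, a) =
        (\<Sum>j'\<in>Sol n. if j' = j then (if a = (\<lambda>_. 0) then y (j, a) else 0) else 0)"
      unfolding sum_fun_apply by (intro sum.cong refl) (auto simp: e_def)
    also have "\<dots> = y (j, a)"
      using fsuppD[OF y, of "(j, a)"] finite_Sol[of n] by (auto simp: inv_supp_def)
    finally show "y (j, a) = (\<Sum>j\<in>Sol n. scl (y (j, \<lambda>_. 0)) (e j)) (j, a)" ..
  qed
  show "y \<in> fsupp (kos_X (Suc n))"
  proof (rule fsuppI)
    fix j a assume "y (j, a) \<noteq> 0"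
    then have "j \<in> Sol n" "a = (\<lambda>_. 0)" using fsuppD[OF y] by (auto simp: inv_supp_def)
    then show "(j, a) \<in> kos_X (Suc n)" using zero_Box by (simp add: Sol_def)
  qed
  assume "b \<in> Bor"
  then obtain t x where b: "b = mat2 t x 0 (inverse t)" "t \<in> units" by (rule Bor_cases)
  have "ka t x (\<Sum>j\<in>Sol n. scl (y (j, \<lambda>_. 0)) (e j)) = (\<Sum>j\<in>Sol n. scl (y (j, \<lambda>_. 0)) (e j))"
    unfolding lin_sum[OF lin_ka] lin_scl[OF lin_ka]
    by (intro sum.cong refl arg_cong[where f = "scl _"]) (simp add: e_def Sol_invariant[OF _ b(2)])
  then show "ka (b $$ (0, 0)) (b $$ (0, 1)) y = y"
    by (simp add: b(1) y_eq[symmetric])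
qed

context
  notes One_nat_def [simp del]
begin

text \<open>The image of a cochain in the minimal resolution. On cocycles it represents the
  cohomology class, since invariants have zero differential there. Degree \<open>n\<close> is index
  \<open>n + 1\<close>.\<close>

definition Lam :: "nat \<Rightarrow> ('k mat list \<Rightarrow> 'k vec) \<Rightarrow> ((nat \<Rightarrow> nat) \<times> (nat \<Rightarrow> nat) \<Rightarrow> 'k)" where
  "Lam n \<phi> = coh.F (Suc n) (bar_of n \<phi>)"

abbreviation Z where "Z n \<equiv> cocycles G LM (\<lambda>A v. \<rho> A *\<^sub>v v) n"
abbreviation ZM where "ZM n \<equiv> cochains G LM n \<lparr>carrier := Z n\<rparr>"

lemma cocycles_iff:
  "\<phi> \<in> Z n \<longleftrightarrow> \<phi> \<in> carrier (cochains G LM n) \<and> rep.bar_diff (Suc n) (bar_of n \<phi>) = 0"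
proof -
  have "cobd n \<phi> = \<zero>\<^bsub>cochains G LM (Suc n)\<^esub> \<longleftrightarrow> rep.bar_diff (Suc n) (bar_of n \<phi>) = 0"
    if "\<phi> \<in> carrier (cochains G LM n)"
    using coboundary_bar[OF that] cochains_zero[of "Suc n"] bar_of_inj[of "cobd n \<phi>" "Suc n"] by metis
  then show ?thesis by (auto simp: cocycles_def)
qed

lemma cocycles_add: "x \<in> Z n \<Longrightarrow> y \<in> Z n \<Longrightarrow> x \<oplus>\<^bsub>cochains G LM n\<^esub> y \<in> Z n"
  by (simp add: cocycles_iff cochains_add lin_add[OF rep.lin_bar_diff])

lemma cocycles_smult: "x \<in> Z n \<Longrightarrow> a \<odot>\<^bsub>cochains G LM n\<^esub> x \<in> Z n"
  by (auto simp: cocycles_iff cochains_smult lin_scl[OF rep.lin_bar_diff] fun_eq_iff)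

lemma Lam_add: "x \<in> Z n \<Longrightarrow> y \<in> Z n \<Longrightarrow> Lam n (x \<oplus>\<^bsub>cochains G LM n\<^esub> y) = Lam n x + Lam n y"
  by (simp add: Lam_def cocycles_iff cochains_add lin_add[OF coh.F(1)])

lemma Lam_smult: "x \<in> Z n \<Longrightarrow> Lam n (a \<odot>\<^bsub>cochains G LM n\<^esub> x) = scl a (Lam n x)"
  by (simp add: Lam_def cocycles_iff cochains_smult lin_scl[OF coh.F(1)])

lemma cocycles_diff:
  assumes x: "x \<in> Z n" and y: "y \<in> Z n"
  shows "\<exists>z\<in>Z n. x = z \<oplus>\<^bsub>cochains G LM n\<^esub> y"
proof
  define z where "z = x \<oplus>\<^bsub>cochains G LM n\<^esub> ((-1) \<odot>\<^bsub>cochains G LM n\<^esub> y)"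
  show z: "z \<in> Z n" unfolding z_def by (intro cocycles_add cocycles_smult x y)
  have c: "x \<in> carrier (cochains G LM n)" "y \<in> carrier (cochains G LM n)" "z \<in> carrier (cochains G LM n)"
    using x y z by (simp_all add: cocycles_iff)
  have "bar_of n z = bar_of n x + scl (-1) (bar_of n y)"
    unfolding z_def using c by (simp add: cochains_add cochains_smult)
  then have "bar_of n (z \<oplus>\<^bsub>cochains G LM n\<^esub> y) = bar_of n x"
    using c by (auto simp: cochains_add fun_eq_iff)
  then show "x = z \<oplus>\<^bsub>cochains G LM n\<^esub> y"
    using c cochains_add(1)[OF c(3,2)] by (intro bar_of_inj[of _ n]) simp_all
qed

lemma Lam_supp: "x \<in> Z n \<Longrightarrow> Lam n x \<in> fsupp (inv_supp n)"
  unfolding Lam_def cocycles_iff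
  by (intro invariant_supp coh.F(2) coh.F_invariant bar_of_in coh.invariant_subset bar_of_invariant) auto

text \<open>Minimality kills the image of a coboundary; the converse is \<open>F_zero\<close>, and
  \<open>F_zero_0\<close> in degree zero.\<close>

lemma coboundaries_eq: "coboundaries G LM (\<lambda>A v. \<rho> A *\<^sub>v v) n = {x \<in> Z n. Lam n x = 0}"
proof (cases n)
  case 0
  have "x = \<zero>\<^bsub>cochains G LM 0\<^esub>" if "x \<in> Z 0" "Lam 0 x = 0" for x
  proof -
    have "bar_of 0 x = 0"
      by (rule coh.F_zero_0[OF bar_of_in]) (use that in \<open>simp_all add: cocycles_iff Lam_def\<close>)
    then show ?thesis
      using that cochains_zero by (intro bar_of_inj[of _ 0]) (simp_all add: cocycles_iff)
  qed
  moreover have "\<zero>\<^bsub>cochains G LM 0\<^esub> \<in> Z 0" "Lam 0 (\<zero>\<^bsub>cochains G LM 0\<^esub>) = 0"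
    using cochains_zero by (simp_all add: cocycles_iff Lam_def lin_0[OF rep.lin_bar_diff] lin_0[OF coh.F(1)])
  ultimately have "{x \<in> Z 0. Lam 0 x = 0} = {\<zero>\<^bsub>cochains G LM 0\<^esub>}" by blast
  then show ?thesis by (simp add: 0 coboundaries_def)
next
  case (Suc l)
  have "cobd l \<psi> \<in> Z (Suc l) \<and> Lam (Suc l) (cobd l \<psi>) = 0" if \<psi>: "\<psi> \<in> carrier (cochains G LM l)" for \<psi>
  proof
    show "cobd l \<psi> \<in> Z (Suc l)"
      using coboundary_bar[OF \<psi>] rep.bar_diff_diff[OF bar_of_in] by (simp add: cocycles_iff)
    have "Lam (Suc l) (cobd l \<psi>) = kos_d (Suc l) (coh.F (Suc l) (bar_of l \<psi>))"
      unfolding Lam_def coboundary_bar(2)[OF \<psi>] by (rule coh.F_chain[OF bar_of_in])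
    also have "\<dots> = 0"
      by (intro coh.minimal coh.F(2) coh.F_invariant bar_of_in coh.invariant_subset bar_of_invariant \<psi>)
    finally show "Lam (Suc l) (cobd l \<psi>) = 0" .
  qed
  moreover have "x \<in> cobd l ` carrier (cochains G LM l)" if x: "x \<in> Z (Suc l)" "Lam (Suc l) x = 0" for x
  proof -
    have xc: "x \<in> carrier (cochains G LM (Suc l))" using x by (simp add: cocycles_iff)
    obtain \<Psi> where \<Psi>: "\<Psi> \<in> fsupp (rep.bar_X (Suc l))" "coh.invariant (carrier G) \<Psi>"
      and eq: "bar_of (Suc l) x = rep.bar_diff (Suc l) \<Psi>"
      using coh.F_zero[OF bar_of_in bar_of_invariant[OF xc]] x by (auto simp: cocycles_iff Lam_def)
    obtain \<psi> where \<psi>: "\<psi> \<in> carrier (cochains G LM l)" "bar_of l \<psi> = \<Psi>"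
      using bar_of_surj[OF \<Psi>] by blast
    have "x = cobd l \<psi>"
      using coboundary_bar[OF \<psi>(1)] xc eq \<psi>(2) by (intro bar_of_inj[of _ "Suc l"]) simp_all
    then show ?thesis using \<psi>(1) by blast
  qed
  ultimately have "cobd l ` carrier (cochains G LM l) = {x \<in> Z (Suc l). Lam (Suc l) x = 0}" by blast
  then show ?thesis by (simp add: Suc coboundaries_def)
qed

lemma Lam_surj:
  assumes y: "y \<in> fsupp (inv_supp (Suc n))"
  shows "y \<in> Lam (Suc n) ` Z (Suc n)"
proof -
  note tr = coh.transfer_F'[OF supp_invariant[OF y]]
  obtain x where x: "x \<in> carrier (cochains G LM (Suc n))"
    "bar_of (Suc n) x = coh.transfer (coh.F' (Suc (Suc n)) y)"
    using bar_of_surj[OF tr(1,2)] by blast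
  have "x \<in> Z (Suc n)" "Lam (Suc n) x = y"
    using x tr(3,4) by (simp_all add: cocycles_iff Lam_def)
  then show ?thesis by blast
qed

lemma cohomology_dim:
  assumes "Lam n ` Z n = fsupp X" "finite X"
  shows "SL2_cohomology_dim (p ^ s) d \<rho> n = card X"
proof -
  have "SL2_cohomology_dim (p ^ s) d \<rho> n =
      vectorspace.dim class_ring (quotient_module (ZM n) (coboundaries G LM (\<lambda>A v. \<rho> A *\<^sub>v v) n))"
    unfolding SL2_cohomology_dim_def group_cohomology_def G_def F_def q_def ..
  also have "\<dots> = card X"
    unfolding coboundaries_eq
  proof (rule quotient_module_dim)
    show "x \<oplus>\<^bsub>ZM n\<^esub> y \<in> carrier (ZM n) \<and> Lam n (x \<oplus>\<^bsub>ZM n\<^esub> y) = Lam n x + Lam n y"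
      if "x \<in> carrier (ZM n)" "y \<in> carrier (ZM n)" for x y
      using that by (simp add: cocycles_add Lam_add)
    show "a \<odot>\<^bsub>ZM n\<^esub> x \<in> carrier (ZM n) \<and> Lam n (a \<odot>\<^bsub>ZM n\<^esub> x) = scl a (Lam n x)"
      if "x \<in> carrier (ZM n)" for a x
      using that by (simp add: cocycles_smult Lam_smult)
    show "\<exists>z\<in>carrier (ZM n). x = z \<oplus>\<^bsub>ZM n\<^esub> y" if "x \<in> carrier (ZM n)" "y \<in> carrier (ZM n)" for x y
      using cocycles_diff[of x n y] that by simp
  qed (use assms in simp_all)
  finally show ?thesis .
qed

theorem cohomology_dim_Suc: "SL2_cohomology_dim (p ^ s) d \<rho> (Suc n) = card (Sol (Suc n))"
proof -
  have "Lam (Suc n) ` Z (Suc n) = fsupp (inv_supp (Suc n))"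
    using Lam_supp Lam_surj by blast
  from cohomology_dim[OF this finite_inv_supp] show ?thesis by (simp add: card_inv_supp)
qed

text \<open>Surjectivity of \<open>Lam\<close> by transfer concerns positive degrees. In degree zero
  the only multidegree is zero, so the image is a subspace of a line: zero or the line.\<close>

theorem cohomology_dim_0: "SL2_cohomology_dim (p ^ s) d \<rho> 0 \<le> 1"
proof (cases "\<exists>x\<in>Z 0. Lam 0 x \<noteq> 0")
  case True
  then obtain x where x: "x \<in> Z 0" "Lam 0 x \<noteq> 0" by blast
  define o0 :: "(nat \<Rightarrow> nat) \<times> (nat \<Rightarrow> nat)" where "o0 = (\<lambda>_. 0, \<lambda>_. 0)"
  have "j = (\<lambda>_. 0)" if "j \<in> J 0" for j
  proof (rule ext)
    fix i show "j i = 0" using that by (cases "i < s") (auto simp: J_def)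
  qed
  then have sub: "fsupp (inv_supp 0) \<subseteq> (fsupp {o0} :: (_ \<Rightarrow> 'k) set)"
    by (auto simp: fsupp_def inv_supp_def Sol_def o0_def)
  have nz: "Lam 0 x o0 \<noteq> 0"
  proof
    assume "Lam 0 x o0 = 0"
    then have "Lam 0 x z = 0" for z using fsuppD[OF subsetD[OF sub Lam_supp[OF x(1)]], of z] by auto
    then show False using x(2) by (simp add: fun_eq_iff)
  qed
  have "Lam 0 ` Z 0 = fsupp {o0}"
  proof
    show "Lam 0 ` Z 0 \<subseteq> fsupp {o0}" using Lam_supp sub by blast
    show "fsupp {o0} \<subseteq> Lam 0 ` Z 0"
    proof
      fix y :: "_ \<Rightarrow> 'k" assume y: "y \<in> fsupp {o0}"
      have "y = scl (y o0 / Lam 0 x o0) (Lam 0 x)"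
      proof
        fix z show "y z = scl (y o0 / Lam 0 x o0) (Lam 0 x) z"
          using fsuppD[OF y, of z] fsuppD[OF subsetD[OF sub Lam_supp[OF x(1)]], of z] nz
          by (cases "z = o0") (simp, metis mult_zero_right scl_apply singletonD)
      qed
      then have "y = Lam 0 ((y o0 / Lam 0 x o0) \<odot>\<^bsub>cochains G LM 0\<^esub> x)"
        using x(1) by (simp add: Lam_smult)
      then show "y \<in> Lam 0 ` Z 0" using cocycles_smult[OF x(1)] by blast
    qed
  qed
  from cohomology_dim[OF this] show ?thesis by simp
next
  case False
  have "\<zero>\<^bsub>cochains G LM 0\<^esub> \<in> Z 0"
    using cochains_zero by (simp add: cocycles_iff lin_0[OF rep.lin_bar_diff])
  then have "Lam 0 ` Z 0 = fsupp {}" using False by (force simp: fsupp_def fun_eq_iff)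
  from cohomology_dim[OF this] show ?thesis by simp
qed

end

end

section \<open>Counting the torus-fixed generators\<close>

text \<open>Carries are listed from the top digit downwards: \<open>x\<close> leaves the digit
  \<open>m\<close> and \<open>y\<close> enters it. In this direction a zero carry determines the
  next entry.\<close>

fun carry_chain :: "nat list \<Rightarrow> nat \<Rightarrow> nat list \<Rightarrow> bool" where
  "carry_chain [] x vs \<longleftrightarrow> vs = []"
| "carry_chain (m # ms) x [] \<longleftrightarrow> False"
| "carry_chain (m # ms) x (y # vs) \<longleftrightarrow> (x = 0 \<longrightarrow> y = m) \<and> carry_chain ms y vs"

definition carry_chains :: "nat list \<Rightarrow> nat \<Rightarrow> nat \<Rightarrow> nat list set" where
  "carry_chains ms B x = {vs. carry_chain ms x vs \<and> x + sum_list vs \<le> B}"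

lemma sum_half_powers: "(\<Sum>y\<le>n. (1 / 2 :: real) ^ y) \<le> 2"
  using sum_gp_strict[of "1 / 2 :: real" "Suc n"] by (simp add: lessThan_Suc_atMost)

text \<open>The weight \<open>4 ^ B * (1 / 2) ^ x\<close> is made for the induction. A zero carry
  has a single continuation and costs nothing, so the length of \<open>ms\<close> does not enter. A
  carry \<open>x > 0\<close> uses up \<open>x\<close> of the budget, and the gain
  \<open>4 ^ x\<close> pays for \<open>2 ^ x\<close> and for the geometric series over the next
  carry.\<close>

lemma carry_chains_bound: "finite (carry_chains ms B x) \<and> real (card (carry_chains ms B x)) \<le> 4 ^ B * (1 / 2) ^ x"
proof (induction ms arbitrary: B x)
  case Nil
  have "carry_chains [] B x = (if x \<le> B then {[]} else {})" by (auto simp: carry_chains_def)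
  moreover have "(1 :: real) \<le> 4 ^ B * (1 / 2) ^ x" if "x \<le> B"
  proof -
    have "(2 :: real) ^ x \<le> 2 ^ B" using that by simp
    also have "\<dots> \<le> 4 ^ B" by (intro power_mono) auto
    finally show ?thesis by (simp add: field_simps power_divide)
  qed
  ultimately show ?case by simp
next
  case (Cons m ms)
  show ?case
  proof (cases "x \<le> B")
    case False
    then have "carry_chains (m # ms) B x = {}" by (auto simp: carry_chains_def)
    then show ?thesis by simp
  next
    case xB: True
    show ?thesis
    proof (cases "x = 0")
      case True
      have eq: "carry_chains (m # ms) B x = (#) m ` carry_chains ms B m"
      proof (rule Set.set_eqI)
        fix vs show "vs \<in> carry_chains (m # ms) B x \<longleftrightarrow> vs \<in> (#) m ` carry_chains ms B m"
          by (cases vs) (auto simp: carry_chains_def True)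
      qed
      have "(1 / 2 :: real) ^ m \<le> 1" by (intro power_le_one) auto
      then have "4 ^ B * (1 / 2) ^ m \<le> (4 :: real) ^ B" by simp
      then have "real (card (carry_chains ms B m)) \<le> 4 ^ B"
        using Cons.IH[of B m] by linarith
      then show ?thesis using Cons.IH[of B m] unfolding eq by (simp add: card_image True)
    next
      case False
      have eq: "carry_chains (m # ms) B x = (\<Union>y\<in>{..B}. (#) y ` carry_chains ms (B - x) y)"
      proof (rule Set.set_eqI)
        fix vs show "vs \<in> carry_chains (m # ms) B x \<longleftrightarrow> vs \<in> (\<Union>y\<in>{..B}. (#) y ` carry_chains ms (B - x) y)"
        proof (cases vs)
          case (Cons a list)
          have "vs \<in> carry_chains (m # ms) B x \<longleftrightarrow> a \<le> B \<and> list \<in> carry_chains ms (B - x) a"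
            using False xB by (auto simp: carry_chains_def Cons)
          then show ?thesis by (auto simp: Cons)
        qed (auto simp: carry_chains_def)
      qed
      have fin: "finite (carry_chains (m # ms) B x)" unfolding eq using Cons.IH by auto
      have "card (carry_chains (m # ms) B x) \<le> (\<Sum>y\<le>B. card ((#) y ` carry_chains ms (B - x) y))"
        unfolding eq by (rule card_UN_le) simp
      then have "real (card (carry_chains (m # ms) B x)) \<le> (\<Sum>y\<le>B. real (card (carry_chains ms (B - x) y)))"
        by (simp add: card_image flip: of_nat_sum)
      also have "\<dots> \<le> (\<Sum>y\<le>B. 4 ^ (B - x) * (1 / 2) ^ y)"
        by (intro sum_mono) (use Cons.IH in blast)
      also have "\<dots> \<le> 4 ^ (B - x) * 2"
        unfolding sum_distrib_left[symmetric] by (intro mult_left_mono sum_half_powers) simp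
      also have "\<dots> \<le> 4 ^ B * (1 / 2) ^ x"
      proof -
        obtain x' where x': "x = Suc x'" using False by (cases x) auto
        obtain c where c: "B = c + x" using xB by (metis add.commute le_Suc_ex)
        have "(4 :: real) ^ x = 2 ^ x * 2 ^ x" by (simp flip: power_mult_distrib)
        then have "4 ^ B * (1 / 2 :: real) ^ x = 4 ^ c * 2 ^ x" by (simp add: c power_add power_divide)
        moreover have "(2 :: real) \<le> 2 ^ x" by (simp add: x')
        ultimately show ?thesis by (simp add: c)
      qed
      finally show ?thesis using fin by blast
    qed
  qed
qed

lemma carry_chain_map:
  assumes "\<And>i. i < n \<Longrightarrow> v (Suc i) = 0 \<Longrightarrow> v i = m i"
  shows "carry_chain (map m (rev [0..<n])) (v n) (map v (rev [0..<n]))"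
  using assms by (induction n) auto

section \<open>Carries of a solution, and the two bounds on their number\<close>

context koszul
begin

lemma cc_0 [simp]: "cc i 0 = 0"
  by (simp add: cc_def)

lemma cc_le: "i < s \<Longrightarrow> cc i l \<le> l * p"
proof (induction l)
  case (Suc l)
  then have "cc i (Suc l) \<le> l * p + step i l" by (simp add: cc_Suc)
  also have "step i l \<le> p" using md[OF Suc.prems] by (auto simp: step_def)
  finally show ?case by simp
qed simp

lemma cc_strict_mono:
  assumes "i < s" "md i \<noteq> p - 1"
  shows "strict_mono (cc i)"
proof (rule strict_mono_Suc_iff[THEN iffD2, rule_format])
  fix l show "cc i l < cc i (Suc l)"
    using assms md[of i] by (auto simp: cc_Suc step_def)
qed

text \<open>The first step alone is \<open>md i + 1\<close>. Hence \<open>j i = 0\<close> wherever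
  the carry out of digit \<open>i\<close> is zero.\<close>

lemma cc_ge: "i < s \<Longrightarrow> 0 < l \<Longrightarrow> md i < cc i l"
proof (induction l)
  case (Suc l)
  show ?case
  proof (cases "l = 0")
    case False
    then show ?thesis using Suc by (simp add: cc_Suc)
  qed (simp add: cc_def)
qed simp

lemma cc_J_inj:
  assumes "j \<in> J n" "j' \<in> J n" "\<And>i. i < s \<Longrightarrow> cc i (j i) = cc i (j' i)"
  shows "j = j'"
proof
  fix i show "j i = j' i"
  proof (cases "i < s \<and> md i \<noteq> p - 1")
    case True
    then show ?thesis using assms(3)[of i] strict_mono_eq[OF cc_strict_mono[of i]] by blast
  next
    case False
    then show ?thesis using assms(1,2) by (cases "i < s") (auto simp: J_def)
  qed
qed

text \<open>The carries that occur when the congruence defining \<^term>\<open>Sol n\<close> is checked digit by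
  digit, cyclically modulo \<^term>\<open>q - 1 = p ^ s - 1\<close>.\<close>

lemma exists_carries:
  assumes j: "j \<in> Sol n" and md': "\<exists>i<s. md i \<noteq> p - 1"
  shows "\<exists>v :: nat \<Rightarrow> nat. v s = v 0 \<and> (\<forall>i<s. 2 * cc i (j i) + v i = md i + p * v (Suc i))"
proof -
  define D where "D i = 2 * int (cc i (j i)) - int (md i)" for i
  define Q where "Q = int (q - 1)"
  define P where "P = int p - 1"
  have wt: "wt j (\<lambda>_. 0) = - (\<Sum>i<s. D i * int p ^ i)"
    by (simp add: wt_def val_0 val_def cval_def D_def left_diff_distrib sum_subtractf sum_distrib_left mult.assoc)
  have "Q dvd wt j (\<lambda>_. 0)" using j by (simp add: Sol_def Q_def)
  then have "Q dvd (\<Sum>i<s. D i * int p ^ i)" by (simp only: wt dvd_minus_iff)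
  then obtain K where K: "(\<Sum>i<s. D i * int p ^ i) = Q * K" by (rule dvdE)
  have q1: "Q = int p ^ s - 1" using q_ge_3 by (simp add: Q_def q_def of_nat_diff)
  have Q0: "Q > 0" using q_ge_3 by (simp add: Q_def)
  have pow0: "int p ^ i > 0" for i using p_pos by simp
  have md_sum: "(\<Sum>l<i. - P * int p ^ l) = 1 - int p ^ i" for i
    by (induction i) (auto simp: P_def algebra_simps)
  have D_ge: "- P \<le> D l" if "l < s" for l
    using md[OF that] by (simp add: D_def P_def)
  \<comment> \<open>Every \<open>D l\<close> is at least \<open>- P\<close>, and equality in all
    digits would sum to \<open>- Q\<close>. The hypothesis on \<open>md\<close> makes one inequality
    strict, which excludes \<open>K = - 1\<close> and everything below.\<close>
  have K0: "K \<ge> 0"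
  proof (rule ccontr)
    assume "\<not> K \<ge> 0"
    then have "Q * K \<le> Q * (- 1)" using Q0 by (intro mult_left_mono) auto
    then have le: "(\<Sum>i<s. D i * int p ^ i) \<le> (\<Sum>i<s. - P * int p ^ i)"
      unfolding K md_sum by (simp add: q1)
    obtain i where i: "i < s" "md i \<noteq> p - 1" using md' by blast
    have "(\<Sum>i<s. - P * int p ^ i) < (\<Sum>i<s. D i * int p ^ i)"
    proof (rule sum_strict_mono_ex1)
      show "\<forall>l\<in>{..<s}. - P * int p ^ l \<le> D l * int p ^ l"
        using D_ge pow0 by (intro ballI mult_right_mono) (auto simp: less_imp_le)
      have "- P < D i" using i md[of i] by (auto simp: D_def P_def)
      then show "\<exists>l\<in>{..<s}. - P * int p ^ l < D l * int p ^ l"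
        using i pow0[of i] by (intro bexI[of _ i] mult_strict_right_mono) auto
    qed simp
    then show False using le by simp
  qed
  \<comment> \<open>\<open>K\<close> is the carry into the lowest digit as well as out of the top
    one, since \<open>int p ^ s\<close> is \<open>1\<close> modulo \<open>Q\<close>. Seen from the
    top, \<open>S i\<close> is divisible by \<open>int p ^ i\<close>; the quotients are the
    carries.\<close>
  define S where "S i = K + (\<Sum>l<i. D l * int p ^ l)" for i
  have S_s: "S s = K * int p ^ s" by (simp add: S_def K q1 algebra_simps)
  have dvd: "int p ^ i dvd S i" if "i \<le> s" for i
  proof -
    have "(\<Sum>l<s. D l * int p ^ l) = (\<Sum>l<i. D l * int p ^ l) + (\<Sum>l\<in>{i..<s}. D l * int p ^ l)"
      using that by (metis lessThan_atLeast0 sum.atLeastLessThan_concat zero_le)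
    then have "S i = K * int p ^ s - (\<Sum>l\<in>{i..<s}. D l * int p ^ l)"
      using S_s by (simp add: S_def)
    moreover have "int p ^ i dvd K * int p ^ s" using that by (intro dvd_mult le_imp_power_dvd)
    moreover have "int p ^ i dvd (\<Sum>l\<in>{i..<s}. D l * int p ^ l)"
      by (intro dvd_sum dvd_mult le_imp_power_dvd) simp
    ultimately show ?thesis by simp
  qed
  define v where "v i = S i div int p ^ i" for i
  have v: "int p ^ i * v i = S i" if "i \<le> s" for i
    using dvd[OF that] by (simp add: v_def)
  have v0: "v i \<ge> 0" if i: "i \<le> s" for i
  proof -
    have "(\<Sum>l<i. - P * int p ^ l) \<le> (\<Sum>l<i. D l * int p ^ l)"
    proof (intro sum_mono mult_right_mono)
      fix l assume "l \<in> {..<i}"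
      then show "- P \<le> D l" using D_ge[of l] i by simp
      show "0 \<le> int p ^ l" by simp
    qed
    then have "- (int p ^ i) < S i" using K0 unfolding md_sum by (simp add: S_def)
    then have "int p ^ i * (- 1) < int p ^ i * v i" using v[OF i] by simp
    then have "- 1 < v i" using pow0[of i] by (simp only: mult_less_cancel_left_pos)
    then show ?thesis by simp
  qed
  have step: "2 * cc i (j i) + nat (v i) = md i + p * nat (v (Suc i))" if i: "i < s" for i
  proof -
    have "int p ^ i * (int p * v (Suc i)) = int p ^ i * (v i + D i)"
      using v[of i] v[of "Suc i"] i by (simp add: S_def algebra_simps)
    then have "int p * v (Suc i) = v i + D i" using p_pos by simp
    then have "int (2 * cc i (j i) + nat (v i)) = int (md i + p * nat (v (Suc i)))"
      using v0[of i] v0[of "Suc i"] i by (simp add: D_def)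
    then show ?thesis by (simp only: of_nat_eq_iff)
  qed
  have "int p ^ s * v s = int p ^ s * K" using v[of s] S_s by (simp add: mult.commute)
  then have "v s = K" using p_pos by simp
  moreover have "v 0 = K" by (simp add: v_def S_def)
  ultimately show ?thesis using step by (intro exI[of _ "\<lambda>i. nat (v i)"]) auto
qed

text \<open>The carries of a solution add up to at most \<open>3 * n\<close>. The starting carry is
  one of them and counts again in \<open>carry_chains\<close>, whence the budget
  \<open>6 * n\<close>.\<close>

theorem card_Sol_le: "real (card (Sol n)) \<le> 2 * 4 ^ (6 * n)"
proof (cases "\<exists>i<s. md i \<noteq> p - 1")
  case False
  have "Sol n \<subseteq> {\<lambda>_. 0}"
  proof
    fix j assume "j \<in> Sol n"
    then have "j i = 0" for i using False by (cases "i < s") (auto simp: Sol_def J_def)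
    then show "j \<in> {\<lambda>_. 0}" by auto
  qed
  then have "card (Sol n) \<le> 1" using card_mono[of "{\<lambda>_. 0}" "Sol n"] by simp
  moreover have "(1 :: real) \<le> 4 ^ (6 * n)" by (rule one_le_power) simp
  ultimately show ?thesis by linarith
next
  case True
  have "\<forall>j\<in>Sol n. \<exists>v :: nat \<Rightarrow> nat. v s = v 0 \<and> (\<forall>i<s. 2 * cc i (j i) + v i = md i + p * v (Suc i))"
    using exists_carries[OF _ True] by blast
  then obtain v :: "(nat \<Rightarrow> nat) \<Rightarrow> nat \<Rightarrow> nat" where cyc: "j \<in> Sol n \<Longrightarrow> v j s = v j 0"
    and v: "j \<in> Sol n \<Longrightarrow> i < s \<Longrightarrow> 2 * cc i (j i) + v j i = md i + p * v j (Suc i)" for j i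
    by (metis (no_types, lifting))
  \<comment> \<open>From the carries, the carry equation recovers \<open>cc i (j i)\<close> and with
    it \<open>j\<close>.\<close>
  define code where "code j = (v j s, map (v j) (rev [0..<s]))" for j
  have inj: "inj_on code (Sol n)"
  proof (rule inj_onI)
    fix j j' assume j: "j \<in> Sol n" "j' \<in> Sol n" and eq: "code j = code j'"
    have "v j i = v j' i" if "i \<le> s" for i
      using eq that by (cases "i = s") (auto simp: code_def)
    then have "cc i (j i) = cc i (j' i)" if "i < s" for i
      using v[OF j(1) that] v[OF j(2) that] that by simp
    then show "j = j'" using j by (intro cc_J_inj) (auto simp: Sol_def)
  qed
  have "code j \<in> Sigma {..6 * n} (carry_chains (map md (rev [0..<s])) (6 * n))" if j: "j \<in> Sol n" for j
  proof -
    have "carry_chain (map md (rev [0..<s])) (v j s) (map (v j) (rev [0..<s]))"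
    proof (rule carry_chain_map)
      fix i assume i: "i < s" and "v j (Suc i) = 0"
      then have eq: "2 * cc i (j i) + v j i = md i" using v[OF j i] by simp
      then have "j i = 0" using cc_ge[OF i, of "j i"] by (cases "j i") auto
      then show "v j i = md i" using eq by simp
    qed
    have "(\<Sum>i<s. v j (Suc i)) + v j 0 = (\<Sum>i<s. v j i) + v j s"
      by (metis sum.lessThan_Suc sum.lessThan_Suc_shift add.commute)
    then have shift: "(\<Sum>i<s. v j (Suc i)) = (\<Sum>i<s. v j i)" using cyc[OF j] by simp
    \<comment> \<open>Summed around the cycle, the carry equations bound \<open>p - 1\<close> times
      the total carry by \<open>2 * p * n\<close>; for \<open>p\<close> at least \<open>3\<close>
      the total is then at most \<open>3 * n\<close>.\<close>
    have "(\<Sum>i<s. 2 * cc i (j i) + v j i) = (\<Sum>i<s. md i + p * v j (Suc i))"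
      using v[OF j] by (intro sum.cong refl) auto
    then have "(\<Sum>i<s. 2 * cc i (j i)) + (\<Sum>i<s. v j i) = (\<Sum>i<s. md i) + p * (\<Sum>i<s. v j i)"
      by (simp add: sum.distrib shift flip: sum_distrib_left)
    moreover have "(\<Sum>i<s. 2 * cc i (j i)) \<le> (\<Sum>i<s. 2 * (j i * p))"
      using cc_le by (intro sum_mono) auto
    moreover have "(\<Sum>i<s. 2 * (j i * p)) = 2 * p * n"
      using j by (simp add: Sol_def J_def flip: sum_distrib_left sum_distrib_right)
    ultimately have "p * (\<Sum>i<s. v j i) \<le> 2 * p * n + (\<Sum>i<s. v j i)" by linarith
    moreover obtain p' where p': "p = Suc (Suc (Suc p'))" using p3 by (metis numeral_3_eq_3 le_Suc_ex add_Suc)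
    ultimately have "(2 + p') * (\<Sum>i<s. v j i) \<le> (2 * p' + 6) * n" by (simp add: algebra_simps)
    also have "\<dots> \<le> (2 + p') * (3 * n)" by (simp add: algebra_simps)
    finally have le: "(\<Sum>i<s. v j i) \<le> 3 * n" by (simp only: mult_le_cancel1)
    moreover have "v j s \<le> (\<Sum>i<s. v j i)"
      unfolding cyc[OF j] using s by (intro member_le_sum) auto
    moreover have "sum_list (map (v j) (rev [0..<s])) = (\<Sum>i<s. v j i)"
      by (simp add: rev_map[symmetric] sum_list_rev interv_sum_list_conv_sum_set_nat lessThan_atLeast0)
    ultimately show ?thesis
      using \<open>carry_chain _ _ _\<close> by (simp add: code_def carry_chains_def)
  qed
  then have "card (Sol n) \<le> card (Sigma {..6 * n} (carry_chains (map md (rev [0..<s])) (6 * n)))"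
    by (intro card_inj_on_le[OF inj] image_subsetI finite_SigmaI) (simp_all add: carry_chains_bound)
  then have "real (card (Sol n)) \<le> (\<Sum>x\<le>6 * n. real (card (carry_chains (map md (rev [0..<s])) (6 * n) x)))"
    using carry_chains_bound by (simp add: card_SigmaI flip: of_nat_sum)
  also have "\<dots> \<le> (\<Sum>x\<le>6 * n. 4 ^ (6 * n) * (1 / 2) ^ x)"
    by (intro sum_mono) (use carry_chains_bound in blast)
  also have "\<dots> \<le> 4 ^ (6 * n) * 2"
    unfolding sum_distrib_left[symmetric] by (intro mult_left_mono sum_half_powers) simp
  finally show ?thesis by simp
qed

text \<open>For \<open>md = 0\<close> all carries can be prescribed as \<open>2 * p\<close> (at \<open>A\<close> places) or \<open>2 * p - 2\<close> (at
  \<open>B\<close> places).\<close>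

theorem card_Sol_ge:
  assumes md0: "\<And>i. md i = 0" and s: "s = A + B"
  shows "(A + B) choose A \<le> card (Sol (A * (2 * p - 2) + B * (2 * p - 3)))"
proof -
  define n where "n = A * (2 * p - 2) + B * (2 * p - 3)"
  define u where "u T i = (if i \<in> T then 0 else 1 :: nat)" for T and i :: nat
  define v where "v T i = 2 * p - 2 * u T (if i = s then 0 else i)" for T i
  \<comment> \<open>The solution \<open>l\<close> of the carry equation
    \<open>2 * cc i l = p * v (Suc i) - v i\<close>: for \<open>md = 0\<close> the remainder of
    \<open>cc i l\<close> modulo \<open>p\<close> is the parity of \<open>l\<close>, and it has to
    be \<open>u T i\<close>.\<close>
  define jj where "jj T i = (if i < s then v T (Suc i) - 2 + u T i else 0)" for T i
  have u1: "u T i \<le> 1" for T i by (simp add: u_def)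
  have jj: "jj T \<in> Sol n" if T: "T \<subseteq> {..<s}" "card T = A" for T
  proof -
    have cc2: "2 * int (cc i (jj T i)) = int p * int (v T (Suc i)) - int (v T i)" if i: "i < s" for i
    proof -
      define w where "w = u T (if Suc i = s then 0 else Suc i)"
      have "w \<le> 1" using u1 by (simp add: w_def)
      then have jj_eq: "jj T i = 2 * (p - 1 - w) + u T i"
        using i p3 by (simp add: jj_def v_def flip: w_def)
      have vS: "int (v T (Suc i)) = 2 * int p - 2 * int w"
        using i \<open>w \<le> 1\<close> p3 by (simp add: v_def of_nat_diff flip: w_def)
      have vi: "int (v T i) = 2 * int p - 2 * int (u T i)"
        using i u1[of T i] p3 by (simp add: v_def of_nat_diff)
      have "cc i (jj T i) = (p - 1 - w) * p + u T i"
        using u1[of T i] by (cases "u T i") (simp_all add: jj_eq cc_def md0)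
      then show ?thesis
        using vS vi \<open>w \<le> 1\<close> p3 by (simp add: of_nat_diff del: One_nat_def) (simp add: algebra_simps)
    qed
    have "2 * int (cval (jj T)) = (\<Sum>i<s. int (v T (Suc i)) * int p ^ Suc i - int (v T i) * int p ^ i)"
      unfolding cval_def of_nat_sum sum_distrib_left
    proof (intro sum.cong refl)
      fix i assume "i \<in> {..<s}"
      then have i: "i < s" by simp
      have "2 * int (cc i (jj T i) * p ^ i) = (2 * int (cc i (jj T i))) * int p ^ i" by simp
      also have "\<dots> = int (v T (Suc i)) * int p ^ Suc i - int (v T i) * int p ^ i"
        unfolding cc2[OF i] by (simp add: algebra_simps)
      finally show "2 * int (cc i (jj T i) * p ^ i) = int (v T (Suc i)) * int p ^ Suc i - int (v T i) * int p ^ i" .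
    qed
    also have "\<dots> = int (v T s) * int p ^ s - int (v T 0) * int p ^ 0"
      by (rule sum_lessThan_telescope)
    also have "\<dots> = int (q - 1) * int (v T 0)"
      using q_ge_3 by (simp add: v_def q_def of_nat_diff algebra_simps)
    finally have "wt (jj T) (\<lambda>_. 0) = - (int (q - 1) * int (v T 0))"
      by (simp add: wt_def val_0 val_def[of md] md0)
    then have dvd: "int (q - 1) dvd wt (jj T) (\<lambda>_. 0)" by simp
    have fin: "finite T" using T(1) finite_subset by blast
    have "(\<Sum>i<s. u T i) = card ({..<s} - T)"
      by (simp add: u_def sum.If_cases Diff_eq)
    then have su: "(\<Sum>i<s. u T i) = B" using T fin by (simp add: card_Diff_subset s)
    have "(\<Sum>i<s. v T (Suc i)) + v T 0 = (\<Sum>i<s. v T i) + v T s"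
      by (metis sum.lessThan_Suc sum.lessThan_Suc_shift add.commute)
    moreover have "v T s = v T 0" by (simp add: v_def)
    ultimately have "(\<Sum>i<s. v T (Suc i)) = (\<Sum>i<s. v T i)" by simp
    moreover have "(\<Sum>i<s. v T i) + 2 * B = 2 * p * s"
    proof -
      have "(\<Sum>i<s. v T i + 2 * u T i) = (\<Sum>i<s. 2 * p)"
        using p3 by (intro sum.cong refl) (auto simp: v_def u_def)
      then show ?thesis using su by (simp add: sum.distrib flip: sum_distrib_left)
    qed
    moreover have "(\<Sum>i<s. jj T i) + 2 * s = (\<Sum>i<s. v T (Suc i)) + B"
    proof -
      have "(\<Sum>i<s. jj T i) + (\<Sum>i<s. 2) = (\<Sum>i<s. v T (Suc i)) + (\<Sum>i<s. u T i)"
        unfolding sum.distrib[symmetric]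
        using p3 by (intro sum.cong refl) (auto simp: jj_def v_def u_def)
      then show ?thesis using su by simp
    qed
    ultimately have "(\<Sum>i<s. jj T i) + 2 * s + B = 2 * p * s" by simp
    moreover have "n + 2 * s + B = 2 * p * s"
    proof -
      obtain p' where "p = Suc (Suc (Suc p'))" using p3 by (metis numeral_3_eq_3 le_Suc_ex add_Suc)
      then show ?thesis by (simp add: n_def s algebra_simps)
    qed
    ultimately have "(\<Sum>i<s. jj T i) = n" by simp
    moreover have "jj T i = 0" if "i \<ge> s" for i using that by (simp add: jj_def)
    ultimately show ?thesis using dvd p3 by (simp add: Sol_def J_def md0)
  qed
  have "inj_on jj {T. T \<subseteq> {..<s} \<and> card T = A}"
  proof (rule inj_onI; clarify)
    fix T T' assume T: "T \<subseteq> {..<s}" "T' \<subseteq> {..<s}" and eq: "jj T = jj T'"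
    \<comment> \<open>All carries are even, so the parity of \<open>jj T i\<close> shows which of
      the two values the carry at \<open>i\<close> has.\<close>
    have "odd (jj T i) \<longleftrightarrow> i \<notin> T" if "i < s" for T i
      using that by (auto simp: jj_def v_def u_def)
    then have "i \<in> T \<longleftrightarrow> i \<in> T'" if "i < s" for i using that eq by metis
    then show "T = T'" using T by blast
  qed
  then have "card {T. T \<subseteq> {..<s} \<and> card T = A} \<le> card (Sol n)"
    using jj finite_Sol by (intro card_inj_on_le) auto
  then show ?thesis using n_subsets[of "{..<s}" A] by (simp add: n_def s)
qed

end

section \<open>Exponential growth\<close>

lemma trivial_simple_module: "simple_module_L 0 1 (\<lambda>A. 1\<^sub>m 1 :: 'k::alg_closed_field mat)"
  unfolding simple_module_L_def
proof (intro conjI)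
  show "rational_representation 1 (\<lambda>A. 1\<^sub>m 1 :: 'k mat)"
    unfolding rational_representation_def by (auto intro: polynomial_functions.const[of 1])
  show "simple_representation 1 (\<lambda>A. 1\<^sub>m 1 :: 'k mat)"
    unfolding simple_representation_def
  proof (intro conjI allI impI)
    fix W assume "VectorSpace.subspace class_ring W (module_vec TYPE('k) 1)"
    then have sub: "submodule class_ring W (module_vec TYPE('k) 1)"
      by (simp add: VectorSpace.subspace_def)
    have Wc: "W \<subseteq> carrier_vec 1" and W0: "0\<^sub>v 1 \<in> W" and Ws: "c \<cdot>\<^sub>v w \<in> W" if "w \<in> W" for c w
      using sub that by (auto simp: submodule_def module_vec_simps)
    have Wc: "W \<subseteq> carrier_vec 1" and W0: "0\<^sub>v 1 \<in> W"
      using sub by (auto simp: submodule_def module_vec_simps)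
    show "W = {0\<^sub>v 1} \<or> W = carrier_vec 1"
    proof (cases "W = {0\<^sub>v 1}")
      case False
      then obtain w where w: "w \<in> W" "w \<noteq> 0\<^sub>v 1" using W0 by blast
      then have w1: "w \<in> carrier_vec 1" using Wc by blast
      then have nz: "w $ 0 \<noteq> 0" using w(2) by (metis eq_vecI carrier_vecD index_zero_vec less_one)
      have "x \<in> W" if x: "x \<in> carrier_vec 1" for x
      proof -
        have "x = (x $ 0 / w $ 0) \<cdot>\<^sub>v w" using x w1 nz by (intro eq_vecI) auto
        then show ?thesis using Ws[OF w(1)] by metis
      qed
      then show ?thesis using Wc by blast
    qed simp
  qed simp
  have "weight_space 1 (\<lambda>A. 1\<^sub>m 1 :: 'k mat) 0 = carrier_vec 1"
    by (auto simp: weight_space_def)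
  moreover have "vec 1 (\<lambda>_. 1) \<in> carrier_vec 1" "vec 1 (\<lambda>_. 1 :: 'k) \<noteq> 0\<^sub>v 1"
    by (auto simp: vec_eq_iff)
  ultimately have w0: "is_weight 1 (\<lambda>A. 1\<^sub>m 1 :: 'k mat) 0"
    unfolding is_weight_def by (metis singletonD)
  have "\<mu> = 0" if weight: "is_weight 1 (\<lambda>A. 1\<^sub>m 1 :: 'k mat) \<mu>" for \<mu>
  proof -
    have "0\<^sub>v 1 \<in> weight_space 1 (\<lambda>A. 1\<^sub>m 1 :: 'k mat) \<mu>"
      by (auto simp: weight_space_def)
    then obtain w where w: "w \<in> weight_space 1 (\<lambda>A. 1\<^sub>m 1 :: 'k mat) \<mu>" "w \<noteq> 0\<^sub>v 1"
      using weight unfolding is_weight_def by blast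
    then have w1: "w \<in> carrier_vec 1" by (simp add: weight_space_def)
    then have nz: "w $ 0 \<noteq> 0" using w(2) by (metis eq_vecI carrier_vecD index_zero_vec less_one)
    have "t powi \<mu> = 1" if "t \<noteq> 0" for t :: 'k
    proof -
      have "w = (t powi \<mu>) \<cdot>\<^sub>v w" using w(1) w1 that by (simp add: weight_space_def del: One_nat_def)
      then have "w $ 0 = (t powi \<mu>) * w $ 0" using w1 by (metis carrier_vecD index_smult_vec(1) less_one)
      then show ?thesis using nz by simp
    qed
    then show ?thesis by (rule powi_eq_1)
  qed
  with w0 show "highest_weight 1 (\<lambda>A. 1\<^sub>m 1 :: 'k mat) (int 0)"
    unfolding highest_weight_def by (auto intro!: exI[of _ 0])
qed

lemma choose_ge_power2: "B \<le> A \<Longrightarrow> 2 ^ B \<le> real ((A + B) choose A)"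
proof -
  assume BA: "B \<le> A"
  have "(2 :: real) ^ B \<le> (real (A + B) / real B) ^ B"
  proof (cases "B = 0")
    case False
    then show ?thesis using BA by (intro power_mono) (auto simp: field_simps)
  qed simp
  also have "\<dots> \<le> real ((A + B) choose B)"
    by (rule binomial_ge_n_over_k_pow_k) simp
  also have "(A + B) choose B = (A + B) choose A"
    using binomial_symmetric[of B "A + B"] by simp
  finally show ?thesis .
qed

section \<open>Bounds on the dimensions, uniform in the group and the module\<close>

context
  fixes p :: nat and kt :: "'k::alg_closed_field itself"
  assumes p: "Factorial_Ring.prime p" and p3: "p \<ge> 3" and CHAR: "CHAR('k) = p"
begin

lemma cohomology_dim_Sol:
  assumes s: "s \<ge> 1" and L: "simple_module_L (\<Sum>i<s. md i * p ^ i) d (\<rho> :: 'k mat \<Rightarrow> 'k mat)"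
    and digits: "\<And>i. i < s \<Longrightarrow> md i < p" "\<And>i. i \<ge> s \<Longrightarrow> md i = 0"
  shows "SL2_cohomology_dim (p ^ s) d \<rho> (Suc n) = card (koszul.Sol p s md (Suc n))"
    and "SL2_cohomology_dim (p ^ s) d \<rho> 0 \<le> 1"
proof -
  interpret koszul p s kt md
    by unfold_locales (use p p3 CHAR s digits(1) in auto)
  have val: "val md = (\<Sum>i<s. md i * p ^ i)" by (simp add: val_def)
  interpret simple_SL2_module p s kt md d \<rho>
    by unfold_locales (use L digits(2) in \<open>auto simp: simple_module_L_def val\<close>)
  obtain r v where "hw_functional r v" using exists_hw_functional by blast
  then interpret hw_module p s kt md d \<rho> r v
    by unfold_locales
  show "SL2_cohomology_dim (p ^ s) d \<rho> (Suc n) = card (Sol (Suc n))"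
    by (rule cohomology_dim_Suc)
  show "SL2_cohomology_dim (p ^ s) d \<rho> 0 \<le> 1" by (rule cohomology_dim_0)
qed

lemma cohomology_dims_le:
  assumes "x \<in> SL2_cohomology_dims kt p n"
  shows "real x \<le> 2 * 4096 ^ n"
proof -
  obtain s m d and \<rho> :: "'k mat \<Rightarrow> 'k mat" where x: "x = SL2_cohomology_dim (p ^ s) d \<rho> n"
    and s: "s \<ge> 1" and m: "m < p ^ s" and L: "simple_module_L m d \<rho>"
    using assms unfolding SL2_cohomology_dims_def by blast
  obtain md where digits: "\<forall>i<s. md i < p" "\<forall>i\<ge>s. md i = 0" and m_eq: "m = (\<Sum>i<s. md i * p ^ i)"
    using exists_digits[of p m s] m p3 by auto
  interpret koszul p s kt md
    by unfold_locales (use p p3 CHAR s digits in auto)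
  note dim = cohomology_dim_Sol[OF s L[unfolded m_eq]]
  show ?thesis
  proof (cases n)
    case 0
    then show ?thesis using dim(2) digits by (simp add: x)
  next
    case (Suc n')
    have "(4096 :: real) ^ n = 4 ^ (6 * n)" by (simp add: power_mult)
    then show ?thesis
      using dim(1)[of n'] digits card_Sol_le[of n] by (simp add: x Suc)
  qed
qed

text \<open>A place with carry \<open>2 * p\<close> adds \<open>2 * p - 2\<close> to the degree, one
  with carry \<open>2 * p - 2\<close> adds \<open>2 * p - 3\<close>, and \<open>u\<close> is the sum
  of the two. So \<open>k\<close> places of each kind give degree \<open>u * k\<close>, and turning
  \<open>r\<close> places of the second kind into the first raises it by \<open>r\<close>. Division
  with remainder reaches every \<open>n\<close> in this way, once \<open>k\<close> is at least
  \<open>r\<close>.\<close>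

lemma cohomology_dims_ge:
  defines "u \<equiv> 4 * p - 5"
  assumes n: "n \<ge> u * u"
  shows "\<exists>x\<in>SL2_cohomology_dims kt p n. 2 ^ (n div u - u) \<le> real x"
proof -
  define t where "t = 2 * p - 3"
  define k where "k = n div u"
  define r where "r = n mod u"
  have u: "u = 2 * t + 1" using p3 by (simp add: u_def t_def)
  have n_eq: "n = u * k + r" by (simp add: k_def r_def)
  have r: "r < u" by (simp add: r_def u)
  have ku: "u \<le> k" using n u by (simp add: k_def less_eq_div_iff_mult_less_eq)
  define A where "A = k + r"
  define B where "B = k - r"
  have AB: "A + B = 2 * k" "A - B = 2 * r" "B \<le> A" using ku r by (auto simp: A_def B_def)
  have A_eq: "A * (2 * p - 2) + B * (2 * p - 3) = n"
  proof -
    have "2 * p - 2 = Suc t" "2 * p - 3 = t" using p3 by (simp_all add: t_def)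
    then have "A * (2 * p - 2) + B * (2 * p - 3) = (A + B) * t + A"
      by (simp add: distrib_right)
    also have "\<dots> = n" unfolding AB(1) by (simp add: A_def n_eq u algebra_simps)
    finally show ?thesis .
  qed
  have s: "A + B \<ge> 1" using ku u by (simp add: AB)
  interpret koszul p "A + B" kt "\<lambda>_. 0"
    by unfold_locales (use p p3 CHAR s in auto)
  have "0 < u * u" by (simp add: u)
  then have "n > 0" using n by linarith
  then obtain n' where n': "n = Suc n'" by (cases n) auto
  define x where "x = SL2_cohomology_dim (p ^ (A + B)) 1 (\<lambda>A. 1\<^sub>m 1 :: 'k mat) n"
  have "x = card (Sol n)"
    unfolding x_def n' by (rule cohomology_dim_Sol(1)[OF s]) (use p3 trivial_simple_module in auto)
  then have "(A + B) choose A \<le> x"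
    using card_Sol_ge[of A B] by (simp add: A_eq)
  then have "2 ^ B \<le> real x" using choose_ge_power2[OF AB(3)] by linarith
  moreover have "(2 :: real) ^ (k - u) \<le> 2 ^ B" using r by (intro power_increasing) (auto simp: B_def)
  moreover have "x \<in> SL2_cohomology_dims kt p n"
    unfolding SL2_cohomology_dims_def x_def using s trivial_simple_module[where ?'k = 'k] p3
    by (intro CollectI exI[of _ "A + B"] exI[of _ 0] exI[of _ 1] exI[of _ "\<lambda>A. 1\<^sub>m 1"]) auto
  ultimately show ?thesis unfolding k_def[symmetric] by (intro bexI[of _ x]) linarith
qed

end

theorem corollary6p7:
  fixes p :: nat
  assumes "Factorial_Ring.prime p" and "p \<ge> 3"
    and "CHAR('k::alg_closed_field) = p"
  shows "(\<forall>n. finite (SL2_cohomology_dims TYPE('k) p n) \<and> SL2_cohomology_dims TYPE('k) p n \<noteq> {}) \<and>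
         grows_exponentially (\<lambda>n. real (Max (SL2_cohomology_dims TYPE('k) p n)))"
proof -
  note le = cohomology_dims_le[OF assms, of _ "TYPE('k)"]
  note ge = cohomology_dims_ge[OF assms, of _ "TYPE('k)"]
  have fin: "finite (SL2_cohomology_dims TYPE('k) p n)" for n
  proof (rule finite_subset)
    show "SL2_cohomology_dims TYPE('k) p n \<subseteq> {..2 * 4096 ^ n}"
    proof
      fix x assume "x \<in> SL2_cohomology_dims TYPE('k) p n"
      then have "real x \<le> real (2 * 4096 ^ n)" using le by simp
      then show "x \<in> {..2 * 4096 ^ n}" by (simp only: of_nat_le_iff atMost_iff)
    qed
  qed simp
  have "SL2_cohomology_dim (p ^ 1) 1 (\<lambda>A. 1\<^sub>m 1 :: 'k mat) n \<in> SL2_cohomology_dims TYPE('k) p n" for n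
    unfolding SL2_cohomology_dims_def using trivial_simple_module[where ?'k = 'k] assms(2)
    by (intro CollectI exI[of _ "1 :: nat"] exI[of _ "0 :: nat"] exI[of _ "\<lambda>A. 1\<^sub>m 1"]) auto
  then have ne: "SL2_cohomology_dims TYPE('k) p n \<noteq> {}" for n by blast
  define u where "u = 4 * p - 5"
  have u0: "u > 0" using assms(2) by (simp add: u_def)
  \<comment> \<open>As \<open>n div u\<close> is at least \<open>n / u - 1\<close>, the base is the
    \<open>u\<close>-th root of two, and the losses \<open>u\<close> and \<open>1\<close> in the
    exponent go into the constant.\<close>
  have lower: "2 powr (- real u - 1) * (2 powr (1 / real u)) ^ n \<le> real (Max (SL2_cohomology_dims TYPE('k) p n))"
    if n: "n \<ge> u * u" for n
  proof -
    obtain x where x: "x \<in> SL2_cohomology_dims TYPE('k) p n" "2 ^ (n div u - u) \<le> real x"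
      using ge[of n] n unfolding u_def by blast
    have "u \<le> n div u" using n u0 by (simp add: less_eq_div_iff_mult_less_eq)
    moreover have "real n / real u \<le> real (n div u) + 1"
    proof -
      have "n < u * (n div u) + u" using u0 by (metis add_strict_left_mono mod_less_divisor mult_div_mod_eq)
      then have "real n \<le> real (u * (n div u) + u)" by (simp only: of_nat_le_iff less_imp_le)
      then show ?thesis using u0 by (simp add: field_simps)
    qed
    ultimately have "- real u - 1 + real n / real u \<le> real (n div u - u)" by (simp add: of_nat_diff)
    then have "2 powr (- real u - 1 + real n / real u) \<le> 2 powr real (n div u - u)" by simp
    then have "2 powr (- real u - 1) * (2 powr (1 / real u)) ^ n \<le> 2 ^ (n div u - u)"
      by (simp add: powr_add powr_realpow[symmetric] powr_powr)
    also have "\<dots> \<le> real x" by (rule x(2))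
    also have "\<dots> \<le> real (Max (SL2_cohomology_dims TYPE('k) p n))" using fin x(1) by simp
    finally show ?thesis .
  qed
  have upper: "real (Max (SL2_cohomology_dims TYPE('k) p n)) \<le> 2 * 4096 ^ n" for n
    using le Max_in[OF fin ne] by blast
  have "grows_exponentially (\<lambda>n. real (Max (SL2_cohomology_dims TYPE('k) p n)))"
    unfolding grows_exponentially_def eventually_sequentially
    using lower upper u0
    by (intro exI[of _ "2 powr (- real u - 1)"] exI[of _ 2] exI[of _ "2 powr (1 / real u)"] exI[of _ 4096]
        exI[of _ "u * u"] conjI) auto
  with fin ne show ?thesis by blast
qed

end
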